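(* Assume the 3SUM Conjecture. Then for every $\varepsilon>0$ there is no algorithm that, given an $N\times N$ matrix $M$ in which each row is given as a straight-line program of size $n=\Theta(N^{1/5})$, and an $N$-dimensional vector $v$ given as a straight-line program of size $n$, computes the matrix-vector product $M\cdot v$ in time $O(N n^{2-\varepsilon})$.
   Context: A straight-line program (SLP), or grammar compression, over an alphabet $\Sigma$ (the possible entries, e.g. $\{0,1\}$) is a sequence of rules $S_1,\dots,S_n$, where each rule is either $S_i\to \sigma$ for a symbol $\sigma\in\Sigma$ or $S_i\to S_jS_k$ with $j,k<i$. Each $S_i$ generates a unique string; the SLP generates the string of its last rule, and its size is the number of rules. Vectors and matrix rows are identified with the strings of their entries. The 3SUM problem: given three sets $A,B,C$ of $m$ integers in $\{1,\dots,U\}$, decide whether there are $a\in A,b\in B,c\in C$ with $a+b=c$. The 3SUM Conjecture: no algorithm (deterministic or randomized, succeeding with high probability) solves the 3SUM problem in time $O(m^{2-\varepsilon})$ for any $\varepsilon>0$. *)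

theory Defs
  imports
    "HOL-Probability.Probability_Mass_Function"
    "Jordan_Normal_Form.Matrix"
begin

unbundle bit_operations_syntax

text \<open>
  Computation model: a randomized word RAM with structured control flow.  A machine has registers
  and a memory addressed by words, both containing signed machine words, i.e. integers in
  \<open>{- (2 ^ w) ..< 2 ^ w}\<close>.  All arithmetic wraps around, and every instruction costs one time unit.
  Each operation below is independent of \<open>w\<close>; the wrapping happens when the result is written.
\<close>

datatype binop = Add | Sub | Mul | Div | Mod | And | Or | Xor | Shl | Shr | Less

fun binop_val :: "binop \<Rightarrow> int \<Rightarrow> int \<Rightarrow> int" where
  "binop_val Add x y = x + y"
| "binop_val Sub x y = x - y"
| "binop_val Mul x y = x * y"
| "binop_val Div x y = x div y"
| "binop_val Mod x y = x mod y"
| "binop_val And x y = x AND y"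
| "binop_val Or x y = x OR y"
| "binop_val Xor x y = x XOR y"
| "binop_val Shl x y = push_bit (nat y) x"
| "binop_val Shr x y = drop_bit (nat y) x"
| "binop_val Less x y = (if x < y then 1 else 0)"

text \<open>
  The arguments of type \<^typ>\<open>nat\<close> are register numbers, the target register coming first
  (\<open>Store r s\<close> writes the content of register \<open>s\<close> to the address in register \<open>r\<close>).
  \<open>Rand\<close> draws a uniformly random word; \<open>If\<close> and \<open>While\<close> test whether a register is nonzero.
\<close>

datatype com =
    Skip
  | Const nat int
  | Op binop nat nat nat
  | Load nat nat
  | Store nat nat
  | Rand nat
  | Seq com com
  | If nat com com
  | While nat com

type_synonym state = "(nat \<Rightarrow> int) \<times> (int \<Rightarrow> int)"

abbreviation regs :: "state \<Rightarrow> nat \<Rightarrow> int" where "regs \<equiv> fst"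
abbreviation mem :: "state \<Rightarrow> int \<Rightarrow> int" where "mem \<equiv> snd"

type_synonym config = "com \<times> state"

definition wrap :: "nat \<Rightarrow> int \<Rightarrow> int" where
  "wrap w x = signed_take_bit w x"

definition set_reg :: "nat \<Rightarrow> nat \<Rightarrow> int \<Rightarrow> state \<Rightarrow> state" where
  "set_reg w r x s = ((regs s)(r := wrap w x), mem s)"

definition set_mem :: "nat \<Rightarrow> int \<Rightarrow> int \<Rightarrow> state \<Rightarrow> state" where
  "set_mem w a x s = (regs s, (mem s)(a := wrap w x))"

text \<open>One time step; \<^const>\<open>Skip\<close> is the halted program.\<close>

fun step :: "nat \<Rightarrow> com \<Rightarrow> state \<Rightarrow> config pmf" where
  "step w Skip s = return_pmf (Skip, s)"
| "step w (Const r k) s = return_pmf (Skip, set_reg w r k s)"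
| "step w (Op f r r1 r2) s =
     return_pmf (Skip, set_reg w r (binop_val f (regs s r1) (regs s r2)) s)"
| "step w (Load r r1) s = return_pmf (Skip, set_reg w r (mem s (regs s r1)) s)"
| "step w (Store r r1) s = return_pmf (Skip, set_mem w (regs s r) (regs s r1) s)"
| "step w (Rand r) s =
     map_pmf (\<lambda>x. (Skip, set_reg w r x s)) (pmf_of_set {- (2 ^ w) ..< 2 ^ w})"
| "step w (Seq p q) s =
     (if p = Skip then return_pmf (q, s)
      else map_pmf (\<lambda>(p', s'). (Seq p' q, s')) (step w p s))"
| "step w (If r p q) s = return_pmf (if regs s r \<noteq> 0 then p else q, s)"
| "step w (While r p) s = return_pmf (if regs s r \<noteq> 0 then Seq p (While r p) else Skip, s)"

fun steps :: "nat \<Rightarrow> nat \<Rightarrow> config \<Rightarrow> config pmf" where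
  "steps w 0 c = return_pmf c"
| "steps w (Suc t) c = bind_pmf (step w (fst c) (snd c)) (steps w t)"

text \<open>
  The input occupies the memory cells \<open>0, 1, 2, \<dots>\<close>, and register \<open>0\<close> contains the word length
  parameter \<open>w\<close>, as is usual for algorithms that may depend on the word length of their machine.
\<close>

definition init_state :: "nat \<Rightarrow> int list \<Rightarrow> state" where
  "init_state w xs =
     ((\<lambda>r. if r = 0 then wrap w (int w) else 0),
      (\<lambda>a. if 0 \<le> a \<and> a < int (length xs) then wrap w (xs ! nat a) else 0))"

definition halts_within :: "nat \<Rightarrow> nat \<Rightarrow> config \<Rightarrow> bool" where
  "halts_within w t c \<longleftrightarrow> (\<forall>c' \<in> set_pmf (steps w t c). fst c' = Skip)"

text \<open>
  A (deterministic or randomized) algorithm is a single program \<open>p\<close> together with a constant \<open>k\<close>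
  that makes it run on words of \<open>O(log magn)\<close> bits, where \<open>magn x\<close> bounds the numbers relevant for
  the instance \<open>x\<close>.  It has to stop in time \<open>O(T)\<close> for all outcomes of the random choices, and
  with high probability, i.e. with probability at least \<open>1 - sz x ^ (- \<gamma>)\<close> for some constant
  \<open>\<gamma> > 0\<close>, the final memory has to be a correct answer.
\<close>

definition word_length :: "nat \<Rightarrow> nat \<Rightarrow> nat" where
  "word_length k n = k * nat \<lceil>log 2 (real n + 1)\<rceil>"

definition solves_in_time ::
  "com \<Rightarrow> 'i set \<Rightarrow> ('i \<Rightarrow> int list) \<Rightarrow> ('i \<Rightarrow> nat) \<Rightarrow> ('i \<Rightarrow> nat) \<Rightarrow>
   ('i \<Rightarrow> (int \<Rightarrow> int) \<Rightarrow> bool) \<Rightarrow> ('i \<Rightarrow> real) \<Rightarrow> bool" where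
  "solves_in_time p instances input magn sz correct T \<longleftrightarrow>
     (\<exists>(k::nat) (K::real) (\<gamma>::real). \<gamma> > 0 \<and> (\<forall>x \<in> instances. \<exists>t::nat.
        let w = word_length k (magn x); c = (p, init_state w (input x)) in
          real t \<le> K * T x \<and>
          halts_within w t c \<and>
          measure_pmf.prob (steps w t c) {c'. correct x (mem (snd c'))}
            \<ge> 1 - real (sz x) powr (- \<gamma>)))"


text \<open>
  3SUM.  An instance is \<open>(m, U, A, B, C)\<close>, the lists enumerating the three sets in arbitrary order.
  The universe size \<open>U\<close> is not tied to \<open>m\<close>, but the machine words have \<open>O(log (m + U))\<close> bits, so that
  every number fits into constantly many words.
\<close>

type_synonym three_sum_inst = "nat \<times> nat \<times> nat list \<times> nat list \<times> nat list"

definition three_sum_instances :: "three_sum_inst set" where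
  "three_sum_instances = {(m, U, A, B, C). m \<ge> 1 \<and>
     (\<forall>X \<in> {A, B, C}. distinct X \<and> length X = m \<and> set X \<subseteq> {1..U})}"

fun three_sum_input :: "three_sum_inst \<Rightarrow> int list" where
  "three_sum_input (m, U, A, B, C) = map int ([m, U] @ A @ B @ C)"

fun three_sum_correct :: "three_sum_inst \<Rightarrow> (int \<Rightarrow> int) \<Rightarrow> bool" where
  "three_sum_correct (m, U, A, B, C) h \<longleftrightarrow>
     (h 0 \<noteq> 0 \<longleftrightarrow> (\<exists>a \<in> set A. \<exists>b \<in> set B. \<exists>c \<in> set C. a + b = c))"

definition three_sum_conjecture :: bool where
  "three_sum_conjecture \<longleftrightarrow> (\<forall>\<epsilon>::real. \<epsilon> > 0 \<longrightarrow>
     \<not> (\<exists>p. solves_in_time p three_sum_instances three_sum_input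
          (\<lambda>(m, U, A, B, C). m + U) (\<lambda>(m, U, A, B, C). m) three_sum_correct
          (\<lambda>(m, U, A, B, C). real m powr (2 - \<epsilon>))))"


text \<open>Straight-line programs; rules are numbered from \<open>0\<close>.\<close>

datatype 'a rule_rhs = Terminal 'a | Concat nat nat

type_synonym 'a slp = "'a rule_rhs list"

definition is_slp :: "'a set \<Rightarrow> 'a slp \<Rightarrow> bool" where
  "is_slp \<Sigma> S \<longleftrightarrow> S \<noteq> [] \<and> (\<forall>i < length S.
     case S ! i of Terminal a \<Rightarrow> a \<in> \<Sigma> | Concat j k \<Rightarrow> j < i \<and> k < i)"

text \<open>The empty string is a dummy value for ill-formed rule sequences.\<close>

fun rule_string :: "'a slp \<Rightarrow> nat \<Rightarrow> 'a list" where
  "rule_string S i =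
     (case S ! i of
        Terminal a \<Rightarrow> [a]
      | Concat j k \<Rightarrow> if j < i \<and> k < i then rule_string S j @ rule_string S k else [])"

declare rule_string.simps [simp del]

definition slp_string :: "'a slp \<Rightarrow> 'a list" where
  "slp_string S = rule_string S (length S - 1)"

fun encode_rule :: "int rule_rhs \<Rightarrow> int list" where
  "encode_rule (Terminal a) = [0, a, 0]"
| "encode_rule (Concat j k) = [1, int j, int k]"

definition encode_slp :: "int slp \<Rightarrow> int list" where
  "encode_slp S = concat (map encode_rule S)"

text \<open>
  Compressed matrix-vector multiplication.  An instance is \<open>(N, n, R, V, M, v)\<close>, where the program
  \<open>R ! i\<close> of size \<open>n\<close> generates row \<open>i\<close> of the matrix \<open>M\<close> and the program \<open>V\<close> of size \<open>n\<close> generates \<open>v\<close>.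
  The machine only receives \<open>N\<close>, \<open>n\<close>, \<open>R\<close> and \<open>V\<close>.  The requirement \<open>n = \<Theta>(N ^ (1 / 5))\<close> is
  \<open>lo * N ^ (1 / 5) \<le> n \<le> hi * N ^ (1 / 5)\<close>.
\<close>

type_synonym mvm_inst = "nat \<times> nat \<times> int slp list \<times> int slp \<times> int mat \<times> int vec"

definition mvm_instances :: "int set \<Rightarrow> real \<Rightarrow> real \<Rightarrow> mvm_inst set" where
  "mvm_instances \<Sigma> lo hi = {(N, n, R, V, M, v). N \<ge> 1 \<and>
     lo * real N powr (1 / 5) \<le> real n \<and> real n \<le> hi * real N powr (1 / 5) \<and>
     M \<in> carrier_mat N N \<and> v \<in> carrier_vec N \<and>
     length R = N \<and>
     (\<forall>i < N. is_slp \<Sigma> (R ! i) \<and> length (R ! i) = n \<and> slp_string (R ! i) = list_of_vec (row M i)) \<and>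
     is_slp \<Sigma> V \<and> length V = n \<and> slp_string V = list_of_vec v}"

fun mvm_input :: "mvm_inst \<Rightarrow> int list" where
  "mvm_input (N, n, R, V, M, v) =
     [int N, int n] @ concat (map encode_slp R) @ encode_slp V"

fun mvm_correct :: "mvm_inst \<Rightarrow> (int \<Rightarrow> int) \<Rightarrow> bool" where
  "mvm_correct (N, n, R, V, M, v) h \<longleftrightarrow> (\<forall>i < N. h (int i) = (M *\<^sub>v v) $ i)"

definition mvm_solves_in_time ::
  "int set \<Rightarrow> real \<Rightarrow> real \<Rightarrow> com \<Rightarrow> (nat \<Rightarrow> nat \<Rightarrow> real) \<Rightarrow> bool" where
  "mvm_solves_in_time \<Sigma> lo hi p T \<longleftrightarrow>
     solves_in_time p (mvm_instances \<Sigma> lo hi) mvm_input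
       (\<lambda>(N, n, R, V, M, v). N + n) (\<lambda>(N, n, R, V, M, v). N) mvm_correct
       (\<lambda>(N, n, R, V, M, v). T N n)"

end

theory Submission
  imports Defs "HOL-Real_Asymp.Real_Asymp"
begin

text \<open>
  Suppose that program \<open>p\<close> computes compressed matrix-vector products in time \<open>O(N n\<^sup>2\<^sup>-\<^sup>\<epsilon>)\<close>.  To solve 3SUM,
  distribute each of the three sets among \<open>N\<close> buckets by the most significant bits \<open>h\<^sub>1 x\<close> of \<open>\<alpha>\<^sub>1 x\<close>,
  where \<open>\<alpha>\<^sub>1\<close> is a random word and \<open>N\<close> is so large that with high probability no bucket of an element
  of a given solution overflows its capacity \<open>cap\<close>.  Since \<open>h\<^sub>1\<close> is additive up to a carry \<open>e \<in> {0, 1}\<close>, a solution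
  \<open>a + b = c\<close> satisfies \<open>h\<^sub>1 b = h\<^sub>1 c - h\<^sub>1 a - e\<close> modulo \<open>N\<close>.  Therefore it suffices to treat, in \<open>2 N\<close> rounds
  \<open>u = 2 h\<^sub>1 c + e\<close>, all \<open>N\<close> pairs of a bucket \<open>r\<close> of \<open>A\<close> and the corresponding bucket of \<open>B\<close>.

  Each round is one call of \<open>p\<close>.  Let \<open>h\<^sub>2\<close> be a second, independent hash function with \<open>L\<close> bits.  The vector
  is the periodic continuation of the characteristic function \<open>v\<close> of the values \<open>h\<^sub>2 c\<close> and \<open>h\<^sub>2 c - 1\<close> for \<open>c\<close> in bucket
  \<open>u div 2\<close>, compressed along a trie.  Row \<open>r\<close> has its ones placed such that its product with the vector is
  the sum of \<open>v (h\<^sub>2 a + h\<^sub>2 b)\<close> over all pairs in the two buckets.  It is a concatenation of shifted copies, one for each \<open>b\<close>, of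
  a string that is itself a concatenation of shifted unit strings, one for each \<open>a\<close>; so it needs only \<open>O(cap L)\<close> rules
  although there are \<open>cap\<^sup>2\<close> pairs.  Rows with nonzero product are verified by exhaustive search; as
  false ones are rare, it is enough to look at the first \<open>Bc\<close> of them.  An erroneous
  answer of \<open>p\<close> can only lead to an overlooked solution, and only the call for one particular \<open>u\<close> matters,
  so its error probability is not multiplied by the number of calls.
\<close>

section \<open>Running programs\<close>

text \<open>The exponent 1/5 results from three demands. For buckets of size c the grammar of a row
  has about c rules, so \<open>n\<close> is about c. Its string needs one period of length
  \<open>2 ^ L\<close> for each of the c^2 pairs, so \<open>N\<close> is about c^2
  \<open>2 ^ L\<close>. A row is falsely positive with probability about c^3 / \<open>2 ^ L\<close>,
  so \<open>2 ^ L\<close> must be about c^3 to make false rows rare. Hence \<open>N\<close> is about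
  c^5. The sets have about \<open>N\<close> c elements and there are 2 \<open>N\<close> calls, so a
  solver needing \<open>n ^ 2\<close> per row would give time m^2, and every polynomial saving beats
  the conjecture. Two obstacles shape the rest. The number of rules carries the logarithmic factor
  \<open>L\<close>, whereas \<open>n\<close> has to be a constant times \<open>N\<close> to the
  power 1/5; a small polynomial slack, controlled by a parameter \<open>J\<close>, absorbs the
  logarithm. And the numbers in a 3SUM instance can be far larger than any polynomial in m, so the
  words of the 3SUM machine are longer than those on which \<open>p\<close> is known to work. Since
  wrap-around and random draws depend on the word length, \<open>p\<close> cannot simply be run
  there; it is simulated on short words.\<close>

lemma steps_Skip [simp]: "steps w t (Skip, s) = return_pmf (Skip, s)"
  by (induction t) (simp_all add: bind_return_pmf)

lemma steps_add: "steps w (a + b) c = bind_pmf (steps w a c) (steps w b)"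
proof (induction a arbitrary: c)
  case (Suc a)
  have "steps w (Suc a + b) c = bind_pmf (step w (fst c) (snd c)) (\<lambda>x. steps w (a + b) x)" by simp
  also have "\<dots> = bind_pmf (steps w (Suc a) c) (steps w b)"
    unfolding Suc.IH by (simp add: bind_assoc_pmf)
  finally show ?case .
qed (simp add: bind_return_pmf)

lemma steps_0: "steps w 0 = return_pmf"
  by (simp add: fun_eq_iff)

lemma steps_1: "steps w (Suc 0) (c, s) = step w c s"
  by (simp add: steps_0 bind_return_pmf' del: steps.simps(1))

lemma halts_within_Suc:
  "halts_within w (Suc t) (c, s) \<longleftrightarrow> (\<forall>c' \<in> set_pmf (step w c s). halts_within w t c')"
  by (auto simp: halts_within_def)

lemma steps_halted:
  assumes "halts_within w t c"
  shows "steps w (t + u) c = steps w t c"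
proof -
  have "steps w (t + u) c = bind_pmf (steps w t c) return_pmf"
    unfolding steps_add using assms
    by (intro bind_pmf_cong refl) (metis halts_within_def prod.collapse steps_Skip)
  thus ?thesis by (simp add: bind_return_pmf')
qed

text \<open>Halting of all runs by time \<open>t\<close> and the distribution of the final states in
  one equation. As \<open>Skip\<close> idles, \<open>t\<close> is only an upper bound, so branches
  of different lengths need no exact timing.\<close>

definition outcome :: "nat \<Rightarrow> com \<Rightarrow> state \<Rightarrow> nat \<Rightarrow> state pmf \<Rightarrow> bool" where
  "outcome w c s t D \<longleftrightarrow> steps w t (c, s) = map_pmf (Pair Skip) D"

lemma outcome_halts: "outcome w c s t D \<Longrightarrow> halts_within w t (c, s)"
  by (auto simp: outcome_def halts_within_def)

lemma halts_outcome:
  assumes "halts_within w t (c, s)"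
  shows "outcome w c s t (map_pmf snd (steps w t (c, s)))"
proof -
  have "map_pmf (Pair Skip) (map_pmf snd (steps w t (c, s))) = map_pmf id (steps w t (c, s))"
    unfolding pmf.map_comp using assms
    by (intro map_pmf_cong refl) (auto simp: halts_within_def)
  thus ?thesis by (simp add: outcome_def pmf.map_id)
qed

lemma outcome_mono: "outcome w c s t D \<Longrightarrow> t \<le> t' \<Longrightarrow> outcome w c s t' D"
  using steps_halted[of w t "(c, s)" "t' - t"] outcome_halts[of w c s t D]
  by (simp add: outcome_def)

lemma outcome_unique: "outcome w c s t D \<Longrightarrow> outcome w c s t D' \<Longrightarrow> D = D'"
  by (metis outcome_def pmf.inj_map_strong prod.inject)

text \<open>The extra step is the one that turns \<open>Seq Skip c2\<close> into \<open>c2\<close>.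
  Random runs of \<open>c1\<close> may halt at different times; a run that halts early starts
  \<open>c2\<close> early and idles at the end, which \<open>outcome_mono\<close> permits.\<close>

lemma outcome_Seq_aux:
  assumes "halts_within w t1 (c1, s)"
    and "\<And>x. x \<in> set_pmf (steps w t1 (c1, s)) \<Longrightarrow> outcome w c2 (snd x) t2 (f (snd x))"
  shows "steps w (t1 + 1 + t2) (Seq c1 c2, s)
     = bind_pmf (steps w t1 (c1, s)) (\<lambda>x. map_pmf (Pair Skip) (f (snd x)))"
  using assms
proof (induction t1 arbitrary: c1 s)
  case 0
  thus ?case by (auto simp: halts_within_def bind_return_pmf outcome_def)
next
  case (Suc t1)
  show ?case
  proof (cases "c1 = Skip")
    case True
    with Suc.prems(2)[of "(Skip, s)"] have "outcome w c2 s t2 (f s)" by simp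
    hence "outcome w c2 s (Suc t1 + t2) (f s)" by (rule outcome_mono) simp
    thus ?thesis using True by (simp add: bind_return_pmf outcome_def)
  next
    case False
    have "steps w (Suc t1 + 1 + t2) (Seq c1 c2, s)
      = bind_pmf (step w c1 s) (\<lambda>x. steps w (t1 + 1 + t2) (Seq (fst x) c2, snd x))"
      using False by (simp add: bind_map_pmf case_prod_beta)
    also have "\<dots> = bind_pmf (step w c1 s)
       (\<lambda>x. bind_pmf (steps w t1 x) (\<lambda>x. map_pmf (Pair Skip) (f (snd x))))"
    proof (intro bind_pmf_cong refl)
      fix x assume x: "x \<in> set_pmf (step w c1 s)"
      have "halts_within w t1 (fst x, snd x)"
        using Suc.prems(1) x by (simp add: halts_within_Suc)
      moreover have "outcome w c2 (snd y) t2 (f (snd y))" if "y \<in> set_pmf (steps w t1 (fst x, snd x))" for y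
        using that x by (intro Suc.prems(2)) auto
      ultimately show "steps w (t1 + 1 + t2) (Seq (fst x) c2, snd x) =
          bind_pmf (steps w t1 x) (\<lambda>x. map_pmf (Pair Skip) (f (snd x)))"
        using Suc.IH[of "fst x" "snd x"] by (simp del: steps.simps)
    qed
    finally show ?thesis by (simp add: bind_assoc_pmf)
  qed
qed

lemma outcome_Seq:
  assumes "outcome w c1 s t1 D1"
    and "\<And>s'. s' \<in> set_pmf D1 \<Longrightarrow> outcome w c2 s' t2 (D2 s')"
  shows "outcome w (Seq c1 c2) s (t1 + 1 + t2) (bind_pmf D1 D2)"
proof -
  have eq: "steps w t1 (c1, s) = map_pmf (Pair Skip) D1" using assms(1) by (simp add: outcome_def)
  have "steps w (t1 + 1 + t2) (Seq c1 c2, s)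
     = bind_pmf (steps w t1 (c1, s)) (\<lambda>x. map_pmf (Pair Skip) (D2 (snd x)))"
    by (rule outcome_Seq_aux[OF outcome_halts[OF assms(1)]]) (use assms(2) eq in auto)
  thus ?thesis unfolding eq outcome_def by (simp add: map_bind_pmf bind_map_pmf)
qed

lemma outcome_step:
  "step w c s = map_pmf (Pair Skip) D \<Longrightarrow> outcome w c s 1 D"
  unfolding outcome_def One_nat_def steps_1 .

lemma outcome_If:
  "outcome w (if regs s r \<noteq> 0 then p else q) s t D \<Longrightarrow> outcome w (If r p q) s (t + 1) D"
  by (simp add: outcome_def bind_return_pmf)

lemma outcome_While_False: "regs s r = 0 \<Longrightarrow> outcome w (While r p) s 1 (return_pmf s)"
  by (simp add: outcome_def bind_return_pmf)

lemma outcome_While_True: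
  "regs s r \<noteq> 0 \<Longrightarrow> outcome w (Seq p (While r p)) s t D \<Longrightarrow> outcome w (While r p) s (t + 1) D"
  by (simp add: outcome_def bind_return_pmf)

section \<open>Machine words and wrap-around arithmetic\<close>

definition okw :: "nat \<Rightarrow> int \<Rightarrow> bool" where
  "okw w x \<longleftrightarrow> - (2 ^ w) \<le> x \<and> x < 2 ^ w"

lemma okw_wrap [simp]: "okw w (wrap w x)"
  by (simp add: okw_def wrap_def signed_take_bit_int_greater_eq_minus_exp signed_take_bit_int_less_exp)

lemma wrap_id: "okw w x \<Longrightarrow> wrap w x = x"
  by (simp add: okw_def wrap_def signed_take_bit_int_eq_self)

lemma wrap_wrap: "w \<le> w' \<Longrightarrow> wrap w (wrap w' x) = wrap w x"
  by (simp add: wrap_def signed_take_bit_signed_take_bit)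

lemma okw_mono: "okw w x \<Longrightarrow> w \<le> w' \<Longrightarrow> okw w' x"
  unfolding okw_def by (smt (verit) power_increasing)

lemma wrap_mod: "wrap w x mod 2 ^ Suc w = x mod 2 ^ Suc w"
  by (metis take_bit_eq_mod take_bit_signed_take_bit wrap_def lessI less_Suc_eq_le order_refl)

text \<open>No instruction reduces a long word to a shorter one, but two shifts do: the left shift
  pushes the surplus high bits out of the word, and the arithmetic right shift brings the rest back
  with the correct sign.\<close>

lemma wrap_shift:
  assumes "w \<le> w'"
  shows "drop_bit (w' - w) (wrap w' (push_bit (w' - w) x)) = wrap w x"
  using assms unfolding wrap_def
  by (intro bit_eqI) (auto simp: bit_simps min_def)

text \<open>Every write wraps its value, so copying a register or a cell is faithful only if the
  source already holds a proper word.\<close>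

definition wf_state :: "nat \<Rightarrow> state \<Rightarrow> bool" where
  "wf_state w s \<longleftrightarrow> (\<forall>r. okw w (regs s r)) \<and> (\<forall>a. okw w (mem s a))"

lemma wf_set_reg [simp]: "wf_state w s \<Longrightarrow> wf_state w (set_reg w r x s)"
  by (simp add: wf_state_def set_reg_def)

lemma wf_set_mem [simp]: "wf_state w s \<Longrightarrow> wf_state w (set_mem w r x s)"
  by (simp add: wf_state_def set_mem_def)

lemma step_wf: "wf_state w s \<Longrightarrow> x \<in> set_pmf (step w c s) \<Longrightarrow> wf_state w (snd x)"
  by (induction w c s arbitrary: x rule: step.induct) (auto split: if_splits)

lemma steps_wf: "wf_state w (snd c) \<Longrightarrow> x \<in> set_pmf (steps w t c) \<Longrightarrow> wf_state w (snd x)"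
  by (induction t arbitrary: c x) (auto dest: step_wf)

lemma outcome_wf: "outcome w c s t D \<Longrightarrow> wf_state w s \<Longrightarrow> s' \<in> set_pmf D \<Longrightarrow> wf_state w s'"
  using steps_wf[of w "(c, s)" "(Skip, s')" t] by (auto simp: outcome_def)

lemma wf_init_state: "wf_state w (init_state w xs)"
  by (simp add: wf_state_def init_state_def okw_def) (metis okw_def okw_wrap)


section \<open>Structured programs and their logic\<close>

text \<open>Registers are split into three classes modulo 3: the variables of the logic, the temporaries
  used in the evaluation of expressions, and the registers of a simulated program.\<close>

definition vars :: "state \<Rightarrow> nat \<Rightarrow> int" where
  "vars s r = regs s (3 * r)"

datatype aexp = V nat | K int | Bi binop aexp aexp | Ld aexp

fun ev :: "nat \<Rightarrow> aexp \<Rightarrow> (nat \<Rightarrow> int) \<Rightarrow> (int \<Rightarrow> int) \<Rightarrow> int" where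
  "ev w (V r) v \<mu> = v r"
| "ev w (K k) v \<mu> = wrap w k"
| "ev w (Bi f a b) v \<mu> = wrap w (binop_val f (ev w a v \<mu>) (ev w b v \<mu>))"
| "ev w (Ld a) v \<mu> = \<mu> (ev w a v \<mu>)"

text \<open>The registers \<open>3 * d + 1\<close> form an evaluation stack of height
  \<open>d\<close>: the right operand is evaluated one level higher, so that the left one survives.
  There is no move instruction; \<open>And\<close> of a register with itself takes its
  place.\<close>

fun eval_code :: "nat \<Rightarrow> aexp \<Rightarrow> com" where
  "eval_code d (V r) = Op And (3 * d + 1) (3 * r) (3 * r)"
| "eval_code d (K k) = Const (3 * d + 1) k"
| "eval_code d (Bi f a b) =
     Seq (eval_code d a) (Seq (eval_code (Suc d) b) (Op f (3 * d + 1) (3 * d + 1) (3 * d + 4)))"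
| "eval_code d (Ld a) = Seq (eval_code d a) (Load (3 * d + 1) (3 * d + 1))"

fun eval_time :: "aexp \<Rightarrow> nat" where
  "eval_time (V r) = 1"
| "eval_time (K k) = 1"
| "eval_time (Bi f a b) = eval_time a + eval_time b + 3"
| "eval_time (Ld a) = eval_time a + 2"

lemma outcome_Seq_return:
  assumes "outcome w c1 s t1 (return_pmf s')" and "outcome w c2 s' t2 D"
    and "t = t1 + 1 + t2"
  shows "outcome w (Seq c1 c2) s t D"
  using outcome_Seq[OF assms(1), of c2 t2 "\<lambda>_. D"] assms by (simp add: bind_return_pmf)

definition eval_post :: "nat \<Rightarrow> state \<Rightarrow> int \<Rightarrow> state \<Rightarrow> bool" where
  "eval_post d s x s' \<longleftrightarrow> regs s' (3 * d + 1) = x \<and> mem s' = mem s \<and>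
     (\<forall>r. r mod 3 \<noteq> 1 \<or> r < 3 * d + 1 \<longrightarrow> regs s' r = regs s r)"

lemma eval_post_vars: "eval_post d s x s' \<Longrightarrow> vars s' = vars s"
  by (auto simp: eval_post_def vars_def)

lemma eval_code:
  assumes "wf_state w s"
  shows "\<exists>s'. outcome w (eval_code d e) s (eval_time e) (return_pmf s') \<and>
    eval_post d s (ev w e (vars s) (mem s)) s'"
  using assms
proof (induction e arbitrary: d s)
  case (V r)
  have "outcome w (eval_code d (V r)) s 1 (return_pmf (set_reg w (3 * d + 1) (regs s (3 * r)) s))"
    by (rule outcome_step) simp
  thus ?case using V
    by (intro exI[of _ "set_reg w (3 * d + 1) (regs s (3 * r)) s"])
      (auto simp: eval_post_def set_reg_def wf_state_def wrap_id vars_def)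
next
  case (K k)
  have "outcome w (eval_code d (K k)) s 1 (return_pmf (set_reg w (3 * d + 1) k s))"
    by (rule outcome_step) simp
  thus ?case
    by (intro exI[of _ "set_reg w (3 * d + 1) k s"])
      (auto simp: eval_post_def set_reg_def wf_state_def wrap_id vars_def)
next
  case (Bi f a b)
  obtain s1 where s1: "outcome w (eval_code d a) s (eval_time a) (return_pmf s1)"
    "eval_post d s (ev w a (vars s) (mem s)) s1" using Bi.IH(1) Bi.prems by blast
  have "wf_state w s1" using outcome_wf[OF s1(1)] Bi.prems by auto
  then obtain s2 where s2: "outcome w (eval_code (Suc d) b) s1 (eval_time b) (return_pmf s2)"
    "eval_post (Suc d) s1 (ev w b (vars s1) (mem s1)) s2" using Bi.IH(2) by blast
  have v1: "vars s1 = vars s" "mem s1 = mem s"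
    using s1(2) eval_post_vars[OF s1(2)] by (auto simp: eval_post_def)
  define s3 where "s3 = set_reg w (3 * d + 1)
    (binop_val f (regs s2 (3 * d + 1)) (regs s2 (3 * d + 4))) s2"
  have s3: "outcome w (Op f (3 * d + 1) (3 * d + 1) (3 * d + 4)) s2 1 (return_pmf s3)"
    by (rule outcome_step) (simp add: s3_def)
  have "outcome w (eval_code d (Bi f a b)) s (eval_time (Bi f a b)) (return_pmf s3)"
    using outcome_Seq_return[OF s1(1) outcome_Seq_return[OF s2(1) s3 refl],
        of "eval_time (Bi f a b)"] by simp
  moreover have "regs s2 (3 * d + 1) = ev w a (vars s) (mem s)"
    "regs s2 (3 * d + 4) = ev w b (vars s) (mem s)"
    using s1(2) s2(2) v1 by (auto simp: eval_post_def algebra_simps)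
  ultimately show ?case using s1(2) s2(2)
    by (intro exI[of _ s3]) (auto simp: eval_post_def s3_def set_reg_def)
next
  case (Ld a)
  obtain s1 where s1: "outcome w (eval_code d a) s (eval_time a) (return_pmf s1)"
    "eval_post d s (ev w a (vars s) (mem s)) s1" using Ld by blast
  have wf1: "wf_state w s1" using outcome_wf[OF s1(1)] Ld.prems by auto
  define s3 where "s3 = set_reg w (3 * d + 1) (mem s1 (regs s1 (3 * d + 1))) s1"
  have s3: "outcome w (Load (3 * d + 1) (3 * d + 1)) s1 1 (return_pmf s3)"
    by (rule outcome_step) (simp add: s3_def)
  have "outcome w (eval_code d (Ld a)) s (eval_time (Ld a)) (return_pmf s3)"
    using outcome_Seq_return[OF s1(1) s3 refl] by simp
  thus ?case using s1(2) wf1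
    by (intro exI[of _ s3]) (auto simp: eval_post_def s3_def set_reg_def wf_state_def wrap_id)
qed

section \<open>Hoare triples with running times and probabilities\<close>

type_synonym assn = "(nat \<Rightarrow> int) \<Rightarrow> (int \<Rightarrow> int) \<Rightarrow> bool"

text \<open>There are two postconditions because the algorithm errs on one side only:
  \<open>Q\<close> is guaranteed for every outcome of the random choices (a reported solution
  exists), while \<open>R\<close> is merely probable (an existing solution is found).\<close>

definition HS :: "nat \<Rightarrow> (state \<Rightarrow> bool) \<Rightarrow> com \<Rightarrow> nat \<Rightarrow> (state \<Rightarrow> bool) \<Rightarrow> real \<Rightarrow> (state \<Rightarrow> bool) \<Rightarrow> bool"
  where "HS w P c t Q \<pi> R \<longleftrightarrow> (\<forall>s. wf_state w s \<longrightarrow> P s \<longrightarrow>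
     (\<exists>D. outcome w c s t D \<and> (\<forall>s' \<in> set_pmf D. Q s') \<and> \<pi> \<le> measure_pmf.prob D {s'. R s'}))"

lemma HS_weaken:
  assumes "HS w P' c t' Q' \<pi>' R'" and "t' \<le> t" and "\<pi> \<le> \<pi>'"
    and "\<And>s. P s \<Longrightarrow> P' s" and "\<And>s. Q' s \<Longrightarrow> Q s" and "\<And>s. Q' s \<Longrightarrow> R' s \<Longrightarrow> R s"
  shows "HS w P c t Q \<pi> R"
  unfolding HS_def
proof (intro allI impI)
  fix s assume "wf_state w s" "P s"
  then obtain D where D: "outcome w c s t' D" "\<forall>s' \<in> set_pmf D. Q' s'"
    "\<pi>' \<le> measure_pmf.prob D {s'. R' s'}"
    using assms(1,4) unfolding HS_def by blast
  have "measure_pmf.prob D {s'. R' s'} \<le> measure_pmf.prob D {s'. R s'}"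
    using D(2) assms(6) by (intro measure_pmf.finite_measure_mono_AE) (auto simp: AE_measure_pmf_iff)
  thus "\<exists>D. outcome w c s t D \<and> (\<forall>s' \<in> set_pmf D. Q s') \<and> \<pi> \<le> measure_pmf.prob D {s'. R s'}"
    using D assms outcome_mono[OF D(1) assms(2)] by (intro exI[of _ D]) auto
qed

lemma HS_certain:
  assumes "HS w P c t Q 0 (\<lambda>_. True)"
  shows "HS w P c t Q 1 Q"
  unfolding HS_def
proof (intro allI impI)
  fix s assume "wf_state w s" "P s"
  then obtain D where D: "outcome w c s t D" "\<forall>s' \<in> set_pmf D. Q s'"
    using assms unfolding HS_def by blast
  hence "measure_pmf.prob D {s'. Q s'} = 1"
    by (subst measure_pmf.prob_eq_1) (auto simp: AE_measure_pmf_iff)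
  thus "\<exists>D. outcome w c s t D \<and> (\<forall>s' \<in> set_pmf D. Q s') \<and> 1 \<le> measure_pmf.prob D {s'. Q s'}"
    using D by (intro exI[of _ D]) simp
qed

text \<open>The first triple for \<open>c2\<close> ensures halting and \<open>R\<close> also when
  \<open>S1\<close> has failed, the second one bounds the success probability from every state with
  \<open>S1\<close>. As that bound is uniform in the state, the probabilities multiply without any
  independence assumption.\<close>

lemma HS_Seq:
  assumes c1: "HS w P c1 t1 Q \<pi>1 S1" and c2: "HS w Q c2 t2 R 0 (\<lambda>_. True)"
    and c2': "HS w (\<lambda>s. Q s \<and> S1 s) c2 t2 R \<pi>2 S2" and "0 \<le> \<pi>2"
  shows "HS w P (Seq c1 c2) (t1 + 1 + t2) R (\<pi>1 * \<pi>2) S2"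
  unfolding HS_def
proof (intro allI impI)
  fix s assume s: "wf_state w s" "P s"
  then obtain D1 where D1: "outcome w c1 s t1 D1" "\<forall>s' \<in> set_pmf D1. Q s'"
    "\<pi>1 \<le> measure_pmf.prob D1 {s'. S1 s'}"
    using c1 unfolding HS_def by blast
  have "\<forall>s'\<in>set_pmf D1. \<exists>D. outcome w c2 s' t2 D \<and> (\<forall>s' \<in> set_pmf D. R s')"
    using c2 D1 s(1) outcome_wf unfolding HS_def by blast
  then obtain D2 where D2: "\<And>s'. s'\<in>set_pmf D1 \<Longrightarrow> outcome w c2 s' t2 (D2 s') \<and>
     (\<forall>s' \<in> set_pmf (D2 s'). R s')" by metis
  let ?B = "{s'. S2 s'}" and ?A = "{s'. S1 s'}"
  have le: "\<pi>2 * indicator ?A s' \<le> measure_pmf.prob (D2 s') ?B" if "s' \<in> set_pmf D1" for s'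
  proof (cases "s' \<in> ?A")
    case True
    have "wf_state w s'" "Q s'" "S1 s'"
      using True D1 s(1) outcome_wf that by auto
    then obtain D where "outcome w c2 s' t2 D" "\<pi>2 \<le> measure_pmf.prob D ?B"
      using c2' unfolding HS_def by blast
    \<comment> \<open>Each of the two triples for \<open>c2\<close> supplies its own distribution;
      uniqueness of outcomes identifies them.\<close>
    moreover have "D = D2 s'" using outcome_unique D2[OF that] calculation(1) by blast
    ultimately show ?thesis using True by simp
  qed simp
  have "\<pi>2 * measure_pmf.prob D1 ?A = (\<integral>s'. \<pi>2 * indicator ?A s' \<partial>measure_pmf D1)"
    by simp
  also have "\<dots> \<le> (\<integral>s'. measure_pmf.prob (D2 s') ?B \<partial>measure_pmf D1)"
    by (intro integral_mono_AE measure_pmf.integrable_const_bound[where B = 1]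
          measure_pmf.integrable_const_bound[where B = "\<bar>\<pi>2\<bar>"])
      (auto simp: AE_measure_pmf_iff le abs_mult split: split_indicator)
  also have "\<dots> = measure_pmf.prob (bind_pmf D1 D2) ?B"
    by (simp add: measure_pmf_bind measure_pmf.measure_bind[where N = "count_space UNIV"]
        measure_pmf_in_subprob_algebra)
  finally have "\<pi>1 * \<pi>2 \<le> measure_pmf.prob (bind_pmf D1 D2) ?B"
    using mult_left_mono[OF D1(3) \<open>0 \<le> \<pi>2\<close>] by (simp add: mult.commute)
  thus "\<exists>D. outcome w (Seq c1 c2) s (t1 + 1 + t2) D \<and> (\<forall>s' \<in> set_pmf D. R s') \<and>
       \<pi>1 * \<pi>2 \<le> measure_pmf.prob D ?B"
    using outcome_Seq[OF D1(1), of c2 t2 D2] D2 by (intro exI[of _ "bind_pmf D1 D2"]) auto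
qed

lemma HS_While_step:
  assumes "HS w P (Seq c (While r c)) t Q \<pi> R" and "\<And>s. P s \<Longrightarrow> regs s r \<noteq> 0"
  shows "HS w P (While r c) (t + 1) Q \<pi> R"
  using assms outcome_While_True unfolding HS_def by meson

lemma HS_While:
  assumes "\<And>j. j < n \<Longrightarrow> HS w (A j) c t (A (Suc j)) 0 (\<lambda>_. True)"
    and "\<And>j s. j \<le> n \<Longrightarrow> A j s \<Longrightarrow> regs s r \<noteq> 0 \<longleftrightarrow> j < n" and "j \<le> n"
  shows "HS w (A j) (While r c) ((n - j) * (t + 2) + 1) (A n) 0 (\<lambda>_. True)"
  using assms(3)
proof (induction rule: inc_induct)
  case base
  show ?case unfolding HS_def using outcome_While_False assms(2)[of n] by (fastforce simp del: One_nat_def)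
next
  case (step m)
  have "HS w (A m) (Seq c (While r c)) (t + 1 + ((n - Suc m) * (t + 2) + 1)) (A n) (0 * 0) (\<lambda>_. True)"
    by (rule HS_Seq[OF assms(1)[OF step.hyps(2)] step.IH]) (use step.IH in auto)
  from HS_While_step[OF this] assms(2)[of m] step
  have "HS w (A m) (While r c) (t + 1 + ((n - Suc m) * (t + 2) + 1) + 1) (A n) 0 (\<lambda>_. True)" by simp
  moreover have "t + 1 + ((n - Suc m) * (t + 2) + 1) + 1 = (n - m) * (t + 2) + 1"
    using step Suc_diff_Suc[of m n] by (metis (no_types, lifting) add.assoc add.commute mult_Suc one_add_one)
  ultimately show ?case by simp
qed

text \<open>One iteration \<open>j0\<close> brings about the event and the later ones preserve it
  with certainty. The probability is therefore that of a single iteration, however long the loop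
  runs.\<close>

lemma HS_While_event:
  assumes "\<And>j. j < n \<Longrightarrow> HS w (A j) c t (A (Suc j)) 0 (\<lambda>_. True)"
    and "\<And>j s. j \<le> n \<Longrightarrow> A j s \<Longrightarrow> regs s r \<noteq> 0 \<longleftrightarrow> j < n"
    and "HS w (A j0) c t (A (Suc j0)) \<pi> B" and "0 \<le> \<pi>"
    and "\<And>j. j0 < j \<Longrightarrow> j < n \<Longrightarrow> HS w (\<lambda>s. A j s \<and> B s) c t (\<lambda>s. A (Suc j) s \<and> B s) 0 (\<lambda>_. True)"
    and "j0 < n" and "j \<le> j0"
  shows "HS w (A j) (While r c) ((n - j) * (t + 2) + 1) (A n) \<pi> B"
  using assms(7)
proof (induction rule: inc_induct)
  case base
  \<comment> \<open>Being unsatisfiable up to \<open>j0\<close>, this invariant makes the premises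
    of \<open>HS_While\<close> vacuous there, so that lemma covers just the iterations after
    \<open>j0\<close>.\<close>
  define A' where "A' j s \<longleftrightarrow> (if j0 < j then A j s \<and> B s else False)" for j s
  have "HS w (A' (Suc j0)) (While r c) ((n - Suc j0) * (t + 2) + 1) (A' n) 0 (\<lambda>_. True)"
  proof (rule HS_While)
    fix j assume "j < n"
    thus "HS w (A' j) c t (A' (Suc j)) 0 (\<lambda>_. True)"
      using assms(5)[of j] by (cases "j0 < j") (auto simp: A'_def HS_def)
  qed (use assms(2,6) in \<open>auto simp: A'_def split: if_splits\<close>)
  from HS_certain[OF this]
  have 1: "HS w (\<lambda>s. A (Suc j0) s \<and> B s) (While r c) ((n - Suc j0) * (t + 2) + 1) (A n) 1 B"
    by (rule HS_weaken) (use assms(6) in \<open>auto simp: A'_def\<close>)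
  have "HS w (A j0) (Seq c (While r c)) (t + 1 + ((n - Suc j0) * (t + 2) + 1)) (A n) (\<pi> * 1) B"
    using assms(3,6) 1 HS_While[where A = A and n = n, OF assms(1,2), where j = "Suc j0"] by (intro HS_Seq) auto
  from HS_While_step[OF this] assms(2)[of j0] assms(6)
  have "HS w (A j0) (While r c) (t + 1 + ((n - Suc j0) * (t + 2) + 1) + 1) (A n) \<pi> B" by simp
  moreover have "t + 1 + ((n - Suc j0) * (t + 2) + 1) + 1 = (n - j0) * (t + 2) + 1"
    using assms(6) Suc_diff_Suc[of j0 n] by (metis (no_types, lifting) add.assoc add.commute mult_Suc one_add_one)
  ultimately show ?case by simp
next
  case (step m)
  have m: "m < n" using step assms(6) by simp
  have "HS w (A m) (Seq c (While r c)) (t + 1 + ((n - Suc m) * (t + 2) + 1)) (A n) (1 * \<pi>) B"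
    using m step.IH HS_certain[OF assms(1)[OF m]] HS_While[where A = A and n = n, OF assms(1,2), where j = "Suc m"] assms(4)
    by (intro HS_Seq) auto
  from HS_While_step[OF this] assms(2)[of m] m
  have "HS w (A m) (While r c) (t + 1 + ((n - Suc m) * (t + 2) + 1) + 1) (A n) \<pi> B" by simp
  moreover have "t + 1 + ((n - Suc m) * (t + 2) + 1) + 1 = (n - m) * (t + 2) + 1"
    using m Suc_diff_Suc[of m n] by (metis (no_types, lifting) add.assoc add.commute mult_Suc one_add_one)
  ultimately show ?case by simp
qed

text \<open>Assertions see only variables and memory. The temporaries of expression evaluation and
  the registers of the simulated program are hidden and may change freely.\<close>

definition HT :: "nat \<Rightarrow> assn \<Rightarrow> com \<Rightarrow> nat \<Rightarrow> assn \<Rightarrow> real \<Rightarrow> assn \<Rightarrow> bool" where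
  "HT w P c t Q \<pi> R \<longleftrightarrow>
     HS w (\<lambda>s. P (vars s) (mem s)) c t (\<lambda>s. Q (vars s) (mem s)) \<pi> (\<lambda>s. R (vars s) (mem s))"

abbreviation T :: "nat \<Rightarrow> assn \<Rightarrow> com \<Rightarrow> nat \<Rightarrow> assn \<Rightarrow> bool" where
  "T w P c t Q \<equiv> HT w P c t Q 0 (\<lambda>_ _. True)"

lemma T_def: "T w P c t Q \<longleftrightarrow> (\<forall>s. wf_state w s \<longrightarrow> P (vars s) (mem s) \<longrightarrow>
     (\<exists>D. outcome w c s t D \<and> (\<forall>s' \<in> set_pmf D. Q (vars s') (mem s'))))"
  by (simp add: HT_def HS_def)

lemma HT_weaken:
  assumes "HT w P' c t' Q' \<pi>' R'" and "t' \<le> t" and "\<pi> \<le> \<pi>'"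
    and "\<And>v \<mu>. P v \<mu> \<Longrightarrow> P' v \<mu>" and "\<And>v \<mu>. Q' v \<mu> \<Longrightarrow> Q v \<mu>" and "\<And>v \<mu>. Q' v \<mu> \<Longrightarrow> R' v \<mu> \<Longrightarrow> R v \<mu>"
  shows "HT w P c t Q \<pi> R"
  using assms(1) unfolding HT_def by (rule HS_weaken) (use assms in auto)

lemma T_weaken:
  assumes "T w P' c t' Q'" and "t' \<le> t"
    and "\<And>v \<mu>. P v \<mu> \<Longrightarrow> P' v \<mu>" and "\<And>v \<mu>. Q' v \<mu> \<Longrightarrow> Q v \<mu>"
  shows "T w P c t Q"
  by (rule HT_weaken[OF assms(1,2)]) (use assms in auto)

lemma HT_certain: "T w P c t Q \<Longrightarrow> HT w P c t Q 1 Q"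
  unfolding HT_def by (rule HS_certain)

lemma HT_Seq:
  assumes "HT w P c1 t1 Q \<pi>1 S1" and "T w Q c2 t2 R"
    and "HT w (\<lambda>v \<mu>. Q v \<mu> \<and> S1 v \<mu>) c2 t2 R \<pi>2 S2" and "0 \<le> \<pi>2"
  shows "HT w P (Seq c1 c2) (t1 + 1 + t2) R (\<pi>1 * \<pi>2) S2"
  using assms unfolding HT_def by (rule HS_Seq)

lemma T_Seq:
  assumes "T w P c1 t1 Q" and "T w Q c2 t2 R" and "t1 + t2 + 1 \<le> t"
  shows "T w P (Seq c1 c2) t R"
proof -
  have "HT w P (Seq c1 c2) (t1 + 1 + t2) R (0 * 0) (\<lambda>_ _. True)"
    by (rule HT_Seq[OF assms(1,2)]) (use assms(2) in auto)
  thus ?thesis by (rule HT_weaken) (use assms(3) in auto)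
qed

section \<open>Straight-line blocks and their symbolic execution\<close>

datatype stm = As nat aexp | St aexp aexp

fun stm_code :: "stm \<Rightarrow> com" where
  "stm_code (As x e) = Seq (eval_code 0 e) (Op And (3 * x) 1 1)"
| "stm_code (St a e) = Seq (eval_code 0 a) (Seq (eval_code 1 e) (Store 1 4))"

fun stm_time :: "stm \<Rightarrow> nat" where
  "stm_time (As x e) = eval_time e + 2"
| "stm_time (St a e) = eval_time a + eval_time e + 3"

fun blk :: "stm list \<Rightarrow> com" where
  "blk [] = Skip"
| "blk (s # ss) = Seq (stm_code s) (blk ss)"

fun blk_time :: "stm list \<Rightarrow> nat" where
  "blk_time [] = 0"
| "blk_time (s # ss) = stm_time s + 1 + blk_time ss"

text \<open>Weakest preconditions turn the correctness of a block into a formula about successive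
  updates of the variables, which rewriting can evaluate.\<close>

fun wp :: "nat \<Rightarrow> stm list \<Rightarrow> assn \<Rightarrow> assn" where
  "wp w [] Q v \<mu> = Q v \<mu>"
| "wp w (As x e # ss) Q v \<mu> = wp w ss Q (v(x := ev w e v \<mu>)) \<mu>"
| "wp w (St a e # ss) Q v \<mu> = wp w ss Q v (\<mu>(ev w a v \<mu> := ev w e v \<mu>))"

lemma ev_okw: "\<forall>r. okw w (v r) \<Longrightarrow> \<forall>a. okw w (\<mu> a) \<Longrightarrow> okw w (ev w e v \<mu>)"
  by (cases e) auto

lemma wf_vars: "wf_state w s \<Longrightarrow> (\<forall>r. okw w (vars s r)) \<and> (\<forall>a. okw w (mem s a))"
  by (simp add: wf_state_def vars_def)

lemma stm_code:
  assumes wf: "wf_state w s"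
  shows "\<exists>s'. outcome w (stm_code st) s (stm_time st) (return_pmf s') \<and>
    (case st of As x e \<Rightarrow> vars s' = (vars s)(x := ev w e (vars s) (mem s)) \<and> mem s' = mem s
     | St a e \<Rightarrow> vars s' = vars s \<and> mem s' = (mem s)(ev w a (vars s) (mem s) := ev w e (vars s) (mem s)))"
proof (cases st)
  case (As x e)
  obtain s1 where s1: "outcome w (eval_code 0 e) s (eval_time e) (return_pmf s1)"
    "eval_post 0 s (ev w e (vars s) (mem s)) s1" using eval_code[OF wf] by blast
  define s2 where "s2 = set_reg w (3 * x) (regs s1 1) s1"
  have "outcome w (Op And (3 * x) 1 1) s1 1 (return_pmf s2)"
    by (rule outcome_step) (simp add: s2_def)
  from outcome_Seq_return[OF s1(1) this refl]
  have "outcome w (stm_code st) s (stm_time st) (return_pmf s2)" by (simp add: As)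
  moreover have "vars s2 = (vars s)(x := ev w e (vars s) (mem s)) \<and> mem s2 = mem s"
    using s1(2) eval_post_vars[OF s1(2)] ev_okw[of w "vars s" "mem s" e] wf_vars[OF wf]
    by (auto simp: s2_def set_reg_def vars_def eval_post_def wrap_id fun_eq_iff)
  ultimately show ?thesis using As by (intro exI[of _ s2]) simp
next
  case (St a e)
  obtain s1 where s1: "outcome w (eval_code 0 a) s (eval_time a) (return_pmf s1)"
    "eval_post 0 s (ev w a (vars s) (mem s)) s1" using eval_code[OF wf] by blast
  have wf1: "wf_state w s1" using outcome_wf[OF s1(1)] wf by auto
  obtain s2 where s2: "outcome w (eval_code 1 e) s1 (eval_time e) (return_pmf s2)"
    "eval_post 1 s1 (ev w e (vars s1) (mem s1)) s2" using eval_code[OF wf1] by blast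
  define s3 where "s3 = set_mem w (regs s2 1) (regs s2 4) s2"
  have "outcome w (Store 1 4) s2 1 (return_pmf s3)"
    by (rule outcome_step) (simp add: s3_def)
  from outcome_Seq_return[OF s1(1) outcome_Seq_return[OF s2(1) this refl], of "stm_time st"]
  have "outcome w (stm_code st) s (stm_time st) (return_pmf s3)" by (simp add: St)
  moreover have v1: "vars s1 = vars s" "mem s1 = mem s" "vars s2 = vars s" "mem s2 = mem s"
    using eval_post_vars[OF s1(2)] eval_post_vars[OF s2(2)] s1(2) s2(2)
    by (auto simp: eval_post_def)
  moreover have r: "regs s2 1 = ev w a (vars s) (mem s)" "regs s2 4 = ev w e (vars s) (mem s)"
    using s1(2) s2(2) v1 by (auto simp: eval_post_def)
  moreover have "vars s3 = vars s \<and> mem s3 = (mem s)(regs s2 1 := regs s2 4)"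
    using v1 ev_okw[of w "vars s" "mem s" e] wf_vars[OF wf] r
    by (auto simp: s3_def set_mem_def vars_def wrap_id fun_eq_iff)
  ultimately show ?thesis using St by (intro exI[of _ s3]) simp
qed

lemma blk:
  assumes "wf_state w s" and "wp w ss Q (vars s) (mem s)"
  shows "\<exists>s'. outcome w (blk ss) s (blk_time ss) (return_pmf s') \<and> Q (vars s') (mem s')"
  using assms
proof (induction ss arbitrary: s)
  case Nil
  thus ?case by (auto simp: outcome_def)
next
  case (Cons st ss)
  obtain s1 where s1: "outcome w (stm_code st) s (stm_time st) (return_pmf s1)"
    "case st of As x e \<Rightarrow> vars s1 = (vars s)(x := ev w e (vars s) (mem s)) \<and> mem s1 = mem s
     | St a e \<Rightarrow> vars s1 = vars s \<and> mem s1 = (mem s)(ev w a (vars s) (mem s) := ev w e (vars s) (mem s))"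
    using stm_code Cons.prems(1) by blast
  have "wf_state w s1" using outcome_wf[OF s1(1)] Cons.prems by auto
  moreover have "wp w ss Q (vars s1) (mem s1)"
    using Cons.prems(2) s1(2) by (cases st) auto
  ultimately obtain s2 where "outcome w (blk ss) s1 (blk_time ss) (return_pmf s2)"
    "Q (vars s2) (mem s2)" using Cons.IH by blast
  with outcome_Seq_return[OF s1(1) this(1) refl] show ?case by (intro exI[of _ s2]) simp
qed

lemma T_blk:
  assumes "\<And>v \<mu>. P v \<mu> \<Longrightarrow> wp w ss Q v \<mu>" and "blk_time ss \<le> t"
  shows "T w P (blk ss) t Q"
  unfolding T_def using blk[of w _ ss Q] assms outcome_mono
  by (metis (no_types, lifting) set_return_pmf singletonD)

section \<open>Conditionals and counting loops\<close>

definition iff :: "aexp \<Rightarrow> com \<Rightarrow> com \<Rightarrow> com" where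
  "iff e c1 c2 = Seq (eval_code 0 e) (If 1 c1 c2)"

lemma T_iff:
  assumes "T w (\<lambda>v \<mu>. P v \<mu> \<and> ev w e v \<mu> \<noteq> 0) c1 t Q"
    and "T w (\<lambda>v \<mu>. P v \<mu> \<and> ev w e v \<mu> = 0) c2 t Q"
    and "eval_time e + t + 2 \<le> t'"
  shows "T w P (iff e c1 c2) t' Q"
  unfolding T_def
proof (intro allI impI)
  fix s assume s: "wf_state w s" "P (vars s) (mem s)"
  obtain s1 where s1: "outcome w (eval_code 0 e) s (eval_time e) (return_pmf s1)"
    "eval_post 0 s (ev w e (vars s) (mem s)) s1" using eval_code[OF s(1)] by blast
  have wf1: "wf_state w s1" using outcome_wf[OF s1(1)] s by auto
  have v1: "vars s1 = vars s" "mem s1 = mem s" "regs s1 1 = ev w e (vars s) (mem s)"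
    using eval_post_vars[OF s1(2)] s1(2) by (auto simp: eval_post_def)
  have "\<exists>D. outcome w (if regs s1 1 \<noteq> 0 then c1 else c2) s1 t D \<and>
     (\<forall>s' \<in> set_pmf D. Q (vars s') (mem s'))"
  proof (cases "regs s1 1 = 0")
    case True
    thus ?thesis using assms(2)[unfolded T_def, rule_format, of s1] wf1 s(2) v1 by simp
  next
    case False
    thus ?thesis using assms(1)[unfolded T_def, rule_format, of s1] wf1 s(2) v1 by simp
  qed
  then obtain D where D: "outcome w (if regs s1 1 \<noteq> 0 then c1 else c2) s1 t D"
     "\<forall>s' \<in> set_pmf D. Q (vars s') (mem s')" by blast
  have "outcome w (iff e c1 c2) s (eval_time e + 1 + (t + 1)) D" unfolding iff_def
    using outcome_Seq_return[OF s1(1) outcome_If[OF D(1)] refl] .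
  hence "outcome w (iff e c1 c2) s t' D" by (rule outcome_mono) (use assms(3) in simp)
  thus "\<exists>D. outcome w (iff e c1 c2) s t' D \<and> (\<forall>s' \<in> set_pmf D. Q (vars s') (mem s'))"
    using D by blast
qed

text \<open>The test result sits in register 1, the lowest cell of the evaluation stack, which every
  expression overwrites; hence the condition is evaluated immediately before each test. The bound
  \<open>e\<close> is evaluated anew each time and must be kept constant by the invariant.\<close>

definition loop :: "nat \<Rightarrow> aexp \<Rightarrow> com \<Rightarrow> com" where
  "loop i e c = Seq (Seq (blk [As i (K 0)]) (eval_code 0 (Bi Less (V i) e)))
     (While 1 (Seq c (Seq (blk [As i (Bi Add (V i) (K 1))]) (eval_code 0 (Bi Less (V i) e)))))"

definition loop_time :: "nat \<Rightarrow> nat \<Rightarrow> nat \<Rightarrow> nat" where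
  "loop_time n t te = n * (t + te + 16) + te + 14"

text \<open>The state in which \<open>While\<close> makes its test. It has to mention register 1,
  which assertions on variables cannot see.\<close>

definition loop_head :: "nat \<Rightarrow> nat \<Rightarrow> (nat \<Rightarrow> assn) \<Rightarrow> nat \<Rightarrow> state \<Rightarrow> bool" where
  "loop_head n i I j s \<longleftrightarrow> I j (vars s) (mem s) \<and> vars s i = int j \<and> (regs s 1 \<noteq> 0 \<longleftrightarrow> j < n)"

lemma okwI: "0 \<le> x \<Longrightarrow> x < 2 ^ w \<Longrightarrow> okw w x"
  unfolding okw_def by (smt (verit) zero_le_power)

lemma wrap_0 [simp]: "wrap w 0 = 0"
  by (simp add: wrap_id okwI)

lemma loop_cond:
  assumes "\<And>v \<mu>. I v \<mu> \<Longrightarrow> v i = int j \<Longrightarrow> ev w e v \<mu> = int n" and "1 \<le> w"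
  shows "HS w (\<lambda>s. I (vars s) (mem s) \<and> vars s i = int j) (eval_code 0 (Bi Less (V i) e))
    (eval_time e + 4) (loop_head n i (\<lambda>_. I) j) 0 (\<lambda>_. True)"
  unfolding HS_def
proof (intro allI impI)
  fix s assume s: "wf_state w s" "I (vars s) (mem s) \<and> vars s i = int j"
  obtain s1 where s1: "outcome w (eval_code 0 (Bi Less (V i) e)) s (eval_time (Bi Less (V i) e)) (return_pmf s1)"
    "eval_post 0 s (ev w (Bi Less (V i) e) (vars s) (mem s)) s1" using eval_code[OF s(1)] by blast
  have "wrap w 1 = 1" using \<open>1 \<le> w\<close> by (intro wrap_id okwI) (simp_all add: one_less_power)
  hence "loop_head n i (\<lambda>_. I) j s1"
    using s1(2) eval_post_vars[OF s1(2)] s(2) assms(1)[of "vars s" "mem s"]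
    by (auto simp: loop_head_def eval_post_def)
  moreover have "eval_time (Bi Less (V i) e) = eval_time e + 4" by simp
  ultimately show "\<exists>D. outcome w (eval_code 0 (Bi Less (V i) e)) s (eval_time e + 4) D \<and>
      (\<forall>s' \<in> set_pmf D. loop_head n i (\<lambda>_. I) j s') \<and> 0 \<le> measure_pmf.prob D {s'. True}"
    using outcome_mono[OF s1(1), of "eval_time e + 4"]
    by (intro exI[of _ "return_pmf s1"]) (simp del: eval_code.simps)
qed

lemma HS_Seq0:
  assumes "HS w P c1 t1 Q 0 (\<lambda>_. True)" and "HS w Q c2 t2 R 0 (\<lambda>_. True)"
  shows "HS w P (Seq c1 c2) (t1 + 1 + t2) R 0 (\<lambda>_. True)"
  using HS_Seq[OF assms(1,2), of 0 "\<lambda>_. True"] assms(2) by simp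

lemma loop_init:
  assumes "\<And>v \<mu> x. I (v(i := x)) \<mu> = I v \<mu>"
    and "\<And>v \<mu>. I v \<mu> \<Longrightarrow> v i = int 0 \<Longrightarrow> ev w e v \<mu> = int n" and "1 \<le> w"
  shows "HS w (\<lambda>s. I (vars s) (mem s)) (Seq (blk [As i (K 0)]) (eval_code 0 (Bi Less (V i) e)))
    (eval_time e + 9) (loop_head n i (\<lambda>_. I) 0) 0 (\<lambda>_. True)"
proof -
  have 1: "T w I (blk [As i (K 0)]) 4 (\<lambda>v \<mu>. I v \<mu> \<and> v i = int 0)"
    by (rule T_blk) (auto simp: assms(1))
  have "HS w (\<lambda>s. I (vars s) (mem s)) (Seq (blk [As i (K 0)]) (eval_code 0 (Bi Less (V i) e)))
    (4 + 1 + (eval_time e + 4)) (loop_head n i (\<lambda>_. I) 0) 0 (\<lambda>_. True)"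
    using HS_Seq0[OF 1[unfolded HT_def] loop_cond[of I i 0, OF assms(2,3)]] .
  thus ?thesis by (rule HS_weaken) auto
qed

lemma loop_inc:
  assumes "HT w (\<lambda>v \<mu>. P v \<mu> \<and> v i = int j) c t (\<lambda>v \<mu>. I v \<mu> \<and> v i = int j) \<pi> B"
    and "\<And>v \<mu> x. I (v(i := x)) \<mu> = I v \<mu>" and "\<And>v \<mu> x. B (v(i := x)) \<mu> = B v \<mu>"
    and "\<And>v \<mu>. I v \<mu> \<Longrightarrow> v i = int (Suc j) \<Longrightarrow> ev w e v \<mu> = int n" and "j < n" and "n < 2 ^ w"
    and "0 \<le> \<pi>"
  shows "HS w (loop_head n i (\<lambda>_. P) j)
      (Seq c (Seq (blk [As i (Bi Add (V i) (K 1))]) (eval_code 0 (Bi Less (V i) e))))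
    (t + eval_time e + 14) (loop_head n i (\<lambda>_. I) (Suc j)) \<pi> (\<lambda>s. B (vars s) (mem s))"
proof -
  have w: "1 \<le> w" using assms(5,6) by (cases w) auto
  have jw: "int j + 1 < 2 ^ w" using assms(5,6) by (metis of_nat_Suc of_nat_less_iff of_nat_numeral
        of_nat_power le_less_trans Suc_leI add.commute)
  have w1: "wrap w 1 = 1" "wrap w (int j + 1) = int j + 1"
    using jw w by (auto intro!: wrap_id okwI simp: one_less_power)
  have inc: "T w (\<lambda>v \<mu>. I' v \<mu> \<and> v i = int j) (blk [As i (Bi Add (V i) (K 1))]) 8 (\<lambda>v \<mu>. I' v \<mu> \<and> v i = int (Suc j))"
    if "\<And>v \<mu> x. I' (v(i := x)) \<mu> = I' v \<mu>" for I'
    by (rule T_blk) (auto simp: that w1)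
  have *: "HS w (\<lambda>s. I' (vars s) (mem s) \<and> vars s i = int j)
      (Seq (blk [As i (Bi Add (V i) (K 1))]) (eval_code 0 (Bi Less (V i) e)))
      (8 + 1 + (eval_time e + 4)) (loop_head n i (\<lambda>_. I') (Suc j)) 0 (\<lambda>_. True)"
    if "\<And>v \<mu> x. I' (v(i := x)) \<mu> = I' v \<mu>" "\<And>v \<mu>. I' v \<mu> \<Longrightarrow> I v \<mu>" for I'
    by (rule HS_Seq0[OF inc[of I', unfolded HT_def] loop_cond]) (use that w assms(4) in auto)
  have "HS w (\<lambda>s. P (vars s) (mem s) \<and> vars s i = int j)
      (Seq c (Seq (blk [As i (Bi Add (V i) (K 1))]) (eval_code 0 (Bi Less (V i) e))))
    (t + 1 + (8 + 1 + (eval_time e + 4))) (loop_head n i (\<lambda>_. I) (Suc j)) (\<pi> * 1) (\<lambda>s. B (vars s) (mem s))"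
  proof (rule HS_Seq[OF assms(1)[unfolded HT_def] *[of I]])
    show "HS w (\<lambda>s. (I (vars s) (mem s) \<and> vars s i = int j) \<and> B (vars s) (mem s))
     (Seq (blk [As i (Bi Add (V i) (K 1))]) (eval_code 0 (Bi Less (V i) e))) (8 + 1 + (eval_time e + 4))
     (loop_head n i (\<lambda>_. I) (Suc j)) 1 (\<lambda>s. B (vars s) (mem s))"
      by (rule HS_weaken[OF HS_certain[OF *[of "\<lambda>v \<mu>. I v \<mu> \<and> B v \<mu>"]]])
        (auto simp: assms loop_head_def)
  qed (use assms in auto)
  thus ?thesis by (rule HS_weaken) (auto simp: loop_head_def)
qed

lemma HT_loop_event:
  assumes body: "\<And>j. j < n \<Longrightarrow> T w (\<lambda>v \<mu>. I j v \<mu> \<and> v i = int j) c t (\<lambda>v \<mu>. I (Suc j) v \<mu> \<and> v i = int j)"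
    and indep: "\<And>j v \<mu> x. I j (v(i := x)) \<mu> = I j v \<mu>" and indepB: "\<And>v \<mu> x. B (v(i := x)) \<mu> = B v \<mu>"
    and bound: "\<And>j v \<mu>. j \<le> n \<Longrightarrow> I j v \<mu> \<Longrightarrow> v i = int j \<Longrightarrow> ev w e v \<mu> = int n"
    and "n < 2 ^ w" and "1 \<le> w" and "0 \<le> \<pi>" and "j0 < n"
    and event: "HT w (\<lambda>v \<mu>. I j0 v \<mu> \<and> v i = int j0) c t (\<lambda>v \<mu>. I (Suc j0) v \<mu> \<and> v i = int j0) \<pi> B"
    and stable: "\<And>j. j0 < j \<Longrightarrow> j < n \<Longrightarrow> T w (\<lambda>v \<mu>. (I j v \<mu> \<and> B v \<mu>) \<and> v i = int j) c t
      (\<lambda>v \<mu>. (I (Suc j) v \<mu> \<and> B v \<mu>) \<and> v i = int j)"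
  shows "HT w (I 0) (loop i e c) (loop_time n t (eval_time e)) (I n) \<pi> B"
proof -
  define A where "A = loop_head n i I"
  have hd: "loop_head n i (\<lambda>_. I j) j = A j" for j
    by (auto simp: A_def loop_head_def fun_eq_iff)
  let ?c = "Seq c (Seq (blk [As i (Bi Add (V i) (K 1))]) (eval_code 0 (Bi Less (V i) e)))"
  have init: "HS w (\<lambda>s. I 0 (vars s) (mem s)) (Seq (blk [As i (K 0)]) (eval_code 0 (Bi Less (V i) e)))
    (eval_time e + 9) (A 0) 0 (\<lambda>_. True)"
    using loop_init[of "I 0" i w e n] indep bound[of 0] \<open>1 \<le> w\<close> unfolding hd by fastforce
  have 1: "HS w (A j) ?c (t + eval_time e + 14) (A (Suc j)) 0 (\<lambda>_. True)" if "j < n" for j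
    using loop_inc[of w "I j" i j c t "I (Suc j)" 0 "\<lambda>_ _. True" e n, OF body[OF that]]
      indep bound[of "Suc j"] that assms(5) unfolding hd by (simp add: Suc_le_eq)
  have 2: "HS w (A j0) ?c (t + eval_time e + 14) (A (Suc j0)) \<pi> (\<lambda>s. B (vars s) (mem s))"
    using loop_inc[OF event, of e n] indep indepB bound[of "Suc j0"] assms(5,7,8) unfolding hd
    by (simp add: Suc_le_eq)
  have 3: "HS w (\<lambda>s. A j s \<and> B (vars s) (mem s)) ?c (t + eval_time e + 14)
      (\<lambda>s. A (Suc j) s \<and> B (vars s) (mem s)) 0 (\<lambda>_. True)" if "j0 < j" "j < n" for j
  proof -
    have "HS w (loop_head n i (\<lambda>_ v \<mu>. I j v \<mu> \<and> B v \<mu>) j) ?c (t + eval_time e + 14)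
      (loop_head n i (\<lambda>_ v \<mu>. I (Suc j) v \<mu> \<and> B v \<mu>) (Suc j)) 0 (\<lambda>_. True)"
      using loop_inc[of w "\<lambda>v \<mu>. I j v \<mu> \<and> B v \<mu>" i j c t "\<lambda>v \<mu>. I (Suc j) v \<mu> \<and> B v \<mu>" 0 "\<lambda>_ _. True" e n, OF stable[OF that]]
        indep indepB bound[of "Suc j"] that assms(5) by simp
    thus ?thesis by (rule HS_weaken) (auto simp: A_def loop_head_def)
  qed
  have n: "regs s 1 \<noteq> 0 \<longleftrightarrow> j < n" if "j \<le> n" "A j s" for j s
    using that by (simp add: A_def loop_head_def)
  have w0: "HS w (A 0) (While 1 ?c) ((n - 0) * (t + eval_time e + 14 + 2) + 1) (A n) 0 (\<lambda>_. True)"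
    by (rule HS_While[where A = A and n = n, OF 1 n]) auto
  have w1: "HS w (A 0) (While 1 ?c) ((n - 0) * (t + eval_time e + 14 + 2) + 1) (A n) \<pi> (\<lambda>s. B (vars s) (mem s))"
    by (rule HS_While_event[where A = A and n = n, OF 1 n 2 \<open>0 \<le> \<pi>\<close> 3 \<open>j0 < n\<close>]) auto
  have "HS w (\<lambda>s. I 0 (vars s) (mem s)) (loop i e c)
      (eval_time e + 9 + 1 + ((n - 0) * (t + eval_time e + 14 + 2) + 1)) (A n) (1 * \<pi>) (\<lambda>s. B (vars s) (mem s))"
    unfolding loop_def
    by (rule HS_Seq[OF HS_certain[OF init] w0 _ \<open>0 \<le> \<pi>\<close>], rule HS_weaken[OF w1]) auto
  thus ?thesis unfolding HT_def
    by (rule HS_weaken) (auto simp: A_def loop_head_def loop_time_def algebra_simps)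
qed

lemma T_loop:
  assumes body: "\<And>j. j < n \<Longrightarrow> T w (\<lambda>v \<mu>. I j v \<mu> \<and> v i = int j) c t (\<lambda>v \<mu>. I (Suc j) v \<mu> \<and> v i = int j)"
    and indep: "\<And>j v \<mu> x. I j (v(i := x)) \<mu> = I j v \<mu>"
    and bound: "\<And>j v \<mu>. j \<le> n \<Longrightarrow> I j v \<mu> \<Longrightarrow> v i = int j \<Longrightarrow> ev w e v \<mu> = int n"
    and "n < 2 ^ w" and "1 \<le> w" and "loop_time n t (eval_time e) \<le> t'"
  shows "T w (I 0) (loop i e c) t' (I n)"
proof (cases "n = 0")
  case False
  have "HT w (I 0) (loop i e c) (loop_time n t (eval_time e)) (I n) 0 (\<lambda>_ _. True)"
  proof (rule HT_loop_event[where ?j0.0 = 0])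
    show "T w (\<lambda>v \<mu>. (I j v \<mu> \<and> True) \<and> v i = int j) c t
      (\<lambda>v \<mu>. (I (Suc j) v \<mu> \<and> True) \<and> v i = int j)" if "j < n" for j
      using body[OF that] by simp
    show "T w (\<lambda>v \<mu>. I 0 v \<mu> \<and> v i = int 0) c t (\<lambda>v \<mu>. I (Suc 0) v \<mu> \<and> v i = int 0)"
      using body[of 0] False by simp
  qed (use assms False in \<open>auto simp del: fun_upd_apply of_nat_Suc\<close>)
  thus ?thesis by (rule HT_weaken) (use assms in auto)
next
  case True
  have init: "HS w (\<lambda>s. I 0 (vars s) (mem s)) (Seq (blk [As i (K 0)]) (eval_code 0 (Bi Less (V i) e)))
    (eval_time e + 9) (loop_head n i (\<lambda>_. I 0) 0) 0 (\<lambda>_. True)"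
    using loop_init[of "I 0" i w e n] indep bound[of 0] \<open>1 \<le> w\<close> by fastforce
  have w0: "HS w (loop_head n i I 0) (While 1 d) ((n - 0) * (0 + 2) + 1) (loop_head n i I n) 0 (\<lambda>_. True)" for d
    by (rule HS_While) (use True in \<open>auto simp: loop_head_def\<close>)
  have "HS w (\<lambda>s. I 0 (vars s) (mem s)) (loop i e c)
      (eval_time e + 9 + 1 + ((n - 0) * (0 + 2) + 1)) (loop_head n i I n) 0 (\<lambda>_. True)"
    unfolding loop_def
    by (rule HS_Seq0[OF init], rule HS_weaken[OF w0]) (auto simp: loop_head_def)
  thus ?thesis unfolding HT_def
    by (rule HS_weaken) (use assms True in \<open>auto simp: loop_head_def loop_time_def algebra_simps\<close>)
qed

text \<open>A signed word has \<open>w + 1\<close> bits, so \<open>\<delta>\<close> bounds the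
  fraction of bad words. The target is register \<open>3 * x\<close> because variable
  \<open>x\<close> lives there.\<close>

lemma HT_Rand:
  assumes Q: "\<And>v \<mu> a. P v \<mu> \<Longrightarrow> okw w a \<Longrightarrow> Q (v(x := a)) \<mu>"
    and R: "\<And>v \<mu>. P v \<mu> \<Longrightarrow> real (card {a. okw w a \<and> \<not> R (v(x := a)) \<mu>}) \<le> \<delta> * 2 ^ (w + 1)"
  shows "HT w P (Rand (3 * x)) 1 Q (1 - \<delta>) R"
  unfolding HT_def HS_def
proof (intro allI impI)
  fix s assume s: "wf_state w s" "P (vars s) (mem s)"
  let ?I = "{- (2 ^ w) ..< 2 ^ w} :: int set"
  have "- (2 ^ w) < (2 ^ w :: int)" using zero_less_power[of "2::int" w] by linarith
  hence I: "finite ?I" "?I \<noteq> {}" "card ?I = 2 ^ (w + 1)"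
    by (auto simp: nat_mult_distrib nat_power_eq)
  have okI: "okw w a \<longleftrightarrow> a \<in> ?I" for a by (auto simp: okw_def)
  define D where "D = map_pmf (\<lambda>a. set_reg w (3 * x) a s) (pmf_of_set ?I)"
  have D: "outcome w (Rand (3 * x)) s 1 D"
    by (rule outcome_step) (simp add: D_def pmf.map_comp o_def)
  have vs: "vars (set_reg w (3 * x) a s) = (vars s)(x := a)" "mem (set_reg w (3 * x) a s) = mem s"
    if "okw w a" for a
    using that by (auto simp: vars_def set_reg_def wrap_id)
  have QD: "\<forall>s' \<in> set_pmf D. Q (vars s') (mem s')"
  proof
    fix s' assume "s' \<in> set_pmf D"
    then obtain a where "okw w a" "s' = set_reg w (3 * x) a s" using I okI by (auto simp: D_def)
    thus "Q (vars s') (mem s')" using Q[OF s(2)] vs by simp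
  qed
  have "measure_pmf.prob D {s'. \<not> R (vars s') (mem s')} =
     real (card (?I \<inter> {a. \<not> R (vars (set_reg w (3 * x) a s)) (mem s)})) / 2 ^ (w + 1)"
    using I by (simp add: D_def measure_pmf_of_set vimage_def set_reg_def)
  also have "?I \<inter> {a. \<not> R (vars (set_reg w (3 * x) a s)) (mem s)} = {a. okw w a \<and> \<not> R ((vars s)(x := a)) (mem s)}"
    using vs by (auto simp: okI)
  also have "real (card \<dots>) / 2 ^ (w + 1) \<le> \<delta>"
    using R[OF s(2)] by (simp add: divide_le_eq)
  finally have "measure_pmf.prob D {s'. \<not> R (vars s') (mem s')} \<le> \<delta>" .
  moreover have "measure_pmf.prob D {s'. \<not> R (vars s') (mem s')} = 1 - measure_pmf.prob D {s'. R (vars s') (mem s')}"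
    using measure_pmf.prob_compl[of "{s'. R (vars s') (mem s')}" D] by (simp add: Compl_eq_Diff_UNIV[symmetric] Collect_neg_eq)
  ultimately show "\<exists>D. outcome w (Rand (3 * x)) s 1 D \<and> (\<forall>s' \<in> set_pmf D. Q (vars s') (mem s')) \<and>
      1 - \<delta> \<le> measure_pmf.prob D {s'. R (vars s') (mem s')}"
    using D QD by (intro exI[of _ D]) auto
qed


section \<open>Simulation with shorter words\<close>

text \<open>The simulating program works with words of length \<open>w'\<close>, the simulated one with words of length
  \<open>w\<close>.  Variable \<open>1\<close> holds the address \<open>B\<close> of cell \<open>0\<close> of the simulated memory and variable \<open>2\<close>
  the difference \<open>w' - w\<close>; shifting left and then right by it reduces a word to length \<open>w\<close>.\<close>

definition preg :: "nat \<Rightarrow> nat" where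
  "preg r = 3 * r + 2"

lemma preg_simps [simp]:
  "preg r = preg r' \<longleftrightarrow> r = r'" "preg r \<noteq> 3 * r'" "3 * r' \<noteq> preg r" "preg r \<noteq> 1" "1 \<noteq> preg r"
  "preg r \<noteq> 3" "3 \<noteq> preg r" "preg r \<noteq> 6" "6 \<noteq> preg r" "preg r \<noteq> Suc 0" "Suc 0 \<noteq> preg r"
  unfolding preg_def by presburger+

definition trim :: "nat \<Rightarrow> com" where
  "trim r = Seq (Op Shl (preg r) (preg r) 6) (Op Shr (preg r) (preg r) 6)"

text \<open>Registers 3 and 6 are the variables 1 and 2; register 1 is a temporary for the
  translated address. An operation may be carried out on long words and trimmed afterwards, since
  the operations themselves do not depend on the word length and wrapping twice equals wrapping once
  to the shorter length.\<close>

fun sim :: "com \<Rightarrow> com" where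
  "sim Skip = Skip"
| "sim (Const r k) = Seq (Const (preg r) k) (trim r)"
| "sim (Op f r a b) = Seq (Op f (preg r) (preg a) (preg b)) (trim r)"
| "sim (Load r a) = Seq (Op Add 1 3 (preg a)) (Load (preg r) 1)"
| "sim (Store a r) = Seq (Op Add 1 3 (preg a)) (Store 1 (preg r))"
| "sim (Rand r) = Seq (Rand (preg r)) (trim r)"
| "sim (Seq p q) = Seq (sim p) (sim q)"
| "sim (If r p q) = If (preg r) (sim p) (sim q)"
| "sim (While r p) = While (preg r) (sim p)"

fun reg_bound :: "com \<Rightarrow> nat" where
  "reg_bound Skip = 0"
| "reg_bound (Const r k) = Suc r"
| "reg_bound (Op f r a b) = Suc (max r (max a b))"
| "reg_bound (Load r a) = Suc (max r a)"
| "reg_bound (Store a r) = Suc (max r a)"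
| "reg_bound (Rand r) = Suc r"
| "reg_bound (Seq p q) = max (reg_bound p) (reg_bound q)"
| "reg_bound (If r p q) = max (Suc r) (max (reg_bound p) (reg_bound q))"
| "reg_bound (While r p) = max (Suc r) (reg_bound p)"

fun sim_time :: "com \<Rightarrow> nat" where
  "sim_time (Const r k) = 5"
| "sim_time (Op f r a b) = 5"
| "sim_time (Load r a) = 3"
| "sim_time (Store a r) = 3"
| "sim_time (Rand r) = 5"
| "sim_time (Seq p q) = (if p = Skip then 1 else sim_time p)"
| "sim_time _ = 1"

lemma sim_time_le: "sim_time c \<le> 5"
  by (induction c) auto

lemma sim_Skip [simp]: "sim c = Skip \<longleftrightarrow> c = Skip"
  by (cases c) auto

text \<open>A component of a \<open>Seq\<close> hands over control one step after it has become
  \<open>Skip\<close>. Several steps of the simulation can be lifted into a \<open>Seq\<close> only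
  if the component is still running before each of them.\<close>

definition runs_long :: "nat \<Rightarrow> nat \<Rightarrow> com \<Rightarrow> state \<Rightarrow> bool" where
  "runs_long w t c s \<longleftrightarrow> (\<forall>i<t. \<forall>x \<in> set_pmf (steps w i (c, s)). fst x \<noteq> Skip)"

lemma runs_long_Suc:
  "runs_long w (Suc t) c s \<longleftrightarrow> c \<noteq> Skip \<and> (\<forall>x \<in> set_pmf (step w c s). runs_long w t (fst x) (snd x))"
proof -
  have "runs_long w (Suc t) c s \<longleftrightarrow> c \<noteq> Skip \<and> (\<forall>i<t. \<forall>x \<in> set_pmf (steps w (Suc i) (c, s)). fst x \<noteq> Skip)"
    unfolding runs_long_def by (subst All_less_Suc2) simp
  thus ?thesis unfolding runs_long_def by (simp, blast)
qed

lemma steps_Seq: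
  assumes "runs_long w t p s"
  shows "steps w t (Seq p q, s) = map_pmf (\<lambda>x. (Seq (fst x) q, snd x)) (steps w t (p, s))"
  using assms
proof (induction t arbitrary: p s)
  case (Suc t)
  have "steps w (Suc t) (Seq p q, s) = bind_pmf (step w p s) (\<lambda>x. steps w t (Seq (fst x) q, snd x))"
    using Suc.prems by (simp add: runs_long_Suc bind_map_pmf case_prod_beta)
  also have "\<dots> = bind_pmf (step w p s) (\<lambda>x. map_pmf (\<lambda>x. (Seq (fst x) q, snd x)) (steps w t x))"
    using Suc.prems Suc.IH by (intro bind_pmf_cong refl) (simp add: runs_long_Suc)
  finally show ?case by (simp add: map_bind_pmf)
qed simp

lemma runs_long_Seq:
  assumes "runs_long w t p s"
  shows "runs_long w t (Seq p q) s"
proof -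
  have "steps w i (Seq p q, s) = map_pmf (\<lambda>x. (Seq (fst x) q, snd x)) (steps w i (p, s))" if "i < t" for i
    using assms that by (intro steps_Seq) (unfold runs_long_def, meson less_trans)
  thus ?thesis by (auto simp: runs_long_def)
qed

definition trim_state :: "nat \<Rightarrow> nat \<Rightarrow> state \<Rightarrow> state" where
  "trim_state w r s = ((regs s)(preg r := wrap w (regs s (preg r))), mem s)"

lemma steps_trim:
  assumes "w \<le> w'" "regs s 6 = int (w' - w)"
  shows "steps w' 3 (trim r, s) = return_pmf (Skip, trim_state w r s)"
    and "runs_long w' 3 (trim r) s"
proof -

  have "wrap w' (drop_bit (w' - w) (wrap w' (push_bit (w' - w) x))) = wrap w x" for x
    using assms(1) by (simp add: wrap_shift wrap_id okw_mono[OF okw_wrap])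
  hence "set_reg w' (preg r) (drop_bit (w' - w) (wrap w' (push_bit (w' - w) (regs s (preg r)))))
     (set_reg w' (preg r) (push_bit (w' - w) (regs s (preg r))) s) = trim_state w r s"
    by (simp add: set_reg_def trim_state_def)
  thus "steps w' 3 (trim r, s) = return_pmf (Skip, trim_state w r s)"
    using assms(2) by (simp add: trim_def numeral_3_eq_3 bind_return_pmf set_reg_def)
  show "runs_long w' 3 (trim r) s"
    by (simp add: numeral_3_eq_3 runs_long_Suc trim_def) (simp add: runs_long_def)
qed

lemma steps_then_trim:
  assumes "step w' X s = map_pmf (Pair Skip) D" and "X \<noteq> Skip" and "w \<le> w'"
    and "\<And>s1. s1 \<in> set_pmf D \<Longrightarrow> regs s1 6 = int (w' - w)"
  shows "steps w' 5 (Seq X (trim r), s) = map_pmf (\<lambda>s1. (Skip, trim_state w r s1)) D"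
    and "runs_long w' 5 (Seq X (trim r)) s"
proof -
  have five: "5 = Suc (Suc 3)" by simp
  have 1: "step w' (Seq X (trim r)) s = map_pmf (\<lambda>s1. (Seq Skip (trim r), s1)) D"
    using assms(1,2) by (simp add: pmf.map_comp o_def)
  have "steps w' 5 (Seq X (trim r), s) = bind_pmf D (\<lambda>s1. steps w' 3 (trim r, s1))"
    unfolding five steps.simps fst_conv snd_conv 1 by (simp add: bind_map_pmf bind_return_pmf)
  also have "\<dots> = bind_pmf D (\<lambda>s1. return_pmf (Skip, trim_state w r s1))"
    using assms(3,4) by (intro bind_pmf_cong refl) (simp add: steps_trim)
  finally show "steps w' 5 (Seq X (trim r), s) = map_pmf (\<lambda>s1. (Skip, trim_state w r s1)) D"
    by (simp add: map_pmf_def)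
  have "runs_long w' 3 (trim r) s1" if "s1 \<in> set_pmf D" for s1
    using steps_trim(2)[OF assms(3) assms(4)[OF that]] .
  thus "runs_long w' 5 (Seq X (trim r)) s"
    unfolding five runs_long_Suc 1 by simp
qed

section \<open>Random words of different lengths and the step-by-step simulation\<close>

lemma words_interval:
  "finite {- (2 ^ w) ..< 2 ^ w :: int}" "{- (2 ^ w) ..< 2 ^ w :: int} \<noteq> {}"
  "card {- (2 ^ w) ..< 2 ^ w :: int} = 2 ^ (w + 1)"
proof -
  have "- (2 ^ w) < (2 ^ w :: int)" using zero_less_power[of "2::int" w] by linarith
  thus "finite {- (2 ^ w) ..< 2 ^ w :: int}" "{- (2 ^ w) ..< 2 ^ w :: int} \<noteq> {}"
    "card {- (2 ^ w) ..< 2 ^ w :: int} = 2 ^ (w + 1)"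
    by (auto simp: nat_mult_distrib nat_power_eq)
qed

text \<open>It suffices to drop one bit at a time: every word of length parameter \<open>v\<close>
  has exactly two preimages of length parameter \<open>v + 1\<close>, itself and the number that
  differs from it by \<open>2 * 2 ^ v\<close> towards the other sign.\<close>

lemma uniform_wrap:
  assumes "w \<le> w'"
  shows "map_pmf (wrap w) (pmf_of_set {- (2 ^ w') ..< 2 ^ w'}) = pmf_of_set {- (2 ^ w) ..< 2 ^ w}"
  using assms
proof (induction rule: inc_induct)
  case base
  have "map_pmf (wrap w') (pmf_of_set {- (2 ^ w') ..< 2 ^ w'}) = map_pmf id (pmf_of_set {- (2 ^ w') ..< 2 ^ w'})"
    using words_interval[of w'] by (intro map_pmf_cong refl) (auto simp: wrap_id okw_def)
  thus ?case by (simp add: pmf.map_id)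
next
  case (step v)
  have "map_pmf (wrap v) (pmf_of_set {- (2 ^ w') ..< 2 ^ w'}) =
      map_pmf (wrap v) (map_pmf (wrap (Suc v)) (pmf_of_set {- (2 ^ w') ..< 2 ^ w'}))"
    by (simp add: pmf.map_comp o_def wrap_wrap)
  also have "\<dots> = map_pmf (wrap v) (pmf_of_set {- (2 ^ Suc v) ..< 2 ^ Suc v})"
    by (simp only: step.IH)
  also have "\<dots> = pmf_of_set {- (2 ^ v) ..< 2 ^ v}"
  proof (rule pmf_eqI)
    fix y :: int
    define E where "E = (2::int) ^ v"
    have E: "E > 0" by (simp add: E_def)
    let ?I = "{- (2 ^ Suc v) ..< 2 ^ Suc v} :: int set" and ?J = "{- (2 ^ v) ..< 2 ^ v} :: int set"
    have "?I \<inter> wrap v -` {y} = (if y \<in> ?J then {y, if y < 0 then y + 2 * E else y - 2 * E} else {})"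
    proof (cases "y \<in> ?J")
      case True
      hence y: "- E \<le> y" "y < E" by (auto simp: E_def)
      have w: "wrap v x = y \<longleftrightarrow> (\<exists>k. x = y + 2 * E * k)" for x
      proof
        assume "wrap v x = y"
        hence "y mod (2 * E) = x mod (2 * E)" using wrap_mod[of v x] by (simp add: E_def)
        thus "\<exists>k. x = y + 2 * E * k" by (metis mod_eqE)
      next
        assume "\<exists>k. x = y + 2 * E * k"
        hence "x mod (2 * E) = y mod (2 * E)" by auto
        hence "wrap v x = wrap v y"
          by (simp add: wrap_def signed_take_bit_eq_iff_take_bit_eq take_bit_eq_mod E_def)
        thus "wrap v x = y" using True by (simp add: wrap_id okw_def)
      qed
      have k: "k = -1 \<or> k = 0 \<or> k = 1" if "x = y + 2 * E * k" "x \<in> ?I" for x k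
      proof -
        have "- (2 * E) \<le> x" "x < 2 * E" using that(2) by (auto simp: E_def)
        moreover have "E * (2 * k) = x - y" using that(1) by simp
        ultimately have "E * (2 * k) < E * 3" "E * (- 3) < E * (2 * k)" using y by linarith+
        hence "2 * k < 3" "- 3 < 2 * k" using E by (metis mult_less_cancel_left_pos)+
        thus ?thesis by linarith
      qed
      have "x \<in> ?I \<inter> wrap v -` {y} \<longleftrightarrow> x \<in> ?I \<and> (x = y - 2 * E \<or> x = y \<or> x = y + 2 * E)" for x
      proof -
        have "\<exists>k. x = y + 2 * E * k" if "x = y - 2 * E \<or> x = y \<or> x = y + 2 * E"
          using that by (metis add.right_neutral diff_conv_add_uminus mult.right_neutral mult_minus_right mult_zero_right)
        moreover have "x = y - 2 * E \<or> x = y \<or> x = y + 2 * E" if "x = y + 2 * E * k" "x \<in> ?I" for k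
          using k[OF that] that(1) by auto
        ultimately show ?thesis using w by blast
      qed
      hence "?I \<inter> wrap v -` {y} = {x \<in> ?I. x = y - 2 * E \<or> x = y \<or> x = y + 2 * E}" by blast
      moreover have I: "?I = {- (2 * E) ..< 2 * E}" by (simp add: E_def)
      moreover have "{x \<in> {- (2 * E) ..< 2 * E}. x = y - 2 * E \<or> x = y \<or> x = y + 2 * E} =
          {y, if y < 0 then y + 2 * E else y - 2 * E}" using y E by auto
      ultimately show ?thesis unfolding I using True by (simp only: if_True)
    next
      case False
      thus ?thesis using okw_wrap[of v] by (auto simp: okw_def)
    qed
    hence c: "card (?I \<inter> wrap v -` {y}) = (if y \<in> ?J then 2 else 0)" using E by auto
    have "pmf (map_pmf (wrap v) (pmf_of_set ?I)) y = real (card (?I \<inter> wrap v -` {y})) / real (card ?I)"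
      by (simp only: pmf_map measure_pmf_of_set[OF words_interval(2,1)])
    also have "\<dots> = (if y \<in> ?J then 1 / real (card ?J) else 0)"
      unfolding c words_interval by (simp add: field_simps)
    also have "\<dots> = pmf (pmf_of_set ?J) y"
      using words_interval[of v] by (simp only: pmf_of_set) (simp split: split_indicator)
    finally show "pmf (map_pmf (wrap v) (pmf_of_set ?I)) y = pmf (pmf_of_set ?J) y" .
  qed
  finally show ?case .
qed

text \<open>The simulated memory is the window of \<open>H\<close> cells on either side of
  \<open>B\<close>. The condition \<open>2 ^ w \<le> H\<close> places every signed short word, used
  as an address, inside it.\<close>

locale simulation =
  fixes w w' :: nat and B H :: int and mx :: nat
  assumes w_le: "w \<le> w'" and H: "2 ^ w \<le> H" and lower: "- (2 ^ w') \<le> B - H" and upper: "B + H \<le> 2 ^ w'"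
begin

text \<open>Registers from \<open>mx\<close> on and addresses beyond the window read as 0, their
  value in \<open>init_state\<close>. The simulated program touches neither, so an abstract state
  can coincide with a genuine initial state.\<close>

definition absr :: "state \<Rightarrow> state" where
  "absr s = ((\<lambda>r. if r < mx then regs s (preg r) else 0),
    (\<lambda>a. if - H \<le> a \<and> a < H then mem s (B + a) else 0))"

definition winv :: "state \<Rightarrow> bool" where
  "winv s \<longleftrightarrow> regs s 3 = B \<and> regs s 6 = int (w' - w) \<and> (\<forall>r<mx. okw w (regs s (preg r))) \<and>
     (\<forall>a. - H \<le> a \<and> a < H \<longrightarrow> okw w (mem s (B + a)))"

definition frame :: "state \<Rightarrow> state \<Rightarrow> bool" where
  "frame s0 s \<longleftrightarrow> vars s = vars s0 \<and> (\<forall>a. \<not> (B - H \<le> a \<and> a < B + H) \<longrightarrow> mem s a = mem s0 a)"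

definition rel :: "state \<Rightarrow> config \<Rightarrow> config \<Rightarrow> bool" where
  "rel s0 x' x \<longleftrightarrow> fst x' = sim (fst x) \<and> reg_bound (fst x) \<le> mx \<and> snd x = absr (snd x') \<and>
     winv (snd x') \<and> frame s0 (snd x')"

lemma trim_rel:
  assumes "winv s" "frame s0 s" "r < mx" "s1 = ((regs s)(preg r := y), mem s)"
  shows "rel s0 (Skip, trim_state w r s1) (Skip, set_reg w r y (absr s))"
proof -
  show ?thesis using assms
    by (auto simp: rel_def winv_def frame_def absr_def trim_state_def set_reg_def vars_def fun_eq_iff)
qed

lemma winv_okw: "winv s \<Longrightarrow> r < mx \<Longrightarrow> okw w (regs s (preg r))"
  by (simp add: winv_def)

lemma sim_address:
  assumes "winv s" "a < mx"
  shows "set_reg w' 1 (regs s 3 + regs s (preg a)) s = ((regs s)(1 := B + regs s (preg a)), mem s)"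
    and "- H \<le> regs s (preg a)" and "regs s (preg a) < H"
proof -
  show 1: "- H \<le> regs s (preg a)" "regs s (preg a) < H"
    using winv_okw[OF assms] H by (auto simp: okw_def)
  show "set_reg w' 1 (regs s 3 + regs s (preg a)) s = ((regs s)(1 := B + regs s (preg a)), mem s)"
    using 1 assms lower upper by (simp add: set_reg_def winv_def wrap_id okw_def)
qed

text \<open>The two machines draw words from different sets, so their runs can only be compared by a
  coupling, which \<open>rel_pmf\<close> expresses. For \<open>Rand\<close> it pairs a long word
  with its reduction, by \<open>uniform_wrap\<close>; all other commands are deterministic.\<close>

lemma sim_step:
  assumes "reg_bound c \<le> mx" "winv s'" "frame s0 s'"
  shows "rel_pmf (rel s0) (steps w' (sim_time c) (sim c, s')) (step w c (absr s'))"
    and "c \<noteq> Skip \<longrightarrow> runs_long w' (sim_time c) (sim c) s'"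
proof -
  have "rel_pmf (rel s0) (steps w' (sim_time c) (sim c, s')) (step w c (absr s')) \<and>
     (c \<noteq> Skip \<longrightarrow> runs_long w' (sim_time c) (sim c) s')"
    using assms
  proof (induction c)
    case Skip
    thus ?case by (simp add: rel_def)
  next
    case (Const r k)
    have st: "step w' (Const (preg r) k) s' = map_pmf (Pair Skip) (return_pmf (set_reg w' (preg r) k s'))"
      by simp
    have 6: "\<And>s1. s1 \<in> set_pmf (return_pmf (set_reg w' (preg r) k s')) \<Longrightarrow> regs s1 6 = int (w' - w)"
      using Const.prems by (auto simp: set_reg_def winv_def)
    have "rel s0 (Skip, trim_state w r (set_reg w' (preg r) k s')) (Skip, set_reg w r (wrap w' k) (absr s'))"
      using Const.prems by (intro trim_rel) (auto simp: set_reg_def)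
    moreover have "set_reg w r (wrap w' k) (absr s') = set_reg w r k (absr s')"
      by (simp add: set_reg_def wrap_wrap[OF w_le])
    ultimately show ?case
      using steps_then_trim[OF st _ w_le 6, of r] by simp
  next
    case (Op f r a b)
    let ?y = "binop_val f (regs s' (preg a)) (regs s' (preg b))"
    have st: "step w' (Op f (preg r) (preg a) (preg b)) s' =
        map_pmf (Pair Skip) (return_pmf (set_reg w' (preg r) ?y s'))"
      by simp
    have 6: "\<And>s1. s1 \<in> set_pmf (return_pmf (set_reg w' (preg r) ?y s')) \<Longrightarrow> regs s1 6 = int (w' - w)"
      using Op.prems by (auto simp: set_reg_def winv_def)
    have "rel s0 (Skip, trim_state w r (set_reg w' (preg r) ?y s')) (Skip, set_reg w r (wrap w' ?y) (absr s'))"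
      using Op.prems by (intro trim_rel) (auto simp: set_reg_def)
    moreover have "set_reg w r (wrap w' ?y) (absr s') =
        set_reg w r (binop_val f (regs (absr s') a) (regs (absr s') b)) (absr s')"
    proof -
      have "a < mx" "b < mx" using Op.prems(1) by auto
      thus ?thesis by (simp add: set_reg_def wrap_wrap[OF w_le] absr_def)
    qed
    ultimately show ?case
      using steps_then_trim[OF st _ w_le 6, of r] by simp
  next
    case (Load r a)
    note addr = sim_address[OF Load.prems(2), of a]
    let ?x = "regs s' (preg a)"
    define s2 where "s2 = ((regs s')(1 := B + ?x, preg r := mem s' (B + ?x)), mem s')"
    have ar: "a < mx" "r < mx" using Load.prems by auto
    have ok: "okw w (mem s' (B + ?x))" using Load.prems(2) addr(2,3) ar by (simp add: winv_def)
    have "steps w' 3 (sim (Load r a), s') = return_pmf (Skip, s2)"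
      using addr(1)[OF ar(1)] ok okw_mono[OF ok w_le]
      by (simp add: numeral_3_eq_3 bind_return_pmf s2_def) (simp add: set_reg_def wrap_id)
    moreover have "rel s0 (Skip, s2) (Skip, set_reg w r (mem (absr s') (regs (absr s') a)) (absr s'))"
    proof -
      have "1 \<noteq> 3 * r'" for r' :: nat by presburger
      thus ?thesis using Load.prems ok addr(2,3) ar
        by (auto simp: rel_def winv_def frame_def absr_def s2_def set_reg_def vars_def fun_eq_iff wrap_id)
    qed
    moreover have "runs_long w' 3 (sim (Load r a)) s'"
      by (simp add: numeral_3_eq_3 runs_long_Suc) (simp add: runs_long_def)
    ultimately show ?case by simp
  next
    case (Store a r)
    note addr = sim_address[OF Store.prems(2), of a]
    let ?x = "regs s' (preg a)" and ?y = "regs s' (preg r)"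
    define s2 where "s2 = ((regs s')(1 := B + ?x), (mem s')(B + ?x := ?y))"
    have ar: "a < mx" "r < mx" using Store.prems by auto
    have ok: "okw w ?y" using Store.prems(2) ar by (simp add: winv_def)
    have "steps w' 3 (sim (Store a r), s') = return_pmf (Skip, s2)"
      using addr(1)[OF ar(1)] ok okw_mono[OF ok w_le]
      by (simp add: numeral_3_eq_3 bind_return_pmf s2_def) (simp add: set_mem_def wrap_id)
    moreover have "rel s0 (Skip, s2) (Skip, set_mem w (regs (absr s') a) (regs (absr s') r) (absr s'))"
    proof -
      have "1 \<noteq> 3 * r'" for r' :: nat by presburger
      thus ?thesis using Store.prems ok addr(2,3) ar
        by (auto simp: rel_def winv_def frame_def absr_def s2_def set_mem_def vars_def fun_eq_iff wrap_id)
    qed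
    moreover have "runs_long w' 3 (sim (Store a r)) s'"
      by (simp add: numeral_3_eq_3 runs_long_Suc) (simp add: runs_long_def)
    ultimately show ?case by simp
  next
    case (Rand r)
    let ?I = "\<lambda>w. {- (2 ^ w) ..< 2 ^ w} :: int set"
    define D where "D = map_pmf (\<lambda>x. set_reg w' (preg r) x s') (pmf_of_set (?I w'))"
    have st: "step w' (Rand (preg r)) s' = map_pmf (Pair Skip) D"
      by (simp add: D_def pmf.map_comp o_def)
    have 6: "\<And>s1. s1 \<in> set_pmf D \<Longrightarrow> regs s1 6 = int (w' - w)"
      using Rand.prems by (auto simp: D_def set_reg_def winv_def)
    have rl: "rel s0 (Skip, trim_state w r (set_reg w' (preg r) x s')) (Skip, set_reg w r (wrap w x) (absr s'))" for x
    proof -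
      have "rel s0 (Skip, trim_state w r (set_reg w' (preg r) x s')) (Skip, set_reg w r (wrap w' x) (absr s'))"
        using Rand.prems by (intro trim_rel) (auto simp: set_reg_def)
      thus ?thesis by (simp add: set_reg_def wrap_wrap[OF w_le] wrap_wrap)
    qed
    have "rel_pmf (rel s0) (map_pmf (\<lambda>s1. (Skip, trim_state w r s1)) D) (step w (Rand r) (absr s'))"
      unfolding D_def step.simps uniform_wrap[OF w_le, symmetric]
      by (auto simp: pmf.map_comp o_def pmf.rel_map rl intro!: rel_pmf_reflI)
    thus ?case using steps_then_trim[OF st _ w_le 6, of r] by simp
  next
    case (Seq p q)
    show ?case
    proof (cases "p = Skip")
      case True
      thus ?thesis using Seq.prems by (simp add: bind_return_pmf rel_def runs_long_def)
    next
      case False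
      have IH: "rel_pmf (rel s0) (steps w' (sim_time p) (sim p, s')) (step w p (absr s'))"
        "runs_long w' (sim_time p) (sim p) s'" using Seq False by auto
      have "rel_pmf (rel s0) (map_pmf (\<lambda>x. (Seq (fst x) (sim q), snd x)) (steps w' (sim_time p) (sim p, s')))
          (map_pmf (\<lambda>(p', s'). (Seq p' q, s')) (step w p (absr s')))"
        unfolding pmf.rel_map
        by (rule pmf.rel_mono_strong[OF IH(1)]) (use Seq.prems in \<open>auto simp: rel_def case_prod_beta\<close>)
      thus ?thesis using False steps_Seq[OF IH(2), of "sim q"] runs_long_Seq[OF IH(2), of "sim q"] by simp
    qed
  next
    case (If r p q)
    have "regs (absr s') r = regs s' (preg r)" using If.prems by (simp add: absr_def)
    thus ?case using If.prems by (auto simp: bind_return_pmf rel_def runs_long_def)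
  next
    case (While r p)
    have "regs (absr s') r = regs s' (preg r)" using While.prems by (simp add: absr_def)
    thus ?case using While.prems by (auto simp: bind_return_pmf rel_def runs_long_def)
  qed
  thus "rel_pmf (rel s0) (steps w' (sim_time c) (sim c, s')) (step w c (absr s'))"
    "c \<noteq> Skip \<longrightarrow> runs_long w' (sim_time c) (sim c) s'" by auto
qed

lemma sim_steps:
  assumes "halts_within w t x" "rel s0 x' x"
  shows "rel_pmf (rel s0) (steps w' (5 * t) x') (steps w t x)"
  using assms
proof (induction t arbitrary: x x')
  case 0
  thus ?case by simp
next
  case (Suc t)
  obtain c s c' s' where x: "x = (c, s)" "x' = (c', s')" by (cases x, cases x')
  have r: "c' = sim c" "reg_bound c \<le> mx" "s = absr s'" "winv s'" "frame s0 s'"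
    using Suc.prems(2) by (auto simp: x rel_def)
  have h: "halts_within w t y" if "y \<in> set_pmf (step w c s)" for y
    using Suc.prems(1) that by (simp add: x halts_within_Suc)
  have fin: "rel_pmf (rel s0) (steps w' (5 * t + u) y') (steps w t y)"
    if "y \<in> set_pmf (step w c s)" "rel s0 y' y" for y y' u
  proof -
    have 1: "rel_pmf (rel s0) (steps w' (5 * t) y') (steps w t y)" using Suc.IH h that by blast
    have "fst z' = Skip" if "z' \<in> set_pmf (steps w' (5 * t) y')" for z'
    proof -
      obtain z where "z \<in> set_pmf (steps w t y)" "rel s0 z' z"
        using 1 \<open>z' \<in> _\<close> rel_pmf_imp_rel_set by (metis rel_setD1)
      thus ?thesis using h[OF \<open>y \<in> _\<close>] by (auto simp: halts_within_def rel_def)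
    qed
    thus ?thesis using 1 steps_halted[of w' "5 * t" y' u] by (simp add: halts_within_def)
  qed
  \<comment> \<open>One simulated step takes at most five steps. The surplus is moved to the end,
    where the simulating program has already halted, so that all commands get the same time
    bound.\<close>
  have "5 * Suc t = sim_time c + (5 * t + (5 - sim_time c))" using sim_time_le[of c] by simp
  hence "steps w' (5 * Suc t) x' = bind_pmf (steps w' (sim_time c) (sim c, s')) (steps w' (5 * t + (5 - sim_time c)))"
    by (metis steps_add x(2) r(1))
  moreover have "rel_pmf (\<lambda>y' y. y \<in> set_pmf (step w c s) \<and> rel s0 y' y) (steps w' (sim_time c) (sim c, s')) (step w c s)"
    using sim_step(1)[OF r(2,4,5)] unfolding r(3) by (rule pmf.rel_mono_strong) auto
  ultimately show ?case unfolding x(1) steps.simps fst_conv snd_conv using fin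
    by (auto intro!: rel_pmf_bindI)
qed

end

fun clear :: "nat \<Rightarrow> com" where
  "clear 0 = Skip"
| "clear (Suc r) = Seq (clear r) (Const (preg r) 0)"

text \<open>This recreates the registers of \<open>init_state\<close>: zeros, and in simulated
  register 0 the short word length, which variable 12 (register 36) holds. \<open>Suc\<close> makes
  sure that register 0 is among the cleared ones.\<close>

definition call :: "com \<Rightarrow> com" where
  "call p = Seq (clear (Suc (reg_bound p))) (Seq (Op And (preg 0) 36 36) (Seq (trim 0) (sim p)))"

lemma clear: "\<exists>s'. outcome w (clear n) s (2 * n) (return_pmf s') \<and> vars s' = vars s \<and> mem s' = mem s \<and>
    (\<forall>r<n. regs s' (preg r) = 0)"
proof (induction n)
  case 0
  show ?case by (intro exI[of _ s]) (simp add: outcome_def)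
next
  case (Suc n)
  then obtain s1 where s1: "outcome w (clear n) s (2 * n) (return_pmf s1)" "vars s1 = vars s"
    "mem s1 = mem s" "\<forall>r<n. regs s1 (preg r) = 0" by blast
  define s2 where "s2 = set_reg w (preg n) 0 s1"
  have "outcome w (Const (preg n) 0) s1 1 (return_pmf s2)"
    by (rule outcome_step) (simp add: s2_def)
  from outcome_Seq_return[OF s1(1) this, of "2 * Suc n"]
  have "outcome w (clear (Suc n)) s (2 * Suc n) (return_pmf s2)" by simp
  moreover have "preg n \<noteq> 3 * r" for r by simp
  moreover have "vars s2 = vars s" "mem s2 = mem s" "\<forall>r<Suc n. regs s2 (preg r) = 0"
    using s1 by (auto simp: s2_def set_reg_def vars_def fun_eq_iff less_Suc_eq)
  ultimately show ?case by blast
qed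

text \<open>The window has to look exactly like an initial memory. As \<open>p\<close> may write
  anywhere in it, each later call gets untouched cells instead of a cleaned-up window. Nothing is
  known about the window afterwards except what \<open>Cor\<close> says with probability
  \<open>\<pi>\<close>.\<close>

lemma HT_call:
  fixes B H :: int and xs :: "int list"
  assumes "w \<le> w'" "2 ^ w \<le> H" "- (2 ^ w') \<le> B - H" "B + H \<le> 2 ^ w'" and len: "int (length xs) \<le> H"
    and halts: "halts_within w t (p, init_state w xs)"
    and prob: "\<pi> \<le> measure_pmf.prob (steps w t (p, init_state w xs)) {c'. Cor (mem (snd c'))}"
    and v0: "v0 1 = B" "v0 2 = int (w' - w)" "v0 12 = int w"
    and \<mu>0: "\<And>a. - H \<le> a \<Longrightarrow> a < H \<Longrightarrow>
       \<mu>0 (B + a) = (if 0 \<le> a \<and> a < int (length xs) then wrap w (xs ! nat a) else 0)"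
  shows "HT w' (\<lambda>v \<mu>. v = v0 \<and> \<mu> = \<mu>0) (call p) (5 * t + 2 * reg_bound p + 12)
    (\<lambda>v \<mu>. v = v0 \<and> (\<forall>a. \<not> (B - H \<le> a \<and> a < B + H) \<longrightarrow> \<mu> a = \<mu>0 a)) \<pi>
    (\<lambda>v \<mu>. Cor (\<lambda>a. if - H \<le> a \<and> a < H then \<mu> (B + a) else 0))"
  unfolding HT_def HS_def
proof (intro allI impI)
  fix s assume s: "wf_state w' s" "vars s = v0 \<and> mem s = \<mu>0"
  interpret simulation w w' B H "Suc (reg_bound p)"
    using assms by unfold_locales
  obtain s1 where s1: "outcome w' (clear (Suc (reg_bound p))) s (2 * Suc (reg_bound p)) (return_pmf s1)"
    "vars s1 = vars s" "mem s1 = mem s" "\<forall>r<Suc (reg_bound p). regs s1 (preg r) = 0"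
    using clear by blast
  have r1: "regs s1 3 = B" "regs s1 6 = int (w' - w)" "regs s1 36 = int w"
    using fun_cong[OF s1(2), of 1] fun_cong[OF s1(2), of 2] fun_cong[OF s1(2), of 12] s(2) v0
    by (simp_all add: vars_def)
  define s2 where "s2 = set_reg w' (preg 0) (int w) s1"
  have o2: "outcome w' (Op And (preg 0) 36 36) s1 1 (return_pmf s2)"
    by (rule outcome_step) (simp add: s2_def r1)
  define s3 where "s3 = trim_state w 0 s2"
  have o3: "outcome w' (trim 0) s2 3 (return_pmf s3)"
    using steps_trim(1)[of w w' s2 0] assms(1) r1 by (simp add: outcome_def s3_def s2_def set_reg_def)
  have s3: "s3 = ((regs s1)(preg 0 := wrap w (int w)), mem s)"
    using s1(3) by (simp add: s3_def trim_state_def s2_def set_reg_def wrap_wrap[OF assms(1)])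
  have v3: "vars s3 = vars s"
    unfolding s1(2)[symmetric] s3 by (auto simp: vars_def)
  have abs: "absr s3 = init_state w xs"
    using s1(4) s(2) \<mu>0 len by (auto simp: absr_def s3 init_state_def fun_eq_iff)
  have "winv s3"
  proof -
    have "okw w 0" by (simp add: okwI)
    thus ?thesis using s1(4) s(2) \<mu>0 r1 by (auto simp: winv_def s3)
  qed
  moreover have "frame s s3" by (simp add: frame_def v3) (simp add: s3)
  ultimately have "rel s (sim p, s3) (p, init_state w xs)" by (simp add: rel_def abs)
  from sim_steps[OF halts this]
  have R: "rel_pmf (rel s) (steps w' (5 * t) (sim p, s3)) (steps w t (p, init_state w xs))" .
  have R': "fst z' = Skip \<and> frame s (snd z')" if z': "z' \<in> set_pmf (steps w' (5 * t) (sim p, s3))" for z'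
  proof -
    obtain z where "z \<in> set_pmf (steps w t (p, init_state w xs))" "rel s z' z"
      using rel_setD1[OF rel_pmf_imp_rel_set[OF R] z'] by blast
    thus ?thesis using halts by (auto simp: halts_within_def rel_def)
  qed
  define D where "D = map_pmf snd (steps w' (5 * t) (sim p, s3))"
  have o4: "outcome w' (sim p) s3 (5 * t) D"
    unfolding D_def by (rule halts_outcome) (use R' in \<open>auto simp: halts_within_def\<close>)
  have "outcome w' (call p) s (5 * t + 2 * reg_bound p + 12) D"
    unfolding call_def
    by (rule outcome_mono[OF outcome_Seq_return[OF s1(1) outcome_Seq_return[OF o2
              outcome_Seq_return[OF o3 o4 refl] refl] refl]]) simp
  moreover have "\<pi> \<le> measure_pmf.prob D {s'. Cor (\<lambda>a. if - H \<le> a \<and> a < H then mem s' (B + a) else 0)}"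
  proof -
    let ?A = "{c'. Cor (mem (snd c'))} :: config set"
    have "rel_pmf (rel s)\<inverse>\<inverse> (steps w t (p, init_state w xs)) (steps w' (5 * t) (sim p, s3))"
      by (rule iffD2[OF pmf.rel_flip R])
    from rel_pmf_measureD[OF this, of ?A]
    have "\<pi> \<le> measure_pmf.prob (steps w' (5 * t) (sim p, s3)) {y. \<exists>x\<in>?A. rel s y x}"
      using prob unfolding conversep_iff by linarith
    also have "\<dots> \<le> measure_pmf.prob (steps w' (5 * t) (sim p, s3))
       (snd -` {s'. Cor (\<lambda>a. if - H \<le> a \<and> a < H then mem s' (B + a) else 0)})"
      by (intro measure_pmf.finite_measure_mono) (auto simp: rel_def absr_def)
    finally show ?thesis by (simp add: D_def)
  qed
  moreover have "\<forall>s' \<in> set_pmf D. vars s' = v0 \<and>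
      (\<forall>a. \<not> (B - H \<le> a \<and> a < B + H) \<longrightarrow> mem s' a = \<mu>0 a)"
    using R' s(2) by (auto simp: D_def frame_def)
  ultimately show "\<exists>D. outcome w' (call p) s (5 * t + 2 * reg_bound p + 12) D \<and>
      (\<forall>s' \<in> set_pmf D. vars s' = v0 \<and> (\<forall>a. \<not> (B - H \<le> a \<and> a < B + H) \<longrightarrow> mem s' a = \<mu>0 a)) \<and>
      \<pi> \<le> measure_pmf.prob D {s'. Cor (\<lambda>a. if - H \<le> a \<and> a < H then mem s' (B + a) else 0)}"
    by blast
qed


section \<open>Inner products of compressed strings\<close>

lemma rule_string_append:
  assumes "i < length S"
  shows "rule_string (S @ S') i = rule_string S i"
  using assms
proof (induction i rule: less_induct)
  case (less i)
  show ?case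
    by (subst (1 2) rule_string.simps)
      (use less in \<open>auto simp: nth_append split: rule_rhs.splits\<close>)
qed

lemma rule_string_Concat:
  assumes "j < length S" "k < length S"
  shows "rule_string (S @ [Concat j k]) (length S) = rule_string S j @ rule_string S k"
  by (subst rule_string.simps) (use assms in \<open>simp add: rule_string_append\<close>)

lemma is_slp_Concat:
  "is_slp \<Sigma> S \<Longrightarrow> j < length S \<Longrightarrow> k < length S \<Longrightarrow> is_slp \<Sigma> (S @ [Concat j k])"
  by (auto simp: is_slp_def nth_append less_Suc_eq split: rule_rhs.splits)

lemma is_slp_replicate:
  "is_slp \<Sigma> S \<Longrightarrow> a \<in> \<Sigma> \<Longrightarrow> is_slp \<Sigma> (S @ replicate n (Terminal a))"
  by (auto simp: is_slp_def nth_append split: rule_rhs.splits)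

lemma is_slp_mono: "is_slp \<Sigma> S \<Longrightarrow> \<Sigma> \<subseteq> \<Sigma>' \<Longrightarrow> is_slp \<Sigma>' S"
  by (fastforce simp: is_slp_def split: rule_rhs.splits)

text \<open>Inner product of a string with an infinite vector \<open>G\<close>, the string being
  placed at position \<open>q\<close>. The free offset makes concatenation additive.\<close>

fun phi :: "(nat \<Rightarrow> int) \<Rightarrow> nat \<Rightarrow> int list \<Rightarrow> int" where
  "phi G q [] = 0"
| "phi G q (x # xs) = x * G q + phi G (Suc q) xs"

lemma phi_append: "phi G q (xs @ ys) = phi G q xs + phi G (q + length xs) ys"
  by (induction xs arbitrary: q) auto

lemma phi_zeros: "phi G q (replicate n 0) = 0"
  by (induction n arbitrary: q) auto

lemma phi_sum: "phi G q xs = (\<Sum>i<length xs. xs ! i * G (q + i))"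
  by (induction xs arbitrary: q) (simp_all add: sum.lessThan_Suc_shift del: sum.lessThan_Suc)

text \<open>A rule is described by the length of its string and by the inner products at all
  offsets. Placing \<open>h\<close> zeros in front replaces \<open>f q\<close> by
  \<open>f (q + h)\<close>, so the construction of a row becomes a calculation with
  functions.\<close>

definition gen :: "(nat \<Rightarrow> int) \<Rightarrow> int slp \<Rightarrow> nat \<Rightarrow> nat \<Rightarrow> (nat \<Rightarrow> int) \<Rightarrow> bool" where
  "gen G S i l f \<longleftrightarrow> i < length S \<and> length (rule_string S i) = l \<and> (\<forall>q. phi G q (rule_string S i) = f q)"

lemma gen_append: "gen G S i l f \<Longrightarrow> gen G (S @ S') i l f"
  by (auto simp: gen_def rule_string_append)

lemma gen_Concat:
  assumes "gen G S j l f" "gen G S k l' f'" "l'' = l + l'" "\<And>q. f'' q = f q + f' (q + l)"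
  shows "gen G (S @ [Concat j k]) (length S) l'' f''"
  using assms by (auto simp: gen_def rule_string_Concat phi_append)

text \<open>A common prefix of all grammars: a single one, then zero strings of lengths 1, 2, 4 and
  so on. Because of the fixed numbering the program finds the zero block of length
  \<open>2 ^ l\<close> as rule \<open>l + 1\<close> without any lookup.\<close>

definition base_slp :: "int slp \<Rightarrow> nat \<Rightarrow> bool" where
  "base_slp S c \<longleftrightarrow> is_slp {0, 1} S \<and> c + 2 \<le> length S \<and> rule_string S 0 = [1] \<and>
     (\<forall>l\<le>c. rule_string S (Suc l) = replicate (2 ^ l) 0)"

lemma base_slp_init: "base_slp [Terminal 1, Terminal 0] 0"
  by (auto simp: base_slp_def is_slp_def rule_string.simps less_Suc_eq)

lemma base_slp_Concat:
  "base_slp S c \<Longrightarrow> j < length S \<Longrightarrow> k < length S \<Longrightarrow> base_slp (S @ [Concat j k]) c"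
  by (subgoal_tac "0 < length S") (auto simp: base_slp_def is_slp_Concat rule_string_append)

lemma base_slp_Suc:
  assumes "base_slp S c" "length S = c + 2"
  shows "base_slp (S @ [Concat (Suc c) (Suc c)]) (Suc c)"
proof -
  have "rule_string (S @ [Concat (Suc c) (Suc c)]) (Suc (Suc c)) = replicate (2 ^ Suc c) 0"
    using rule_string_Concat[of "Suc c" S "Suc c"] assms
    by (simp add: base_slp_def replicate_add[symmetric] mult_2)
  thus ?thesis using assms
    by (auto simp: base_slp_def is_slp_Concat rule_string_append le_Suc_eq)
qed

lemma base_slp_zeros: "base_slp S c \<Longrightarrow> l \<le> c \<Longrightarrow> gen G S (Suc l) (2 ^ l) (\<lambda>_. 0)"
  by (simp add: base_slp_def gen_def phi_zeros)

lemma base_slp_one: "base_slp S c \<Longrightarrow> gen G S 0 1 G"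
  by (auto simp: base_slp_def gen_def)

text \<open>One step of the construction of \<open>0\<^sup>x s 0\<^sup>y\<close> with \<open>x = h mod 2 ^ i\<close> and \<open>x + y = 2 ^ i - 1\<close>\<close>

lemma shift_step:
  assumes "base_slp S c" "i \<le> c" "gen G S k (l + 2 ^ i - 1) (\<lambda>q. f (q + h mod 2 ^ i))" "l \<ge> 1"
    and "r = (if bit h i then Concat (Suc i) k else Concat k (Suc i))"
  shows "gen G (S @ [r]) (length S) (l + 2 ^ Suc i - 1) (\<lambda>q. f (q + h mod 2 ^ Suc i))"
    and "base_slp (S @ [r]) c"
proof -
  have z: "gen G S (Suc i) (2 ^ i) (\<lambda>_. 0)" using base_slp_zeros assms(1,2) .
  have m: "h mod 2 ^ Suc i = (if bit h i then 2 ^ i else 0) + h mod 2 ^ i"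
    by (simp add: mod_mult2_eq[of h "2 ^ i" 2, simplified mult.commute] bit_iff_odd odd_iff_mod_2_eq_one)
  have l: "l + 2 ^ Suc i - 1 = l + 2 ^ i - 1 + 2 ^ i" using \<open>l \<ge> 1\<close> by simp
  show "gen G (S @ [r]) (length S) (l + 2 ^ Suc i - 1) (\<lambda>q. f (q + h mod 2 ^ Suc i))"
  proof (cases "bit h i")
    case True
    have "gen G (S @ [Concat (Suc i) k]) (length S) (l + 2 ^ Suc i - 1) (\<lambda>q. f (q + h mod 2 ^ Suc i))"
      by (rule gen_Concat[OF z assms(3)]) (use True l m in \<open>auto simp: ac_simps\<close>)
    thus ?thesis using True by (simp add: assms(5))
  next
    case False
    have "gen G (S @ [Concat k (Suc i)]) (length S) (l + 2 ^ Suc i - 1) (\<lambda>q. f (q + h mod 2 ^ Suc i))"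
      by (rule gen_Concat[OF assms(3) z]) (use False l m in \<open>auto simp: ac_simps\<close>)
    thus ?thesis using False by (simp add: assms(5))
  qed
  show "base_slp (S @ [r]) c"
    unfolding assms(5) using assms z by (auto simp: gen_def intro: base_slp_Concat)
qed

lemma mv_inner:
  fixes M :: "int mat"
  assumes "M \<in> carrier_mat N N" "v \<in> carrier_vec N" "i < N"
    and "list_of_vec v = map G [0..<N]" and "gen G S j N f" "list_of_vec (row M i) = rule_string S j"
  shows "(M *\<^sub>v v) $ i = f 0"
proof -
  have v: "v $ k = G k" if "k < N" for k
    using arg_cong[OF assms(4), of "\<lambda>xs. xs ! k"] assms(2) that by (simp add: list_of_vec_index)
  have r: "row M i $ k = rule_string S j ! k" if "k < N" for k
    using arg_cong[OF assms(6), of "\<lambda>xs. xs ! k"] assms(1) that by (simp add: list_of_vec_index)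
  have "(M *\<^sub>v v) $ i = (\<Sum>k<N. row M i $ k * v $ k)"
    using assms(1-3) by (simp add: scalar_prod_def lessThan_atLeast0)
  also have "\<dots> = (\<Sum>k<N. rule_string S j ! k * G (0 + k))"
    using v r by (intro sum.cong) auto
  also have "\<dots> = phi G 0 (rule_string S j)" using assms(5) by (simp add: gen_def phi_sum)
  also have "\<dots> = f 0" using assms(5) by (simp add: gen_def)
  finally show ?thesis .
qed


section \<open>Multiplicative hashing\<close>

text \<open>Multiply-shift hashing: the \<open>b\<close> most significant bits of
  \<open>\<alpha> * x\<close>, where words have \<open>W + 1\<close> bits including the sign. Unlike
  a hash modulo a prime it is a product and a shift, and it is additive up to a carry.\<close>

definition hsh :: "nat \<Rightarrow> nat \<Rightarrow> int \<Rightarrow> int \<Rightarrow> nat" where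
  "hsh W b \<alpha> x = nat ((\<alpha> * x mod 2 ^ Suc W) div 2 ^ (Suc W - b))"

lemma hsh_decomp:
  assumes "b \<le> Suc W"
  obtains k r where "\<alpha> * x = k * 2 ^ Suc W + int (hsh W b \<alpha> x) * 2 ^ (Suc W - b) + r"
    and "0 \<le> r" and "r < 2 ^ (Suc W - b)"
proof -
  let ?M = "2 ^ Suc W :: int" and ?s = "2 ^ (Suc W - b) :: int"
  have "\<alpha> * x = (\<alpha> * x div ?M) * ?M + ((\<alpha> * x mod ?M) div ?s) * ?s + (\<alpha> * x mod ?M) mod ?s"
    by (simp add: algebra_simps del: power_Suc)
  moreover have "(\<alpha> * x mod ?M) div ?s = int (hsh W b \<alpha> x)"
    unfolding hsh_def by (simp add: pos_imp_zdiv_nonneg_iff del: power_Suc)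
  ultimately show ?thesis by (intro that[of "\<alpha> * x div ?M" "(\<alpha> * x mod ?M) mod ?s"]) auto
qed

lemma hsh_less:
  assumes "b \<le> Suc W"
  shows "hsh W b \<alpha> x < 2 ^ b"
proof -
  have "(2::int) ^ Suc W = 2 ^ b * 2 ^ (Suc W - b)" using assms by (simp add: power_add[symmetric] del: power_Suc)
  hence "\<alpha> * x mod 2 ^ Suc W < 2 ^ b * 2 ^ (Suc W - b)"
    using pos_mod_bound[of "2 ^ Suc W" "\<alpha> * x"] by (simp del: power_Suc)
  moreover have "y div s < c" if "y < c * s" "0 < s" for y c s :: int
  proof (rule ccontr)
    assume "\<not> y div s < c"
    hence "c * s \<le> y div s * s" using that by (intro mult_right_mono) auto
    thus False using div_mult_mod_eq[of y s] pos_mod_sign[of s y] that by linarith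
  qed
  ultimately have "\<alpha> * x mod 2 ^ Suc W div 2 ^ (Suc W - b) < 2 ^ b" by simp
  thus ?thesis unfolding hsh_def by (simp add: nat_less_iff pos_imp_zdiv_nonneg_iff del: power_Suc)
qed

text \<open>The machine holds \<open>\<alpha> * x\<close> as a signed word, so the arithmetic shift
  may produce a negative number; the final reduction modulo \<open>2 ^ b\<close> removes the copies
  of the sign bit.\<close>

lemma hsh_program:
  assumes "b \<le> Suc W"
  shows "drop_bit (Suc W - b) (wrap W (\<alpha> * x)) mod 2 ^ b = int (hsh W b \<alpha> x)"
proof -
  let ?s = "2 ^ (Suc W - b) :: int"
  have M: "(2::int) ^ Suc W = ?s * 2 ^ b" using assms by (simp add: power_add[symmetric] del: power_Suc)
  have "wrap W (\<alpha> * x) mod (?s * 2 ^ b) = \<alpha> * x mod (?s * 2 ^ b)"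
    using wrap_mod[of W "\<alpha> * x"] unfolding M .
  hence "(wrap W (\<alpha> * x) mod (?s * 2 ^ b)) div ?s = (\<alpha> * x mod (?s * 2 ^ b)) div ?s" by simp
  hence "(wrap W (\<alpha> * x) div ?s) mod 2 ^ b = (\<alpha> * x mod (?s * 2 ^ b)) div ?s"
    by (subst (asm) zmod_zmult2_eq) auto
  thus ?thesis unfolding hsh_def M drop_bit_eq_div by (simp add: pos_imp_zdiv_nonneg_iff)
qed

text \<open>Multiplication by \<open>\<alpha>\<close> sends \<open>z\<close> close to 0 on the
  circle of integers modulo \<open>2 ^ Suc W\<close>. Every unwanted coincidence of hash values is
  an instance of this for one fixed nonzero \<open>z\<close>, so a single count handles both hash
  functions.\<close>

definition near :: "nat \<Rightarrow> int \<Rightarrow> int \<Rightarrow> int \<Rightarrow> bool" where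
  "near W l z \<alpha> \<longleftrightarrow> (\<exists>k. \<bar>\<alpha> * z - k * 2 ^ Suc W\<bar> < l)"

lemma collision_near:
  assumes "b \<le> Suc W" "hsh W b \<alpha> x = hsh W b \<alpha> y"
  shows "near W (2 ^ (Suc W - b)) (x - y) \<alpha>"
proof -
  obtain k r where x: "\<alpha> * x = k * 2 ^ Suc W + int (hsh W b \<alpha> x) * 2 ^ (Suc W - b) + r"
    "0 \<le> r" "r < 2 ^ (Suc W - b)" using hsh_decomp[OF assms(1)] .
  obtain k' r' where y: "\<alpha> * y = k' * 2 ^ Suc W + int (hsh W b \<alpha> y) * 2 ^ (Suc W - b) + r'"
    "0 \<le> r'" "r' < 2 ^ (Suc W - b)" using hsh_decomp[OF assms(1)] .
  have "\<alpha> * (x - y) - (k - k') * 2 ^ Suc W = r - r'"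
    using x(1) y(1) assms(2) by (simp add: algebra_simps)
  thus ?thesis unfolding near_def using x y by (intro exI[of _ "k - k'"]) auto
qed

text \<open>The discarded low parts of the two products are each less than
  \<open>2 ^ (Suc W - b)\<close>, so their sum carries at most 1 into the retained bits.\<close>

lemma hsh_sum:
  assumes "b \<le> Suc W"
  obtains e where "e \<in> {0, 1}" "(hsh W b \<alpha> x + hsh W b \<alpha> y + e) mod 2 ^ b = hsh W b \<alpha> (x + y)"
proof -
  let ?s = "2 ^ (Suc W - b) :: int"
  have M: "(2::int) ^ Suc W = 2 ^ b * ?s" using assms by (simp add: power_add[symmetric] del: power_Suc)
  obtain k r where x: "\<alpha> * x = k * 2 ^ Suc W + int (hsh W b \<alpha> x) * ?s + r"
    "0 \<le> r" "r < ?s" using hsh_decomp[OF assms(1)] .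
  obtain k' r' where y: "\<alpha> * y = k' * 2 ^ Suc W + int (hsh W b \<alpha> y) * ?s + r'"
    "0 \<le> r'" "r' < ?s" using hsh_decomp[OF assms(1)] .
  define d where "d = (r + r') div ?s"
  define t where "t = (r + r') mod ?s"
  have rr: "r + r' = d * ?s + t" "0 \<le> t" "t < ?s"
    unfolding d_def t_def by (rule div_mult_mod_eq[symmetric]) simp_all
  have d: "d = 0 \<or> d = 1"
  proof -
    have "0 \<le> d" using x y by (simp add: d_def pos_imp_zdiv_nonneg_iff)
    moreover have "d < 2"
    proof (rule ccontr)
      assume "\<not> d < 2"
      hence "2 * ?s \<le> d * ?s" by (intro mult_right_mono) auto
      thus False using rr x y by linarith
    qed
    ultimately show ?thesis by linarith
  qed
  let ?h = "int (hsh W b \<alpha> x) + int (hsh W b \<alpha> y) + d"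
  have e1: "\<alpha> * (x + y) = (k + k') * 2 ^ Suc W + ?h * ?s + t"
    using x(1) y(1) rr(1) by (simp add: algebra_simps)
  have e2: "\<alpha> * (x + y) = ?s * (?h + (k + k') * 2 ^ b) + t"
    unfolding e1 M by (simp add: algebra_simps)
  have "\<alpha> * (x + y) mod (?s * 2 ^ b) div ?s = (\<alpha> * (x + y) div ?s) mod 2 ^ b"
    by (subst zmod_zmult2_eq) auto
  also have "\<alpha> * (x + y) div ?s = ?h + (k + k') * 2 ^ b"
    unfolding e2 using rr by simp
  finally have "int (hsh W b \<alpha> (x + y)) = ?h mod 2 ^ b"
    unfolding hsh_def M mult.commute[of "2 ^ b"] by (simp add: pos_imp_zdiv_nonneg_iff)
  hence "int (hsh W b \<alpha> (x + y)) = int ((hsh W b \<alpha> x + hsh W b \<alpha> y + nat d) mod 2 ^ b)"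
    using d by (auto simp: zmod_int)
  thus ?thesis using that[of "nat d"] d by auto
qed

text \<open>Approximate converse of \<open>hsh_sum\<close>: when the retained bits cancel, only the
  three low parts and the carry remain, and together they have absolute value less than twice
  \<open>2 ^ (Suc W - b)\<close>.\<close>

lemma hash_match_near:
  assumes "b \<le> Suc W" "e \<in> {0, 1}" "(hsh W b \<alpha> x + hsh W b \<alpha> y + e) mod 2 ^ b = hsh W b \<alpha> z"
  shows "near W (2 * 2 ^ (Suc W - b)) (x + y - z) \<alpha>"
proof -
  let ?s = "2 ^ (Suc W - b) :: int"
  have M: "(2::int) ^ Suc W = 2 ^ b * ?s" using assms by (simp add: power_add[symmetric] del: power_Suc)
  obtain k r where x: "\<alpha> * x = k * 2 ^ Suc W + int (hsh W b \<alpha> x) * ?s + r"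
    "0 \<le> r" "r < ?s" using hsh_decomp[OF assms(1)] .
  obtain k' r' where y: "\<alpha> * y = k' * 2 ^ Suc W + int (hsh W b \<alpha> y) * ?s + r'"
    "0 \<le> r'" "r' < ?s" using hsh_decomp[OF assms(1)] .
  obtain k'' r'' where z: "\<alpha> * z = k'' * 2 ^ Suc W + int (hsh W b \<alpha> z) * ?s + r''"
    "0 \<le> r''" "r'' < ?s" using hsh_decomp[OF assms(1)] .
  define j where "j = (hsh W b \<alpha> x + hsh W b \<alpha> y + e) div 2 ^ b"
  have "hsh W b \<alpha> x + hsh W b \<alpha> y + e = j * 2 ^ b + hsh W b \<alpha> z"
    using assms(3) unfolding j_def by (metis div_mult_mod_eq)
  hence "int (hsh W b \<alpha> x + hsh W b \<alpha> y + e) = int (j * 2 ^ b + hsh W b \<alpha> z)" by (rule arg_cong)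
  hence h: "int (hsh W b \<alpha> x) + int (hsh W b \<alpha> y) - int (hsh W b \<alpha> z) = int j * 2 ^ b - int e" by simp
  have "\<alpha> * (x + y - z) = (k + k' - k'') * 2 ^ Suc W +
      (int (hsh W b \<alpha> x) + int (hsh W b \<alpha> y) - int (hsh W b \<alpha> z)) * ?s + (r + r' - r'')"
    using x(1) y(1) z(1) by (simp add: algebra_simps)
  also have "\<dots> = (k + k' - k'' + int j) * 2 ^ Suc W + (r + r' - r'' - int e * ?s)"
    unfolding h M by (simp add: algebra_simps)
  finally have "\<alpha> * (x + y - z) - (k + k' - k'' + int j) * 2 ^ Suc W = r + r' - r'' - int e * ?s" by simp
  moreover have "\<bar>r + r' - r'' - int e * ?s\<bar> < 2 * ?s" using x y z assms(2) by auto
  ultimately show ?thesis unfolding near_def by metis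
qed

text \<open>For a given multiple \<open>k * 2 ^ Suc W\<close> the suitable \<open>\<alpha>\<close>
  lie in an interval of about \<open>2 * l / \<bar>z\<bar>\<close> integers, and only about
  \<open>\<bar>z\<bar>\<close> values of \<open>k\<close> are within reach of a word
  \<open>\<alpha>\<close>. The product is of order \<open>l\<close>, for odd and even
  \<open>z\<close> and \<open>\<alpha>\<close> alike; \<open>\<bar>z\<bar> \<le> l\<close> keeps the
  rounding error of the interval lengths at the same order.\<close>

lemma card_near:
  assumes "z \<noteq> 0" "\<bar>z\<bar> \<le> l" "l \<le> 2 ^ Suc W"
  shows "finite {\<alpha>. okw W \<alpha> \<and> near W l z \<alpha>}" "int (card {\<alpha>. okw W \<alpha> \<and> near W l z \<alpha>}) \<le> 9 * l"
proof -
  let ?M = "2 ^ Suc W :: int"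
  define A where "A k = {\<alpha>. okw W \<alpha> \<and> \<bar>\<alpha> * z - k * ?M\<bar> < l}" for k
  define m where "m = (\<bar>z\<bar> + 1) div 2"
  define c where "c = (2 * l - 1) div \<bar>z\<bar> + 1"
  have l: "l > 0" and z: "\<bar>z\<bar> > 0" using assms by auto
  have okf: "finite {\<alpha>. okw W \<alpha>}"
    by (rule finite_subset[of _ "{- (2 ^ W) .. 2 ^ W}"]) (auto simp: okw_def)
  thus "finite {\<alpha>. okw W \<alpha> \<and> near W l z \<alpha>}" by (rule rev_finite_subset) auto
  have fin: "finite (A k)" for k by (rule finite_subset[OF _ okf]) (auto simp: A_def)
  have cA: "int (card (A k)) \<le> c" for k
  proof (cases "A k = {}")
    case True
    have "(2 * l - 1) div \<bar>z\<bar> \<ge> 0" using l z by (simp add: pos_imp_zdiv_nonneg_iff)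
    thus ?thesis using True by (simp add: c_def)
  next
    case False
    define a where "a = Min (A k)"
    have a: "a \<in> A k" using fin False by (simp add: a_def)
    have "x \<in> {a .. a + (c - 1)}" if x: "x \<in> A k" for x
    proof -
      have "a \<le> x" using fin x by (simp add: a_def)
      moreover have "(x - a) * \<bar>z\<bar> \<le> 2 * l - 1"
      proof -
        have "\<bar>(x - a) * z\<bar> < 2 * l" using x a by (auto simp: A_def algebra_simps)
        thus ?thesis using \<open>a \<le> x\<close> by (simp add: abs_mult)
      qed
      hence "x - a \<le> (2 * l - 1) div \<bar>z\<bar>" using z by (metis zdiv_mono1 nonzero_mult_div_cancel_right less_irrefl)
      ultimately show ?thesis by (auto simp: c_def)
    qed
    hence "card (A k) \<le> card {a .. a + (c - 1)}" by (intro card_mono) auto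
    moreover have "c \<ge> 1" using l z by (simp add: c_def pos_imp_zdiv_nonneg_iff)
    ultimately show ?thesis by simp
  qed
  have "{\<alpha>. okw W \<alpha> \<and> near W l z \<alpha>} \<subseteq> (\<Union>k \<in> {- m .. m}. A k)"
  proof
    fix \<alpha> assume "\<alpha> \<in> {\<alpha>. okw W \<alpha> \<and> near W l z \<alpha>}"
    then obtain k where k: "okw W \<alpha>" "\<bar>\<alpha> * z - k * ?M\<bar> < l" by (auto simp: near_def)
    have "\<bar>\<alpha>\<bar> \<le> 2 ^ W" using k(1) by (auto simp: okw_def)
    hence "\<bar>\<alpha> * z\<bar> \<le> 2 ^ W * \<bar>z\<bar>" by (simp add: abs_mult mult_right_mono)
    hence "\<bar>k * ?M\<bar> < 2 ^ W * \<bar>z\<bar> + ?M" using k(2) assms(3) by linarith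
    hence "2 ^ W * (2 * \<bar>k\<bar>) < 2 ^ W * (\<bar>z\<bar> + 2)" by (simp add: abs_mult algebra_simps)
    hence "2 * \<bar>k\<bar> < \<bar>z\<bar> + 2" by simp
    hence "\<bar>k\<bar> \<le> m" unfolding m_def by linarith
    thus "\<alpha> \<in> (\<Union>k \<in> {- m .. m}. A k)" using k by (intro UN_I[of k]) (auto simp: A_def)
  qed
  hence "card {\<alpha>. okw W \<alpha> \<and> near W l z \<alpha>} \<le> card (\<Union>k \<in> {- m .. m}. A k)"
    using fin by (intro card_mono) auto
  also have "\<dots> \<le> (\<Sum>k \<in> {- m .. m}. card (A k))" by (rule card_UN_le) simp
  finally have "int (card {\<alpha>. okw W \<alpha> \<and> near W l z \<alpha>}) \<le> (\<Sum>k \<in> {- m .. m}. int (card (A k)))"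
    by (simp flip: of_nat_sum)
  also have "\<dots> \<le> (\<Sum>k \<in> {- m .. m}. c)" by (intro sum_mono cA)
  also have "\<dots> = (2 * m + 1) * c" using z by (simp add: m_def)
  also have "\<dots> \<le> (3 * \<bar>z\<bar>) * c"
    using l z by (intro mult_right_mono) (auto simp: m_def c_def pos_imp_zdiv_nonneg_iff)
  also have "\<dots> = 3 * (\<bar>z\<bar> * ((2 * l - 1) div \<bar>z\<bar>) + \<bar>z\<bar>)" by (simp add: c_def algebra_simps)
  also have "\<dots> \<le> 3 * (2 * l - 1 + l)"
  proof -
    have "\<bar>z\<bar> * ((2 * l - 1) div \<bar>z\<bar>) \<le> 2 * l - 1"
      using mult_div_mod_eq[of "\<bar>z\<bar>" "2 * l - 1"] pos_mod_sign[OF z, of "2 * l - 1"] by linarith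
    thus ?thesis using assms(2) by (intro mult_left_mono add_mono) simp_all
  qed
  also have "\<dots> \<le> 9 * l" using l by simp
  finally show "int (card {\<alpha>. okw W \<alpha> \<and> near W l z \<alpha>}) \<le> 9 * l" .
qed


section \<open>Building the compressed rows\<close>

declare fun_upd_apply [simp del] fun_upd_same [simp] fun_upd_other [simp]

text \<open>Fixes the initial state by name, so that later assertions can refer to the values it
  had.\<close>

lemma T_exact:
  assumes "\<And>v0 \<mu>0. P v0 \<mu>0 \<Longrightarrow> HT w (\<lambda>v \<mu>. v = v0 \<and> \<mu> = \<mu>0) c t Q \<pi> R"
  shows "HT w P c t Q \<pi> R"
  using assms unfolding HT_def HS_def by blast

lemma blk_time_append: "blk_time (a @ b) = blk_time a + blk_time b"
  by (induction a) auto

definition eqx :: "nat set \<Rightarrow> (nat \<Rightarrow> int) \<Rightarrow> (nat \<Rightarrow> int) \<Rightarrow> bool" where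
  "eqx X v v' \<longleftrightarrow> (\<forall>r. r \<notin> X \<longrightarrow> v r = v' r)"

lemma eqx_refl [simp]: "eqx X v v"
  by (simp add: eqx_def)

lemma eqx_upd [simp]: "x \<in> X \<Longrightarrow> eqx X (v(x := y)) v' = eqx X v v'"
  by (auto simp: eqx_def fun_upd_apply)

lemma eqxD: "eqx X v v' \<Longrightarrow> r \<notin> X \<Longrightarrow> v r = v' r"
  by (simp add: eqx_def)

lemma eqx_trans: "eqx X v v' \<Longrightarrow> eqx Y v' v'' \<Longrightarrow> X \<subseteq> Z \<Longrightarrow> Y \<subseteq> Z \<Longrightarrow> eqx Z v v''"
  unfolding eqx_def by (metis subsetD)

definition put :: "nat \<Rightarrow> int \<Rightarrow> int list \<Rightarrow> (int \<Rightarrow> int) \<Rightarrow> int \<Rightarrow> int" where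
  "put w a xs \<mu> = (\<lambda>z. if a \<le> z \<and> z < a + int (length xs) then wrap w (xs ! nat (z - a)) else \<mu> z)"

lemma put_Nil [simp]: "put w a [] \<mu> = \<mu>"
  by (auto simp: put_def)

lemma put_append: "put w (a + int (length xs)) ys (put w a xs \<mu>) = put w a (xs @ ys) \<mu>"
  by (auto simp: put_def fun_eq_iff nth_append nat_less_iff nat_diff_distrib' algebra_simps
      intro!: arg_cong[where f = "wrap w"] arg_cong[where f = "nth ys"])

lemma put_single: "\<mu>(a := wrap w x) = put w a [x] \<mu>"
  by (auto simp: put_def fun_eq_iff)

lemma put_snoc: "z = a + int (length xs) \<Longrightarrow> (put w a xs \<mu>)(z := wrap w x) = put w a (xs @ [x]) \<mu>"
  by (simp add: put_single put_append)

lemma put_zeros: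
  assumes "\<And>z. a \<le> z \<Longrightarrow> z < a + int n \<Longrightarrow> \<mu> z = 0"
  shows "put w a (replicate n 0) \<mu> = \<mu>"
  using assms by (auto simp: put_def fun_eq_iff)

lemma length_encode_slp [simp]: "length (encode_slp S) = 3 * length S"
proof -
  have "length (encode_rule r) = 3" for r by (cases r) auto
  thus ?thesis unfolding encode_slp_def by (induction S) auto
qed

lemma encode_slp_append [simp]: "encode_slp (S @ S') = encode_slp S @ encode_slp S'"
  by (simp add: encode_slp_def)

lemma encode_slp_replicate: "encode_slp (replicate k (Terminal 0)) = replicate (3 * k) 0"
  by (induction k) (simp_all add: encode_slp_def numeral_3_eq_3)

lemma wrap_add_left: "wrap w (wrap w a + b) = wrap w (a + b)"
  and wrap_add_right: "wrap w (a + wrap w b) = wrap w (a + b)"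
  and wrap_mult_left: "wrap w (wrap w a * b) = wrap w (a * b)"
  and wrap_mult_right: "wrap w (a * wrap w b) = wrap w (a * b)"
  and wrap_diff_left: "wrap w (wrap w a - b) = wrap w (a - b)"
  and wrap_diff_right: "wrap w (a - wrap w b) = wrap w (a - b)"
proof -
  have *: "wrap w x = wrap w y" if "x mod 2 ^ Suc w = y mod 2 ^ Suc w" for x y
    using that unfolding wrap_def by (simp add: signed_take_bit_eq_iff_take_bit_eq take_bit_eq_mod)
  show "wrap w (wrap w a + b) = wrap w (a + b)" by (rule *) (metis mod_add_left_eq wrap_mod)
  show "wrap w (a + wrap w b) = wrap w (a + b)" by (rule *) (metis mod_add_right_eq wrap_mod)
  show "wrap w (wrap w a * b) = wrap w (a * b)" by (rule *) (metis mod_mult_left_eq wrap_mod)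
  show "wrap w (a * wrap w b) = wrap w (a * b)" by (rule *) (metis mod_mult_right_eq wrap_mod)
  show "wrap w (wrap w a - b) = wrap w (a - b)" by (rule *) (metis mod_diff_left_eq wrap_mod)
  show "wrap w (a - wrap w b) = wrap w (a - b)" by (rule *) (metis mod_diff_right_eq wrap_mod)
qed

lemmas wrap_ring = wrap_add_left wrap_add_right wrap_mult_left wrap_mult_right
  wrap_diff_left wrap_diff_right

lemma wrap_idI: "0 \<le> x \<Longrightarrow> x < 2 ^ w \<Longrightarrow> wrap w x = x"
  by (simp add: wrap_id okwI)

abbreviation add (infixl "\<boxplus>" 65) where "a \<boxplus> b \<equiv> Bi Add a b"
abbreviation sub (infixl "\<boxminus>" 65) where "a \<boxminus> b \<equiv> Bi Sub a b"
abbreviation mul (infixl "\<boxtimes>" 70) where "a \<boxtimes> b \<equiv> Bi Mul a b"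

text \<open>Whatever becomes input of the simulated program must be a short word; variable 2 holds
  the difference of the word lengths.\<close>

definition trimE :: "aexp \<Rightarrow> aexp" where
  "trimE e = Bi Shr (Bi Shl e (V 2)) (V 2)"

text \<open>Variable 23 is the address of the grammar under construction and variable 24 its number
  of rules. A rule occupies three cells, the tag 1 standing for \<open>Concat\<close>.\<close>

definition emit :: "aexp \<Rightarrow> aexp \<Rightarrow> stm list" where
  "emit e1 e2 = [St (V 23 \<boxplus> K 3 \<boxtimes> V 24) (trimE (K 1)),
     St (V 23 \<boxplus> K 3 \<boxtimes> V 24 \<boxplus> K 1) (trimE e1), St (V 23 \<boxplus> K 3 \<boxtimes> V 24 \<boxplus> K 2) (trimE e2),
     As 24 (V 24 \<boxplus> K 1)]"

text \<open>Variable 32 is the hash value and 29 the current rule. Bit \<open>i\<close> of the hash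
  value decides on which side the zero block of length \<open>2 ^ i\<close>, which is rule
  \<open>i + 1\<close>, is attached; thus a shift by any amount costs \<open>L\<close>
  rules.\<close>

definition chain :: com where
  "chain = loop 31 (V 10) (Seq (blk [As 35 (Bi Mod (Bi Shr (V 32) (V 31)) (K 2))])
     (iff (V 35) (blk (emit (V 31 \<boxplus> K 1) (V 29) @ [As 29 (V 24 \<boxminus> K 1)]))
       (blk (emit (V 29) (V 31 \<boxplus> K 1) @ [As 29 (V 24 \<boxminus> K 1)]))))"

definition zeros :: "aexp \<Rightarrow> com" where
  "zeros e = loop 31 e (blk (emit (V 24 \<boxminus> K 1) (V 24 \<boxminus> K 1)))"

text \<open>The element in a bucket slot; an empty slot stands for the number \<open>U\<close>, which cannot be a
  summand of a solution.\<close>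

definition cellE :: "int \<Rightarrow> nat \<Rightarrow> nat \<Rightarrow> aexp" where
  "cellE b r j = Ld (K b \<boxtimes> V 16 \<boxplus> (V r \<boxtimes> V 39 \<boxplus> V j))"

definition elemS :: "nat \<Rightarrow> int \<Rightarrow> nat \<Rightarrow> nat \<Rightarrow> stm list" where
  "elemS x b r j = [As x (cellE b r j), As x (V x \<boxplus> Bi Less (V x) (K 1) \<boxtimes> V 4)]"

definition hashE :: "nat \<Rightarrow> nat \<Rightarrow> nat \<Rightarrow> nat \<Rightarrow> aexp" where
  "hashE a sh M x = Bi Mod (Bi Shr (V a \<boxtimes> V x) (V sh)) (V M)"

text \<open>Variables 25 and 26 are the two bucket numbers, 27 and 28 the rules for the string over
  \<open>a\<close> and for the string over the pairs. Before the last \<open>emit\<close> the rule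
  counter is set to \<open>n - 1\<close>: the skipped rules are never written, as fresh memory
  already encodes \<open>Terminal 0\<close>.\<close>

definition row_code :: com where
  "row_code = Seq (blk [St (V 23 \<boxplus> K 1) (trimE (K 1)), As 24 (K 2)])
    (Seq (zeros (V 10 \<boxplus> K 2 \<boxtimes> V 6 \<boxplus> K 1))
    (Seq (blk [As 27 (V 10 \<boxplus> K 1)])
    (Seq (loop 30 (V 7) (Seq (blk (elemS 33 2 25 30 @ [As 32 (hashE 18 14 38 33), As 29 (K 0)]))
       (Seq chain (blk (emit (V 27) (V 10 \<boxplus> K 1) @ [As 27 (V 24 \<boxminus> K 1)] @ emit (V 27) (V 29) @
          [As 27 (V 24 \<boxminus> K 1)])))))
    (Seq (blk [As 28 (V 10 \<boxplus> V 6 \<boxplus> K 2)])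
    (Seq (loop 30 (V 7) (Seq (blk (elemS 33 3 26 30 @ [As 32 (hashE 18 14 38 33), As 29 (V 27)]))
       (Seq chain (blk (emit (V 29) (K 1) @ [As 29 (V 24 \<boxminus> K 1)] @ emit (V 28) (V 29) @
          [As 28 (V 24 \<boxminus> K 1)])))))
    (blk ([As 24 (V 11 \<boxminus> K 1)] @ emit (V 10 \<boxplus> K 2 \<boxtimes> V 6 \<boxplus> K 2) (V 28))))))))"

lemma wrap_drop_bit: "wrap w (drop_bit k (wrap w x)) = drop_bit k (wrap w x)"
  unfolding wrap_def by (intro bit_eqI) (auto simp: bit_simps min_def)

text \<open>The choice \<open>cap + 1 = 2 ^ D\<close> makes all lengths powers of two. The string
  over \<open>a\<close> takes up \<open>2 ^ (L + 1 + D)\<close> once it is shifted and padded; with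
  one zero block and \<open>cap\<close> such copies the length is
  \<open>2 ^ (L + 1 + 2 * D)\<close>; a zero block of the same length in front doubles this to
  \<open>N\<close>, whence \<open>\<nu>\<close>. The conditions on \<open>H\<close> say that each
  table, the trie and the input of \<open>p\<close> fit into one block, and \<open>W_H\<close> that
  the blocks of all rounds are addressable.\<close>

locale params =
  fixes W U D L n w Bc :: nat and H \<alpha>1 \<alpha>2 :: int
  fixes \<nu> N cap :: nat
  defines "\<nu> \<equiv> L + 2 + 2 * D" and "N \<equiv> 2 ^ \<nu>" and "cap \<equiv> 2 ^ D - 1"
  assumes L: "1 \<le> L" and D: "1 \<le> D"
    and rules: "cap * (2 * L + 4) + L + 2 * D + 5 \<le> n" and nN: "n < N"
    and H_tables: "int N * 2 ^ D \<le> H" and H_trie: "(int L + 1) * 2 ^ L \<le> H"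
    and H_input: "2 + 3 * int n * (int N + 1) \<le> H" and H_U: "2 * int U < H" and H_w: "2 ^ w \<le> H"
    and W_H: "H * (8 * int N + 16) \<le> 2 ^ W" and w_W: "w \<le> W" and \<nu>_W: "\<nu> \<le> W" and Bc_N: "Bc \<le> N"
    and W_16: "16 \<le> W"
begin

text \<open>The memory is divided into blocks of \<open>H\<close> cells: the 3SUM instance is in block \<open>0\<close>, the
  characteristic function of \<open>C\<close> in block \<open>1\<close>, the buckets of \<open>A\<close>, \<open>B\<close>, \<open>C\<close> in blocks \<open>2\<close>, \<open>3\<close>, \<open>4\<close>, and
  the numbers of their elements in blocks \<open>5\<close>, \<open>6\<close>, \<open>7\<close>.  Round \<open>u\<close> uses the fresh blocks from \<open>4 u + 9\<close>
  on: two for the memory of the simulated program, with its cell \<open>0\<close> at the start of the second one,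
  one for the trie of the vector, and one for the list of the positive rows.\<close>

definition env :: "(nat \<Rightarrow> int) \<Rightarrow> bool" where
  "env v \<longleftrightarrow> v 2 = int (W - w) \<and> v 4 = int U \<and> v 6 = int D \<and> v 7 = int cap \<and> v 9 = int N \<and> v 10 = int L \<and>
     v 11 = int n \<and> v 12 = int w \<and> v 13 = int (Suc W - \<nu>) \<and> v 14 = int (Suc W - L) \<and> v 15 = int Bc \<and>
     v 16 = H \<and> v 17 = \<alpha>1 \<and> v 18 = \<alpha>2 \<and> v 38 = 2 ^ L \<and> v 39 = 2 ^ D"

lemma env_upd [simp]: "x \<notin> {2, 4, 6, 7, 9, 10, 11, 12, 13, 14, 15, 16, 17, 18, 38, 39} \<Longrightarrow> env (v(x := y)) = env v"
  by (simp add: env_def)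

lemma env_eqx: "env v' \<Longrightarrow> eqx X v v' \<Longrightarrow> X \<inter> {2, 4, 6, 7, 9, 10, 11, 12, 13, 14, 15, 16, 17, 18, 38, 39} = {} \<Longrightarrow> env v"
  by (auto simp: env_def eqx_def)

lemma H_pos: "H \<ge> 2" and H16: "H * 16 \<le> 2 ^ W" and H_lt: "H < 2 ^ W" and N_H: "int N \<le> H"
proof -
  show H2: "H \<ge> 2" using H_input by (smt (verit) mult_nonneg_nonneg of_nat_0_le_iff)
  have "H * 16 \<le> H * (8 * int N + 16)" using H2 by (intro mult_left_mono) auto
  thus *: "H * 16 \<le> 2 ^ W" using W_H by linarith
  show "H < 2 ^ W" using * H2 by linarith
  have "int N * 1 \<le> int N * 2 ^ D" by (intro mult_left_mono) auto
  thus "int N \<le> H" using H_tables by linarith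
qed

lemma small: "0 \<le> x \<Longrightarrow> x < 65536 \<Longrightarrow> wrap W x = x"
proof -
  assume x: "0 \<le> x" "x < 65536"
  have "(2::int) ^ 16 \<le> 2 ^ W" using W_16 by (intro power_increasing) auto
  thus ?thesis using x by (intro wrap_idI) auto
qed

lemma small_ge [simp]: "wrap W 1 = 1" "wrap W (numeral k) = (if (numeral k :: int) < 65536 then numeral k else wrap W (numeral k))"
  by (simp_all add: small)

lemma wrapH: "0 \<le> x \<Longrightarrow> x < 16 * H \<Longrightarrow> wrap W x = x"
  using H16 by (intro wrap_idI) auto

lemma n_H: "int n \<le> H" and L_n: "L + 2 * D + 5 \<le> n"
proof -
  show "L + 2 * D + 5 \<le> n" using rules by linarith
  have "int n * 1 \<le> int n * (3 * (int N + 1))" by (intro mult_left_mono) auto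
  thus "int n \<le> H" using H_input by linarith
qed

lemma ev_trimE: "v 2 = int (W - w) \<Longrightarrow> ev W (trimE e) v \<mu> = wrap w (ev W e v \<mu>)"
  by (simp add: trimE_def wrap_shift[OF w_W] wrap_id okw_mono[OF okw_wrap w_W])

lemma wp_emit:
  assumes "v 2 = int (W - w)" "v 23 = sb" "v 24 = int (length S)" "0 \<le> sb" "sb + 3 * int (length S) + 3 \<le> 2 ^ W"
    and "\<And>\<mu>. ev W e1 v \<mu> = int j" "\<And>\<mu>. ev W e2 v \<mu> = int k"
    and "\<mu> = put w sb (encode_slp S) \<mu>1"
  shows "wp W (emit e1 e2 @ ss) Q v \<mu> = wp W ss Q (v(24 := int (Suc (length S))))
     (put w sb (encode_slp (S @ [Concat j k])) \<mu>1)"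
proof -
  have a: "wrap W (sb + 3 * int (length S)) = sb + 3 * int (length S)"
    "wrap W (sb + 3 * int (length S) + 1) = sb + 3 * int (length S) + 1"
    "wrap W (sb + 3 * int (length S) + 2) = sb + 3 * int (length S) + 2"
    "wrap W (int (length S) + 1) = 1 + int (length S)"
    using assms(4,5) by (auto simp: wrap_idI)
  have e: "encode_slp [Concat j k] = [1, int j, int k]" by (simp add: encode_slp_def)
  have "put w sb (encode_slp (S @ [Concat j k])) \<mu>1 =
    \<mu>(sb + 3 * int (length S) := wrap w 1, sb + 3 * int (length S) + 1 := wrap w (int j),
      sb + 3 * int (length S) + 2 := wrap w (int k))"
    unfolding assms(8) encode_slp_append e by (simp add: put_snoc)
  thus ?thesis unfolding emit_def using assms
    by (simp add: ev_trimE wrap_ring a)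
qed

lemma emit_time: "blk_time (emit e1 e2) = eval_time e1 + eval_time e2 + 80"
  by (simp add: emit_def trimE_def)

text \<open>State of a construction: the grammar \<open>S\<close> written so far is laid over the
  memory \<open>\<mu>1\<close> that was there before. Keeping \<open>\<mu>1\<close> explicit shows
  that nothing else has changed.\<close>

definition bst :: "int \<Rightarrow> (int \<Rightarrow> int) \<Rightarrow> int slp \<Rightarrow> assn" where
  "bst sb \<mu>1 S v \<mu> \<longleftrightarrow> env v \<and> v 23 = sb \<and> 0 \<le> sb \<and> sb + 3 * int n \<le> 2 ^ W \<and> v 24 = int (length S) \<and>
     length S \<le> n \<and> \<mu> = put w sb (encode_slp S) \<mu>1"

lemma bst_upd [simp]: "x \<notin> {2, 4, 6, 7, 9, 10, 11, 12, 13, 14, 15, 16, 17, 18, 38, 39, 23, 24} \<Longrightarrow>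
    bst sb \<mu>1 S (v(x := y)) \<mu> = bst sb \<mu>1 S v \<mu>"
  by (simp add: bst_def)

lemma wp_emit_bst:
  assumes "bst sb \<mu>1 S v \<mu>" "length S < n"
    and "\<And>\<mu>. ev W e1 v \<mu> = int j" "\<And>\<mu>. ev W e2 v \<mu> = int k"
    and "\<And>v' \<mu>'. v' = v(24 := int (Suc (length S))) \<Longrightarrow> bst sb \<mu>1 (S @ [Concat j k]) v' \<mu>' \<Longrightarrow> wp W ss Q v' \<mu>'"
  shows "wp W (emit e1 e2 @ ss) Q v \<mu>"
proof -
  have "env (v(24 := int (Suc (length S))))" using assms(1) by (simp add: bst_def del: of_nat_Suc)
  hence "bst sb \<mu>1 (S @ [Concat j k]) (v(24 := int (Suc (length S)))) (put w sb (encode_slp (S @ [Concat j k])) \<mu>1)"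
    using assms(1,2) by (simp add: bst_def)
  moreover have "wp W (emit e1 e2 @ ss) Q v \<mu> = wp W ss Q (v(24 := int (Suc (length S))))
     (put w sb (encode_slp (S @ [Concat j k])) \<mu>1)"
    using assms(1-4) by (intro wp_emit) (auto simp: bst_def env_def)
  ultimately show ?thesis using assms(5) by simp
qed

lemma n_W: "int n * 3 \<le> 2 ^ W" and n_word: "0 \<le> x \<Longrightarrow> x \<le> int n + 1 \<Longrightarrow> wrap W x = x"
proof -
  show "int n * 3 \<le> 2 ^ W" using n_H H16 H_pos by linarith
  show "wrap W x = x" if "0 \<le> x" "x \<le> int n + 1" using that n_H H_pos by (intro wrapH) linarith+
qed

lemma T_zeros:
  assumes "bst sb \<mu>1 [Terminal 1, Terminal 0] v1 \<mu>0" "c + 2 \<le> n"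
    and "\<And>v \<mu>. eqx {24, 31} v v1 \<Longrightarrow> ev W e v \<mu> = int c"
  shows "T W (\<lambda>v \<mu>. v = v1 \<and> \<mu> = \<mu>0) (zeros e) (c * (eval_time e + 110) + eval_time e + 20)
     (\<lambda>v \<mu>. eqx {24, 31} v v1 \<and> (\<exists>S. bst sb \<mu>1 S v \<mu> \<and> base_slp S c \<and> length S = c + 2))"
proof -
  let ?I = "\<lambda>j v \<mu>. eqx {24, 31} v v1 \<and> (\<exists>S. bst sb \<mu>1 S v \<mu> \<and> base_slp S j \<and> length S = j + 2)"
  have "T W (?I 0) (zeros e) (loop_time c 90 (eval_time e)) (?I c)"
    unfolding zeros_def
  proof (rule T_loop[where I = ?I])
    fix j assume j: "j < c"
    show "T W (\<lambda>v \<mu>. ?I j v \<mu> \<and> v 31 = int j) (blk (emit (V 24 \<boxminus> K 1) (V 24 \<boxminus> K 1))) 90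
       (\<lambda>v \<mu>. ?I (Suc j) v \<mu> \<and> v 31 = int j)"
    proof (rule T_blk)
      fix v \<mu> assume "?I j v \<mu> \<and> v 31 = int j"
      then obtain S where S: "eqx {24, 31} v v1" "bst sb \<mu>1 S v \<mu>" "base_slp S j" "length S = j + 2"
        "v 31 = int j" by blast
      have v24: "v 24 = int j + 2" using S by (simp add: bst_def)
      have ev: "ev W (V 24 \<boxminus> K 1) v \<mu> = int (Suc j)" for \<mu>
        using v24 assms(2) j by (simp add: n_word)
      have "wp W (emit (V 24 \<boxminus> K 1) (V 24 \<boxminus> K 1) @ []) (\<lambda>v \<mu>. ?I (Suc j) v \<mu> \<and> v 31 = int j) v \<mu>"
      proof (rule wp_emit_bst[OF S(2) _ ev ev])
        show "length S < n" using S(4) j assms(2) by simp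
      qed (use S base_slp_Suc[OF S(3,4)] in auto)
      thus "wp W (emit (V 24 \<boxminus> K 1) (V 24 \<boxminus> K 1)) (\<lambda>v \<mu>. ?I (Suc j) v \<mu> \<and> v 31 = int j) v \<mu>" by simp
    qed (simp add: emit_time)
  next
    show "c < 2 ^ W"
    proof -
      have "int c < 2 ^ W" using assms(2) n_W by linarith
      thus ?thesis by (metis of_nat_less_iff of_nat_numeral of_nat_power)
    qed
  qed (use assms W_16 in auto)
  thus ?thesis
    by (rule T_weaken) (use assms(1) base_slp_init in \<open>auto simp: loop_time_def algebra_simps\<close>)
qed

text \<open>The iteration of \<open>shift_step\<close> over the \<open>L\<close> bits of
  \<open>h\<close> surrounds a string by \<open>h\<close> zeros on the left and
  \<open>2 ^ L - 1 - h\<close> on the right. The resulting length is independent of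
  \<open>h\<close>, so equal summands for different elements stay aligned.\<close>

lemma T_chain:
  assumes "bst sb \<mu>1 S0 v1 \<mu>0" "length S0 + L \<le> n" "base_slp S0 c" "L \<le> c" "gen G S0 k0 l f" "1 \<le> l"
    and "v1 29 = int k0" "v1 32 = int h" "int h < 2 ^ L"
  shows "T W (\<lambda>v \<mu>. v = v1 \<and> \<mu> = \<mu>0) chain (L * 200 + 20)
     (\<lambda>v \<mu>. eqx {24, 29, 31, 35} v v1 \<and> (\<exists>S k. bst sb \<mu>1 (S0 @ S) v \<mu> \<and> length S = L \<and>
        base_slp (S0 @ S) c \<and> v 29 = int k \<and> gen G (S0 @ S) k (l + 2 ^ L - 1) (\<lambda>q. f (q + h))))"
proof -
  let ?I = "\<lambda>j v \<mu>. eqx {24, 29, 31, 35} v v1 \<and> (\<exists>S k. bst sb \<mu>1 (S0 @ S) v \<mu> \<and> length S = j \<and>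
        base_slp (S0 @ S) c \<and> v 29 = int k \<and> gen G (S0 @ S) k (l + 2 ^ j - 1) (\<lambda>q. f (q + h mod 2 ^ j)))"
  let ?e = "\<lambda>b. blk (emit (if b then V 31 \<boxplus> K 1 else V 29) (if b then V 29 else V 31 \<boxplus> K 1) @ [As 29 (V 24 \<boxminus> K 1)])"
  have "T W (?I 0) chain (loop_time L 180 (eval_time (V 10))) (?I L)"
    unfolding chain_def
  proof (rule T_loop[where I = ?I])
    fix j assume j: "j < L"
    let ?J = "\<lambda>v \<mu>. (?I j v \<mu> \<and> v 31 = int j) \<and> v 35 = (if bit h j then 1 else 0)"
    have h35: "ev W (Bi Mod (Bi Shr (V 32) (V 31)) (K 2)) v \<mu> = (if bit h j then 1 else 0)"
      if "v 32 = int h" "v 31 = int j" for v \<mu>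
    proof -
      have "int (h div 2 ^ j) \<le> int h" by (simp only: of_nat_le_iff) simp
      moreover have "(2::int) ^ L \<le> 2 ^ W" using \<nu>_W by (intro power_increasing) (auto simp: \<nu>_def)
      ultimately have lt: "int (h div 2 ^ j) < 2 ^ W" using assms(9) by (meson le_less_trans less_le_trans)
      have "int (h div 2 ^ j) mod 2 = (if bit h j then 1 else 0)"
        by (simp add: bit_iff_odd mod_2_eq_odd)
      thus ?thesis using that wrap_idI[OF _ lt]
        by (simp add: drop_bit_eq_div zdiv_int[symmetric, of h "2 ^ j", simplified] small del: of_nat_div)
    qed
    have br: "T W (\<lambda>v \<mu>. ?J v \<mu> \<and> bit h j = b) (?e b) 110 (\<lambda>v \<mu>. ?I (Suc j) v \<mu> \<and> v 31 = int j)" for b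
    proof (rule T_blk)
      fix v \<mu> assume "?J v \<mu> \<and> bit h j = b"
      then obtain S k where S: "eqx {24, 29, 31, 35} v v1" "bst sb \<mu>1 (S0 @ S) v \<mu>" "length S = j"
        "base_slp (S0 @ S) c" "v 29 = int k" "gen G (S0 @ S) k (l + 2 ^ j - 1) (\<lambda>q. f (q + h mod 2 ^ j))"
        "v 31 = int j" "bit h j = b" by blast
      have ev: "ev W (V 31 \<boxplus> K 1) v \<mu> = int (Suc j)" "ev W (V 29) v \<mu> = int k" for \<mu>
        using S j assms(2) by (simp_all add: n_word)
      let ?r = "Concat (if b then Suc j else k) (if b then k else Suc j)"
      have r: "?r = (if bit h j then Concat (Suc j) k else Concat k (Suc j))" using S(8) by simp
      note st = shift_step[OF S(4) _ S(6) assms(6) r]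
      show "wp W (emit (if b then V 31 \<boxplus> K 1 else V 29) (if b then V 29 else V 31 \<boxplus> K 1) @ [As 29 (V 24 \<boxminus> K 1)])
          (\<lambda>v \<mu>. ?I (Suc j) v \<mu> \<and> v 31 = int j) v \<mu>"
      proof (rule wp_emit_bst[OF S(2)])
        fix v' \<mu>' assume v': "v' = v(24 := int (Suc (length (S0 @ S))))"
          "bst sb \<mu>1 ((S0 @ S) @ [?r]) v' \<mu>'"
        have "wrap W (int (Suc (length (S0 @ S))) - 1) = int (length (S0 @ S))"
          using S(3) j assms(2) by (simp add: n_word)
        hence "ev W (V 24 \<boxminus> K 1) v' \<mu>' = int (length (S0 @ S))"
          using v'(1) by (simp del: of_nat_Suc length_append)
        moreover have "length (S @ [?r]) = Suc j" using S(3) by simp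
        hence "?I (Suc j) (v'(29 := int (length (S0 @ S)))) \<mu>'"
          using v' S st j assms(4)
          by (intro conjI exI[of _ "S @ [?r]"] exI[of _ "length (S0 @ S)"])
            (simp_all del: length_append of_nat_Suc fun_upd_apply power_Suc)
        ultimately show "wp W [As 29 (V 24 \<boxminus> K 1)] (\<lambda>v \<mu>. ?I (Suc j) v \<mu> \<and> v 31 = int j) v' \<mu>'"
          using v'(1) S(7) by (simp del: ev.simps length_append of_nat_Suc fun_upd_apply)
      qed (use S j assms(2) ev in auto)
    qed (simp add: emit_time blk_time_append)
    show "T W (\<lambda>v \<mu>. ?I j v \<mu> \<and> v 31 = int j) (Seq (blk [As 35 (Bi Mod (Bi Shr (V 32) (V 31)) (K 2))])
     (iff (V 35) (blk (emit (V 31 \<boxplus> K 1) (V 29) @ [As 29 (V 24 \<boxminus> K 1)]))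
       (blk (emit (V 29) (V 31 \<boxplus> K 1) @ [As 29 (V 24 \<boxminus> K 1)])))) 180 (\<lambda>v \<mu>. ?I (Suc j) v \<mu> \<and> v 31 = int j)"
    proof (rule T_Seq)
      show "T W (\<lambda>v \<mu>. ?I j v \<mu> \<and> v 31 = int j) (blk [As 35 (Bi Mod (Bi Shr (V 32) (V 31)) (K 2))]) 20 ?J"
      proof (rule T_blk)
        fix v \<mu> assume a: "?I j v \<mu> \<and> v 31 = int j"
        have "v 32 = int h" using a eqxD[of "{24, 29, 31, 35}" v v1 32] assms(8) by simp
        thus "wp W [As 35 (Bi Mod (Bi Shr (V 32) (V 31)) (K 2))] ?J v \<mu>"
          using a h35[of v \<mu>] by (simp del: ev.simps)
      qed simp
      show "T W ?J (iff (V 35) (blk (emit (V 31 \<boxplus> K 1) (V 29) @ [As 29 (V 24 \<boxminus> K 1)]))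
       (blk (emit (V 29) (V 31 \<boxplus> K 1) @ [As 29 (V 24 \<boxminus> K 1)]))) 120 (\<lambda>v \<mu>. ?I (Suc j) v \<mu> \<and> v 31 = int j)"
      proof (rule T_iff[where t = 110])
        show "T W (\<lambda>v \<mu>. ?J v \<mu> \<and> ev W (V 35) v \<mu> \<noteq> 0) (blk (emit (V 31 \<boxplus> K 1) (V 29) @ [As 29 (V 24 \<boxminus> K 1)])) 110
           (\<lambda>v \<mu>. ?I (Suc j) v \<mu> \<and> v 31 = int j)"
          by (rule T_weaken[OF br[of True, unfolded if_True]]) (auto split: if_splits)
        show "T W (\<lambda>v \<mu>. ?J v \<mu> \<and> ev W (V 35) v \<mu> = 0) (blk (emit (V 29) (V 31 \<boxplus> K 1) @ [As 29 (V 24 \<boxminus> K 1)])) 110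
           (\<lambda>v \<mu>. ?I (Suc j) v \<mu> \<and> v 31 = int j)"
          by (rule T_weaken[OF br[of False, unfolded if_False]]) (auto split: if_splits)
      qed simp
    qed simp
  next
    show "L < 2 ^ W" using \<nu>_W less_exp[of W] unfolding \<nu>_def by linarith
    show "ev W (V 10) v \<mu> = int L" if "?I j v \<mu>" for j v \<mu>
      using that by (auto simp: bst_def env_def)
  qed (use W_16 in auto)
  thus ?thesis
  proof (rule T_weaken)
    fix v \<mu> assume "?I L v \<mu>"
    moreover have "h mod 2 ^ L = h"
    proof -
      have "int h < int (2 ^ L)" using assms(9) by simp
      thus ?thesis by simp
    qed
    ultimately show "eqx {24, 29, 31, 35} v v1 \<and> (\<exists>S k. bst sb \<mu>1 (S0 @ S) v \<mu> \<and> length S = L \<and>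
        base_slp (S0 @ S) c \<and> v 29 = int k \<and> gen G (S0 @ S) k (l + 2 ^ L - 1) (\<lambda>q. f (q + h)))" by simp
  next
    fix v \<mu> assume "v = v1 \<and> \<mu> = \<mu>0"
    thus "?I 0 v \<mu>" using assms by (intro conjI exI[of _ "[]"] exI[of _ k0]) auto
  qed (simp add: loop_time_def)
qed

section \<open>Bucket slots and their hash values\<close>

definition el :: "int \<Rightarrow> int" where
  "el x = (if x < 1 then x + int U else x)"

definition slot :: "(int \<Rightarrow> int) \<Rightarrow> int \<Rightarrow> nat \<Rightarrow> nat \<Rightarrow> int" where
  "slot \<mu> b r j = \<mu> (b * H + (int r * 2 ^ D + int j))"

lemma cap_less: "j < cap \<Longrightarrow> int j + 1 < 2 ^ D"
proof -
  assume "j < cap"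
  hence "j + 1 < 2 ^ D" by (simp add: cap_def)
  hence "int (j + 1) < int (2 ^ D)" by (simp only: of_nat_less_iff)
  thus ?thesis by (simp only: of_nat_add of_nat_1 of_nat_power of_nat_numeral)
qed

lemma bucket_bound:
  assumes "r < N" "0 \<le> j" "j < 2 ^ D"
  shows "0 \<le> int r * 2 ^ D + j" "int r * 2 ^ D + j < H" "int r * 2 ^ D < H" "0 \<le> int r * 2 ^ D"
proof -
  have "(int r + 1) * 2 ^ D \<le> int N * 2 ^ D" using assms by (intro mult_right_mono) auto
  hence "int r * 2 ^ D + 2 ^ D \<le> int N * 2 ^ D" by (simp only: distrib_right mult_1)
  moreover show "0 \<le> int r * 2 ^ D" by simp
  ultimately show "int r * 2 ^ D + j < H" "int r * 2 ^ D < H" "0 \<le> int r * 2 ^ D + j"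
    using H_tables assms(2,3) by linarith+
qed

lemma ev_cell:
  assumes "env v" "v r = int rr" "rr < N" "v j = jj" "0 \<le> jj" "jj < 2 ^ D" "0 \<le> b" "b \<le> 7"
  shows "ev W (cellE b r j) v \<mu> = \<mu> (b * H + (int rr * 2 ^ D + jj))"
proof -
  note bb = bucket_bound[OF assms(3,5,6)]
  have "0 \<le> b * H" "b * H \<le> 7 * H" using assms(7,8) H_pos by (auto intro: mult_right_mono)
  hence "wrap W (b * H + (int rr * 2 ^ D + jj)) = b * H + (int rr * 2 ^ D + jj)"
    using bb H_pos by (intro wrapH) linarith+
  thus ?thesis using assms by (simp add: cellE_def env_def wrap_ring)
qed

lemma wp_elem:
  assumes "env v" "v r = int rr" "rr < N" "v jr = int j" "j < cap" "0 \<le> b" "b \<le> 7" "x \<noteq> 4"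
    and "0 \<le> slot \<mu> b rr j" "slot \<mu> b rr j \<le> int U"
  shows "wp W (elemS x b r jr @ ss) Q v \<mu> = wp W ss Q (v(x := el (slot \<mu> b rr j))) \<mu>"
proof -
  have U: "int U < H" using H_U by simp
  have "wrap W (slot \<mu> b rr j + int U) = slot \<mu> b rr j + int U"
    using assms(9,10) U H_pos by (intro wrapH) auto
  moreover have "wrap W (slot \<mu> b rr j) = slot \<mu> b rr j"
    using assms(9,10) U H_pos by (intro wrapH) auto
  moreover have "wrap W (int U) = int U" using U H_pos by (intro wrapH) auto
  moreover have "j < 2 ^ D" using assms(5) by (simp add: cap_def)
  hence "ev W (cellE b r jr) v \<mu> = slot \<mu> b rr j"
    unfolding slot_def using assms by (intro ev_cell) auto
  ultimately show ?thesis using assms(1,8) by (simp add: elemS_def el_def env_def)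
qed

lemma L_W: "L \<le> Suc W" "\<nu> \<le> Suc W" "(2::int) ^ L \<le> H" "int N = 2 ^ \<nu>"
proof -
  show "L \<le> Suc W" "\<nu> \<le> Suc W" using \<nu>_W by (auto simp: \<nu>_def)
  show "int N = 2 ^ \<nu>" by (simp add: N_def)
  have "2 ^ L \<le> (2::int) ^ \<nu>" by (intro power_increasing) (auto simp: \<nu>_def)
  also have "\<dots> = int N" by (simp add: N_def)
  finally show "(2::int) ^ L \<le> H" using N_H by linarith
qed

lemma ev_hash2: "env v \<Longrightarrow> ev W (hashE 18 14 38 x) v \<mu> = int (hsh W L \<alpha>2 (v x))"
proof -
  assume v: "env v"
  have "hsh W L \<alpha>2 (v x) < 2 ^ L" using hsh_less L_W(1) .
  hence "int (hsh W L \<alpha>2 (v x)) < 2 ^ L" by (metis of_nat_less_iff of_nat_numeral of_nat_power)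
  hence "int (hsh W L \<alpha>2 (v x)) < 16 * H" using L_W(3) H_pos by linarith
  hence "wrap W (int (hsh W L \<alpha>2 (v x))) = int (hsh W L \<alpha>2 (v x))" by (intro wrapH) auto
  moreover have "wrap W (drop_bit (Suc W - L) (wrap W (\<alpha>2 * v x))) = drop_bit (Suc W - L) (wrap W (\<alpha>2 * v x))"
    by (rule wrap_drop_bit)
  ultimately show ?thesis using v hsh_program[OF L_W(1), of \<alpha>2 "v x"] by (simp add: hashE_def env_def del: of_nat_diff)
qed

lemma ev_hash1: "env v \<Longrightarrow> ev W (hashE 17 13 9 x) v \<mu> = int (hsh W \<nu> \<alpha>1 (v x))"
proof -
  assume v: "env v"
  have "hsh W \<nu> \<alpha>1 (v x) < N" unfolding N_def using hsh_less L_W(2) .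
  hence "int (hsh W \<nu> \<alpha>1 (v x)) < 16 * H" using N_H H_pos by linarith
  hence "wrap W (int (hsh W \<nu> \<alpha>1 (v x))) = int (hsh W \<nu> \<alpha>1 (v x))" by (intro wrapH) auto
  moreover have "wrap W (drop_bit (Suc W - \<nu>) (wrap W (\<alpha>1 * v x))) = drop_bit (Suc W - \<nu>) (wrap W (\<alpha>1 * v x))"
    by (rule wrap_drop_bit)
  ultimately show ?thesis using v hsh_program[OF L_W(2), of \<alpha>1 "v x"] L_W(4)
    by (simp add: hashE_def env_def del: of_nat_diff)
qed

text \<open>With period \<open>2 ^ L\<close> only positions modulo \<open>2 ^ L\<close> count.
  Strings whose lengths are multiples of the period can therefore be concatenated without disturbing
  each other's inner products.\<close>

definition periodic :: "(nat \<Rightarrow> int) \<Rightarrow> bool" where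
  "periodic G \<longleftrightarrow> (\<forall>x k. G (x + 2 ^ L * k) = G x)"

lemma periodicD: "periodic G \<Longrightarrow> G (x + 2 ^ L * k + y) = G (x + y)"
  unfolding periodic_def by (metis add.assoc add.commute)

text \<open>A unit string shifted by \<open>h j\<close> contributes \<open>G (q + h j)\<close>. A
  grammar has no empty string to start from, so the first piece is a zero block; one more zero block
  per element then gives the final length
  \<open>2 ^ L * (1 + 2 * cap) = 2 ^ (L + 1 + D) - 2 ^ L\<close>, which the later shifts fill up to
  a power of two.\<close>

lemma T_summandsA:
  assumes "bst sb \<mu>1 S0 v1 \<mu>0" "base_slp S0 c" "L \<le> c" "length S0 + cap * (L + 2) \<le> n"
    and "v1 27 = int (Suc L)" "v1 25 = int r1" "r1 < N" "8 * H \<le> sb" "periodic G"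
    and cells: "\<And>j. j < cap \<Longrightarrow> 0 \<le> slot \<mu>1 2 r1 j \<and> slot \<mu>1 2 r1 j \<le> int U"
  defines "h \<equiv> \<lambda>j. hsh W L \<alpha>2 (el (slot \<mu>1 2 r1 j))"
  defines "X \<equiv> {24, 27, 29, 30, 31, 32, 33, 35}"
  shows "T W (\<lambda>v \<mu>. v = v1 \<and> \<mu> = \<mu>0)
     (loop 30 (V 7) (Seq (blk (elemS 33 2 25 30 @ [As 32 (hashE 18 14 38 33), As 29 (K 0)]))
       (Seq chain (blk (emit (V 27) (V 10 \<boxplus> K 1) @ [As 27 (V 24 \<boxminus> K 1)] @ emit (V 27) (V 29) @
          [As 27 (V 24 \<boxminus> K 1)]))))) (cap * (L * 200 + 400) + 20)
     (\<lambda>v \<mu>. eqx X v v1 \<and> (\<exists>S k. bst sb \<mu>1 (S0 @ S) v \<mu> \<and> length S = cap * (L + 2) \<and>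
        base_slp (S0 @ S) c \<and> v 27 = int k \<and>
        gen G (S0 @ S) k (2 ^ L * (1 + 2 * cap)) (\<lambda>q. \<Sum>j<cap. G (q + h j))))"
proof -
  let ?I = "\<lambda>j v \<mu>. eqx X v v1 \<and> (\<exists>S k. bst sb \<mu>1 (S0 @ S) v \<mu> \<and> length S = j * (L + 2) \<and>
        base_slp (S0 @ S) c \<and> v 27 = int k \<and>
        gen G (S0 @ S) k (2 ^ L * (1 + 2 * j)) (\<lambda>q. \<Sum>i<j. G (q + h i)))"
  let ?A = "elemS 33 2 25 30 @ [As 32 (hashE 18 14 38 33), As 29 (K 0)]"
  let ?B = "emit (V 27) (V 10 \<boxplus> K 1) @ [As 27 (V 24 \<boxminus> K 1)] @ emit (V 27) (V 29) @ [As 27 (V 24 \<boxminus> K 1)]"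
  have "T W (?I 0) (loop 30 (V 7) (Seq (blk ?A) (Seq chain (blk ?B)))) (cap * (L * 200 + 400) + 20) (?I cap)"
  proof (rule T_loop[where I = ?I])
    fix j assume j: "j < cap"
    have "j * (L + 2) + (L + 2) = Suc j * (L + 2)" by simp
    also have "\<dots> \<le> cap * (L + 2)" using j by (intro mult_right_mono) auto
    finally have room: "length S0 + j * (L + 2) + (L + 2) \<le> n" using assms(4) by linarith
    show "T W (\<lambda>v \<mu>. ?I j v \<mu> \<and> v 30 = int j) (Seq (blk ?A) (Seq chain (blk ?B))) (L * 200 + 383)
       (\<lambda>v \<mu>. ?I (Suc j) v \<mu> \<and> v 30 = int j)"
    proof (rule T_exact)
      fix v \<mu> assume "?I j v \<mu> \<and> v 30 = int j"
      then obtain S k where S: "eqx X v v1" "bst sb \<mu>1 (S0 @ S) v \<mu>" "length S = j * (L + 2)"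
        "base_slp (S0 @ S) c" "v 27 = int k" "gen G (S0 @ S) k (2 ^ L * (1 + 2 * j)) (\<lambda>q. \<Sum>i<j. G (q + h i))"
        "v 30 = int j" by blast
      have env: "env v" using S(2) by (simp add: bst_def)
      have r25: "v 25 = int r1" using eqxD[OF S(1), of 25] assms(6) by (simp add: X_def)
      have sl: "slot \<mu> 2 r1 j = slot \<mu>1 2 r1 j"
      proof -
        have "2 * H + (int r1 * 2 ^ D + int j) < sb"
          using bucket_bound[OF assms(7), of "int j"] cap_less[OF j] assms(8) H_pos by linarith
        thus ?thesis using S(2) by (auto simp: bst_def put_def slot_def)
      qed
      define v2 where "v2 = v(33 := el (slot \<mu>1 2 r1 j), 32 := int (h j), 29 := 0)"
      have 1: "T W (\<lambda>v' \<mu>'. v' = v \<and> \<mu>' = \<mu>) (blk ?A) 60 (\<lambda>v' \<mu>'. v' = v2 \<and> \<mu>' = \<mu>)"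
      proof (rule T_blk)
        show "wp W ?A (\<lambda>v' \<mu>'. v' = v2 \<and> \<mu>' = \<mu>) v' \<mu>'" if "v' = v \<and> \<mu>' = \<mu>" for v' \<mu>'
        proof -
          have "env (v(33 := el (slot \<mu>1 2 r1 j)))" using env by simp
          thus ?thesis using that cells[OF j] ev_hash2[of "v(33 := el (slot \<mu>1 2 r1 j))" 33]
            by (subst wp_elem[where rr = r1 and j = j]) (auto simp: env r25 assms(7) S(7) j sl v2_def h_def)
        qed
      qed (simp add: blk_time_append elemS_def hashE_def cellE_def)
      have b2: "bst sb \<mu>1 (S0 @ S) v2 \<mu>" using S(2) by (simp add: v2_def)
      have hL: "int (h j) < 2 ^ L"
        unfolding h_def by (metis hsh_less[OF L_W(1)] of_nat_less_iff of_nat_numeral of_nat_power)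
      have 2: "T W (\<lambda>v' \<mu>'. v' = v2 \<and> \<mu>' = \<mu>) chain (L * 200 + 20)
         (\<lambda>v' \<mu>'. eqx {24, 29, 31, 35} v' v2 \<and> (\<exists>S' k. bst sb \<mu>1 ((S0 @ S) @ S') v' \<mu>' \<and> length S' = L \<and>
        base_slp ((S0 @ S) @ S') c \<and> v' 29 = int k \<and> gen G ((S0 @ S) @ S') k (1 + 2 ^ L - 1) (\<lambda>q. G (q + h j))))"
        by (rule T_chain[OF b2 _ S(4) assms(3) base_slp_one[OF S(4)] _ _ _ hL])
          (use room S(3) in \<open>simp_all add: v2_def\<close>)
      have 3: "T W (\<lambda>v' \<mu>'. eqx {24, 29, 31, 35} v' v2 \<and> (\<exists>S' k. bst sb \<mu>1 ((S0 @ S) @ S') v' \<mu>' \<and> length S' = L \<and>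
        base_slp ((S0 @ S) @ S') c \<and> v' 29 = int k \<and> gen G ((S0 @ S) @ S') k (1 + 2 ^ L - 1) (\<lambda>q. G (q + h j))))
        (blk ?B) 300 (\<lambda>v \<mu>. ?I (Suc j) v \<mu> \<and> v 30 = int j)"
      proof (rule T_blk)
        fix v3 \<mu>3 assume "eqx {24, 29, 31, 35} v3 v2 \<and> (\<exists>S' k. bst sb \<mu>1 ((S0 @ S) @ S') v3 \<mu>3 \<and> length S' = L \<and>
        base_slp ((S0 @ S) @ S') c \<and> v3 29 = int k \<and> gen G ((S0 @ S) @ S') k (1 + 2 ^ L - 1) (\<lambda>q. G (q + h j)))"
        then obtain S' k' where S': "eqx {24, 29, 31, 35} v3 v2" "bst sb \<mu>1 (S0 @ S @ S') v3 \<mu>3" "length S' = L"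
          "base_slp (S0 @ S @ S') c" "v3 29 = int k'" "gen G (S0 @ S @ S') k' (2 ^ L) (\<lambda>q. G (q + h j))" by auto
        define S1 where "S1 = S0 @ S @ S'"
        have len: "length S1 + 2 \<le> n" using room S(3) S'(3) by (simp add: S1_def)
        have v27: "v3 27 = int k" using eqxD[OF S'(1), of 27] S(5) by (simp add: v2_def)
        have v10: "v3 10 = int L" using S'(2) by (simp add: bst_def env_def)
        have gk: "gen G S1 k (2 ^ L * (1 + 2 * j)) (\<lambda>q. \<Sum>i<j. G (q + h i))"
          using gen_append[OF S(6), of S'] by (simp add: S1_def)
        have z: "gen G S1 (Suc L) (2 ^ L) (\<lambda>_. 0)" using base_slp_zeros S'(4) assms(3) by (simp add: S1_def)
        define S2 where "S2 = S1 @ [Concat k (Suc L)]"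
        have g2: "gen G S2 (length S1) (2 ^ L * (2 + 2 * j)) (\<lambda>q. \<Sum>i<j. G (q + h i))"
          unfolding S2_def by (rule gen_Concat[OF gk z]) (simp_all add: algebra_simps)
        have g2': "gen G S2 k' (2 ^ L) (\<lambda>q. G (q + h j))" unfolding S2_def using gen_append[OF S'(6), of "[Concat k (Suc L)]"] by (simp add: S1_def)
        have base2: "base_slp S2 c" unfolding S2_def
          using S'(4) gk z by (intro base_slp_Concat) (auto simp: gen_def S1_def)
        define S3 where "S3 = S2 @ [Concat (length S1) k']"
        have g3: "gen G S3 (length S2) (2 ^ L * (1 + 2 * Suc j)) (\<lambda>q. \<Sum>i<Suc j. G (q + h i))"
          unfolding S3_def by (rule gen_Concat[OF g2 g2'])
            (simp_all only: periodicD[OF assms(9)] sum.lessThan_Suc, simp add: algebra_simps)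
        have base3: "base_slp S3 c" unfolding S3_def
          using base2 g2 g2' by (intro base_slp_Concat) (auto simp: gen_def)
        have "Suc L < n" using L_n by simp
        have word: "wrap W (int x) = int x" if "x \<le> n" for x using that by (intro n_word) auto
        show "wp W ?B (\<lambda>v \<mu>. ?I (Suc j) v \<mu> \<and> v 30 = int j) v3 \<mu>3"
        proof (rule wp_emit_bst[OF S'(2)[folded S1_def]])
          show "ev W (V 27) v3 \<mu> = int k" "ev W (V 10 \<boxplus> K 1) v3 \<mu> = int (Suc L)" for \<mu>
            using v27 v10 \<open>Suc L < n\<close> word[of "Suc L"] by (simp_all add: add.commute)
          fix v4 \<mu>4 assume v4: "v4 = v3(24 := int (Suc (length S1)))" "bst sb \<mu>1 (S1 @ [Concat k (Suc L)]) v4 \<mu>4"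
          have e4: "ev W (V 24 \<boxminus> K 1) v4 \<mu>4 = int (length S1)" using v4(1) word[of "length S1"] len by simp
          define v5 where "v5 = v4(27 := int (length S1))"
          have b5: "bst sb \<mu>1 S2 v5 \<mu>4" using v4(2) by (simp add: v5_def S2_def)
          have "wp W (emit (V 27) (V 29) @ [As 27 (V 24 \<boxminus> K 1)]) (\<lambda>v \<mu>. ?I (Suc j) v \<mu> \<and> v 30 = int j) v5 \<mu>4"
          proof (rule wp_emit_bst[OF b5])
            show "length S2 < n" using len by (simp add: S2_def)
            show "ev W (V 27) v5 \<mu> = int (length S1)" "ev W (V 29) v5 \<mu> = int k'" for \<mu>
              using S'(5) by (simp_all add: v5_def v4(1))
            fix v6 \<mu>6 assume v6: "v6 = v5(24 := int (Suc (length S2)))" "bst sb \<mu>1 (S2 @ [Concat (length S1) k']) v6 \<mu>6"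
            have e6: "ev W (V 24 \<boxminus> K 1) v6 \<mu>6 = int (length S2)" using v6(1) word[of "length S2"] len by (simp add: S2_def)
            have S3': "S3 = S0 @ (S @ S' @ [Concat k (Suc L), Concat (length S1) k'])" by (simp add: S3_def S2_def S1_def)
            have "eqx X v6 v1"
            proof (rule eqx_trans)
              show "eqx (X) v6 v3" by (simp add: v6(1) v5_def v4(1) X_def)
              show "eqx X v3 v1" by (rule eqx_trans[OF S'(1), of X v1]) (use S(1) in \<open>auto simp: v2_def X_def\<close>)
            qed auto
            moreover have "v6 30 = int j"
              using eqxD[OF S'(1), of 30] S(7) by (simp add: v6(1) v5_def v4(1) v2_def)
            ultimately have "?I (Suc j) (v6(27 := int (length S2))) \<mu>6 \<and> (v6(27 := int (length S2))) 30 = int j"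
              using v6(2) g3 base3 S(3) S'(3) unfolding S3_def[symmetric] unfolding S3'
              by (intro conjI exI[of _ "S @ S' @ [Concat k (Suc L), Concat (length S1) k']"] exI[of _ "length S2"])
                (simp_all add: X_def)
            thus "wp W [As 27 (V 24 \<boxminus> K 1)] (\<lambda>v \<mu>. ?I (Suc j) v \<mu> \<and> v 30 = int j) v6 \<mu>6"
              using e6 by (simp only: wp.simps)
          qed
          thus "wp W ([As 27 (V 24 \<boxminus> K 1)] @ emit (V 27) (V 29) @ [As 27 (V 24 \<boxminus> K 1)])
            (\<lambda>v \<mu>. ?I (Suc j) v \<mu> \<and> v 30 = int j) v4 \<mu>4"
            using e4 by (simp only: wp.simps append.simps v5_def)
        qed (use len in simp)
      qed (simp add: blk_time_append emit_time)
      show "T W (\<lambda>v' \<mu>'. v' = v \<and> \<mu>' = \<mu>) (Seq (blk ?A) (Seq chain (blk ?B))) (L * 200 + 383)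
         (\<lambda>v \<mu>. ?I (Suc j) v \<mu> \<and> v 30 = int j)"
        by (rule T_Seq[OF 1 T_Seq[OF 2 3 order_refl]]) simp
    qed
  next
    show "cap < 2 ^ W"
    proof -
      have "cap * 1 \<le> cap * (2 * L + 4)" by (intro mult_left_mono) auto
      hence "int cap < 2 ^ W" using rules n_W by linarith
      thus ?thesis by (metis of_nat_less_iff of_nat_numeral of_nat_power)
    qed
    show "ev W (V 7) v \<mu> = int cap" if "?I j v \<mu>" for j v \<mu>
      using that by (auto simp: bst_def env_def)
  qed (use W_16 in \<open>auto simp: X_def loop_time_def algebra_simps\<close>)
  thus ?thesis
  proof (rule T_weaken)
    fix v \<mu> assume "v = v1 \<and> \<mu> = \<mu>0"
    thus "?I 0 v \<mu>" using assms base_slp_zeros[OF assms(2,3), of G]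
      by (intro conjI exI[of _ "[]"] exI[of _ "Suc L"]) auto
  qed auto
qed

lemma cap_word: "cap < 2 ^ W"
proof -
  have "cap * 1 \<le> cap * (2 * L + 4)" by (intro mult_left_mono) auto
  hence "int cap < 2 ^ W" using rules n_W by linarith
  thus ?thesis by (metis of_nat_less_iff of_nat_numeral of_nat_power)
qed

text \<open>The rule for the string over \<open>a\<close> is shared: each \<open>b\<close> costs
  only a shift by its hash value, that is \<open>L\<close> rules and two more, although it accounts
  for \<open>cap\<close> pairs. This is what compression gains.\<close>

lemma T_summandsB:
  assumes "bst sb \<mu>1 S0 v1 \<mu>0" "base_slp S0 c" "L + 1 + D \<le> c" "length S0 + cap * (L + 2) \<le> n"
    and "v1 27 = int x" "gen G S0 x (2 ^ (L + 1 + D) - 2 ^ L) f" "\<And>q k y. f (q + 2 ^ L * k + y) = f (q + y)"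
    and "v1 28 = int (L + D + 2)" "v1 26 = int r2" "r2 < N" "8 * H \<le> sb"
    and cells: "\<And>j. j < cap \<Longrightarrow> 0 \<le> slot \<mu>1 3 r2 j \<and> slot \<mu>1 3 r2 j \<le> int U"
  defines "h \<equiv> \<lambda>j. hsh W L \<alpha>2 (el (slot \<mu>1 3 r2 j))"
  defines "X \<equiv> {24, 28, 29, 30, 31, 32, 33, 35}"
  shows "T W (\<lambda>v \<mu>. v = v1 \<and> \<mu> = \<mu>0)
     (loop 30 (V 7) (Seq (blk (elemS 33 3 26 30 @ [As 32 (hashE 18 14 38 33), As 29 (V 27)]))
       (Seq chain (blk (emit (V 29) (K 1) @ [As 29 (V 24 \<boxminus> K 1)] @ emit (V 28) (V 29) @
          [As 28 (V 24 \<boxminus> K 1)]))))) (cap * (L * 200 + 400) + 20)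
     (\<lambda>v \<mu>. eqx X v v1 \<and> (\<exists>S k. bst sb \<mu>1 (S0 @ S) v \<mu> \<and> length S = cap * (L + 2) \<and>
        base_slp (S0 @ S) c \<and> v 28 = int k \<and>
        gen G (S0 @ S) k (2 ^ (L + 1 + D) * (1 + cap)) (\<lambda>q. \<Sum>j<cap. f (q + h j))))"
proof -
  let ?l = "2 ^ (L + 1 + D) :: nat"
  let ?I = "\<lambda>j v \<mu>. eqx X v v1 \<and> (\<exists>S k. bst sb \<mu>1 (S0 @ S) v \<mu> \<and> length S = j * (L + 2) \<and>
        base_slp (S0 @ S) c \<and> v 28 = int k \<and>
        gen G (S0 @ S) k (?l * (1 + j)) (\<lambda>q. \<Sum>i<j. f (q + h i)))"
  let ?A = "elemS 33 3 26 30 @ [As 32 (hashE 18 14 38 33), As 29 (V 27)]"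
  let ?B = "emit (V 29) (K 1) @ [As 29 (V 24 \<boxminus> K 1)] @ emit (V 28) (V 29) @ [As 28 (V 24 \<boxminus> K 1)]"
  have l2: "?l = 2 ^ L * 2 ^ (1 + D)" by (simp add: power_add)
  have lx: "1 \<le> ?l - 2 ^ L" "?l - 2 ^ L + 2 ^ L - 1 + 2 ^ 0 = ?l"
  proof -
    have "2 ^ L * 2 \<le> ?l" unfolding l2 by (intro mult_left_mono) auto
    moreover have "1 \<le> (2::nat) ^ L" by simp
    moreover have "2 * b \<le> a \<Longrightarrow> 1 \<le> b \<Longrightarrow> 1 \<le> a - b \<and> a - b + b - 1 + 1 = a" for a b :: nat by arith
    ultimately show "1 \<le> ?l - 2 ^ L" "?l - 2 ^ L + 2 ^ L - 1 + 2 ^ 0 = ?l"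
      unfolding power_0 by (simp_all only: mult.commute[of _ 2])
  qed
  have "T W (?I 0) (loop 30 (V 7) (Seq (blk ?A) (Seq chain (blk ?B)))) (cap * (L * 200 + 400) + 20) (?I cap)"
  proof (rule T_loop[where I = ?I])
    fix j assume j: "j < cap"
    have "j * (L + 2) + (L + 2) = Suc j * (L + 2)" by simp
    also have "\<dots> \<le> cap * (L + 2)" using j by (intro mult_right_mono) auto
    finally have room: "length S0 + j * (L + 2) + (L + 2) \<le> n" using assms(4) by linarith
    show "T W (\<lambda>v \<mu>. ?I j v \<mu> \<and> v 30 = int j) (Seq (blk ?A) (Seq chain (blk ?B))) (L * 200 + 383)
       (\<lambda>v \<mu>. ?I (Suc j) v \<mu> \<and> v 30 = int j)"
    proof (rule T_exact)
      fix v \<mu> assume "?I j v \<mu> \<and> v 30 = int j"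
      then obtain S k where S: "eqx X v v1" "bst sb \<mu>1 (S0 @ S) v \<mu>" "length S = j * (L + 2)"
        "base_slp (S0 @ S) c" "v 28 = int k" "gen G (S0 @ S) k (?l * (1 + j)) (\<lambda>q. \<Sum>i<j. f (q + h i))"
        "v 30 = int j" by blast
      have env: "env v" using S(2) by (simp add: bst_def)
      have r26: "v 26 = int r2" "v 27 = int x"
        using eqxD[OF S(1), of 26] eqxD[OF S(1), of 27] assms(5,9) by (simp_all add: X_def)
      have gx: "gen G (S0 @ S) x (?l - 2 ^ L) f" using assms(6) gen_append by simp
      have sl: "slot \<mu> 3 r2 j = slot \<mu>1 3 r2 j"
      proof -
        have "3 * H + (int r2 * 2 ^ D + int j) < sb"
          using bucket_bound[OF assms(10), of "int j"] cap_less[OF j] assms(11) H_pos by linarith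
        thus ?thesis using S(2) by (auto simp: bst_def put_def slot_def)
      qed
      define v2 where "v2 = v(33 := el (slot \<mu>1 3 r2 j), 32 := int (h j), 29 := int x)"
      have 1: "T W (\<lambda>v' \<mu>'. v' = v \<and> \<mu>' = \<mu>) (blk ?A) 60 (\<lambda>v' \<mu>'. v' = v2 \<and> \<mu>' = \<mu>)"
      proof (rule T_blk)
        show "wp W ?A (\<lambda>v' \<mu>'. v' = v2 \<and> \<mu>' = \<mu>) v' \<mu>'" if "v' = v \<and> \<mu>' = \<mu>" for v' \<mu>'
        proof -
          have "env (v(33 := el (slot \<mu>1 3 r2 j)))" using env by simp
          thus ?thesis using that cells[OF j] ev_hash2[of "v(33 := el (slot \<mu>1 3 r2 j))" 33]
            by (subst wp_elem[where rr = r2 and j = j]) (auto simp: env r26 assms(10) S(7) j sl v2_def h_def)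
        qed
      qed (simp add: blk_time_append elemS_def hashE_def cellE_def)
      have b2: "bst sb \<mu>1 (S0 @ S) v2 \<mu>" using S(2) by (simp add: v2_def)
      have hL: "int (h j) < 2 ^ L"
        unfolding h_def by (metis hsh_less[OF L_W(1)] of_nat_less_iff of_nat_numeral of_nat_power)
      have 2: "T W (\<lambda>v' \<mu>'. v' = v2 \<and> \<mu>' = \<mu>) chain (L * 200 + 20)
         (\<lambda>v' \<mu>'. eqx {24, 29, 31, 35} v' v2 \<and> (\<exists>S' k. bst sb \<mu>1 ((S0 @ S) @ S') v' \<mu>' \<and> length S' = L \<and>
        base_slp ((S0 @ S) @ S') c \<and> v' 29 = int k \<and> gen G ((S0 @ S) @ S') k (?l - 2 ^ L + 2 ^ L - 1) (\<lambda>q. f (q + h j))))"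
        by (rule T_chain[OF b2 _ S(4) _ gx lx(1) _ _ hL])
          (use room S(3) assms(3) in \<open>simp_all add: v2_def\<close>)
      have 3: "T W (\<lambda>v' \<mu>'. eqx {24, 29, 31, 35} v' v2 \<and> (\<exists>S' k. bst sb \<mu>1 ((S0 @ S) @ S') v' \<mu>' \<and> length S' = L \<and>
        base_slp ((S0 @ S) @ S') c \<and> v' 29 = int k \<and> gen G ((S0 @ S) @ S') k (?l - 2 ^ L + 2 ^ L - 1) (\<lambda>q. f (q + h j))))
        (blk ?B) 300 (\<lambda>v \<mu>. ?I (Suc j) v \<mu> \<and> v 30 = int j)"
      proof (rule T_blk)
        fix v3 \<mu>3 assume "eqx {24, 29, 31, 35} v3 v2 \<and> (\<exists>S' k. bst sb \<mu>1 ((S0 @ S) @ S') v3 \<mu>3 \<and> length S' = L \<and>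
        base_slp ((S0 @ S) @ S') c \<and> v3 29 = int k \<and> gen G ((S0 @ S) @ S') k (?l - 2 ^ L + 2 ^ L - 1) (\<lambda>q. f (q + h j)))"
        then obtain S' k' where S': "eqx {24, 29, 31, 35} v3 v2" "bst sb \<mu>1 (S0 @ S @ S') v3 \<mu>3" "length S' = L"
          "base_slp (S0 @ S @ S') c" "v3 29 = int k'" "gen G (S0 @ S @ S') k' (?l - 2 ^ L + 2 ^ L - 1) (\<lambda>q. f (q + h j))"
          unfolding append_assoc by blast
        define S1 where "S1 = S0 @ S @ S'"
        have len: "length S1 + 2 \<le> n" using room S(3) S'(3) by (simp add: S1_def)
        have v28: "v3 28 = int k" using eqxD[OF S'(1), of 28] S(5) by (simp add: v2_def)
        have gk: "gen G S1 k (?l * (1 + j)) (\<lambda>q. \<Sum>i<j. f (q + h i))"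
          using gen_append[OF S(6), of S'] by (simp add: S1_def)
        have z: "gen G S1 (Suc 0) (2 ^ 0) (\<lambda>_. 0)" by (rule base_slp_zeros[OF S'(4)[folded S1_def]]) simp
        \<comment> \<open>The shift leaves length \<open>2 ^ (L + 1 + D) - 1\<close>; rule 1 is the
          single missing zero.\<close>
        define S2 where "S2 = S1 @ [Concat k' 1]"
        have g2: "gen G S2 (length S1) ?l (\<lambda>q. f (q + h j))"
          unfolding S2_def using gen_Concat[OF S'(6)[folded S1_def] z lx(2)[symmetric]] by simp
        have g2': "gen G S2 k (?l * (1 + j)) (\<lambda>q. \<Sum>i<j. f (q + h i))"
          unfolding S2_def using gen_append[OF gk] by simp
        have base2: "base_slp S2 c" unfolding S2_def
          using S'(4,6) z by (intro base_slp_Concat) (auto simp: gen_def S1_def)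
        define S3 where "S3 = S2 @ [Concat k (length S1)]"
        have g3: "gen G S3 (length S2) (?l * (1 + Suc j)) (\<lambda>q. \<Sum>i<Suc j. f (q + h i))"
        proof -
          have "f (q + ?l * (1 + j) + y) = f (q + y)" for q y
            unfolding l2 mult.assoc by (rule assms(7))
          thus ?thesis unfolding S3_def by (intro gen_Concat[OF g2' g2]) simp_all
        qed
        have base3: "base_slp S3 c" unfolding S3_def
          using base2 g2 g2' by (intro base_slp_Concat) (auto simp: gen_def)
        have word: "wrap W (int x) = int x" if "x \<le> n" for x using that by (intro n_word) auto
        show "wp W ?B (\<lambda>v \<mu>. ?I (Suc j) v \<mu> \<and> v 30 = int j) v3 \<mu>3"
        proof (rule wp_emit_bst[OF S'(2)[folded S1_def]])
          show "ev W (V 29) v3 \<mu> = int k'" "ev W (K 1) v3 \<mu> = int 1" for \<mu>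
            using S'(5) by simp_all
          fix v4 \<mu>4 assume v4: "v4 = v3(24 := int (Suc (length S1)))" "bst sb \<mu>1 (S1 @ [Concat k' 1]) v4 \<mu>4"
          have e4: "ev W (V 24 \<boxminus> K 1) v4 \<mu>4 = int (length S1)" using v4(1) word[of "length S1"] len by simp
          define v5 where "v5 = v4(29 := int (length S1))"
          have b5: "bst sb \<mu>1 S2 v5 \<mu>4" using v4(2) by (simp add: v5_def S2_def)
          have "wp W (emit (V 28) (V 29) @ [As 28 (V 24 \<boxminus> K 1)]) (\<lambda>v \<mu>. ?I (Suc j) v \<mu> \<and> v 30 = int j) v5 \<mu>4"
          proof (rule wp_emit_bst[OF b5])
            show "length S2 < n" using len by (simp add: S2_def)
            show "ev W (V 28) v5 \<mu> = int k" "ev W (V 29) v5 \<mu> = int (length S1)" for \<mu>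
              using v28 by (simp_all add: v5_def v4(1))
            fix v6 \<mu>6 assume v6: "v6 = v5(24 := int (Suc (length S2)))" "bst sb \<mu>1 (S2 @ [Concat k (length S1)]) v6 \<mu>6"
            have e6: "ev W (V 24 \<boxminus> K 1) v6 \<mu>6 = int (length S2)" using v6(1) word[of "length S2"] len by (simp add: S2_def)
            have S3': "S3 = S0 @ (S @ S' @ [Concat k' 1, Concat k (length S1)])" by (simp add: S3_def S2_def S1_def)
            have "eqx X v6 v1"
            proof (rule eqx_trans)
              show "eqx (X) v6 v3" by (simp add: v6(1) v5_def v4(1) X_def)
              show "eqx X v3 v1" by (rule eqx_trans[OF S'(1), of X v1]) (use S(1) in \<open>auto simp: v2_def X_def\<close>)
            qed auto
            moreover have "v6 30 = int j"
              using eqxD[OF S'(1), of 30] S(7) by (simp add: v6(1) v5_def v4(1) v2_def)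
            ultimately have "?I (Suc j) (v6(28 := int (length S2))) \<mu>6 \<and> (v6(28 := int (length S2))) 30 = int j"
              using v6(2) g3 base3 S(3) S'(3) unfolding S3_def[symmetric] unfolding S3'
              by (intro conjI exI[of _ "S @ S' @ [Concat k' 1, Concat k (length S1)]"] exI[of _ "length S2"])
                (simp_all add: X_def)
            thus "wp W [As 28 (V 24 \<boxminus> K 1)] (\<lambda>v \<mu>. ?I (Suc j) v \<mu> \<and> v 30 = int j) v6 \<mu>6"
              using e6 by (simp only: wp.simps)
          qed
          thus "wp W ([As 29 (V 24 \<boxminus> K 1)] @ emit (V 28) (V 29) @ [As 28 (V 24 \<boxminus> K 1)])
            (\<lambda>v \<mu>. ?I (Suc j) v \<mu> \<and> v 30 = int j) v4 \<mu>4"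
            using e4 by (simp only: wp.simps append.simps v5_def)
        qed (use len in simp)
      qed (simp add: blk_time_append emit_time)
      show "T W (\<lambda>v' \<mu>'. v' = v \<and> \<mu>' = \<mu>) (Seq (blk ?A) (Seq chain (blk ?B))) (L * 200 + 383)
         (\<lambda>v \<mu>. ?I (Suc j) v \<mu> \<and> v 30 = int j)"
        by (rule T_Seq[OF 1 T_Seq[OF 2 3 order_refl]]) simp
    qed
  next
    show "cap < 2 ^ W" by (rule cap_word)
    show "ev W (V 7) v \<mu> = int cap" if "?I j v \<mu>" for j v \<mu>
      using that by (auto simp: bst_def env_def)
  qed (use W_16 in \<open>auto simp: X_def loop_time_def algebra_simps\<close>)
  thus ?thesis
  proof (rule T_weaken)
    fix v \<mu> assume "v = v1 \<and> \<mu> = \<mu>0"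
    thus "?I 0 v \<mu>" using assms base_slp_zeros[OF assms(2,3), of G]
      by (intro conjI exI[of _ "[]"] exI[of _ "L + D + 2"]) auto
  qed auto
qed

lemma n_bound: "2 * (cap * (L + 2)) + L + 2 * D + 5 \<le> n" "cap \<le> n"
proof -
  have "cap * (2 * L + 4) = 2 * (cap * (L + 2))" by (simp add: algebra_simps)
  thus *: "2 * (cap * (L + 2)) + L + 2 * D + 5 \<le> n" using rules by simp
  have "cap * 1 \<le> cap * (L + 2)" by (intro mult_left_mono) auto
  thus "cap \<le> n" using * by linarith
qed

text \<open>In fresh memory the encoding of the two terminal rules differs from zeros in a single
  cell, the symbol 1 of rule 0.\<close>

lemma T_init:
  assumes "env v1" "v1 23 = sb" "0 \<le> sb" "sb + 3 * int n \<le> 2 ^ W"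
    and zero: "\<And>z. sb \<le> z \<Longrightarrow> z < sb + 3 * int n \<Longrightarrow> \<mu>1 z = 0"
  shows "T W (\<lambda>v \<mu>. v = v1 \<and> \<mu> = \<mu>1) (blk [St (V 23 \<boxplus> K 1) (trimE (K 1)), As 24 (K 2)]) 30
    (\<lambda>v \<mu>. eqx {24} v v1 \<and> bst sb \<mu>1 [Terminal 1, Terminal 0] v \<mu>)" (is "T W _ _ _ ?P")
proof (rule T_blk)
  fix v \<mu> assume v: "v = v1 \<and> \<mu> = \<mu>1"
  have six: "6 \<le> 3 * int n" using n_bound by linarith
  have "\<mu>1(sb + 1 := wrap w 1) = put w sb (encode_slp [Terminal 1, Terminal 0]) \<mu>1"
  proof
    fix z
    have "z \<in> {sb, sb + 1, sb + 2, sb + 3, sb + 4, sb + 5} \<or> z < sb \<or> sb + 6 \<le> z" by auto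
    thus "(\<mu>1(sb + 1 := wrap w 1)) z = put w sb (encode_slp [Terminal 1, Terminal 0]) \<mu>1 z"
      using zero[of z] six by (auto simp: put_def encode_slp_def fun_upd_apply)
  qed
  moreover have "wrap W (sb + 1) = sb + 1" using assms(3,4) six by (intro wrap_idI) auto
  ultimately show "wp W [St (V 23 \<boxplus> K 1) (trimE (K 1)), As 24 (K 2)] ?P v \<mu>"
    using v assms(1-4) n_bound(1) ev_trimE[of v1 "K 1"]
    by (simp add: bst_def) (simp add: env_def)
qed (simp add: trimE_def)

text \<open>\<open>Terminal 0\<close> is encoded by three zeros. In fresh memory a grammar can
  therefore be lengthened by such rules without any writing, which is how it gets the prescribed
  size \<open>n\<close>.\<close>

lemma bst_pad:
  assumes "bst sb \<mu>1 S v \<mu>" "length S \<le> n - 1"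
    and zero: "\<And>z. sb \<le> z \<Longrightarrow> z < sb + 3 * int n \<Longrightarrow> \<mu>1 z = 0"
  shows "\<mu> = put w sb (encode_slp (S @ replicate (n - 1 - length S) (Terminal 0))) \<mu>1"
proof -
  have "put w (sb + int (length (encode_slp S))) (replicate (3 * (n - 1 - length S)) 0) (put w sb (encode_slp S) \<mu>1)
     = put w sb (encode_slp S) \<mu>1"
  proof (rule put_zeros)
    fix z assume z: "sb + int (length (encode_slp S)) \<le> z"
      "z < sb + int (length (encode_slp S)) + int (3 * (n - 1 - length S))"
    hence "\<mu>1 z = 0" using assms(2) by (intro zero) auto
    thus "put w sb (encode_slp S) \<mu>1 z = 0" using z by (simp add: put_def)
  qed
  thus ?thesis using assms(1) unfolding encode_slp_append encode_slp_replicate put_append by (simp add: bst_def)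
qed

text \<open>The offset \<open>2 ^ (L + 1 + 2 * D)\<close> comes from the zero block that the last
  rule puts in front to reach length \<open>N\<close>. It is a multiple of the period and drops out
  once the inner product is evaluated.\<close>

lemma T_row:
  assumes "env v1" "v1 23 = sb" "v1 25 = int r1" "v1 26 = int r2" "r1 < N" "r2 < N"
    and "8 * H \<le> sb" "sb + 3 * int n \<le> 2 ^ W" "periodic G"
    and zero: "\<And>z. sb \<le> z \<Longrightarrow> z < sb + 3 * int n \<Longrightarrow> \<mu>1 z = 0"
    and cellsA: "\<And>j. j < cap \<Longrightarrow> 0 \<le> slot \<mu>1 2 r1 j \<and> slot \<mu>1 2 r1 j \<le> int U"
    and cellsB: "\<And>j. j < cap \<Longrightarrow> 0 \<le> slot \<mu>1 3 r2 j \<and> slot \<mu>1 3 r2 j \<le> int U"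
  defines "hA \<equiv> \<lambda>j. hsh W L \<alpha>2 (el (slot \<mu>1 2 r1 j))" and "hB \<equiv> \<lambda>j. hsh W L \<alpha>2 (el (slot \<mu>1 3 r2 j))"
  defines "X \<equiv> {24, 27, 28, 29, 30, 31, 32, 33, 35}"
  shows "T W (\<lambda>v \<mu>. v = v1 \<and> \<mu> = \<mu>1) row_code (n * 700)
    (\<lambda>v \<mu>. eqx X v v1 \<and> (\<exists>S. \<mu> = put w sb (encode_slp S) \<mu>1 \<and> is_slp {0, 1} S \<and> length S = n \<and>
       gen G S (n - 1) N (\<lambda>q. \<Sum>j<cap. \<Sum>i<cap. G (q + 2 ^ (L + 1 + 2 * D) + hB j + hA i))))"
proof -
  define c where "c = L + 2 * D + 1"
  note nb = n_bound
  have sb0: "0 \<le> sb" using assms(7) H_pos by linarith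
  have word: "wrap W (int x) = int x" if "x \<le> n" for x using that by (intro n_word) auto
  have w2: "wrap W (2 * int D) = 2 * int D" "wrap W (int L + 2 * int D) = int L + 2 * int D"
    "wrap W (int L + int D) = int L + int D"
    using word[of "2 * D"] word[of "L + 2 * D"] word[of "L + D"] nb by simp_all
  let ?S0 = "[Terminal 1, Terminal 0] :: int slp"
  define P1 where "P1 v \<mu> \<longleftrightarrow> eqx {24} v v1 \<and> bst sb \<mu>1 ?S0 v \<mu>" for v \<mu>
  have 1: "T W (\<lambda>v \<mu>. v = v1 \<and> \<mu> = \<mu>1) (blk [St (V 23 \<boxplus> K 1) (trimE (K 1)), As 24 (K 2)]) 30 P1"
    unfolding P1_def by (rule T_init[OF assms(1,2) sb0 assms(8) zero])
  define P2 where "P2 v \<mu> \<longleftrightarrow> eqx {24, 31} v v1 \<and> (\<exists>S. bst sb \<mu>1 S v \<mu> \<and> base_slp S c \<and> length S = c + 2)" for v \<mu>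
  have 2: "T W P1 (zeros (V 10 \<boxplus> K 2 \<boxtimes> V 6 \<boxplus> K 1)) (c * 123 + 33) P2"
  proof (rule T_exact)
    fix v0 \<mu>0 assume "P1 v0 \<mu>0"
    hence P: "eqx {24} v0 v1" "bst sb \<mu>1 ?S0 v0 \<mu>0" by (auto simp: P1_def)
    show "T W (\<lambda>v \<mu>. v = v0 \<and> \<mu> = \<mu>0) (zeros (V 10 \<boxplus> K 2 \<boxtimes> V 6 \<boxplus> K 1)) (c * 123 + 33) P2"
    proof (rule T_weaken[OF T_zeros[OF P(2), of c]])
      show "ev W (V 10 \<boxplus> K 2 \<boxtimes> V 6 \<boxplus> K 1) v \<mu> = int c" if "eqx {24, 31} v v0" for v \<mu>
      proof -
        have "v 10 = int L" "v 6 = int D"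
          using eqxD[OF that, of 10] eqxD[OF that, of 6] P(2) by (simp_all add: bst_def env_def)
        thus ?thesis using word[of c] w2 nb by (simp add: c_def add.commute)
      qed
      show "P2 v \<mu>" if "eqx {24, 31} v v0 \<and> (\<exists>S. bst sb \<mu>1 S v \<mu> \<and> base_slp S c \<and> length S = c + 2)" for v \<mu>
        using that eqx_trans[of "{24, 31}" v v0 "{24}" v1 "{24, 31}"] P(1) by (auto simp: P2_def)
    qed (use nb in \<open>auto simp: c_def\<close>)
  qed
  define P3 where "P3 v \<mu> \<longleftrightarrow> eqx X v v1 \<and> (\<exists>S. bst sb \<mu>1 S v \<mu> \<and> base_slp S c \<and> length S = c + 2) \<and> v 27 = int (Suc L)" for v \<mu>
  have 3: "T W P2 (blk [As 27 (V 10 \<boxplus> K 1)]) 10 P3"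
  proof (rule T_blk)
    fix v \<mu> assume P: "P2 v \<mu>"
    hence "v 10 = int L" by (auto simp: P2_def bst_def env_def)
    hence "ev W (V 10 \<boxplus> K 1) v \<mu> = int (Suc L)" using word[of "Suc L"] nb by (simp add: add.commute)
    moreover have "eqx X v v1" using P by (auto simp: P2_def X_def eqx_def)
    ultimately show "wp W [As 27 (V 10 \<boxplus> K 1)] P3 v \<mu>"
      using P by (simp add: P2_def P3_def X_def del: ev.simps of_nat_Suc)
  qed simp
  define fX where "fX q = (\<Sum>j<cap. G (q + hA j))" for q
  define P4 where "P4 v \<mu> \<longleftrightarrow> eqx X v v1 \<and> (\<exists>S k. bst sb \<mu>1 S v \<mu> \<and> base_slp S c \<and> length S = c + 2 + cap * (L + 2) \<and>
     v 27 = int k \<and> gen G S k (2 ^ L * (1 + 2 * cap)) fX)" for v \<mu>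
  have 4: "T W P3 (loop 30 (V 7) (Seq (blk (elemS 33 2 25 30 @ [As 32 (hashE 18 14 38 33), As 29 (K 0)]))
       (Seq chain (blk (emit (V 27) (V 10 \<boxplus> K 1) @ [As 27 (V 24 \<boxminus> K 1)] @ emit (V 27) (V 29) @
          [As 27 (V 24 \<boxminus> K 1)]))))) (cap * (L * 200 + 400) + 20) P4"
  proof (rule T_exact)
    fix v0 \<mu>0 assume "P3 v0 \<mu>0"
    then obtain S where P: "eqx X v0 v1" "bst sb \<mu>1 S v0 \<mu>0" "base_slp S c" "length S = c + 2" "v0 27 = int (Suc L)"
      by (auto simp: P3_def)
    have r: "v0 25 = int r1" using eqxD[OF P(1), of 25] assms(3) by (simp add: X_def)
    show "T W (\<lambda>v \<mu>. v = v0 \<and> \<mu> = \<mu>0) (loop 30 (V 7) (Seq (blk (elemS 33 2 25 30 @ [As 32 (hashE 18 14 38 33), As 29 (K 0)]))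
       (Seq chain (blk (emit (V 27) (V 10 \<boxplus> K 1) @ [As 27 (V 24 \<boxminus> K 1)] @ emit (V 27) (V 29) @
          [As 27 (V 24 \<boxminus> K 1)]))))) (cap * (L * 200 + 400) + 20) P4"
    proof (rule T_weaken[OF T_summandsA[OF P(2,3) _ _ P(5) r assms(5,7,9) cellsA]])
      fix v \<mu> assume a: "eqx {24, 27, 29, 30, 31, 32, 33, 35} v v0 \<and> (\<exists>S' k. bst sb \<mu>1 (S @ S') v \<mu> \<and> length S' = cap * (L + 2) \<and>
        base_slp (S @ S') c \<and> v 27 = int k \<and>
        gen G (S @ S') k (2 ^ L * (1 + 2 * cap)) (\<lambda>q. \<Sum>j<cap. G (q + hsh W L \<alpha>2 (el (slot \<mu>1 2 r1 j)))))"
      then obtain S' k where "bst sb \<mu>1 (S @ S') v \<mu>" "length S' = cap * (L + 2)"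
        "base_slp (S @ S') c" "v 27 = int k" "gen G (S @ S') k (2 ^ L * (1 + 2 * cap)) fX"
        unfolding fX_def hA_def by blast
      moreover have "eqx X v v1" by (rule eqx_trans[OF conjunct1[OF a] P(1)]) (auto simp: X_def)
      ultimately show "P4 v \<mu>" unfolding P4_def using P(4)
        by (intro conjI exI[of _ "S @ S'"] exI[of _ k]) simp_all
    next
      show "length S + cap * (L + 2) \<le> n" using nb P(4) unfolding c_def by linarith
    qed (auto simp: c_def)
  qed
  define P5 where "P5 v \<mu> \<longleftrightarrow> P4 v \<mu> \<and> v 28 = int (L + D + 2)" for v \<mu>
  have 5: "T W P4 (blk [As 28 (V 10 \<boxplus> V 6 \<boxplus> K 2)]) 20 P5"
  proof (rule T_blk)
    fix v \<mu> assume P: "P4 v \<mu>"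
    hence "v 10 = int L" "v 6 = int D" by (auto simp: P4_def bst_def env_def)
    hence "ev W (V 10 \<boxplus> V 6 \<boxplus> K 2) v \<mu> = int (L + D + 2)" using word[of "L + D + 2"] w2 nb by (simp add: add.commute)
    thus "wp W [As 28 (V 10 \<boxplus> V 6 \<boxplus> K 2)] P5 v \<mu>"
      using P by (simp add: P4_def P5_def X_def del: ev.simps of_nat_Suc of_nat_add)
  qed simp
  define P6 where "P6 v \<mu> \<longleftrightarrow> eqx X v v1 \<and> (\<exists>S k. bst sb \<mu>1 S v \<mu> \<and> base_slp S c \<and> length S = c + 2 + 2 * (cap * (L + 2)) \<and>
     v 28 = int k \<and> gen G S k (2 ^ (L + 1 + D) * (1 + cap)) (\<lambda>q. \<Sum>j<cap. fX (q + hB j)))" for v \<mu>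
  have cap1: "Suc cap = 2 ^ D" by (simp add: cap_def)
  have lX: "2 ^ L * (1 + 2 * cap) = 2 ^ (L + 1 + D) - (2::nat) ^ L"
  proof -
    have "1 + 2 * cap = 2 * 2 ^ D - 1" using cap1 by linarith
    thus ?thesis by (simp add: power_add algebra_simps diff_mult_distrib2)
  qed
  have 6: "T W P5 (loop 30 (V 7) (Seq (blk (elemS 33 3 26 30 @ [As 32 (hashE 18 14 38 33), As 29 (V 27)]))
       (Seq chain (blk (emit (V 29) (K 1) @ [As 29 (V 24 \<boxminus> K 1)] @ emit (V 28) (V 29) @
          [As 28 (V 24 \<boxminus> K 1)]))))) (cap * (L * 200 + 400) + 20) P6"
  proof (rule T_exact)
    fix v0 \<mu>0 assume "P5 v0 \<mu>0"
    then obtain S k where P: "eqx X v0 v1" "bst sb \<mu>1 S v0 \<mu>0" "base_slp S c" "length S = c + 2 + cap * (L + 2)"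
       "v0 28 = int (L + D + 2)" "v0 27 = int k" "gen G S k (2 ^ (L + 1 + D) - 2 ^ L) fX"
      unfolding P5_def P4_def lX by auto
    have r: "v0 26 = int r2" using eqxD[OF P(1), of 26] assms(4) by (simp add: X_def)
    have per: "fX (q + 2 ^ L * k + y) = fX (q + y)" for q k y
      unfolding fX_def using periodicD[OF assms(9)] by (simp add: add.assoc)
    show "T W (\<lambda>v \<mu>. v = v0 \<and> \<mu> = \<mu>0) (loop 30 (V 7) (Seq (blk (elemS 33 3 26 30 @ [As 32 (hashE 18 14 38 33), As 29 (V 27)]))
       (Seq chain (blk (emit (V 29) (K 1) @ [As 29 (V 24 \<boxminus> K 1)] @ emit (V 28) (V 29) @
          [As 28 (V 24 \<boxminus> K 1)]))))) (cap * (L * 200 + 400) + 20) P6"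
    proof (rule T_weaken[OF T_summandsB[OF P(2,3) _ _ P(6,7) per P(5) r assms(6,7) cellsB]])
      fix v \<mu> assume a: "eqx {24, 28, 29, 30, 31, 32, 33, 35} v v0 \<and> (\<exists>S' k. bst sb \<mu>1 (S @ S') v \<mu> \<and> length S' = cap * (L + 2) \<and>
        base_slp (S @ S') c \<and> v 28 = int k \<and>
        gen G (S @ S') k (2 ^ (L + 1 + D) * (1 + cap)) (\<lambda>q. \<Sum>j<cap. fX (q + hsh W L \<alpha>2 (el (slot \<mu>1 3 r2 j)))))"
      then obtain S' k where "bst sb \<mu>1 (S @ S') v \<mu>" "length S' = cap * (L + 2)"
        "base_slp (S @ S') c" "v 28 = int k" "gen G (S @ S') k (2 ^ (L + 1 + D) * (1 + cap)) (\<lambda>q. \<Sum>j<cap. fX (q + hB j))"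
        unfolding hB_def by blast
      moreover have "eqx X v v1" by (rule eqx_trans[OF conjunct1[OF a] P(1)]) (auto simp: X_def)
      ultimately show "P6 v \<mu>" unfolding P6_def using P(4)
        by (intro conjI exI[of _ "S @ S'"] exI[of _ k]) simp_all
    next
      show "length S + cap * (L + 2) \<le> n" using nb P(4) unfolding c_def by linarith
    qed (auto simp: c_def)
  qed
  let ?R = "\<lambda>v \<mu>. eqx X v v1 \<and> (\<exists>S. \<mu> = put w sb (encode_slp S) \<mu>1 \<and> is_slp {0, 1} S \<and> length S = n \<and>
       gen G S (n - 1) N (\<lambda>q. \<Sum>j<cap. \<Sum>i<cap. G (q + 2 ^ (L + 1 + 2 * D) + hB j + hA i)))"
  have 7: "T W P6 (blk ([As 24 (V 11 \<boxminus> K 1)] @ emit (V 10 \<boxplus> K 2 \<boxtimes> V 6 \<boxplus> K 2) (V 28))) 110 ?R"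
  proof (rule T_blk)
    fix v \<mu> assume "P6 v \<mu>"
    then obtain S k where P: "eqx X v v1" "bst sb \<mu>1 S v \<mu>" "base_slp S c" "length S = c + 2 + 2 * (cap * (L + 2))"
      "v 28 = int k" "gen G S k (2 ^ (L + 1 + D) * (1 + cap)) (\<lambda>q. \<Sum>j<cap. fX (q + hB j))"
      by (auto simp: P6_def)
    have lS: "length S \<le> n - 1" using P(4) nb by (simp add: c_def)
    define S' where "S' = S @ replicate (n - 1 - length S) (Terminal 0)"
    have lS': "length S' = n - 1" using lS by (simp add: S'_def)
    have mu: "\<mu> = put w sb (encode_slp S') \<mu>1"
      unfolding S'_def by (rule bst_pad[OF P(2) lS zero])
    have v: "env v" "v 23 = sb" "v 11 = int n" "v 10 = int L" "v 6 = int D" using P(2) by (auto simp: bst_def env_def)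
    define v' where "v' = v(24 := int (n - 1))"
    have ni: "int n - 1 = int (n - 1)" using nb by simp
    have wn: "wrap W (int (n - 1)) = int (n - 1)" by (rule word) simp
    have e: "ev W (V 11 \<boxminus> K 1) v \<mu> = int (n - 1)"
      by (simp only: ev.simps binop_val.simps small_ge(1) v ni wn)
    have ev': "ev W (V 10 \<boxplus> K 2 \<boxtimes> V 6 \<boxplus> K 2) v' \<mu> = int (Suc c)" "ev W (V 28) v' \<mu> = int k" for \<mu>
      using v word[of "Suc c"] w2 nb P(5) by (simp_all add: c_def v'_def add.commute)
    have "env v'" using P(2) by (auto simp: bst_def env_def v'_def)
    have "wp W (emit (V 10 \<boxplus> K 2 \<boxtimes> V 6 \<boxplus> K 2) (V 28) @ []) ?R v' \<mu>"
    proof (subst wp_emit[where S = S' and ?\<mu>1.0 = \<mu>1])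
      have z: "gen G S (Suc c) (2 ^ c) (\<lambda>_. 0)" using base_slp_zeros[OF P(3)] by simp
      have "0 < length S" using P(4) by simp
      hence b': "base_slp S' c" unfolding S'_def base_slp_def
        using P(3) is_slp_replicate[of "{0, 1}" S 0] by (auto simp: base_slp_def rule_string_append)
      define S2 where "S2 = S' @ [Concat (Suc c) k]"
      have g: "gen G S' (Suc c) (2 ^ c) (\<lambda>_. 0)"
        "gen G S' k (2 ^ (L + 1 + D) * (1 + cap)) (\<lambda>q. \<Sum>j<cap. fX (q + hB j))"
        unfolding S'_def by (rule gen_append[OF z], rule gen_append[OF P(6)])
      have "gen G S2 (length S') N (\<lambda>q. \<Sum>j<cap. \<Sum>i<cap. G (q + 2 ^ (L + 1 + 2 * D) + hB j + hA i))"
        unfolding S2_def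
      proof (rule gen_Concat[OF g])
        have "2 ^ (L + 1 + D) * (1 + cap) = (2::nat) ^ (L + 1 + D) * 2 ^ D" using cap1 by simp
        also have "\<dots> = 2 ^ c" by (simp add: c_def power_add[symmetric])
        finally show "N = 2 ^ c + 2 ^ (L + 1 + D) * (1 + cap)"
          by (simp add: N_def \<nu>_def c_def)
      qed (simp_all add: fX_def c_def ac_simps)
      moreover have "is_slp {0, 1} S2" unfolding S2_def
        using base_slp_Concat[OF b'] g by (auto simp: gen_def base_slp_def)
      moreover have "eqx X (v'(24 := int (Suc (length S')))) v1" using P(1) by (simp add: v'_def X_def)
      moreover have "length S2 = n" using lS' nb by (simp add: S2_def)
      ultimately show "wp W [] ?R (v'(24 := int (Suc (length S')))) (put w sb (encode_slp (S' @ [Concat (Suc c) k])) \<mu>1)"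
        unfolding S2_def[symmetric] lS' by auto
      show "\<mu> = put w sb (encode_slp S') \<mu>1" by (rule mu)
      have "sb + 3 * int (n - 1) + 3 \<le> 2 ^ W" using assms(8) ni by linarith
      thus "sb + 3 * int (length S') + 3 \<le> 2 ^ W" unfolding lS' .
    qed (use v \<open>env v'\<close> sb0 ev' lS' in \<open>simp_all add: v'_def env_def\<close>)
    thus "wp W ([As 24 (V 11 \<boxminus> K 1)] @ emit (V 10 \<boxplus> K 2 \<boxtimes> V 6 \<boxplus> K 2) (V 28)) ?R v \<mu>"
      using e by (simp add: v'_def del: ev.simps)
  qed (simp add: emit_time)
  have eq: "cap * (L * 200 + 400) = 200 * (cap * (L + 2))" by (simp add: algebra_simps)
  have time: "30 + ((c * 123 + 33) + (10 + ((cap * (L * 200 + 400) + 20) + (20 + ((cap * (L * 200 + 400) + 20) + 110 + 1) + 1) + 1) + 1) + 1) + 1 \<le> n * 700"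
  proof -
    define e where "e = cap * (L + 2)"
    have "2 * e + L + 2 * D + 5 \<le> n" using nb(1) by (simp only: e_def)
    thus ?thesis unfolding eq c_def e_def[symmetric] by simp
  qed
  show ?thesis unfolding row_code_def
    by (rule T_Seq[OF 1 T_Seq[OF 2 T_Seq[OF 3 T_Seq[OF 4 T_Seq[OF 5 T_Seq[OF 6 7 order_refl] order_refl] order_refl] order_refl] order_refl] time])
qed

end


section \<open>Building the compressed vector\<close>

lemma put_upd: "\<not> (a \<le> z \<and> z < a + int (length xs)) \<Longrightarrow> (put w a xs \<mu>)(z := x) = put w a xs (\<mu>(z := x))"
  by (auto simp: put_def fun_eq_iff fun_upd_apply)

text \<open>The part of the vector below a trie node: a dyadic interval of length
  \<open>2 ^ l\<close>.\<close>

definition seg :: "(nat \<Rightarrow> int) \<Rightarrow> nat \<Rightarrow> nat \<Rightarrow> int list" where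
  "seg G l t = map G [t * 2 ^ l ..< (t + 1) * 2 ^ l]"

lemma seg_Suc: "seg G l (2 * t) @ seg G l (2 * t + 1) = seg G (Suc l) t"
proof -
  have 1: "[2 * t * 2 ^ l ..< (2 * t + 1) * 2 ^ l] @ [(2 * t + 1) * 2 ^ l ..< (2 * t + 1 + 1) * 2 ^ l] =
     [2 * t * 2 ^ l ..< (2 * t + 1 + 1) * 2 ^ l]"
    using upt_add_eq_append[of "2 * t * 2 ^ l" "(2 * t + 1) * 2 ^ l" "2 ^ l"] by (simp add: algebra_simps)
  have 2: "2 * t * 2 ^ l = t * 2 ^ Suc l" "(2 * t + 1 + 1) * 2 ^ l = (t + 1) * 2 ^ Suc l"
    by (simp_all add: algebra_simps)
  show ?thesis unfolding seg_def map_append[symmetric] 1 unfolding 2 ..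
qed

text \<open>Trie entries are stored relative to the number \<open>l + 1\<close> of the rule that generates a zero
  string of length \<open>2 ^ l\<close>, so that untouched memory represents an empty subtree.\<close>

definition node :: "(nat \<Rightarrow> int) \<Rightarrow> int slp \<Rightarrow> nat \<Rightarrow> nat \<Rightarrow> int \<Rightarrow> bool" where
  "node G S l t a \<longleftrightarrow> (\<exists>k. int k = a + int l + 1 \<and> k < length S \<and> rule_string S k = seg G l t)"

lemma node_append: "node G S l t a \<Longrightarrow> node G (S @ S') l t a"
  by (auto simp: node_def rule_string_append intro: trans_less_add1)

text \<open>The index in variable 30 runs over pairs of a slot of \<open>C\<close> and a carry, as
  quotient and remainder modulo 2. The position to be marked is the hash value minus the carry,
  modulo \<open>2 ^ L\<close>.\<close>

definition markS :: "stm list" where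
  "markS = [As 37 (Bi Shr (V 30) (K 1)), As 33 (cellE 4 21 37), As 32 (hashE 18 14 38 33),
     As 35 (Bi Mod (V 32 \<boxminus> Bi Mod (V 30) (K 2)) (V 38))]"

text \<open>For every level and every marked position the ancestor one level up is built from its
  two children. After \<open>emit\<close> the new rule has number \<open>V 24 - 1\<close>; relative
  to the zero rule \<open>V 36 + 2\<close> of the new level this is
  \<open>V 24 - V 36 - 3\<close>.\<close>

definition trie_code :: com where
  "trie_code = loop 36 (V 10) (loop 30 (V 7 \<boxplus> V 7) (blk (markS @ [As 35 (Bi Shr (V 35) (V 36 \<boxplus> K 1)),
     As 32 (Ld (V 34 \<boxplus> (V 36 \<boxtimes> V 38 \<boxplus> K 2 \<boxtimes> V 35)) \<boxplus> V 36 \<boxplus> K 1),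
     As 33 (Ld (V 34 \<boxplus> (V 36 \<boxtimes> V 38 \<boxplus> (K 2 \<boxtimes> V 35 \<boxplus> K 1))) \<boxplus> V 36 \<boxplus> K 1)] @ emit (V 32) (V 33) @
     [St (V 34 \<boxplus> ((V 36 \<boxplus> K 1) \<boxtimes> V 38 \<boxplus> V 35)) (V 24 \<boxminus> V 36 \<boxminus> K 3)])))"

definition vec_code :: com where
  "vec_code = Seq (blk [St (V 23 \<boxplus> K 1) (trimE (K 1)), As 24 (K 2)])
    (Seq (zeros (V 10))
    (Seq (loop 30 (V 7 \<boxplus> V 7) (blk (markS @ [St (V 34 \<boxplus> V 35) (K (- 1))])))
    (Seq trie_code
    (Seq (loop 31 (V 6 \<boxplus> V 6 \<boxplus> K 1) (blk (emit (V 24 \<boxminus> K 1) (V 24 \<boxminus> K 1))))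
    (blk ([As 35 (V 24 \<boxminus> K 1), As 24 (V 11 \<boxminus> K 1)] @ emit (V 35) (V 35)))))))"

locale vec_build = params +
  fixes v1 :: "nat \<Rightarrow> int" and \<mu>1 :: "int \<Rightarrow> int" and sb tb :: int and r3 :: nat
  assumes env1: "env v1" and v23: "v1 23 = sb" and v21: "v1 21 = int r3" and v34: "v1 34 = tb" and r3: "r3 < N"
    and sb: "8 * H \<le> sb" and sbtb: "sb + 3 * int n \<le> tb" and tb: "tb + H \<le> 2 ^ W"
    and zero: "\<And>z. sb \<le> z \<Longrightarrow> z < tb + H \<Longrightarrow> \<mu>1 z = 0"
    and cells: "\<And>j. j < cap \<Longrightarrow> 0 \<le> slot \<mu>1 4 r3 j \<and> slot \<mu>1 4 r3 j \<le> int U"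
begin

definition hC :: "nat \<Rightarrow> nat" where
  "hC j = hsh W L \<alpha>2 (slot \<mu>1 4 r3 j)"

definition y :: "nat \<Rightarrow> nat" where
  "y j = nat ((int (hC (j div 2)) - int (j mod 2)) mod 2 ^ L)"

definition G :: "nat \<Rightarrow> int" where
  "G x = (if \<exists>j<2 * cap. x mod 2 ^ L = y j then 1 else 0)"

abbreviation "X \<equiv> {24, 30, 31, 32, 33, 35, 36, 37 :: nat}"

lemma y_less: "y j < 2 ^ L" "int (y j) = (int (hC (j div 2)) - int (j mod 2)) mod 2 ^ L"
proof -
  show *: "int (y j) = (int (hC (j div 2)) - int (j mod 2)) mod 2 ^ L" by (simp add: y_def)
  have "int (y j) < 2 ^ L" unfolding * by simp
  thus "y j < 2 ^ L" by (metis of_nat_less_iff of_nat_numeral of_nat_power)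
qed

lemma G_periodic: "periodic G"
  by (simp add: periodic_def G_def)

lemma base_vars: "eqx X v v1 \<Longrightarrow> env v \<and> v 23 = sb \<and> v 21 = int r3 \<and> v 34 = tb"
  using env_eqx[OF env1, of X v] eqxD[of X v v1 23] eqxD[of X v v1 21] eqxD[of X v v1 34] v23 v21 v34 by auto

lemma trie_address:
  assumes "l \<le> L" "t < 2 ^ L"
  shows "0 \<le> int l * 2 ^ L + int t" "int l * 2 ^ L + int t < H" "0 \<le> int l * 2 ^ L" "int l * 2 ^ L < H"
proof -
  have "int t < 2 ^ L" using assms(2) by (metis of_nat_less_iff of_nat_numeral of_nat_power)
  moreover have "(int l + 1) * 2 ^ L \<le> (int L + 1) * 2 ^ L" using assms(1) by (intro mult_right_mono) auto
  hence "int l * 2 ^ L + 2 ^ L \<le> (int L + 1) * 2 ^ L" by (simp only: distrib_right mult_1)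
  moreover show "0 \<le> int l * 2 ^ L" by simp
  ultimately show "0 \<le> int l * 2 ^ L + int t" "int l * 2 ^ L + int t < H" "int l * 2 ^ L < H"
    using H_trie by linarith+
qed

lemma wrap_minus1: "wrap W (- 1) = - 1"
proof -
  have "(1::int) \<le> 2 ^ W" by (rule one_le_power) simp
  thus ?thesis by (intro wrap_id) (unfold okw_def, linarith)
qed

lemma tb_word: "0 \<le> x \<Longrightarrow> x < H \<Longrightarrow> wrap W (tb + x) = tb + x"
  using tb sbtb sb H_pos by (intro wrap_idI) linarith+


definition trie :: "(int \<Rightarrow> int) \<Rightarrow> (nat \<Rightarrow> nat \<Rightarrow> int) \<Rightarrow> bool" where
  "trie \<mu>' arr \<longleftrightarrow> (\<forall>z. \<not> (tb \<le> z \<and> z < tb + H) \<longrightarrow> \<mu>' z = \<mu>1 z) \<and>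
     (\<forall>l\<le>L. \<forall>t<2 ^ L. \<mu>' (tb + (int l * 2 ^ L + int t)) = arr l t)"

lemma trie_upd:
  assumes "trie \<mu>' arr" "l \<le> L" "t < 2 ^ L"
  shows "trie (\<mu>'(tb + (int l * 2 ^ L + int t) := x)) (arr(l := (arr l)(t := x)))"
  unfolding trie_def
proof (intro conjI allI impI)
  fix z assume "\<not> (tb \<le> z \<and> z < tb + H)"
  thus "(\<mu>'(tb + (int l * 2 ^ L + int t) := x)) z = \<mu>1 z"
    using assms(1) trie_address[OF assms(2,3)] by (auto simp: trie_def fun_upd_apply)
next
  fix l' t' :: nat assume lt: "l' \<le> L" "t' < 2 ^ L"
  have "l' = l \<and> t' = t" if "int l' * 2 ^ L + int t' = int l * 2 ^ L + int t"
  proof -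
    have "l' * 2 ^ L + t' = l * 2 ^ L + t" using that by (simp flip: of_nat_eq_iff[where 'a = int])
    hence "(l' * 2 ^ L + t') div 2 ^ L = (l * 2 ^ L + t) div 2 ^ L" "(l' * 2 ^ L + t') mod 2 ^ L = (l * 2 ^ L + t) mod 2 ^ L"
      by simp_all
    thus ?thesis using lt(2) assms(3) by simp
  qed
  thus "(\<mu>'(tb + (int l * 2 ^ L + int t) := x)) (tb + (int l' * 2 ^ L + int t')) = (arr(l := (arr l)(t := x))) l' t'"
    using assms(1) lt by (auto simp: trie_def fun_upd_apply)
qed

text \<open>The trie lies above the space reserved for the grammar, so its cells belong to the
  underlying memory and commute with the written rules.\<close>

lemma bst_trie_upd:
  assumes "bst sb \<mu>' S v \<mu>" "0 \<le> x"
  shows "bst sb (\<mu>'(tb + x := z)) S v (\<mu>(tb + x := z))"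
proof -
  have "\<not> (sb \<le> tb + x \<and> tb + x < sb + int (length (encode_slp S)))"
    using assms sbtb by (auto simp: bst_def)
  thus ?thesis using assms(1) put_upd by (auto simp: bst_def)
qed

lemma bst_trie_read:
  assumes "bst sb \<mu>' S v \<mu>" "0 \<le> x"
  shows "\<mu> (tb + x) = \<mu>' (tb + x)"
  using assms sbtb by (auto simp: bst_def put_def)

lemma wp_mark:
  assumes "bst sb \<mu>' S v \<mu>" "trie \<mu>' arr" "eqx X v v1" "v 30 = int j" "j < 2 * cap"
  shows "wp W (markS @ ss) Q v \<mu> = wp W ss Q (v(37 := int (j div 2), 33 := slot \<mu>1 4 r3 (j div 2),
     32 := int (hC (j div 2)), 35 := int (y j))) \<mu>"
proof -
  note b = base_vars[OF assms(3)]
  have jc: "j div 2 < cap" using assms(5) by simp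
  have cH: "int (j div 2) < 2 ^ D" "int j < 2 * 2 ^ D" using cap_less[OF jc] assms(5) by linarith+
  have "int (j div 2) \<le> int n" using jc n_bound(2) by linarith
  hence w1: "wrap W (drop_bit 1 (int j)) = int (j div 2)"
    using n_word[of "int (j div 2)"] by (simp add: drop_bit_eq_div zdiv_int)
  let ?v1 = "v(37 := int (j div 2))"
  have e1: "env ?v1" using b by simp
  have "ev W (cellE 4 21 37) ?v1 \<mu> = slot \<mu> 4 r3 (j div 2)"
    unfolding slot_def using b r3 cH e1 by (intro ev_cell) auto
  also have "\<dots> = slot \<mu>1 4 r3 (j div 2)"
  proof -
    have "4 * H + (int r3 * 2 ^ D + int (j div 2)) < sb"
      using bucket_bound[OF r3, of "int (j div 2)"] cH sb H_pos by linarith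
    thus ?thesis using assms(1,2) sbtb by (auto simp: bst_def put_def slot_def trie_def)
  qed
  finally have e2: "ev W (cellE 4 21 37) ?v1 \<mu> = slot \<mu>1 4 r3 (j div 2)" .
  let ?v2 = "?v1(33 := slot \<mu>1 4 r3 (j div 2))"
  have e3: "ev W (hashE 18 14 38 33) ?v2 \<mu> = int (hC (j div 2))"
    using ev_hash2[of ?v2 33 \<mu>] e1 by (simp add: hC_def)
  have hL: "int (hC (j div 2)) < 2 ^ L"
    unfolding hC_def by (metis hsh_less[OF L_W(1)] of_nat_less_iff of_nat_numeral of_nat_power)
  have "wrap W (int (hC (j div 2)) - int (j mod 2)) = int (hC (j div 2)) - int (j mod 2)"
  proof (rule wrap_id)
    have "int (j mod 2) \<le> 1" by linarith
    thus "okw W (int (hC (j div 2)) - int (j mod 2))"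
      using hL L_W(3) H_lt H_pos unfolding okw_def by (smt (verit) of_nat_0_le_iff)
  qed
  moreover have "wrap W (int (y j)) = int (y j)"
    using trie_address[of 0 "y j"] y_less(1)[of j] H_pos by (intro wrapH) auto
  moreover have "int j mod 2 = int (j mod 2)" "wrap W (int (j mod 2)) = int (j mod 2)"
    by (simp add: zmod_int) (rule small, simp, linarith)
  moreover have "v 38 = 2 ^ L" using b by (simp add: env_def)
  ultimately have e4: "ev W (Bi Mod (V 32 \<boxminus> Bi Mod (V 30) (K 2)) (V 38)) (?v2(32 := int (hC (j div 2)))) \<mu> = int (y j)"
    using assms(4) by (simp add: y_less(2)[symmetric])
  have e0: "ev W (Bi Shr (V 30) (K 1)) v \<mu> = int (j div 2)" using assms(4) w1 by simp
  show ?thesis unfolding markS_def append.simps wp.simps e0 e2 e3 e4 ..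
qed

text \<open>In relative numbering the entry -1 at level 0 denotes rule 0, the string of a single
  one, while an untouched 0 denotes rule 1, a single zero.\<close>

lemma marks:
  assumes "trie \<mu>' (\<lambda>_ _. 0)" "length S \<le> n"
  shows "T W (\<lambda>v \<mu>. eqx X v v1 \<and> bst sb \<mu>' S v \<mu>)
    (loop 30 (V 7 \<boxplus> V 7) (blk (markS @ [St (V 34 \<boxplus> V 35) (K (- 1))]))) (cap * 200 + 40)
    (\<lambda>v \<mu>. eqx X v v1 \<and> (\<exists>\<mu>'. bst sb \<mu>' S v \<mu> \<and>
       trie \<mu>' (\<lambda>l t. if l = 0 \<and> (\<exists>j<2 * cap. t = y j) then - 1 else 0)))"
proof -
  let ?arr = "\<lambda>j l t. if l = (0 :: nat) \<and> (\<exists>i<j. t = y i) then - 1 else 0 :: int"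
  let ?I = "\<lambda>j v \<mu>. eqx X v v1 \<and> (\<exists>\<mu>'. bst sb \<mu>' S v \<mu> \<and> trie \<mu>' (?arr j))"
  have "T W (?I 0) (loop 30 (V 7 \<boxplus> V 7) (blk (markS @ [St (V 34 \<boxplus> V 35) (K (- 1))]))) (cap * 200 + 40) (?I (2 * cap))"
  proof (rule T_loop[where I = ?I])
    fix j assume j: "j < 2 * cap"
    show "T W (\<lambda>v \<mu>. ?I j v \<mu> \<and> v 30 = int j) (blk (markS @ [St (V 34 \<boxplus> V 35) (K (- 1))])) 75 (\<lambda>v \<mu>. ?I (Suc j) v \<mu> \<and> v 30 = int j)"
    proof (rule T_blk)
      fix v \<mu> assume "?I j v \<mu> \<and> v 30 = int j"
      then obtain \<mu>'' where P: "eqx X v v1" "bst sb \<mu>'' S v \<mu>" "trie \<mu>'' (?arr j)" "v 30 = int j" by blast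
      let ?v = "v(37 := int (j div 2), 33 := slot \<mu>1 4 r3 (j div 2), 32 := int (hC (j div 2)), 35 := int (y j))"
      have yH: "0 \<le> int (y j)" "int (y j) < H" using trie_address[of 0 "y j"] y_less(1) by auto
      have e: "ev W (V 34 \<boxplus> V 35) ?v \<mu> = tb + int (y j)" "ev W (K (- 1)) ?v \<mu> = - 1"
        using base_vars[OF P(1)] tb_word[OF yH] by (simp_all add: wrap_minus1)
      have "(?arr j)(0 := (?arr j 0)(y j := - 1)) = ?arr (Suc j)"
        by (auto simp: fun_eq_iff fun_upd_apply less_Suc_eq)
      moreover have "trie (\<mu>''(tb + int (y j) := - 1)) ((?arr j)(0 := (?arr j 0)(y j := - 1)))"
        using trie_upd[OF P(3) le0 y_less(1)[of j], of "- 1"]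
        by (simp only: of_nat_0 mult_zero_left add_0)
      ultimately have "trie (\<mu>''(tb + int (y j) := - 1)) (?arr (Suc j))" by (simp only:)
      moreover have "bst sb (\<mu>''(tb + int (y j) := - 1)) S ?v (\<mu>(tb + int (y j) := - 1))"
        using bst_trie_upd[OF P(2) yH(1)] by simp
      moreover have "eqx X ?v v1" using P(1) by simp
      ultimately show "wp W (markS @ [St (V 34 \<boxplus> V 35) (K (- 1))]) (\<lambda>v \<mu>. ?I (Suc j) v \<mu> \<and> v 30 = int j) v \<mu>"
        unfolding wp_mark[OF P(2,3,1,4) j] wp.simps e using P(4) by auto
    qed (simp add: markS_def cellE_def hashE_def)
  next
    show "2 * cap < 2 ^ W"
    proof -
      have "2 * int cap \<le> int n"
      proof -
        have "cap * 1 \<le> cap * (L + 2)" by (intro mult_left_mono) auto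
        thus ?thesis using n_bound by linarith
      qed
      hence "2 * int cap < 2 ^ W" using n_W n_bound by linarith
      thus ?thesis by (metis of_nat_less_iff of_nat_mult of_nat_numeral of_nat_power)
    qed
    show "ev W (V 7 \<boxplus> V 7) v \<mu> = int (2 * cap)" if "?I j v \<mu>" for j v \<mu>
    proof -
      have "cap * 1 \<le> cap * (L + 2)" by (intro mult_left_mono) auto
      hence "2 * int cap \<le> int n" using n_bound by linarith
      thus ?thesis using that n_word[of "2 * int cap"] by (auto simp: bst_def env_def)
    qed
  qed (use W_16 in \<open>auto simp: loop_time_def algebra_simps\<close>)
  thus ?thesis by (rule T_weaken) (use assms in \<open>auto intro!: exI[of _ \<mu>']\<close>)
qed

text \<open>Level \<open>l\<close> is complete, level \<open>l + 1\<close> contains the ancestors of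
  the first \<open>j\<close> marked positions, and everything above is untouched. The last clause
  follows the most recent rule: at the top level it is the root, so the rule for a full period is
  found without reading the trie.\<close>

definition nodes :: "nat \<Rightarrow> nat \<Rightarrow> int slp \<Rightarrow> (nat \<Rightarrow> nat \<Rightarrow> int) \<Rightarrow> bool" where
  "nodes l j S arr \<longleftrightarrow> (\<forall>t<2 ^ (L - l). node G S l t (arr l t)) \<and>
     (\<forall>t. if \<exists>i<j. t = y i div 2 ^ Suc l then node G S (Suc l) t (arr (Suc l) t) else arr (Suc l) t = 0) \<and>
     (\<forall>l'>Suc l. \<forall>t. arr l' t = 0) \<and>
     (0 < j \<longrightarrow> rule_string S (length S - 1) = seg G (Suc l) (y (j - 1) div 2 ^ Suc l))"

lemma cap_pos: "0 < cap"
proof -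
  have "(2::nat) ^ 1 \<le> 2 ^ D" using D by (intro power_increasing) auto
  thus ?thesis unfolding cap_def by simp
qed

lemma seg_empty:
  assumes "base_slp S c" "l \<le> L" "L \<le> c" "t < 2 ^ (L - l)" "\<And>i. i < 2 * cap \<Longrightarrow> t \<noteq> y i div 2 ^ l"
  shows "node G S l t 0"
proof -
  have "G x = 0" if x: "t * 2 ^ l \<le> x" "x < (t + 1) * 2 ^ l" for x
  proof -
    have "(t + 1) * 2 ^ l \<le> 2 ^ (L - l) * 2 ^ l" using assms(4) by (intro mult_right_mono) auto
    hence "x < 2 ^ L" using x assms(2) by (simp add: power_add[symmetric] flip: power_add)
    moreover have "x div 2 ^ l = t" using x by (intro div_nat_eqI) (auto simp: algebra_simps)
    ultimately show ?thesis using assms(5) by (auto simp: G_def)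
  qed
  hence "seg G l t = replicate (2 ^ l) 0"
    unfolding seg_def by (intro replicate_eqI[symmetric, THEN sym]) (auto simp: algebra_simps)
  moreover have "rule_string S (Suc l) = replicate (2 ^ l) 0" "Suc l < length S"
    using assms(1-3) by (auto simp: base_slp_def)
  ultimately show ?thesis by (auto simp: node_def intro!: exI[of _ "Suc l"])
qed

lemma nodes_level0:
  assumes "base_slp S c"
  shows "nodes 0 0 S (\<lambda>l t. if l = 0 \<and> (\<exists>j<2 * cap. t = y j) then - 1 else 0)"
proof -
  have "node G S 0 t (if \<exists>j<2 * cap. t = y j then - 1 else 0)" if "t < 2 ^ L" for t
  proof -
    have s: "0 < length S" "Suc 0 < length S" "rule_string S 0 = [1]" "rule_string S (Suc 0) = [0]"
      using assms by (auto simp: base_slp_def)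
    have "seg G 0 t = [if \<exists>j<2 * cap. t = y j then 1 else 0]" using that by (simp add: seg_def G_def)
    thus ?thesis using s by (auto simp: node_def intro: exI[of _ 0] exI[of _ "Suc 0"])
  qed
  thus ?thesis by (simp add: nodes_def)
qed

lemma nodes_next_level:
  assumes "nodes l (2 * cap) S arr" "base_slp S L" "Suc l \<le> L"
  shows "nodes (Suc l) 0 S arr" "rule_string S (length S - 1) = seg G (Suc l) (y (2 * cap - 1) div 2 ^ Suc l)"
proof -
  have "node G S (Suc l) t (arr (Suc l) t)" if "t < 2 ^ (L - Suc l)" for t
  proof (cases "\<exists>i<2 * cap. t = y i div 2 ^ Suc l")
    case False
    hence "arr (Suc l) t = 0" using assms(1) by (auto simp: nodes_def)
    thus ?thesis using seg_empty[OF assms(2,3) _ that] False by auto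
  qed (use assms(1) in \<open>auto simp: nodes_def\<close>)
  thus "nodes (Suc l) 0 S arr" using assms(1) by (auto simp: nodes_def)
  show "rule_string S (length S - 1) = seg G (Suc l) (y (2 * cap - 1) div 2 ^ Suc l)"
    using assms(1) cap_pos unfolding nodes_def by simp
qed

lemma nodes_step:
  assumes "nodes l j S arr" "Suc l \<le> L" "j < 2 * cap" "t = y j div 2 ^ Suc l"
  obtains k1 k2 where "int k1 = arr l (2 * t) + int l + 1" "int k2 = arr l (2 * t + 1) + int l + 1"
    "k1 < length S" "k2 < length S" "2 * t + 1 < 2 ^ L" "t < 2 ^ L"
    "nodes l (Suc j) (S @ [Concat k1 k2]) (arr(Suc l := (arr (Suc l))(t := int (length S) - int l - 2)))"
proof -
  have "2 ^ (L - Suc l) * 2 ^ Suc l = (2::nat) ^ L" using assms(2) by (simp only: power_add[symmetric] le_add_diff_inverse2)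
  hence "y j < 2 ^ (L - Suc l) * 2 ^ Suc l" using y_less(1)[of j] by (simp only:)
  hence t: "t < 2 ^ (L - Suc l)" unfolding assms(4) by (rule less_mult_imp_div_less)
  have "(2::nat) ^ (L - l) = 2 * 2 ^ (L - Suc l)" using assms(2) by (simp flip: power_Suc add: Suc_diff_Suc)
  hence t2: "2 * t < 2 ^ (L - l)" "2 * t + 1 < 2 ^ (L - l)" using t by linarith+
  have pl: "(2::nat) ^ (L - l) \<le> 2 ^ L" by (intro power_increasing) auto
  obtain k1 where k1: "int k1 = arr l (2 * t) + int l + 1" "k1 < length S" "rule_string S k1 = seg G l (2 * t)"
    using assms(1) t2(1) by (auto simp: nodes_def node_def)
  obtain k2 where k2: "int k2 = arr l (2 * t + 1) + int l + 1" "k2 < length S" "rule_string S k2 = seg G l (2 * t + 1)"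
    using assms(1) t2(2) by (auto simp: nodes_def node_def)
  let ?S = "S @ [Concat k1 k2]" and ?arr = "arr(Suc l := (arr (Suc l))(t := int (length S) - int l - 2))"
  have s: "rule_string ?S (length S) = seg G (Suc l) t"
    using k1 k2 seg_Suc by (simp add: rule_string_Concat)
  have nt: "node G ?S (Suc l) t (int (length S) - int l - 2)"
    unfolding node_def using s by (intro exI[of _ "length S"]) simp
  have "nodes l (Suc j) ?S ?arr"
    unfolding nodes_def
  proof (intro conjI allI impI)
    fix t' :: nat assume "t' < 2 ^ (L - l)"
    thus "node G ?S l t' (?arr l t')" using assms(1) node_append by (simp add: nodes_def)
  next
    fix t' :: nat
    show "if \<exists>i<Suc j. t' = y i div 2 ^ Suc l then node G ?S (Suc l) t' (?arr (Suc l) t') else ?arr (Suc l) t' = 0"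
    proof (cases "t' = t")
      case True
      thus ?thesis using nt assms(4) by auto
    next
      case False
      hence "(\<exists>i<Suc j. t' = y i div 2 ^ Suc l) \<longleftrightarrow> (\<exists>i<j. t' = y i div 2 ^ Suc l)"
        using assms(4) less_Suc_eq by metis
      thus ?thesis using assms(1) False node_append by (simp add: nodes_def)
    qed
  qed (use assms(1,4) s in \<open>auto simp: nodes_def\<close>)
  thus ?thesis using that k1 k2 t2 pl by simp
qed

text \<open>Only \<open>2 * cap\<close> positions are marked, so the trie costs
  \<open>2 * cap\<close> rules per level instead of one per leaf. A node is rebuilt for each marked
  position below it; the repetition keeps the number of rules fixed.\<close>

lemma trie_code:
  "T W (\<lambda>v \<mu>. eqx X v v1 \<and> (\<exists>S \<mu>'. bst sb \<mu>' S v \<mu> \<and> base_slp S L \<and> length S = L + 2 \<and>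
       trie \<mu>' (\<lambda>l t. if l = 0 \<and> (\<exists>j<2 * cap. t = y j) then - 1 else 0)))
     trie_code (L * (cap * 600 + 60) + 20)
     (\<lambda>v \<mu>. eqx X v v1 \<and> (\<exists>S \<mu>' arr. bst sb \<mu>' S v \<mu> \<and> base_slp S L \<and> length S = L + 2 + L * (2 * cap) \<and>
       trie \<mu>' arr \<and> rule_string S (length S - 1) = seg G L 0))"
proof -
  let ?K = "\<lambda>l j v \<mu>. eqx X v v1 \<and> (\<exists>S \<mu>' arr. bst sb \<mu>' S v \<mu> \<and> base_slp S L \<and>
      length S = L + 2 + l * (2 * cap) + j \<and> trie \<mu>' arr \<and> nodes l j S arr)"
  let ?J = "\<lambda>l v \<mu>. ?K l 0 v \<mu>"
  let ?I = "\<lambda>l v \<mu>. eqx X v v1 \<and> (\<exists>S \<mu>' arr. bst sb \<mu>' S v \<mu> \<and> base_slp S L \<and>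
      length S = L + 2 + l * (2 * cap) \<and> trie \<mu>' arr \<and> nodes l 0 S arr \<and>
      (l = L \<longrightarrow> rule_string S (length S - 1) = seg G L 0))"
  let ?c = "[As 35 (Bi Shr (V 35) (V 36 \<boxplus> K 1)),
     As 32 (Ld (V 34 \<boxplus> (V 36 \<boxtimes> V 38 \<boxplus> K 2 \<boxtimes> V 35)) \<boxplus> V 36 \<boxplus> K 1),
     As 33 (Ld (V 34 \<boxplus> (V 36 \<boxtimes> V 38 \<boxplus> (K 2 \<boxtimes> V 35 \<boxplus> K 1))) \<boxplus> V 36 \<boxplus> K 1)] @ emit (V 32) (V 33) @
     [St (V 34 \<boxplus> ((V 36 \<boxplus> K 1) \<boxtimes> V 38 \<boxplus> V 35)) (V 24 \<boxminus> V 36 \<boxminus> K 3)]"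
  have capn: "2 * cap \<le> n"
  proof -
    have "cap * 1 \<le> cap * (L + 2)" by (intro mult_left_mono) auto
    thus ?thesis using n_bound by linarith
  qed
  have word: "wrap W (int x) = int x" if "x \<le> n" for x using that by (intro n_word) auto
  have cw: "2 * cap < 2 ^ W"
  proof -
    have "int (2 * cap) < 2 ^ W" using capn n_W n_bound by linarith
    thus ?thesis by (metis of_nat_less_iff of_nat_numeral of_nat_power)
  qed
  have inner: "T W (\<lambda>v \<mu>. ?K l j v \<mu> \<and> v 36 = int l \<and> v 30 = int j) (blk (markS @ ?c)) 270
      (\<lambda>v \<mu>. (?K l (Suc j) v \<mu> \<and> v 36 = int l) \<and> v 30 = int j)" if l: "l < L" and j: "j < 2 * cap" for l j
  proof (rule T_blk)
    fix v \<mu> assume "?K l j v \<mu> \<and> v 36 = int l \<and> v 30 = int j"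
    then obtain S \<mu>' arr where P: "eqx X v v1" "bst sb \<mu>' S v \<mu>" "base_slp S L"
      "length S = L + 2 + l * (2 * cap) + j" "trie \<mu>' arr" "nodes l j S arr" "v 36 = int l" "v 30 = int j" by blast
    define t where "t = y j div 2 ^ Suc l"
    obtain k1 k2 where k: "int k1 = arr l (2 * t) + int l + 1" "int k2 = arr l (2 * t + 1) + int l + 1"
      "k1 < length S" "k2 < length S" "2 * t + 1 < 2 ^ L" "t < 2 ^ L"
      "nodes l (Suc j) (S @ [Concat k1 k2]) (arr(Suc l := (arr (Suc l))(t := int (length S) - int l - 2)))"
      by (rule nodes_step[OF P(6) _ j t_def]) (use l in auto)
    have "(l + 1) * (2 * cap) \<le> L * (2 * cap)" using l by (intro mult_right_mono) auto
    also have "\<dots> \<le> 2 * (cap * (L + 2))" by (simp add: algebra_simps)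
    finally have len: "length S < n" using P(4) j n_bound(1) by simp
    note b = base_vars[OF P(1)]
    have v38: "v 38 = 2 ^ L" "v 34 = tb" using b by (auto simp: env_def)
    let ?v0 = "v(37 := int (j div 2), 33 := slot \<mu>1 4 r3 (j div 2), 32 := int (hC (j div 2)), 35 := int (y j))"
    have w36: "wrap W (int l + 1) = int (Suc l)" using word[of "Suc l"] l n_bound by (simp add: add.commute)
    have tH: "0 \<le> int t" "int t < H" using trie_address[of 0 t] k(6) by auto
    have e35: "ev W (Bi Shr (V 35) (V 36 \<boxplus> K 1)) ?v0 \<mu> = int t"
    proof -
      have "int (y j) div 2 ^ Suc l = int t" by (simp add: t_def zdiv_int)
      thus ?thesis using P(7) w36 tH H_pos by (simp add: drop_bit_eq_div wrapH del: of_nat_Suc power_Suc)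
    qed
    let ?v1 = "?v0(35 := int t)"
    have rd: "\<mu> (tb + (int l * 2 ^ L + int x)) = arr l x" if "x < 2 ^ L" for x
      using bst_trie_read[OF P(2), of "int l * 2 ^ L + int x"] P(5) trie_address[of l x] l that
      by (auto simp: trie_def)
    have wd: "wrap W (tb + (int l * 2 ^ L + int x)) = tb + (int l * 2 ^ L + int x)" if "x < 2 ^ L" for x
      using trie_address[of l x] l that by (intro tb_word) auto
    have t2: "2 * t < 2 ^ L" using k(5) by simp
    have ek: "wrap W (arr l (2 * t) + int l + 1) = int k1" "wrap W (arr l (2 * t + 1) + int l + 1) = int k2"
      unfolding k(1,2)[symmetric] using k(3,4) len by (auto intro: word)
    have e32: "ev W (Ld (V 34 \<boxplus> (V 36 \<boxtimes> V 38 \<boxplus> K 2 \<boxtimes> V 35)) \<boxplus> V 36 \<boxplus> K 1) ?v1 \<mu> = int k1"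
      using P(7) v38 rd[OF t2] wd[OF t2] ek(1) by (simp add: wrap_ring)
    let ?v2 = "?v1(32 := int k1)"
    have e33: "ev W (Ld (V 34 \<boxplus> (V 36 \<boxtimes> V 38 \<boxplus> (K 2 \<boxtimes> V 35 \<boxplus> K 1))) \<boxplus> V 36 \<boxplus> K 1) ?v2 \<mu> = int k2"
    proof -
      have "int (2 * t + 1) = 2 * int t + 1" by simp
      thus ?thesis using P(7) v38 rd[OF k(5)] wd[OF k(5)] ek(2) by (simp only:) (simp add: wrap_ring)
    qed
    let ?v3 = "?v2(33 := int k2)"
    have b3: "bst sb \<mu>' S ?v3 \<mu>" using P(2) by simp
    have "wp W (emit (V 32) (V 33) @ [St (V 34 \<boxplus> ((V 36 \<boxplus> K 1) \<boxtimes> V 38 \<boxplus> V 35)) (V 24 \<boxminus> V 36 \<boxminus> K 3)])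
       (\<lambda>v \<mu>. (?K l (Suc j) v \<mu> \<and> v 36 = int l) \<and> v 30 = int j) ?v3 \<mu>"
    proof (rule wp_emit_bst[OF b3 len])
      fix v4 \<mu>4 assume v4: "v4 = ?v3(24 := int (Suc (length S)))" "bst sb \<mu>' (S @ [Concat k1 k2]) v4 \<mu>4"
      have ad: "0 \<le> int (Suc l) * 2 ^ L + int t" "int (Suc l) * 2 ^ L + int t < H"
        using trie_address[of "Suc l" t] l k(6) by auto
      have ea: "ev W (V 34 \<boxplus> ((V 36 \<boxplus> K 1) \<boxtimes> V 38 \<boxplus> V 35)) v4 \<mu>4 = tb + (int (Suc l) * 2 ^ L + int t)"
      proof -
        have "wrap W (tb + ((int l + 1) * 2 ^ L + int t)) = tb + ((int l + 1) * 2 ^ L + int t)"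
          using tb_word[OF ad] by (simp add: add.commute)
        thus ?thesis using P(7) v38 by (simp add: v4(1) wrap_ring add.commute)
      qed
      have eb: "ev W (V 24 \<boxminus> V 36 \<boxminus> K 3) v4 \<mu>4 = int (length S) - int l - 2"
      proof -
        have "wrap W (int (length S) - int l - 2) = int (length S) - int l - 2"
        proof -
          have "l + 2 \<le> length S" unfolding P(4) using l by linarith
          thus ?thesis using len by (intro n_word) linarith+
        qed
        thus ?thesis using P(7) by (simp add: v4(1) wrap_ring)
      qed
      have "trie (\<mu>'(tb + (int (Suc l) * 2 ^ L + int t) := int (length S) - int l - 2))
         (arr(Suc l := (arr (Suc l))(t := int (length S) - int l - 2)))"
        by (rule trie_upd[OF P(5) _ k(6)]) (use l in auto)
      moreover have "bst sb (\<mu>'(tb + (int (Suc l) * 2 ^ L + int t) := int (length S) - int l - 2)) (S @ [Concat k1 k2]) v4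
         (\<mu>4(tb + (int (Suc l) * 2 ^ L + int t) := int (length S) - int l - 2))"
        by (rule bst_trie_upd[OF v4(2) ad(1)])
      moreover have "base_slp (S @ [Concat k1 k2]) L" by (rule base_slp_Concat[OF P(3) k(3,4)])
      moreover have "eqx X v4 v1" using P(1) by (simp add: v4(1))
      moreover have "length (S @ [Concat k1 k2]) = L + 2 + l * (2 * cap) + Suc j" "v4 36 = int l" "v4 30 = int j"
        using P(4,7,8) by (simp_all add: v4(1))
      ultimately show "wp W [St (V 34 \<boxplus> ((V 36 \<boxplus> K 1) \<boxtimes> V 38 \<boxplus> V 35)) (V 24 \<boxminus> V 36 \<boxminus> K 3)]
         (\<lambda>v \<mu>. (?K l (Suc j) v \<mu> \<and> v 36 = int l) \<and> v 30 = int j) v4 \<mu>4"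
        unfolding wp.simps ea eb using k(7) by blast
    qed simp_all
    thus "wp W (markS @ ?c) (\<lambda>v \<mu>. (?K l (Suc j) v \<mu> \<and> v 36 = int l) \<and> v 30 = int j) v \<mu>"
      unfolding wp_mark[OF P(2,5,1,8) j] append.simps wp.simps e35 e32 e33 .
  qed (simp add: markS_def cellE_def hashE_def blk_time_append emit_time)
  have level: "T W (\<lambda>v \<mu>. ?J l v \<mu> \<and> v 36 = int l) (loop 30 (V 7 \<boxplus> V 7) (blk (markS @ ?c))) (cap * 600 + 35)
      (\<lambda>v \<mu>. ?K l (2 * cap) v \<mu> \<and> v 36 = int l)" if l: "l < L" for l
  proof (rule T_loop[where I = "\<lambda>j v \<mu>. ?K l j v \<mu> \<and> v 36 = int l"])
    show "T W (\<lambda>v \<mu>. (?K l j v \<mu> \<and> v 36 = int l) \<and> v 30 = int j) (blk (markS @ ?c)) 270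
      (\<lambda>v \<mu>. (?K l (Suc j) v \<mu> \<and> v 36 = int l) \<and> v 30 = int j)" if "j < 2 * cap" for j
      by (rule T_weaken[OF inner[OF l that]]) auto
    show "ev W (V 7 \<boxplus> V 7) v \<mu> = int (2 * cap)" if "?K l j v \<mu> \<and> v 36 = int l" for j v \<mu>
      using that word[OF capn] by (auto simp: bst_def env_def)
  qed (use cw W_16 in \<open>auto simp: loop_time_def algebra_simps\<close>)
  have "T W (?I 0) trie_code (L * (cap * 600 + 60) + 20) (?I L)"
    unfolding trie_code_def
  proof (rule T_loop[where I = ?I])
    fix l assume l: "l < L"
    show "T W (\<lambda>v \<mu>. ?I l v \<mu> \<and> v 36 = int l) (loop 30 (V 7 \<boxplus> V 7) (blk (markS @ ?c))) (cap * 600 + 35)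
      (\<lambda>v \<mu>. ?I (Suc l) v \<mu> \<and> v 36 = int l)"
    proof (rule T_weaken[OF level[OF l]])
      fix v \<mu> assume "?K l (2 * cap) v \<mu> \<and> v 36 = int l"
      then obtain S \<mu>' arr where P: "eqx X v v1" "bst sb \<mu>' S v \<mu>" "base_slp S L"
        "length S = L + 2 + l * (2 * cap) + 2 * cap" "trie \<mu>' arr" "nodes l (2 * cap) S arr" "v 36 = int l" by blast
      note nl = nodes_next_level[OF P(6,3) Suc_leI[OF l]]
      \<comment> \<open>All positions are below \<open>2 ^ L\<close>, so every one has the root as
        its ancestor at level \<open>L\<close>.\<close>
      have "Suc l = L \<longrightarrow> rule_string S (length S - 1) = seg G L 0"
        using nl(2) y_less(1)[of "2 * cap - 1"] by auto
      thus "?I (Suc l) v \<mu> \<and> v 36 = int l" using P nl(1)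
        by (intro conjI exI[of _ S] exI[of _ \<mu>'] exI[of _ arr]) auto
    qed auto
  next
    show "ev W (V 10) v \<mu> = int L" if "?I l v \<mu>" for l v \<mu>
      using that by (auto simp: bst_def env_def)
    show "L < 2 ^ W" using \<nu>_W less_exp[of W] unfolding \<nu>_def by linarith
  qed (use W_16 in \<open>auto simp: loop_time_def algebra_simps\<close>)
  thus ?thesis
  proof (rule T_weaken)
    fix v \<mu> assume "eqx X v v1 \<and> (\<exists>S \<mu>'. bst sb \<mu>' S v \<mu> \<and> base_slp S L \<and> length S = L + 2 \<and>
       trie \<mu>' (\<lambda>l t. if l = 0 \<and> (\<exists>j<2 * cap. t = y j) then - 1 else 0))"
    thus "?I 0 v \<mu>" using nodes_level0 L by fastforce
  qed auto
qed



lemma map_periodic: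
  assumes "L \<le> i"
  shows "map G [0..<2 ^ i] @ map G [0..<2 ^ i] = map G [0..<2 ^ Suc i]"
proof -
  have "G (x + 2 ^ i) = G x" for x
    using G_periodic assms unfolding periodic_def by (metis le_add_diff_inverse power_add)
  moreover have "[0..<2 ^ Suc i] = [0..<2 ^ i] @ map (\<lambda>x. x + 2 ^ i) [0..<2 ^ i]"
  proof -
    have "[0..<2 ^ Suc i] = [0..<2 ^ i + 2 ^ i]" by (simp add: mult_2)
    also have "\<dots> = [0..<2 ^ i] @ [2 ^ i..<2 ^ i + 2 ^ i]" by (rule upt_add_eq_append) simp
    also have "[2 ^ i..<2 ^ i + 2 ^ i] = map (\<lambda>x. x + 2 ^ i) [0..<2 ^ i]" by (simp only: map_add_upt)
    finally show ?thesis .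
  qed
  ultimately show ?thesis by (simp add: comp_def del: power_Suc)
qed

text \<open>One doubling short of \<open>N\<close>: from \<open>L\<close> to
  \<open>L + 2 * D + 1\<close> instead of \<open>\<nu> = L + 2 * D + 2\<close>. The last doubling is
  rule \<open>n - 1\<close>, after the padding.\<close>

lemma doubling:
  "T W (\<lambda>v \<mu>. eqx X v v1 \<and> (\<exists>S \<mu>' arr. bst sb \<mu>' S v \<mu> \<and> base_slp S L \<and> length S = L + 2 + L * (2 * cap) \<and>
       trie \<mu>' arr \<and> rule_string S (length S - 1) = seg G L 0))
    (loop 31 (V 6 \<boxplus> V 6 \<boxplus> K 1) (blk (emit (V 24 \<boxminus> K 1) (V 24 \<boxminus> K 1)))) (D * 250 + 200)
    (\<lambda>v \<mu>. eqx X v v1 \<and> (\<exists>S \<mu>' arr. bst sb \<mu>' S v \<mu> \<and> base_slp S L \<and>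
       length S = L + 2 + L * (2 * cap) + (2 * D + 1) \<and>
       trie \<mu>' arr \<and> rule_string S (length S - 1) = map G [0..<2 ^ (L + (2 * D + 1))]))"
proof -
  let ?I = "\<lambda>i v \<mu>. eqx X v v1 \<and> (\<exists>S \<mu>' arr. bst sb \<mu>' S v \<mu> \<and> base_slp S L \<and>
       length S = L + 2 + L * (2 * cap) + i \<and>
       trie \<mu>' arr \<and> rule_string S (length S - 1) = map G [0..<2 ^ (L + i)])"
  have nb: "L + 2 + L * (2 * cap) + (2 * D + 1) < n"
  proof -
    have "L * (2 * cap) \<le> 2 * (cap * (L + 2))" by (simp add: algebra_simps)
    thus ?thesis using n_bound(1) by linarith
  qed
  have word: "wrap W (int x) = int x" if "x \<le> n" for x using that by (intro n_word) auto
  have "T W (?I 0) (loop 31 (V 6 \<boxplus> V 6 \<boxplus> K 1) (blk (emit (V 24 \<boxminus> K 1) (V 24 \<boxminus> K 1)))) (D * 250 + 200) (?I (2 * D + 1))"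
  proof (rule T_loop[where I = ?I])
    fix i assume i: "i < 2 * D + 1"
    show "T W (\<lambda>v \<mu>. ?I i v \<mu> \<and> v 31 = int i) (blk (emit (V 24 \<boxminus> K 1) (V 24 \<boxminus> K 1))) 90
       (\<lambda>v \<mu>. ?I (Suc i) v \<mu> \<and> v 31 = int i)"
    proof (rule T_blk)
      fix v \<mu> assume "?I i v \<mu> \<and> v 31 = int i"
      then obtain S \<mu>' arr where P: "eqx X v v1" "bst sb \<mu>' S v \<mu>" "base_slp S L"
       "length S = L + 2 + L * (2 * cap) + i" "trie \<mu>' arr" "rule_string S (length S - 1) = map G [0..<2 ^ (L + i)]"
       "v 31 = int i" by blast
      have len: "length S < n" "0 < length S" using P(4) nb i by linarith+
      have ni: "int (length S) - 1 = int (length S - 1)"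
        by (metis One_nat_def Suc_leI len(2) of_nat_1 of_nat_diff)
      have wn: "wrap W (int (length S - 1)) = int (length S - 1)" by (rule word) (use len in linarith)
      have v24: "v 24 = int (length S)" using P(2) by (simp add: bst_def)
      have ev: "ev W (V 24 \<boxminus> K 1) v \<mu> = int (length S - 1)" for \<mu>
        by (simp only: ev.simps binop_val.simps small_ge(1) v24 ni wn)
      have lt: "length S - 1 < length S" using len by simp
      define S2 where "S2 = S @ [Concat (length S - 1) (length S - 1)]"
      have "rule_string S2 (length S) = map G [0..<2 ^ (L + Suc i)]"
        unfolding S2_def using rule_string_Concat[OF lt lt] P(6) map_periodic[of "L + i"] by (simp del: power_Suc)
      hence S2: "rule_string S2 (length S2 - 1) = map G [0..<2 ^ (L + Suc i)]"
        "length S2 = L + 2 + L * (2 * cap) + Suc i" "base_slp S2 L"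
        using P(4) base_slp_Concat[OF P(3) lt lt] by (simp_all add: S2_def del: power_Suc)
      have "wp W (emit (V 24 \<boxminus> K 1) (V 24 \<boxminus> K 1) @ []) (\<lambda>v \<mu>. ?I (Suc i) v \<mu> \<and> v 31 = int i) v \<mu>"
      proof (rule wp_emit_bst[OF P(2) len(1) ev ev])
        fix v' \<mu>'' assume v': "v' = v(24 := int (Suc (length S)))"
          "bst sb \<mu>' (S @ [Concat (length S - 1) (length S - 1)]) v' \<mu>''"
        have "eqx X v' v1" "v' 31 = int i" using P(1,7) by (simp_all add: v'(1))
        thus "wp W [] (\<lambda>v \<mu>. ?I (Suc i) v \<mu> \<and> v 31 = int i) v' \<mu>''"
          using v'(2)[folded S2_def] S2 P(5) unfolding wp.simps by blast
      qed
      thus "wp W (emit (V 24 \<boxminus> K 1) (V 24 \<boxminus> K 1)) (\<lambda>v \<mu>. ?I (Suc i) v \<mu> \<and> v 31 = int i) v \<mu>" by simp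
    qed (simp add: emit_time)
  next
    show "2 * D + 1 < 2 ^ W" using \<nu>_W less_exp[of W] unfolding \<nu>_def by linarith
    show "ev W (V 6 \<boxplus> V 6 \<boxplus> K 1) v \<mu> = int (2 * D + 1)" if "?I i v \<mu>" for i v \<mu>
    proof -
      have "v 6 = int D" using that by (auto simp: bst_def env_def)
      thus ?thesis using word[of "2 * D + 1"] nb by (simp add: wrap_ring add.commute)
    qed
  qed (use W_16 in \<open>auto simp: loop_time_def\<close>)
  thus ?thesis by (rule T_weaken) (auto simp: seg_def)
qed

lemma T_vec:
  "T W (\<lambda>v \<mu>. v = v1 \<and> \<mu> = \<mu>1) vec_code (n * 700)
    (\<lambda>v \<mu>. eqx X v v1 \<and> (\<exists>S. is_slp {0, 1} S \<and> length S = n \<and> slp_string S = map G [0..<N] \<and>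
       (\<forall>z<tb. \<mu> z = put w sb (encode_slp S) \<mu>1 z) \<and> (\<forall>z\<ge>tb + H. \<mu> z = \<mu>1 z)))"
proof -
  note nb = n_bound
  have sb0: "0 \<le> sb" "sb + 3 * int n \<le> 2 ^ W" using sb sbtb tb H_pos by linarith+
  have word: "wrap W (int x) = int x" if "x \<le> n" for x using that by (intro n_word) auto
  have zero1: "\<mu>1 z = 0" if "sb \<le> z" "z < sb + 3 * int n" for z using zero[of z] that sbtb H_pos by auto
  have trie0: "trie \<mu>1 (\<lambda>_ _. 0)"
  proof -
    have "\<mu>1 (tb + (int l * 2 ^ L + int t)) = 0" if "l \<le> L" "t < 2 ^ L" for l t
      using trie_address(1,2)[OF that] sbtb sb0 by (intro zero) linarith+
    thus ?thesis by (simp add: trie_def)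
  qed
  let ?S0 = "[Terminal 1, Terminal 0] :: int slp"
  define P1 where "P1 v \<mu> \<longleftrightarrow> eqx X v v1 \<and> bst sb \<mu>1 ?S0 v \<mu>" for v \<mu>
  have 1: "T W (\<lambda>v \<mu>. v = v1 \<and> \<mu> = \<mu>1) (blk [St (V 23 \<boxplus> K 1) (trimE (K 1)), As 24 (K 2)]) 30 P1"
    by (rule T_weaken[OF T_init[OF env1 v23 sb0 zero1]]) (auto simp: P1_def eqx_def)
  define P2 where "P2 v \<mu> \<longleftrightarrow> eqx X v v1 \<and> (\<exists>S. bst sb \<mu>1 S v \<mu> \<and> base_slp S L \<and> length S = L + 2)" for v \<mu>
  have 2: "T W P1 (zeros (V 10)) (L * 111 + 21) P2"
  proof (rule T_exact)
    fix v0 \<mu>0 assume "P1 v0 \<mu>0"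
    hence P: "eqx X v0 v1" "bst sb \<mu>1 ?S0 v0 \<mu>0" by (auto simp: P1_def)
    show "T W (\<lambda>v \<mu>. v = v0 \<and> \<mu> = \<mu>0) (zeros (V 10)) (L * 111 + 21) P2"
    proof (rule T_weaken[OF T_zeros[OF P(2), of L]])
      show "ev W (V 10) v \<mu> = int L" if "eqx {24, 31} v v0" for v \<mu>
        using eqxD[OF that, of 10] P(2) by (simp add: bst_def env_def)
      show "P2 v \<mu>" if "eqx {24, 31} v v0 \<and> (\<exists>S. bst sb \<mu>1 S v \<mu> \<and> base_slp S L \<and> length S = L + 2)" for v \<mu>
        using that eqx_trans[of "{24, 31}" v v0 X v1 X] P(1) by (auto simp: P2_def)
    qed (use nb in auto)
  qed
  define P3 where "P3 v \<mu> \<longleftrightarrow> eqx X v v1 \<and> (\<exists>S \<mu>'. bst sb \<mu>' S v \<mu> \<and> base_slp S L \<and> length S = L + 2 \<and>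
       trie \<mu>' (\<lambda>l t. if l = 0 \<and> (\<exists>j<2 * cap. t = y j) then - 1 else 0))" for v \<mu>
  have 3: "T W P2 (loop 30 (V 7 \<boxplus> V 7) (blk (markS @ [St (V 34 \<boxplus> V 35) (K (- 1))]))) (cap * 200 + 40) P3"
  proof (rule T_exact)
    fix v0 \<mu>0 assume "P2 v0 \<mu>0"
    then obtain S where S: "eqx X v0 v1" "bst sb \<mu>1 S v0 \<mu>0" "base_slp S L" "length S = L + 2" by (auto simp: P2_def)
    show "T W (\<lambda>v \<mu>. v = v0 \<and> \<mu> = \<mu>0) (loop 30 (V 7 \<boxplus> V 7) (blk (markS @ [St (V 34 \<boxplus> V 35) (K (- 1))]))) (cap * 200 + 40) P3"
      by (rule T_weaken[OF marks[OF trie0, of S]]) (use S nb in \<open>auto simp: P3_def\<close>)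
  qed
  define P6 where "P6 v \<mu> \<longleftrightarrow> eqx X v v1 \<and> (\<exists>S \<mu>' arr. bst sb \<mu>' S v \<mu> \<and> base_slp S L \<and>
       length S = L + 2 + L * (2 * cap) + (2 * D + 1) \<and>
       trie \<mu>' arr \<and> rule_string S (length S - 1) = map G [0..<2 ^ (L + (2 * D + 1))])" for v \<mu>
  let ?R = "\<lambda>v \<mu>. eqx X v v1 \<and> (\<exists>S. is_slp {0, 1} S \<and> length S = n \<and> slp_string S = map G [0..<N] \<and>
       (\<forall>z<tb. \<mu> z = put w sb (encode_slp S) \<mu>1 z) \<and> (\<forall>z\<ge>tb + H. \<mu> z = \<mu>1 z))"
  have 6: "T W P6 (blk ([As 35 (V 24 \<boxminus> K 1), As 24 (V 11 \<boxminus> K 1)] @ emit (V 35) (V 35))) 120 ?R"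
  proof (rule T_blk)
    fix v \<mu> assume "P6 v \<mu>"
    then obtain S \<mu>' arr where P: "eqx X v v1" "bst sb \<mu>' S v \<mu>" "base_slp S L"
       "length S = L + 2 + L * (2 * cap) + (2 * D + 1)" "trie \<mu>' arr"
       "rule_string S (length S - 1) = map G [0..<2 ^ (L + (2 * D + 1))]" by (auto simp: P6_def)
    have lS: "length S \<le> n - 1"
    proof -
      have "L * (2 * cap) \<le> 2 * (cap * (L + 2))" by (simp add: algebra_simps)
      thus ?thesis using nb(1) P(4) by linarith
    qed
    define S' where "S' = S @ replicate (n - 1 - length S) (Terminal 0)"
    have lS': "length S' = n - 1" using lS by (simp add: S'_def)
    have mu: "\<mu> = put w sb (encode_slp S') \<mu>'"
      unfolding S'_def using P(5) zero1 sbtb by (intro bst_pad[OF P(2)]) (use lS in \<open>auto simp: trie_def\<close>)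
    have v: "env v" "v 23 = sb" "v 11 = int n" "v 24 = int (length S)" using P(2) by (auto simp: bst_def env_def)
    have ni: "int n - 1 = int (n - 1)" "int (length S) - 1 = int (length S - 1)" using nb P(4) by simp_all
    have wn: "wrap W (int (n - 1)) = int (n - 1)" "wrap W (int (length S - 1)) = int (length S - 1)"
      using lS by (auto intro: word)
    have e1: "ev W (V 24 \<boxminus> K 1) v \<mu> = int (length S - 1)"
      by (simp only: ev.simps binop_val.simps small_ge(1) v ni wn)
    let ?v1 = "v(35 := int (length S - 1))"
    have e2: "ev W (V 11 \<boxminus> K 1) ?v1 \<mu> = int (n - 1)"
    proof -
      have "?v1 11 = int n" using v(3) by simp
      thus ?thesis by (simp only: ev.simps binop_val.simps small_ge(1) ni wn)
    qed
    define v' where "v' = ?v1(24 := int (n - 1))"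
    have v': "v' 2 = int (W - w)" "v' 23 = sb" "v' 24 = int (length S')" using v lS' by (auto simp: v'_def env_def)
    have ek: "ev W (V 35) v' \<mu> = int (length S - 1)" for \<mu> by (simp add: v'_def)
    have lt: "length S - 1 < length S'" using P(4) by (simp add: S'_def)
    define S2 where "S2 = S' @ [Concat (length S - 1) (length S - 1)]"
    have l2: "length S2 = n" using lS' nb by (simp add: S2_def)
    have lt': "length S - 1 < length S" using P(4) by simp
    have rs: "rule_string S' (length S - 1) = map G [0..<2 ^ (L + (2 * D + 1))]"
      unfolding S'_def rule_string_append[OF lt'] P(6) ..
    have "rule_string S2 (length S') = map G [0..<2 ^ Suc (L + (2 * D + 1))]"
      unfolding S2_def rule_string_Concat[OF lt lt] rs by (rule map_periodic) simp
    moreover have "Suc (L + (2 * D + 1)) = \<nu>" by (simp add: \<nu>_def)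
    ultimately have str: "slp_string S2 = map G [0..<N]" using l2 lS' by (simp add: slp_string_def N_def del: power_Suc)
    have slp: "is_slp {0, 1} S2" unfolding S2_def S'_def
      by (intro is_slp_Concat is_slp_replicate) (use P(3) lt' lt in \<open>auto simp: base_slp_def S'_def\<close>)
    have "wp W (emit (V 35) (V 35) @ []) ?R v' \<mu>"
    proof (subst wp_emit[where S = S' and ?\<mu>1.0 = \<mu>', OF v' _ _ ek ek mu])
      have m2: "put w sb (encode_slp S2) \<mu>' z = put w sb (encode_slp S2) \<mu>1 z" if "\<not> (tb \<le> z \<and> z < tb + H)" for z
        using P(5) that by (auto simp: put_def trie_def)
      have "put w sb (encode_slp S2) \<mu>' z = \<mu>1 z" if "tb + H \<le> z" for z
        using P(5) that sbtb l2 H_pos by (auto simp: put_def trie_def)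
      moreover have "eqx X (v'(24 := int (Suc (length S')))) v1" using P(1) by (simp add: v'_def)
      ultimately show "wp W [] ?R (v'(24 := int (Suc (length S')))) (put w sb (encode_slp (S' @ [Concat (length S - 1) (length S - 1)])) \<mu>')"
        unfolding S2_def[symmetric] using slp l2 str m2 by auto
      have "sb + 3 * int (n - 1) + 3 \<le> 2 ^ W" using sb0 ni by linarith
      thus "sb + 3 * int (length S') + 3 \<le> 2 ^ W" unfolding lS' .
    qed (use sb0 in auto)
    thus "wp W ([As 35 (V 24 \<boxminus> K 1), As 24 (V 11 \<boxminus> K 1)] @ emit (V 35) (V 35)) ?R v \<mu>"
      unfolding append.simps wp.simps e1 e2 v'_def by simp
  qed (simp add: emit_time)
  have time: "30 + ((L * 111 + 21) + ((cap * 200 + 40) + ((L * (cap * 600 + 60) + 20) + ((D * 250 + 200) + 120 + 1) + 1) + 1) + 1) + 1 \<le> n * 700"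
  proof -
    define e where "e = cap * (L + 2)"
    have "L * (cap * 600 + 60) + cap * 200 \<le> 600 * e + 60 * L" by (simp add: algebra_simps e_def)
    moreover have "2 * e + L + 2 * D + 5 \<le> n" using nb(1) by (simp only: e_def)
    ultimately show ?thesis by linarith
  qed
  show ?thesis unfolding vec_code_def
    by (rule T_Seq[OF 1 T_Seq[OF 2 T_Seq[OF 3 T_Seq[OF trie_code[folded P3_def]
      T_Seq[OF doubling[folded P6_def] 6 order_refl] order_refl] order_refl] order_refl] time])
qed

end


section \<open>One call of the matrix-vector algorithm\<close>

lemma sum_nonzero_iff:
  fixes f :: "nat \<Rightarrow> int"
  shows "(\<And>i. 0 \<le> f i) \<Longrightarrow> (\<Sum>i<c. f i) \<noteq> 0 \<longleftrightarrow> (\<exists>i<c. f i \<noteq> 0)"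
  by (subst sum_nonneg_eq_0_iff) auto

lemma T_HT_Seq:
  assumes "T w P c1 t1 Q" "HT w Q c2 t2 R \<pi> S" "0 \<le> \<pi>"
  shows "HT w P (Seq c1 c2) (t1 + 1 + t2) R \<pi> S"
proof -
  have "T w Q c2 t2 R" by (rule HT_weaken[OF assms(2)]) (use assms(3) in auto)
  from HT_Seq[OF HT_certain[OF assms(1)] this _ assms(3), of S]
  show ?thesis using assms(2) by simp
qed

definition r2E :: aexp where
  "r2E = Bi Mod (V 21 \<boxminus> V 25 \<boxminus> V 22) (V 9)"

definition rows_code :: com where
  "rows_code = loop 25 (V 9) (Seq (blk [As 26 r2E]) (Seq row_code (blk [As 23 (V 23 \<boxplus> K 3 \<boxtimes> V 11)])))"

definition collect_code :: com where
  "collect_code = loop 25 (V 9) (iff (Ld (V 1 \<boxplus> V 25))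
     (iff (Bi Less (V 37) (V 15)) (blk [St (V 34 \<boxplus> V 37) (V 25), As 37 (V 37 \<boxplus> K 1)]) (blk [])) (blk []))"

text \<open>A candidate pair is tested in constant time by looking up \<open>a + b\<close> in the
  characteristic function of \<open>C\<close>, so the exhaustive search of a row costs
  \<open>cap\<close> squared. Variable 19 is the flag that a solution has been seen.\<close>

definition verify_code :: com where
  "verify_code = loop 36 (V 15) (Seq (blk [As 25 (Ld (V 34 \<boxplus> V 36)), As 26 r2E])
     (loop 30 (V 7) (loop 31 (V 7) (Seq (blk (elemS 33 2 25 30 @ elemS 32 3 26 31 @
        [As 33 (V 33 \<boxplus> V 32), As 33 (Ld (V 16 \<boxplus> V 33))]))
       (iff (V 33) (blk [As 19 (K 1)]) (blk []))))))"

definition start_code :: com where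
  "start_code = blk [As 21 (Bi Shr (V 20) (K 1)), As 22 (Bi Mod (V 20) (K 2)),
     As 1 ((K 4 \<boxtimes> V 20 \<boxplus> K 10) \<boxtimes> V 16), As 34 (V 1 \<boxplus> V 16), St (V 1) (trimE (V 9)),
     St (V 1 \<boxplus> K 1) (trimE (V 11)), As 23 (V 1 \<boxplus> K 2)]"

definition round_code :: "com \<Rightarrow> com" where
  "round_code p = Seq start_code (Seq rows_code (Seq vec_code (Seq (call p)
     (Seq (blk [As 37 (K 0), As 34 (V 34 \<boxplus> V 16)]) (Seq collect_code verify_code)))))"

text \<open>A round does not depend on how the buckets were filled: it suffices that every slot is
  empty or holds an element of the right set. The assumption on the solver speaks of
  \<open>{0, 1}\<close> entries only, since these are all that the construction produces.\<close>

locale search = params +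
  fixes p :: com and tp :: nat and \<pi> :: real and bA bB bC :: "nat \<Rightarrow> nat \<Rightarrow> int" and SA SB SC :: "int set"
  assumes bA: "\<And>r j. r < N \<Longrightarrow> j < cap \<Longrightarrow> bA r j = 0 \<or> bA r j \<in> SA"
    and bB: "\<And>r j. r < N \<Longrightarrow> j < cap \<Longrightarrow> bB r j = 0 \<or> bB r j \<in> SB"
    and bC: "\<And>r j. r < N \<Longrightarrow> j < cap \<Longrightarrow> bC r j = 0 \<or> bC r j \<in> SC"
    and SA: "SA \<subseteq> {1..int U}" and SB: "SB \<subseteq> {1..int U}" and SC: "SC \<subseteq> {1..int U}"
    and solver: "\<And>R V' M v. length R = N \<Longrightarrow> (\<forall>S \<in> set R. is_slp {0, 1} S \<and> length S = n) \<Longrightarrow>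
      is_slp {0, 1} V' \<Longrightarrow> length V' = n \<Longrightarrow> M \<in> carrier_mat N N \<Longrightarrow> v \<in> carrier_vec N \<Longrightarrow>
      (\<forall>i<N. slp_string (R ! i) = list_of_vec (row M i)) \<Longrightarrow> slp_string V' = list_of_vec v \<Longrightarrow>
      halts_within w tp (p, init_state w (mvm_input (N, n, R, V', M, v))) \<and>
      \<pi> \<le> measure_pmf.prob (steps w tp (p, init_state w (mvm_input (N, n, R, V', M, v))))
        {c'. mvm_correct (N, n, R, V', M, v) (mem (snd c'))}"
    and \<pi>: "0 \<le> \<pi>"
begin

definition sol :: bool where
  "sol \<longleftrightarrow> (\<exists>a\<in>SA. \<exists>b\<in>SB. a + b \<in> SC)"

definition tab :: "(int \<Rightarrow> int) \<Rightarrow> bool" where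
  "tab \<mu> \<longleftrightarrow> (\<forall>r<N. \<forall>j<cap. slot \<mu> 2 r j = bA r j \<and> slot \<mu> 3 r j = bB r j \<and> slot \<mu> 4 r j = bC r j) \<and>
     (\<forall>z. 0 \<le> z \<and> z < H \<longrightarrow> (\<mu> (H + z) \<noteq> 0 \<longleftrightarrow> z \<in> SC))"

lemma tab_cong:
  assumes "tab \<mu>" "\<And>z. z < 9 * H \<Longrightarrow> \<mu>' z = \<mu> z"
  shows "tab \<mu>'"
proof -
  have "slot \<mu>' b r j = slot \<mu> b r j" if "r < N" "j < cap" "b \<le> 4" for b r j
  proof -
    have "b * H \<le> 4 * H" using that(3) H_pos by (intro mult_right_mono) auto
    hence "b * H + (int r * 2 ^ D + int j) < 9 * H"
      using bucket_bound[OF that(1), of "int j"] cap_less[OF that(2)] H_pos by linarith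
    thus ?thesis using assms(2) by (simp add: slot_def)
  qed
  moreover have "\<mu>' (H + z) = \<mu> (H + z)" if "z < H" for z using assms(2) that H_pos by simp
  ultimately show ?thesis using assms(1) by (simp add: tab_def)
qed

lemma cells:
  assumes "r < N" "j < cap"
  shows "0 \<le> bA r j" "bA r j \<le> int U" "0 \<le> bB r j" "bB r j \<le> int U" "0 \<le> bC r j" "bC r j \<le> int U"
  using bA[OF assms] bB[OF assms] bC[OF assms] SA SB SC by auto

text \<open>The last clause is soundness of the flag, valid whatever \<open>p\<close> answers.
  Freshness of all blocks from \<open>4 * u + 9\<close> on is what allows the next simulated
  call.\<close>

definition Inv :: "nat \<Rightarrow> assn" where
  "Inv u v \<mu> \<longleftrightarrow> env v \<and> tab \<mu> \<and> (\<forall>z. (4 * int u + 9) * H \<le> z \<longrightarrow> z < 2 ^ W \<longrightarrow> \<mu> z = 0) \<and> (v 19 \<noteq> 0 \<longrightarrow> sol)"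

definition r2 :: "nat \<Rightarrow> nat \<Rightarrow> nat" where
  "r2 u r = nat ((int (u div 2) - int r - int (u mod 2)) mod int N)"

definition hit :: "nat \<Rightarrow> nat \<Rightarrow> bool" where
  "hit u r \<longleftrightarrow> (\<exists>i<cap. \<exists>j<cap. el (bA r i) + el (bB (r2 u r) j) \<in> SC)"

abbreviation h2 :: "int \<Rightarrow> nat" where "h2 \<equiv> hsh W L \<alpha>2"

text \<open>\<open>posi u r\<close> says that entry \<open>r\<close> of the product computed in round \<open>u\<close> is nonzero.\<close>

definition posi :: "nat \<Rightarrow> nat \<Rightarrow> bool" where
  "posi u r \<longleftrightarrow> (\<exists>i<cap. \<exists>j<cap. \<exists>l<cap. \<exists>e\<in>{0, 1}.
     (h2 (el (bA r i)) + h2 (el (bB (r2 u r) j)) + e) mod 2 ^ L = h2 (bC (u div 2) l))"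

text \<open>The condition on the hash functions under which a correct product in round
  \<open>u\<close> leads to a detected solution: false rows cannot fill the list of
  candidates.\<close>

definition good :: "nat \<Rightarrow> bool" where
  "good u \<longleftrightarrow> card {r. r < N \<and> posi u r \<and> \<not> hit u r} < Bc \<and> (\<exists>r<N. posi u r \<and> hit u r)"

lemma N_pos: "0 < N" and N_word: "int N < 2 ^ W"
proof -
  show "0 < N" by (simp add: N_def)
  show "int N < 2 ^ W" using N_H H_lt by linarith
qed

lemma r2_less: "r2 u r < N"
  using N_pos by (simp add: r2_def nat_less_iff)

text \<open>Both summands are at least 1, and an empty slot counts as \<open>U\<close>; a sum that
  involves one exceeds \<open>U\<close> and cannot lie in \<open>SC\<close>. So the sum of a hit
  comes from two genuine elements.\<close>

lemma hit_sol:
  assumes "r < N" "hit u r"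
  shows sol
proof -
  obtain i j where ij: "i < cap" "j < cap" "el (bA r i) + el (bB (r2 u r) j) \<in> SC"
    using assms(2) by (auto simp: hit_def)
  have s: "el (bA r i) + el (bB (r2 u r) j) \<le> int U" using ij(3) SC by auto
  have "1 \<le> el (bB (r2 u r) j) \<or> U = 0" "1 \<le> el (bA r i) \<or> U = 0"
    using cells[OF assms(1) ij(1)] cells[OF r2_less ij(2), of u r] by (auto simp: el_def)
  moreover have "U \<noteq> 0" using ij(3) SC by force
  ultimately have "1 \<le> bA r i" "1 \<le> bB (r2 u r) j"
    using s cells[OF assms(1) ij(1)] cells[OF r2_less ij(2), of u r] by (auto simp: el_def split: if_splits)
  hence "bA r i \<in> SA" "bB (r2 u r) j \<in> SB" "bA r i + bB (r2 u r) j \<in> SC"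
    using bA[OF assms(1) ij(1)] bB[OF r2_less ij(2), of u r] ij(3) by (auto simp: el_def)
  thus ?thesis unfolding sol_def by blast
qed

text \<open>If none of the first \<open>Bc\<close> positive rows were a hit, then either all
  positive rows would be listed, including the hit that \<open>good\<close> provides, or the list
  would consist of \<open>Bc\<close> false rows, more than \<open>good\<close> allows.\<close>

lemma good_verified:
  assumes "good u"
  shows "\<exists>r\<in>set (take Bc (filter (posi u) [0..<N])). hit u r"
proof (rule ccontr)
  assume no: "\<not> ?thesis"
  let ?l = "filter (posi u) [0..<N]"
  have sub: "set (take Bc ?l) \<subseteq> {r. r < N \<and> posi u r \<and> \<not> hit u r}"
    using no by (auto dest: in_set_takeD)
  obtain r where r: "r < N" "posi u r" "hit u r" using assms by (auto simp: good_def)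
  hence "r \<in> set ?l" by simp
  moreover have "r \<notin> set (take Bc ?l)" using no r by auto
  ultimately have "Bc \<le> length ?l" by (metis linorder_not_le order_less_imp_le take_all)
  hence "card (set (take Bc ?l)) = Bc" by (subst distinct_card) (auto intro: distinct_take)
  moreover have "card (set (take Bc ?l)) \<le> card {r. r < N \<and> posi u r \<and> \<not> hit u r}"
    using sub by (intro card_mono) auto
  ultimately show False using assms by (simp add: good_def)
qed

lemma ev_r2:
  assumes "env v" "v 21 = int (u div 2)" "v 22 = int (u mod 2)" "u < 2 * N" "v 25 = int r" "r < N"
  shows "ev W r2E v \<mu> = int (r2 u r)"
proof -
  have "int (u div 2) < int N" "int (u mod 2) \<le> 1" using assms(4) by auto
  moreover have "int r < int N" using assms(6) by simp
  ultimately have "okw W (int (u div 2) - int r - int (u mod 2))" "okw W (int (u div 2) - int r)"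
    using N_word unfolding okw_def by linarith+
  moreover have "wrap W (int (r2 u r)) = int (r2 u r)" using r2_less[of u r] N_word by (intro wrap_idI) auto
  moreover have "int (r2 u r) = (int (u div 2) - int r - int (u mod 2)) mod int N"
    using N_pos by (simp add: r2_def)
  moreover have "v 9 = int N" using assms(1) by (simp add: env_def)
  ultimately show ?thesis using assms(2,3,5) by (simp add: r2E_def wrap_id del: of_nat_div of_nat_mod)
qed

definition round_time :: nat where
  "round_time = N * (n * 700 + 80) + n * 700 + (5 * tp + 2 * reg_bound p + 12) +
     (N * 100 + Bc * (cap * (cap * 170 + 40) + 100)) + 240"

context
  fixes u :: nat and v0 :: "nat \<Rightarrow> int" and \<mu>0 :: "int \<Rightarrow> int"
  assumes u: "u < 2 * N" and inv0: "Inv u v0 \<mu>0" and v0u: "v0 20 = int u"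
begin

definition Bs :: int where "Bs = (4 * int u + 10) * H"

definition Gv :: "nat \<Rightarrow> int" where
  "Gv x = (if \<exists>j<2 * cap. x mod 2 ^ L = nat ((int (h2 (bC (u div 2) (j div 2))) - int (j mod 2)) mod 2 ^ L) then 1 else 0)"

abbreviation "X0 \<equiv> {1, 21, 22, 23, 24, 25, 26, 27, 28, 29, 30, 31, 32, 33, 34, 35, 36, 37 :: nat}"

lemma facts0: "env v0" "tab \<mu>0" "\<And>z. Bs - H \<le> z \<Longrightarrow> z < 2 ^ W \<Longrightarrow> \<mu>0 z = 0" "v0 19 \<noteq> 0 \<Longrightarrow> sol"
proof -
  have "Bs - H = (4 * int u + 9) * H" by (simp add: Bs_def algebra_simps)
  thus "env v0" "tab \<mu>0" "\<And>z. Bs - H \<le> z \<Longrightarrow> z < 2 ^ W \<Longrightarrow> \<mu>0 z = 0" "v0 19 \<noteq> 0 \<Longrightarrow> sol"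
    using inv0 by (auto simp: Inv_def)
qed

lemma u2: "u div 2 < N"
  using u by auto

lemma Bs: "10 * H \<le> Bs" "Bs + 4 * H \<le> 2 ^ W"
proof -
  have "0 \<le> 4 * int u * H" using H_pos by simp
  thus "10 * H \<le> Bs" by (simp add: Bs_def distrib_right)
  have "(4 * int u + 14) * H \<le> (8 * int N + 16) * H" using u H_pos by (intro mult_right_mono) auto
  also have "\<dots> \<le> 2 ^ W" using W_H by (simp add: mult.commute)
  finally show "Bs + 4 * H \<le> 2 ^ W" by (simp add: Bs_def distrib_right)
qed

lemma Bs_word: "0 \<le> x \<Longrightarrow> x < 4 * H \<Longrightarrow> wrap W (Bs + x) = Bs + x"
  using Bs H_pos by (intro wrap_idI) linarith+

lemma env_X0: "eqx X0 v v0 \<Longrightarrow> env v" and v20: "eqx X0 v v0 \<Longrightarrow> v 20 = int u" and v19: "eqx X0 v v0 \<Longrightarrow> v 19 = v0 19"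
  using env_eqx[OF facts0(1), of X0 v] eqxD[of X0 v v0 20] eqxD[of X0 v v0 19] v0u by auto

definition st :: "(nat \<Rightarrow> int) \<Rightarrow> bool" where
  "st v \<longleftrightarrow> eqx X0 v v0 \<and> v 1 = Bs \<and> v 21 = int (u div 2) \<and> v 22 = int (u mod 2)"

lemma T_start: "T W (\<lambda>v \<mu>. v = v0 \<and> \<mu> = \<mu>0) start_code 120
   (\<lambda>v \<mu>. st v \<and> v 34 = Bs + H \<and> v 23 = Bs + 2 \<and> \<mu> = put w Bs [int N, int n] \<mu>0)"
  unfolding start_code_def
proof (rule T_blk)
  fix v \<mu> assume v: "v = v0 \<and> \<mu> = \<mu>0"
  have u_small: "int u < 2 * int N" using u by simp
  have w1: "wrap W (int u) = int u" "wrap W (int (u div 2)) = int (u div 2)" "wrap W (int (u mod 2)) = int (u mod 2)"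
  proof -
    have "int u < 2 ^ W" using u_small N_H H16 H_pos by linarith
    moreover have "int (u div 2) \<le> int u" "int (u mod 2) \<le> int u" by simp_all
    ultimately show "wrap W (int u) = int u" "wrap W (int (u div 2)) = int (u div 2)" "wrap W (int (u mod 2)) = int (u mod 2)"
      by (auto intro!: wrap_idI simp del: of_nat_div of_nat_mod of_nat_less_numeral_power_cancel_iff)
  qed
  have e1: "ev W (Bi Shr (V 20) (K 1)) v0 \<mu>0 = int (u div 2)"
    using v0u w1(2) by (simp add: drop_bit_eq_div zdiv_int)
  let ?v1 = "v0(21 := int (u div 2))"
  have e2: "ev W (Bi Mod (V 20) (K 2)) ?v1 \<mu>0 = int (u mod 2)"
    using v0u w1(3) by (simp add: zmod_int)
  let ?v2 = "?v1(22 := int (u mod 2))"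
  have H: "v0 16 = H" "v0 9 = int N" "v0 11 = int n" "v0 2 = int (W - w)" using facts0(1) by (auto simp: env_def)
  have b0: "wrap W Bs = Bs" "wrap W (Bs + H) = Bs + H" "wrap W (Bs + 1) = Bs + 1" "wrap W (Bs + 2) = Bs + 2"
    using Bs_word[of 0] Bs_word[of H] Bs_word[of 1] Bs_word[of 2] H_pos by auto
  have e3: "ev W ((K 4 \<boxtimes> V 20 \<boxplus> K 10) \<boxtimes> V 16) ?v2 \<mu>0 = Bs"
    using v0u H b0(1) by (simp add: wrap_ring Bs_def)
  let ?v3 = "?v2(1 := Bs)"
  have e4: "ev W (V 1 \<boxplus> V 16) ?v3 \<mu>0 = Bs + H" using H b0 by simp
  let ?v4 = "?v3(34 := Bs + H)"
  have e5: "ev W (trimE (V 9)) ?v4 \<mu>0 = wrap w (int N)" using H by (simp add: ev_trimE)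
  have e6: "ev W (V 1 \<boxplus> K 1) ?v4 \<mu> = Bs + 1" "ev W (trimE (V 11)) ?v4 \<mu> = wrap w (int n)" for \<mu>
    using H b0 by (simp_all add: ev_trimE)
  have e7: "ev W (V 1 \<boxplus> K 2) ?v4 \<mu> = Bs + 2" for \<mu> using b0 by simp
  have m: "\<mu>0(Bs := wrap w (int N), Bs + 1 := wrap w (int n)) = put w Bs [int N, int n] \<mu>0"
    using put_snoc[of "Bs + 1" Bs "[int N]" w \<mu>0 "int n"] by (simp add: put_single)
  have "eqx X0 (?v4(23 := Bs + 2)) v0" by simp
  thus "wp W [As 21 (Bi Shr (V 20) (K 1)), As 22 (Bi Mod (V 20) (K 2)),
     As 1 ((K 4 \<boxtimes> V 20 \<boxplus> K 10) \<boxtimes> V 16), As 34 (V 1 \<boxplus> V 16), St (V 1) (trimE (V 9)),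
     St (V 1 \<boxplus> K 1) (trimE (V 11)), As 23 (V 1 \<boxplus> K 2)]
     (\<lambda>v \<mu>. st v \<and> v 34 = Bs + H \<and> v 23 = Bs + 2 \<and> \<mu> = put w Bs [int N, int n] \<mu>0) v \<mu>"
    using v unfolding wp.simps by (simp only: e1 e2 e3 e4 e5 e6 e7 m) (simp add: st_def m e5)
qed (simp add: trimE_def)

abbreviation "hA r i \<equiv> h2 (el (bA r i))"
abbreviation "hB r j \<equiv> h2 (el (bB (r2 u r) j))"

definition row_val :: "nat \<Rightarrow> nat \<Rightarrow> int" where
  "row_val r q = (\<Sum>j<cap. \<Sum>i<cap. Gv (q + 2 ^ (L + 1 + 2 * D) + hB r j + hA r i))"

definition rows_ok :: "int slp list \<Rightarrow> nat \<Rightarrow> bool" where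
  "rows_ok R k \<longleftrightarrow> length R = k \<and> (\<forall>r<k. is_slp {0, 1} (R ! r) \<and> length (R ! r) = n \<and> gen Gv (R ! r) (n - 1) N (row_val r))"

abbreviation "xs R \<equiv> [int N, int n] @ concat (map encode_slp R)"

lemma rows_ok_length: "rows_ok R k \<Longrightarrow> length (xs R) = 2 + 3 * n * k"
proof -
  assume R: "rows_ok R k"
  have "map (length \<circ> encode_slp) R = replicate k (3 * n)"
    using R by (intro nth_equalityI) (auto simp: rows_ok_def)
  thus ?thesis by (simp add: length_concat sum_list_replicate)
qed

lemma Gv_periodic: "periodic Gv"
  by (simp add: periodic_def Gv_def)

lemma T_rows: "T W (\<lambda>v \<mu>. st v \<and> v 34 = Bs + H \<and> v 23 = Bs + 2 \<and> \<mu> = put w Bs [int N, int n] \<mu>0)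
   rows_code (N * (n * 700 + 80) + 20)
   (\<lambda>v \<mu>. st v \<and> v 34 = Bs + H \<and> v 23 = Bs + 2 + 3 * int n * int N \<and> (\<exists>R. rows_ok R N \<and> \<mu> = put w Bs (xs R) \<mu>0))"
proof -
  let ?I = "\<lambda>k v \<mu>. st v \<and> v 34 = Bs + H \<and> v 23 = Bs + 2 + 3 * int n * int k \<and> (\<exists>R. rows_ok R k \<and> \<mu> = put w Bs (xs R) \<mu>0)"
  have "T W (?I 0) rows_code (N * (n * 700 + 80) + 20) (?I N)"
    unfolding rows_code_def
  proof (rule T_loop[where I = ?I])
    fix k assume k: "k < N"
    have "3 * int n * (int k + 1) \<le> 3 * int n * int N" using k by (intro mult_left_mono) auto
    hence k3: "3 * int n * int k + 3 * int n \<le> 3 * int n * int N" by (simp add: algebra_simps)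
    have inH: "2 + 3 * int n * int N + 3 * int n \<le> H" using H_input by (simp add: algebra_simps)
    have kp: "0 \<le> 3 * int n * int k" by simp
    show "T W (\<lambda>v \<mu>. ?I k v \<mu> \<and> v 25 = int k) (Seq (blk [As 26 r2E]) (Seq row_code (blk [As 23 (V 23 \<boxplus> K 3 \<boxtimes> V 11)])))
      (n * 700 + 60) (\<lambda>v \<mu>. ?I (Suc k) v \<mu> \<and> v 25 = int k)"
    proof (rule T_exact)
      fix v \<mu> assume "?I k v \<mu> \<and> v 25 = int k"
      then obtain R where P: "st v" "v 34 = Bs + H" "v 23 = Bs + 2 + 3 * int n * int k" "rows_ok R k"
        "\<mu> = put w Bs (xs R) \<mu>0" "v 25 = int k" by blast
      have env: "env v" using P(1) env_X0 by (simp add: st_def)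
      have len: "int (length (xs R)) = 2 + 3 * int n * int k" unfolding rows_ok_length[OF P(4)] by simp
      define v2 where "v2 = v(26 := int (r2 u k))"
      have 1: "T W (\<lambda>v' \<mu>'. v' = v \<and> \<mu>' = \<mu>) (blk [As 26 r2E]) 20 (\<lambda>v' \<mu>'. v' = v2 \<and> \<mu>' = \<mu>)"
        by (rule T_blk) (use ev_r2[OF env _ _ u P(6) k] P(1) in \<open>auto simp: st_def v2_def r2E_def[symmetric]\<close>, simp add: r2E_def)
      have tabm: "tab \<mu>" by (rule tab_cong[OF facts0(2)]) (use Bs H_pos in \<open>simp add: P(5) put_def\<close>)
      have sA: "slot \<mu> 2 k i = bA k i" "slot \<mu> 3 (r2 u k) i = bB (r2 u k) i" if "i < cap" for i
        using tabm that k r2_less by (auto simp: tab_def)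
      let ?S = "\<lambda>v' \<mu>'. eqx {24, 27, 28, 29, 30, 31, 32, 33, 35} v' v2 \<and>
        (\<exists>S. \<mu>' = put w (Bs + 2 + 3 * int n * int k) (encode_slp S) \<mu> \<and> is_slp {0, 1} S \<and> length S = n \<and> gen Gv S (n - 1) N (row_val k))"
      have 2: "T W (\<lambda>v' \<mu>'. v' = v2 \<and> \<mu>' = \<mu>) row_code (n * 700) ?S"
      proof (rule T_weaken[OF T_row[of v2 "Bs + 2 + 3 * int n * int k" k "r2 u k" Gv \<mu>]])
        show "env v2" "v2 23 = Bs + 2 + 3 * int n * int k" "v2 25 = int k" "v2 26 = int (r2 u k)" "k < N" "r2 u k < N" "periodic Gv"
          using env P k r2_less Gv_periodic by (simp_all add: v2_def)
        show "8 * H \<le> Bs + 2 + 3 * int n * int k" "Bs + 2 + 3 * int n * int k + 3 * int n \<le> 2 ^ W"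
          using Bs inH k3 kp H_pos by linarith+
        show "\<mu> z = 0" if "Bs + 2 + 3 * int n * int k \<le> z" "z < Bs + 2 + 3 * int n * int k + 3 * int n" for z
        proof -
          have "\<mu> z = \<mu>0 z" using that len by (simp add: P(5) put_def)
          thus ?thesis using facts0(3)[of z] that Bs inH k3 kp H_pos by linarith
        qed
        show "0 \<le> slot \<mu> 2 k j \<and> slot \<mu> 2 k j \<le> int U" "0 \<le> slot \<mu> 3 (r2 u k) j \<and> slot \<mu> 3 (r2 u k) j \<le> int U" if "j < cap" for j
          using sA[OF that] cells[OF k that] cells[OF r2_less that] by auto
        show "?S v' \<mu>'" if "eqx {24, 27, 28, 29, 30, 31, 32, 33, 35} v' v2 \<and>
          (\<exists>S. \<mu>' = put w (Bs + 2 + 3 * int n * int k) (encode_slp S) \<mu> \<and> is_slp {0, 1} S \<and> length S = n \<and> gen Gv S (n - 1) N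
           (\<lambda>q. \<Sum>j<cap. \<Sum>i<cap. Gv (q + 2 ^ (L + 1 + 2 * D) + h2 (el (slot \<mu> 3 (r2 u k) j)) + h2 (el (slot \<mu> 2 k i)))))" for v' \<mu>'
        proof -
          have "(\<lambda>q. \<Sum>j<cap. \<Sum>i<cap. Gv (q + 2 ^ (L + 1 + 2 * D) + h2 (el (slot \<mu> 3 (r2 u k) j)) + h2 (el (slot \<mu> 2 k i)))) = row_val k"
            using sA by (auto simp: row_val_def fun_eq_iff intro!: sum.cong)
          thus ?thesis using that by simp
        qed
      qed auto
      have 3: "T W ?S (blk [As 23 (V 23 \<boxplus> K 3 \<boxtimes> V 11)]) 15 (\<lambda>v \<mu>. ?I (Suc k) v \<mu> \<and> v 25 = int k)"
      proof (rule T_blk)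
        fix v3 \<mu>3 assume "?S v3 \<mu>3"
        then obtain S where S: "eqx {24, 27, 28, 29, 30, 31, 32, 33, 35} v3 v2" "\<mu>3 = put w (Bs + 2 + 3 * int n * int k) (encode_slp S) \<mu>"
          "is_slp {0, 1} S" "length S = n" "gen Gv S (n - 1) N (row_val k)" by blast
        have vv: "v3 23 = Bs + 2 + 3 * int n * int k" "v3 11 = int n" "v3 25 = int k" "v3 34 = Bs + H" "v3 1 = Bs"
          "v3 21 = int (u div 2)" "v3 22 = int (u mod 2)"
          using eqxD[OF S(1), of 23] eqxD[OF S(1), of 11] eqxD[OF S(1), of 25] eqxD[OF S(1), of 34] eqxD[OF S(1), of 1]
            eqxD[OF S(1), of 21] eqxD[OF S(1), of 22] P env by (simp_all add: v2_def env_def st_def)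
        have ex: "eqx X0 v3 v0"
          by (rule eqx_trans[OF S(1), of X0 v0]) (use P(1) in \<open>auto simp: v2_def st_def\<close>)
        have "wrap W (Bs + (2 + 3 * int n * int k + 3 * int n)) = Bs + (2 + 3 * int n * int k + 3 * int n)"
          using inH k3 kp H_pos by (intro Bs_word) linarith+
        hence "wrap W (Bs + 2 + 3 * int n * int k + 3 * int n) = Bs + 2 + 3 * int n * int (Suc k)"
          by (simp only: add.assoc of_nat_Suc distrib_left mult_1_right)
        hence e: "ev W (V 23 \<boxplus> K 3 \<boxtimes> V 11) v3 \<mu>3 = Bs + 2 + 3 * int n * int (Suc k)"
          using vv by (simp add: wrap_ring del: of_nat_Suc)
        have "put w (Bs + int (length (xs R))) (encode_slp S) (put w Bs (xs R) \<mu>0) = put w Bs (xs (R @ [S])) \<mu>0"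
          unfolding put_append by simp
        hence "\<mu>3 = put w Bs (xs (R @ [S])) \<mu>0" unfolding S(2) P(5) len by (simp add: add.assoc)
        moreover have "rows_ok (R @ [S]) (Suc k)" using P(4) S by (auto simp: rows_ok_def nth_append less_Suc_eq)
        moreover have "st (v3(23 := Bs + 2 + 3 * int n * int (Suc k)))" using ex vv by (simp add: st_def)
        ultimately show "wp W [As 23 (V 23 \<boxplus> K 3 \<boxtimes> V 11)] (\<lambda>v \<mu>. ?I (Suc k) v \<mu> \<and> v 25 = int k) v3 \<mu>3"
          unfolding wp.simps e using vv by auto
      qed simp
      show "T W (\<lambda>v' \<mu>'. v' = v \<and> \<mu>' = \<mu>) (Seq (blk [As 26 r2E]) (Seq row_code (blk [As 23 (V 23 \<boxplus> K 3 \<boxtimes> V 11)])))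
        (n * 700 + 60) (\<lambda>v \<mu>. ?I (Suc k) v \<mu> \<and> v 25 = int k)"
        by (rule T_Seq[OF 1 T_Seq[OF 2 3 order_refl]]) simp
    qed
  next
    show "N < 2 ^ W" using N_word by (metis of_nat_less_iff of_nat_numeral of_nat_power)
    show "ev W (V 9) v \<mu> = int N" if "?I k v \<mu>" for k v \<mu>
      using that env_X0 by (auto simp: st_def env_def)
  qed (use W_16 in \<open>auto simp: loop_time_def algebra_simps st_def\<close>)
  thus ?thesis by (rule T_weaken) (auto simp: rows_ok_def intro!: exI[of _ "[]"])
qed

lemma Gv_pos: "0 \<le> Gv x"
  by (simp add: Gv_def)

text \<open>All summands are nonnegative, so nothing cancels, and the sum is nonzero just when some
  \<open>h2 a + h2 b\<close> is a marked position, that is congruent to some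
  \<open>h2 c - e\<close>.\<close>

lemma row_val_pos: "row_val r 0 \<noteq> 0 \<longleftrightarrow> posi u r"
proof -
  have per: "Gv (2 ^ (L + 1 + 2 * D) + x + y) = Gv (x + y)" for x y
    using periodicD[OF Gv_periodic, of 0 "2 ^ (1 + 2 * D)" "x + y"] by (simp add: power_add ac_simps)
  have "row_val r 0 = (\<Sum>j<cap. \<Sum>i<cap. Gv (hB r j + hA r i))"
    unfolding row_val_def add_0 per ..
  hence "row_val r 0 \<noteq> 0 \<longleftrightarrow> (\<exists>j<cap. \<exists>i<cap. Gv (hB r j + hA r i) \<noteq> 0)"
    using Gv_pos by (simp only: sum_nonzero_iff sum_nonneg)
  also have "\<dots> \<longleftrightarrow> posi u r"
  proof -
    have "Gv x \<noteq> 0 \<longleftrightarrow> (\<exists>l<cap. \<exists>e\<in>{0, 1}. (x + e) mod 2 ^ L = h2 (bC (u div 2) l))" for x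
    proof -
      have key: "x mod 2 ^ L = nat ((int (h2 c) - int e) mod 2 ^ L) \<longleftrightarrow> (x + e) mod 2 ^ L = h2 c" for c and e :: nat
      proof -
        have "0 \<le> (int (h2 c) - int e) mod 2 ^ L" by simp
        hence "x mod 2 ^ L = nat ((int (h2 c) - int e) mod 2 ^ L) \<longleftrightarrow> int (x mod 2 ^ L) = (int (h2 c) - int e) mod 2 ^ L"
          by (metis int_nat_eq nat_int)
        hence "x mod 2 ^ L = nat ((int (h2 c) - int e) mod 2 ^ L) \<longleftrightarrow> int x mod 2 ^ L = (int (h2 c) - int e) mod 2 ^ L"
          by (simp only: zmod_int of_nat_power of_nat_numeral)
        also have "\<dots> \<longleftrightarrow> (int x + int e) mod 2 ^ L = int (h2 c) mod 2 ^ L"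
          by (simp add: mod_eq_dvd_iff algebra_simps)
        also have "\<dots> \<longleftrightarrow> int ((x + e) mod 2 ^ L) = int (h2 c mod 2 ^ L)"
          by (simp only: zmod_int of_nat_power of_nat_numeral of_nat_add)
        also have "\<dots> \<longleftrightarrow> (x + e) mod 2 ^ L = h2 c mod 2 ^ L" by (simp only: of_nat_eq_iff)
        also have "h2 c mod 2 ^ L = h2 c" using hsh_less[OF L_W(1)] by simp
        finally show ?thesis .
      qed
      show ?thesis
      proof
        assume "Gv x \<noteq> 0"
        then obtain j where "j < 2 * cap" "x mod 2 ^ L = nat ((int (h2 (bC (u div 2) (j div 2))) - int (j mod 2)) mod 2 ^ L)"
          by (auto simp: Gv_def split: if_splits)
        thus "\<exists>l<cap. \<exists>e\<in>{0, 1}. (x + e) mod 2 ^ L = h2 (bC (u div 2) l)"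
          unfolding key by (intro exI[of _ "j div 2"] conjI bexI[of _ "j mod 2"]) auto
      next
        assume "\<exists>l<cap. \<exists>e\<in>{0, 1}. (x + e) mod 2 ^ L = h2 (bC (u div 2) l)"
        then obtain l e where le: "l < cap" "e \<in> {0, 1}" "(x + e) mod 2 ^ L = h2 (bC (u div 2) l)" by blast
        hence "e < 2" by auto
        hence "(2 * l + e) div 2 = l" "(2 * l + e) mod 2 = e" "2 * l + e < 2 * cap" using le by auto
        hence "\<exists>j<2 * cap. x mod 2 ^ L = nat ((int (h2 (bC (u div 2) (j div 2))) - int (j mod 2)) mod 2 ^ L)"
          unfolding key using le(3) by (intro exI[of _ "2 * l + e"]) simp
        thus "Gv x \<noteq> 0" by (simp add: Gv_def)
      qed
    qed
    thus ?thesis unfolding posi_def by (auto simp: ac_simps)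
  qed
  finally show ?thesis .
qed

definition vec_ok :: "int slp \<Rightarrow> bool" where
  "vec_ok S \<longleftrightarrow> is_slp {0, 1} S \<and> length S = n \<and> slp_string S = map Gv [0..<N]"

lemma T_vector: "T W (\<lambda>v \<mu>. st v \<and> v 34 = Bs + H \<and> v 23 = Bs + 2 + 3 * int n * int N \<and> (\<exists>R. rows_ok R N \<and> \<mu> = put w Bs (xs R) \<mu>0))
   vec_code (n * 700)
   (\<lambda>v \<mu>. st v \<and> v 34 = Bs + H \<and> (\<exists>R S. rows_ok R N \<and> vec_ok S \<and>
      (\<forall>z<Bs + H. \<mu> z = put w Bs (xs R @ encode_slp S) \<mu>0 z) \<and> (\<forall>z\<ge>Bs + 2 * H. \<mu> z = \<mu>0 z)))"
proof (rule T_exact)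
  fix v1 \<mu>1 assume "st v1 \<and> v1 34 = Bs + H \<and> v1 23 = Bs + 2 + 3 * int n * int N \<and> (\<exists>R. rows_ok R N \<and> \<mu>1 = put w Bs (xs R) \<mu>0)"
  then obtain R where P: "st v1" "v1 34 = Bs + H" "v1 23 = Bs + 2 + 3 * int n * int N" "rows_ok R N" "\<mu>1 = put w Bs (xs R) \<mu>0" by blast
  have len: "int (length (xs R)) = 2 + 3 * int n * int N" unfolding rows_ok_length[OF P(4)] by simp
  have inH: "2 + 3 * int n * int N + 3 * int n \<le> H" using H_input by (simp add: algebra_simps)
  have kp: "0 \<le> 3 * int n * int N" by simp
  have tabm: "tab \<mu>1" by (rule tab_cong[OF facts0(2)]) (use Bs H_pos in \<open>simp add: P(5) put_def\<close>)
  have sC: "slot \<mu>1 4 (u div 2) i = bC (u div 2) i" if "i < cap" for i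
    using tabm that u2 by (auto simp: tab_def)
  interpret vb: vec_build W U D L n w Bc H \<alpha>1 \<alpha>2 \<nu> N cap v1 \<mu>1 "Bs + 2 + 3 * int n * int N" "Bs + H" "u div 2"
  proof (unfold_locales, unfold \<nu>_def[symmetric] N_def[symmetric] cap_def[symmetric])
    show "env v1" using P(1) env_X0 by (simp add: st_def)
    show "v1 21 = int (u div 2)" using P(1) by (simp add: st_def)
    show "8 * H \<le> Bs + 2 + 3 * int n * int N" "Bs + 2 + 3 * int n * int N + 3 * int n \<le> Bs + H" "Bs + H + H \<le> 2 ^ W"
      using Bs inH kp H_pos by linarith+
    show "\<mu>1 z = 0" if "Bs + 2 + 3 * int n * int N \<le> z" "z < Bs + H + H" for z
    proof -
      have "\<mu>1 z = \<mu>0 z" using that len by (simp add: P(5) put_def)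
      thus ?thesis using facts0(3)[of z] that Bs kp H_pos by linarith
    qed
    show "0 \<le> slot \<mu>1 4 (u div 2) j \<and> slot \<mu>1 4 (u div 2) j \<le> int U" if "j < cap" for j
      using sC[OF that] cells[OF u2 that] by auto
  qed (use P u2 in auto)
  have G: "vb.G = Gv"
  proof
    fix x
    have "vb.y j = nat ((int (h2 (bC (u div 2) (j div 2))) - int (j mod 2)) mod 2 ^ L)" if "j < 2 * cap" for j
      using sC[of "j div 2"] that by (simp add: vb.y_def vb.hC_def)
    thus "vb.G x = Gv x" unfolding vb.G_def[folded cap_def] Gv_def by (metis (no_types, lifting))
  qed
  show "T W (\<lambda>v \<mu>. v = v1 \<and> \<mu> = \<mu>1) vec_code (n * 700)
   (\<lambda>v \<mu>. st v \<and> v 34 = Bs + H \<and> (\<exists>R S. rows_ok R N \<and> vec_ok S \<and>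
      (\<forall>z<Bs + H. \<mu> z = put w Bs (xs R @ encode_slp S) \<mu>0 z) \<and> (\<forall>z\<ge>Bs + 2 * H. \<mu> z = \<mu>0 z)))"
  proof (rule T_weaken[OF vb.T_vec[folded \<nu>_def N_def cap_def]])
    fix v \<mu> assume a: "eqx {24, 30, 31, 32, 33, 35, 36, 37} v v1 \<and> (\<exists>S. is_slp {0, 1} S \<and> length S = n \<and> slp_string S = map vb.G [0..<N] \<and>
       (\<forall>z<Bs + H. \<mu> z = put w (Bs + 2 + 3 * int n * int N) (encode_slp S) \<mu>1 z) \<and> (\<forall>z\<ge>Bs + H + H. \<mu> z = \<mu>1 z))"
    then obtain S where S: "vec_ok S" "\<forall>z<Bs + H. \<mu> z = put w (Bs + 2 + 3 * int n * int N) (encode_slp S) \<mu>1 z"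
      "\<forall>z\<ge>Bs + H + H. \<mu> z = \<mu>1 z" unfolding vec_ok_def G by blast
    have "put w (Bs + int (length (xs R))) (encode_slp S) \<mu>1 = put w Bs (xs R @ encode_slp S) \<mu>0"
      unfolding P(5) by (rule put_append)
    hence "\<forall>z<Bs + H. \<mu> z = put w Bs (xs R @ encode_slp S) \<mu>0 z" using S(2) unfolding len by (simp add: add.assoc)
    moreover have "\<forall>z\<ge>Bs + 2 * H. \<mu> z = \<mu>0 z" using S(3) len inH kp H_pos by (auto simp: P(5) put_def)
    moreover have "st v" "v 34 = Bs + H"
      using P(1,2) conjunct1[OF a] eqx_trans[of _ v v1 X0 v0 X0] eqxD[OF conjunct1[OF a], of 1] eqxD[OF conjunct1[OF a], of 21]
        eqxD[OF conjunct1[OF a], of 22] eqxD[OF conjunct1[OF a], of 34] by (auto simp: st_def)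
    ultimately show "st v \<and> v 34 = Bs + H \<and> (\<exists>R S. rows_ok R N \<and> vec_ok S \<and>
      (\<forall>z<Bs + H. \<mu> z = put w Bs (xs R @ encode_slp S) \<mu>0 z) \<and> (\<forall>z\<ge>Bs + 2 * H. \<mu> z = \<mu>0 z))"
      using P(4) S(1) by blast
  qed auto
qed

text \<open>What survives any behaviour of \<open>p\<close>: the simulation confines its writes to
  the window, so the tables and the later blocks are intact even if the answer is wrong.\<close>

definition after :: assn where
  "after v \<mu> \<longleftrightarrow> st v \<and> v 34 = Bs + H \<and> tab \<mu> \<and> (\<forall>z. Bs + 2 * H \<le> z \<longrightarrow> z < 2 ^ W \<longrightarrow> \<mu> z = 0)"

definition correct :: assn where
  "correct v \<mu> \<longleftrightarrow> (\<forall>r<N. \<mu> (Bs + int r) \<noteq> 0 \<longleftrightarrow> posi u r)"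

lemma HT_call_round: "HT W (\<lambda>v \<mu>. st v \<and> v 34 = Bs + H \<and> (\<exists>R S. rows_ok R N \<and> vec_ok S \<and>
      (\<forall>z<Bs + H. \<mu> z = put w Bs (xs R @ encode_slp S) \<mu>0 z) \<and> (\<forall>z\<ge>Bs + 2 * H. \<mu> z = \<mu>0 z)))
   (call p) (5 * tp + 2 * reg_bound p + 12) after \<pi> correct"
proof (rule T_exact)
  fix v1 \<mu>1 assume "st v1 \<and> v1 34 = Bs + H \<and> (\<exists>R S. rows_ok R N \<and> vec_ok S \<and>
      (\<forall>z<Bs + H. \<mu>1 z = put w Bs (xs R @ encode_slp S) \<mu>0 z) \<and> (\<forall>z\<ge>Bs + 2 * H. \<mu>1 z = \<mu>0 z))"
  then obtain R S where P: "st v1" "v1 34 = Bs + H" "rows_ok R N" "vec_ok S"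
      "\<And>z. z < Bs + H \<Longrightarrow> \<mu>1 z = put w Bs (xs R @ encode_slp S) \<mu>0 z" "\<And>z. Bs + 2 * H \<le> z \<Longrightarrow> \<mu>1 z = \<mu>0 z" by blast
  \<comment> \<open>Matrix and vector exist only in the proof: they are read off the strings of the
    grammars that lie in memory.\<close>
  define M where "M = mat N N (\<lambda>(i, j). rule_string (R ! i) (n - 1) ! j)"
  define x where "x = vec N Gv"
  have R: "length R = N" "\<And>r. r < N \<Longrightarrow> is_slp {0, 1} (R ! r)" "\<And>r. r < N \<Longrightarrow> length (R ! r) = n"
    "\<And>r. r < N \<Longrightarrow> gen Gv (R ! r) (n - 1) N (row_val r)" using P(3) by (auto simp: rows_ok_def)
  have rs: "slp_string (R ! i) = rule_string (R ! i) (n - 1)" "length (rule_string (R ! i) (n - 1)) = N" if "i < N" for i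
    using R(2-4)[OF that] by (auto simp: slp_string_def gen_def)
  have row: "list_of_vec (row M i) = rule_string (R ! i) (n - 1)" if "i < N" for i
    using that rs(2)[OF that] by (intro nth_equalityI) (simp_all add: M_def list_of_vec_index)
  have xv: "list_of_vec x = map Gv [0..<N]"
    by (intro nth_equalityI) (simp_all add: x_def list_of_vec_index)
  have carr: "M \<in> carrier_mat N N" "x \<in> carrier_vec N" by (simp_all add: M_def x_def)
  have val: "(M *\<^sub>v x) $ i = row_val i 0" if "i < N" for i
    by (rule mv_inner[OF carr that xv R(4)[OF that] row[OF that]])
  have S: "is_slp {0, 1} S" "length S = n" "slp_string S = list_of_vec x" using P(4) xv by (auto simp: vec_ok_def)
  let ?inst = "(N, n, R, S, M, x)"
  have inp: "mvm_input ?inst = xs R @ encode_slp S" by simp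
  have slv: "halts_within w tp (p, init_state w (mvm_input ?inst))"
    "\<pi> \<le> measure_pmf.prob (steps w tp (p, init_state w (mvm_input ?inst))) {c'. mvm_correct ?inst (mem (snd c'))}"
  proof -
    have "\<forall>S'\<in>set R. is_slp {0, 1} S' \<and> length S' = n" using R(1-3) by (auto simp: in_set_conv_nth)
    moreover have "\<forall>i<N. slp_string (R ! i) = list_of_vec (row M i)" using rs row by simp
    ultimately show "halts_within w tp (p, init_state w (mvm_input ?inst))"
      "\<pi> \<le> measure_pmf.prob (steps w tp (p, init_state w (mvm_input ?inst))) {c'. mvm_correct ?inst (mem (snd c'))}"
      using solver[OF R(1) _ S(1,2) carr _ S(3)] by blast+
  qed
  have len: "int (length (mvm_input ?inst)) = 2 + 3 * int n * int N + 3 * int n"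
    unfolding inp length_append using rows_ok_length[OF P(3)] S(2) by simp
  have inH: "2 + 3 * int n * int N + 3 * int n \<le> H" using H_input by (simp add: algebra_simps)
  have tab1: "tab \<mu>1" by (rule tab_cong[OF facts0(2)]) (use Bs H_pos in \<open>simp add: P(5) put_def\<close>)
  show "HT W (\<lambda>v \<mu>. v = v1 \<and> \<mu> = \<mu>1) (call p) (5 * tp + 2 * reg_bound p + 12) after \<pi> correct"
  proof (rule HT_weaken[OF HT_call[where B = Bs and H = H and Cor = "mvm_correct ?inst" and ?v0.0 = v1 and ?\<mu>0.0 = \<mu>1,
        OF w_W H_w _ _ _ slv]])
    show "- (2 ^ W) \<le> Bs - H" "Bs + H \<le> 2 ^ W" using Bs H_pos H_lt by linarith+
    show "int (length (mvm_input ?inst)) \<le> H" unfolding len by (rule inH)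
    show "v1 1 = Bs" "v1 2 = int (W - w)" "v1 12 = int w" using P(1) env_X0 by (auto simp: st_def env_def)
    show "\<mu>1 (Bs + a) = (if 0 \<le> a \<and> a < int (length (mvm_input ?inst)) then wrap w (mvm_input ?inst ! nat a) else 0)"
      if "- H \<le> a" "a < H" for a
    proof -
      have "\<mu>0 (Bs + a) = 0" using that Bs H_pos by (intro facts0(3)) linarith+
      thus ?thesis using P(5)[of "Bs + a"] that unfolding inp by (simp add: put_def)
    qed
    fix v \<mu> assume a: "v = v1 \<and> (\<forall>a. \<not> (Bs - H \<le> a \<and> a < Bs + H) \<longrightarrow> \<mu> a = \<mu>1 a)"
    have "tab \<mu>" by (rule tab_cong[OF tab1]) (use a Bs in auto)
    moreover have "\<mu> z = 0" if "Bs + 2 * H \<le> z" "z < 2 ^ W" for z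
      using a P(6)[OF that(1)] facts0(3)[of z] that H_pos by auto
    ultimately show "after v \<mu>" using a P(1,2) by (simp add: after_def)
    assume "mvm_correct ?inst (\<lambda>a. if - H \<le> a \<and> a < H then \<mu> (Bs + a) else 0)"
    hence "\<mu> (Bs + int r) = row_val r 0" if "r < N" for r
      using that val[OF that] N_H that by auto
    thus "correct v \<mu>" using row_val_pos by (simp add: correct_def)
  qed auto
qed

lemma el_bound: "0 \<le> x \<Longrightarrow> x \<le> int U \<Longrightarrow> 0 \<le> el x \<and> el x \<le> int U"
  by (auto simp: el_def)

lemma T_collect:
  assumes "st v1" "v1 34 = Bs + 2 * H" "v1 37 = 0" "\<And>z. Bs + 2 * H \<le> z \<Longrightarrow> z < 2 ^ W \<Longrightarrow> \<mu>1 z = 0"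
  shows "T W (\<lambda>v \<mu>. v = v1 \<and> \<mu> = \<mu>1) collect_code (N * 100 + 20)
    (\<lambda>v \<mu>. eqx {25, 37} v v1 \<and> \<mu> = put W (Bs + 2 * H) (map int (take Bc (filter (\<lambda>r. \<mu>1 (Bs + int r) \<noteq> 0) [0..<N]))) \<mu>1)"
proof -
  let ?l = "\<lambda>k. take Bc (filter (\<lambda>r. \<mu>1 (Bs + int r) \<noteq> 0) [0..<k])"
  let ?m = "\<lambda>k. put W (Bs + 2 * H) (map int (?l k)) \<mu>1"
  let ?I = "\<lambda>k v \<mu>. eqx {25, 37} v v1 \<and> v 37 = int (length (?l k)) \<and> \<mu> = ?m k"
  have env1: "env v1" using assms(1) env_X0 by (simp add: st_def)
  have BcN: "int Bc \<le> int N" using Bc_N by simp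
  have "T W (?I 0) collect_code (N * 100 + 20) (?I N)"
    unfolding collect_code_def
  proof (rule T_loop[where I = ?I])
    fix k assume k: "k < N"
    show "T W (\<lambda>v \<mu>. ?I k v \<mu> \<and> v 25 = int k) (iff (Ld (V 1 \<boxplus> V 25))
     (iff (Bi Less (V 37) (V 15)) (blk [St (V 34 \<boxplus> V 37) (V 25), As 37 (V 37 \<boxplus> K 1)]) (blk [])) (blk [])) 80
     (\<lambda>v \<mu>. ?I (Suc k) v \<mu> \<and> v 25 = int k)"
    proof (rule T_exact)
      fix v \<mu> assume P: "?I k v \<mu> \<and> v 25 = int k"
      have vv: "v 1 = Bs" "v 34 = Bs + 2 * H" "v 15 = int Bc" "v 25 = int k" "v 37 = int (length (?l k))"
        using eqxD[of "{25, 37}" v v1] P assms(1,2) env1 by (auto simp: st_def env_def)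
      have kH: "int k < H" using k N_H by linarith
      have out: "ev W (Ld (V 1 \<boxplus> V 25)) v \<mu> = \<mu>1 (Bs + int k)"
        using vv P Bs_word[of "int k"] kH H_pos by (simp add: put_def)
      have lenle: "length (?l k) \<le> Bc" by simp
      have lenH: "int (length (?l k)) < H"
      proof -
        have "length (?l k) \<le> length (filter (\<lambda>r. \<mu>1 (Bs + int r) \<noteq> 0) [0..<k])" by simp
        also have "\<dots> \<le> k" using length_filter_le[of _ "[0..<k]"] by simp
        finally show ?thesis using kH by linarith
      qed
      have skip: "T W (\<lambda>v' \<mu>'. (v' = v \<and> \<mu>' = \<mu>) \<and> c v' \<mu>') (blk []) 50 (\<lambda>v \<mu>. ?I (Suc k) v \<mu> \<and> v 25 = int k)"
        if "c v \<mu> \<Longrightarrow> ?l (Suc k) = ?l k" for c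
      proof (rule T_blk)
        fix v' \<mu>' assume b: "(v' = v \<and> \<mu>' = \<mu>) \<and> c v' \<mu>'"
        hence "?l (Suc k) = ?l k" using that by blast
        thus "wp W [] (\<lambda>v \<mu>. ?I (Suc k) v \<mu> \<and> v 25 = int k) v' \<mu>'"
          using P b unfolding wp.simps by (simp only:)
      qed simp
      show "T W (\<lambda>v' \<mu>'. v' = v \<and> \<mu>' = \<mu>) (iff (Ld (V 1 \<boxplus> V 25))
        (iff (Bi Less (V 37) (V 15)) (blk [St (V 34 \<boxplus> V 37) (V 25), As 37 (V 37 \<boxplus> K 1)]) (blk [])) (blk [])) 80
        (\<lambda>v \<mu>. ?I (Suc k) v \<mu> \<and> v 25 = int k)"
      proof (rule T_iff[where t = 60])
        show "T W (\<lambda>v' \<mu>'. (v' = v \<and> \<mu>' = \<mu>) \<and> ev W (Ld (V 1 \<boxplus> V 25)) v' \<mu>' = 0) (blk []) 60 (\<lambda>v \<mu>. ?I (Suc k) v \<mu> \<and> v 25 = int k)"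
          by (rule T_weaken[OF skip[of "\<lambda>v' \<mu>'. ev W (Ld (V 1 \<boxplus> V 25)) v' \<mu>' = 0"]]) (use out in auto)
        show "T W (\<lambda>v' \<mu>'. (v' = v \<and> \<mu>' = \<mu>) \<and> ev W (Ld (V 1 \<boxplus> V 25)) v' \<mu>' \<noteq> 0)
          (iff (Bi Less (V 37) (V 15)) (blk [St (V 34 \<boxplus> V 37) (V 25), As 37 (V 37 \<boxplus> K 1)]) (blk [])) 60
          (\<lambda>v \<mu>. ?I (Suc k) v \<mu> \<and> v 25 = int k)"
        proof (cases "\<mu>1 (Bs + int k) = 0")
          case True
          thus ?thesis using out by (auto simp: T_def)
        next
          case pos: False
          hence fs: "filter (\<lambda>r. \<mu>1 (Bs + int r) \<noteq> 0) [0..<Suc k] = filter (\<lambda>r. \<mu>1 (Bs + int r) \<noteq> 0) [0..<k] @ [k]" by simp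
          show ?thesis
          proof (rule T_iff[where t = 50])
            show "T W (\<lambda>v' \<mu>'. ((v' = v \<and> \<mu>' = \<mu>) \<and> ev W (Ld (V 1 \<boxplus> V 25)) v' \<mu>' \<noteq> 0) \<and> ev W (Bi Less (V 37) (V 15)) v' \<mu>' = 0)
              (blk []) 50 (\<lambda>v \<mu>. ?I (Suc k) v \<mu> \<and> v 25 = int k)"
            proof (rule T_weaken[OF skip[of "\<lambda>v' \<mu>'. ev W (Bi Less (V 37) (V 15)) v' \<mu>' = 0"]])
              assume "ev W (Bi Less (V 37) (V 15)) v \<mu> = 0"
              hence "Bc \<le> length (?l k)" using vv by (simp split: if_splits)
              hence "Bc \<le> length (filter (\<lambda>r. \<mu>1 (Bs + int r) \<noteq> 0) [0..<k])" by simp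
              thus "?l (Suc k) = ?l k" unfolding fs by simp
            qed auto
            show "T W (\<lambda>v' \<mu>'. ((v' = v \<and> \<mu>' = \<mu>) \<and> ev W (Ld (V 1 \<boxplus> V 25)) v' \<mu>' \<noteq> 0) \<and> ev W (Bi Less (V 37) (V 15)) v' \<mu>' \<noteq> 0)
              (blk [St (V 34 \<boxplus> V 37) (V 25), As 37 (V 37 \<boxplus> K 1)]) 50 (\<lambda>v \<mu>. ?I (Suc k) v \<mu> \<and> v 25 = int k)"
            proof (rule T_blk)
              fix v' \<mu>' assume a: "((v' = v \<and> \<mu>' = \<mu>) \<and> ev W (Ld (V 1 \<boxplus> V 25)) v' \<mu>' \<noteq> 0) \<and> ev W (Bi Less (V 37) (V 15)) v' \<mu>' \<noteq> 0"
              hence "length (?l k) < Bc" using vv by (simp split: if_splits)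
              hence "length (filter (\<lambda>r. \<mu>1 (Bs + int r) \<noteq> 0) [0..<k]) < Bc" by simp
              hence l: "?l (Suc k) = ?l k @ [k]" unfolding fs by simp
              have e1: "ev W (V 34 \<boxplus> V 37) v \<mu>'' = Bs + 2 * H + int (length (map int (?l k)))" for \<mu>''
                using vv Bs_word[of "2 * H + int (length (?l k))"] lenH H_pos by (simp add: add.assoc)
              have "wrap W (int (length (?l k)) + 1) = int (Suc (length (?l k)))"
                using lenH H_pos by (subst wrapH) auto
              hence e2: "ev W (V 37 \<boxplus> K 1) v \<mu>'' = int (length (?l (Suc k)))" for \<mu>''
                using vv unfolding l by simp
              have "wrap W (int k) = int k" using kH H_pos by (intro wrapH) auto
              hence m: "(?m k)(Bs + 2 * H + int (length (map int (?l k))) := int k) = ?m (Suc k)"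
                unfolding l using put_snoc[where a = "Bs + 2 * H" and xs = "map int (?l k)" and w = W and \<mu> = \<mu>1 and x = "int k", OF refl] by simp
              show "wp W [St (V 34 \<boxplus> V 37) (V 25), As 37 (V 37 \<boxplus> K 1)] (\<lambda>v \<mu>. ?I (Suc k) v \<mu> \<and> v 25 = int k) v' \<mu>'"
                proof -
                have v': "v' = v" "\<mu>' = ?m k" "v 25 = int k" using a P by auto
                have "ev W (V 25) v \<mu>' = int (k)" using vv by simp
                moreover have "eqx {25, 37} (v(37 := int (length (?l (Suc k))))) v1" using P by simp
                ultimately show ?thesis unfolding v'(1) wp.simps e1 e2 v'(2) m[symmetric] using v'(3) by (simp only:) simp
              qed
            qed simp
          qed simp
        qed
      qed simp
    qed
  next
    show "N < 2 ^ W" using N_word by (metis of_nat_less_iff of_nat_numeral of_nat_power)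
    show "ev W (V 9) v \<mu> = int N" if "?I k v \<mu>" for k v \<mu>
      using that env1 eqxD[of "{25, 37}" v v1 9] by (auto simp: env_def)
  qed (use W_16 in \<open>auto simp: loop_time_def\<close>)
  thus ?thesis by (rule T_weaken) (use assms(3) in auto)
qed

lemma T_verify:
  assumes "st v1" "v1 34 = Bs + 2 * H" "tab \<mu>1" "v1 19 \<noteq> 0 \<Longrightarrow> sol"
    and row: "\<And>k. k < Bc \<Longrightarrow> \<mu>1 (Bs + 2 * H + int k) = int (idx k) \<and> idx k < N"
  shows "T W (\<lambda>v \<mu>. v = v1 \<and> \<mu> = \<mu>1) verify_code (Bc * (cap * (cap * 170 + 40) + 100) + 20)
    (\<lambda>v \<mu>. \<mu> = \<mu>1 \<and> eqx {19, 25, 26, 30, 31, 32, 33, 36} v v1 \<and> (v 19 \<noteq> 0 \<longrightarrow> sol) \<and> (v1 19 \<noteq> 0 \<longrightarrow> v 19 \<noteq> 0) \<and>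
       (\<forall>k<Bc. hit u (idx k) \<longrightarrow> v 19 \<noteq> 0))"
proof -
  let ?f = "\<lambda>k i j. el (bA (idx k) i) + el (bB (r2 u (idx k)) j) \<in> SC"
  let ?P = "\<lambda>v \<mu>. \<mu> = \<mu>1 \<and> eqx {19, 25, 26, 30, 31, 32, 33, 36} v v1 \<and> (v 19 \<noteq> 0 \<longrightarrow> sol) \<and> (v1 19 \<noteq> 0 \<longrightarrow> v 19 \<noteq> 0)"
  let ?K = "\<lambda>k v \<mu>. ?P v \<mu> \<and> (\<forall>k'<k. hit u (idx k') \<longrightarrow> v 19 \<noteq> 0)"
  let ?I = "\<lambda>k i v \<mu>. (?K k v \<mu> \<and> v 36 = int k \<and> v 25 = int (idx k) \<and> v 26 = int (r2 u (idx k))) \<and>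
     (\<forall>i'<i. \<forall>j<cap. ?f k i' j \<longrightarrow> v 19 \<noteq> 0)"
  let ?J = "\<lambda>k i j v \<mu>. (?I k i v \<mu> \<and> v 30 = int i) \<and> (\<forall>j'<j. ?f k i j' \<longrightarrow> v 19 \<noteq> 0)"
  have env: "env v" if "?P v \<mu>" for v \<mu>
    using that env_X0[of v1] assms(1) env_eqx[of v1 "{19, 25, 26, 30, 31, 32, 33, 36}" v] by (auto simp: st_def)
  have vv: "v 34 = Bs + 2 * H" "v 21 = int (u div 2)" "v 22 = int (u mod 2)" if "?P v \<mu>" for v \<mu>
    using that eqxD[of _ v v1] assms(1,2) by (auto simp: st_def)
  let ?c1 = "elemS 33 2 25 30 @ elemS 32 3 26 31 @ [As 33 (V 33 \<boxplus> V 32), As 33 (Ld (V 16 \<boxplus> V 33))]"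
  let ?c2 = "iff (V 33) (blk [As 19 (K 1)]) (blk [])"
  have inner: "T W (\<lambda>v \<mu>. ?J k i j v \<mu> \<and> v 31 = int j) (Seq (blk ?c1) ?c2) 150 (\<lambda>v \<mu>. ?J k i (Suc j) v \<mu> \<and> v 31 = int j)"
    if k: "k < Bc" and i: "i < cap" and j: "j < cap" for k i j
  proof (rule T_Seq)
    let ?M = "\<lambda>v \<mu>. (?J k i j v \<mu> \<and> v 31 = int j) \<and> (v 33 \<noteq> 0 \<longleftrightarrow> ?f k i j)"
    have rk: "idx k < N" using row[OF k] by simp
    note cA = cells(1,2)[OF rk i] and cB = cells(3,4)[OF r2_less j, of u "idx k"]
    show "T W (\<lambda>v \<mu>. ?J k i j v \<mu> \<and> v 31 = int j) (blk ?c1) 120 ?M"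
    proof (rule T_blk)
      fix v \<mu> assume a: "?J k i j v \<mu> \<and> v 31 = int j"
      hence P: "?P v \<mu>" and regs: "v 25 = int (idx k)" "v 26 = int (r2 u (idx k))" "v 30 = int i" "v 31 = int j" by blast+
      have e: "env v" by (rule env[OF P])
      have sl: "slot \<mu> 2 (idx k) i = bA (idx k) i" "slot \<mu> 3 (r2 u (idx k)) j = bB (r2 u (idx k)) j"
        using P assms(3) rk r2_less i j by (auto simp: tab_def)
      let ?a = "el (bA (idx k) i)" and ?b = "el (bB (r2 u (idx k)) j)"
      have ab: "0 \<le> ?a + ?b" "?a + ?b < H"
        using el_bound[OF cA] el_bound[OF cB] H_U by linarith+
      let ?v1 = "v(33 := ?a)"
      let ?v2 = "?v1(32 := ?b)"
      have w1: "wp W ?c1 Q v \<mu> = wp W [As 33 (V 33 \<boxplus> V 32), As 33 (Ld (V 16 \<boxplus> V 33))] Q ?v2 \<mu>" for Q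
        using e regs rk r2_less i j cA cB sl
        by (subst wp_elem[where rr = "idx k" and j = i], simp_all)
          (subst wp_elem[where rr = "r2 u (idx k)" and j = j], simp_all)
      have e1: "ev W (V 33 \<boxplus> V 32) ?v2 \<mu> = ?a + ?b" using ab H_pos by (simp add: wrapH)
      have "wrap W (H + (?a + ?b)) = H + (?a + ?b)" using ab H_pos by (intro wrapH) linarith+
      hence e2: "ev W (Ld (V 16 \<boxplus> V 33)) (?v2(33 := ?a + ?b)) \<mu> = \<mu> (H + (?a + ?b))"
        using e by (simp add: env_def)
      have t: "\<mu> (H + (?a + ?b)) \<noteq> 0 \<longleftrightarrow> ?f k i j" using P assms(3) ab by (simp add: tab_def)
      show "wp W ?c1 ?M v \<mu>"
        unfolding w1 wp.simps e1 e2 using a t by simp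
    qed (simp add: elemS_def cellE_def blk_time_append)
    show "T W ?M ?c2 20 (\<lambda>v \<mu>. ?J k i (Suc j) v \<mu> \<and> v 31 = int j)"
    proof (rule T_iff[where t = 10])
      show "T W (\<lambda>v \<mu>. ?M v \<mu> \<and> ev W (V 33) v \<mu> \<noteq> 0) (blk [As 19 (K 1)]) 10 (\<lambda>v \<mu>. ?J k i (Suc j) v \<mu> \<and> v 31 = int j)"
      proof (rule T_blk)
        fix v \<mu> assume a: "?M v \<mu> \<and> ev W (V 33) v \<mu> \<noteq> 0"
        hence "hit u (idx k)" using i j by (auto simp: hit_def)
        hence "sol" by (rule hit_sol[OF rk])
        thus "wp W [As 19 (K 1)] (\<lambda>v \<mu>. ?J k i (Suc j) v \<mu> \<and> v 31 = int j) v \<mu>" using a by simp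
      qed simp
      show "T W (\<lambda>v \<mu>. ?M v \<mu> \<and> ev W (V 33) v \<mu> = 0) (blk []) 10 (\<lambda>v \<mu>. ?J k i (Suc j) v \<mu> \<and> v 31 = int j)"
        by (rule T_blk) (auto simp: less_Suc_eq)
    qed simp
  qed simp
  have capev: "ev W (V 7) v \<mu> = int cap" if "?P v \<mu>" for v \<mu> using env[OF that] by (simp add: env_def)
  have middle: "T W (\<lambda>v \<mu>. ?I k i v \<mu> \<and> v 30 = int i) (loop 31 (V 7) (Seq (blk ?c1) ?c2)) (cap * 170 + 20)
     (\<lambda>v \<mu>. ?I k (Suc i) v \<mu> \<and> v 30 = int i)" if k: "k < Bc" and i: "i < cap" for k i
  proof (rule T_weaken)
    show "T W (?J k i 0) (loop 31 (V 7) (Seq (blk ?c1) ?c2)) (cap * 170 + 20) (?J k i cap)"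
      by (rule T_loop[where I = "?J k i", OF inner[OF k i] _ capev cap_word])
        (use W_16 in \<open>auto simp: loop_time_def\<close>)
  qed (auto simp: less_Suc_eq)
  have outer: "T W (\<lambda>v \<mu>. ?K k v \<mu> \<and> v 36 = int k) (Seq (blk [As 25 (Ld (V 34 \<boxplus> V 36)), As 26 r2E])
     (loop 30 (V 7) (loop 31 (V 7) (Seq (blk ?c1) ?c2)))) (cap * (cap * 170 + 40) + 80)
     (\<lambda>v \<mu>. ?K (Suc k) v \<mu> \<and> v 36 = int k)" if k: "k < Bc" for k
  proof (rule T_Seq)
    have kH: "int k < H" using k Bc_N N_H by linarith
    show "T W (\<lambda>v \<mu>. ?K k v \<mu> \<and> v 36 = int k) (blk [As 25 (Ld (V 34 \<boxplus> V 36)), As 26 r2E]) 40 (?I k 0)"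
    proof (rule T_blk)
      fix v \<mu> assume a: "?K k v \<mu> \<and> v 36 = int k"
      hence P: "?P v \<mu>" by blast
      have e1: "ev W (Ld (V 34 \<boxplus> V 36)) v \<mu> = int (idx k)"
        using a vv[OF P] Bs_word[of "2 * H + int k"] kH H_pos row[OF k] by (simp add: add.assoc)
      have e2: "ev W r2E (v(25 := int (idx k))) \<mu> = int (r2 u (idx k))"
        using vv[OF P] env[OF P] row[OF k] by (intro ev_r2[OF _ _ _ u]) auto
      show "wp W [As 25 (Ld (V 34 \<boxplus> V 36)), As 26 r2E] (?I k 0) v \<mu>"
        unfolding wp.simps e1 e2 using a by simp
    qed (simp add: r2E_def)
    show "T W (?I k 0) (loop 30 (V 7) (loop 31 (V 7) (Seq (blk ?c1) ?c2))) (cap * (cap * 170 + 40) + 20)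
      (\<lambda>v \<mu>. ?K (Suc k) v \<mu> \<and> v 36 = int k)"
    proof (rule T_weaken)
      show "T W (?I k 0) (loop 30 (V 7) (loop 31 (V 7) (Seq (blk ?c1) ?c2))) (cap * (cap * 170 + 40) + 20) (?I k cap)"
        by (rule T_loop[where I = "?I k", OF middle[OF k] _ capev cap_word])
          (use W_16 in \<open>auto simp: loop_time_def algebra_simps\<close>)
    qed (auto simp: less_Suc_eq hit_def)
  qed simp
  have "T W (?K 0) verify_code (Bc * (cap * (cap * 170 + 40) + 100) + 20) (?K Bc)"
    unfolding verify_code_def
  proof (rule T_loop[where I = ?K, OF outer])
    show "Bc < 2 ^ W"
    proof -
      have "int Bc < 2 ^ W" using Bc_N N_word by linarith
      thus ?thesis by (metis of_nat_less_iff of_nat_numeral of_nat_power)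
    qed
    show "ev W (V 15) v \<mu> = int Bc" if "?K k v \<mu>" for k v \<mu> using env[OF conjunct1[OF that]] by (simp add: env_def)
  qed (use W_16 in \<open>auto simp: loop_time_def algebra_simps\<close>)
  thus ?thesis by (rule T_weaken) (use assms(4) in auto)
qed

lemma T_rest:
  assumes "after v1 \<mu>1"
  shows "T W (\<lambda>v \<mu>. v = v1 \<and> \<mu> = \<mu>1) (Seq (blk [As 37 (K 0), As 34 (V 34 \<boxplus> V 16)]) (Seq collect_code verify_code))
    (N * 100 + Bc * (cap * (cap * 170 + 40) + 100) + 80)
    (\<lambda>v \<mu>. (Inv (Suc u) v \<mu> \<and> v 20 = int u \<and> (v0 19 \<noteq> 0 \<longrightarrow> v 19 \<noteq> 0)) \<and>
      ((\<exists>r\<in>set (take Bc (filter (\<lambda>r. \<mu>1 (Bs + int r) \<noteq> 0) [0..<N])). hit u r) \<longrightarrow> v 19 \<noteq> 0))"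
proof -
  let ?l = "take Bc (filter (\<lambda>r. \<mu>1 (Bs + int r) \<noteq> 0) [0..<N])"
  have a: "st v1" "v1 34 = Bs + H" "tab \<mu>1" "\<And>z. Bs + 2 * H \<le> z \<Longrightarrow> z < 2 ^ W \<Longrightarrow> \<mu>1 z = 0"
    using assms by (auto simp: after_def)
  have v16: "v1 16 = H" using a(1) env_X0 by (auto simp: st_def env_def)
  define v2 where "v2 = v1(37 := 0, 34 := Bs + 2 * H)"
  have 1: "T W (\<lambda>v \<mu>. v = v1 \<and> \<mu> = \<mu>1) (blk [As 37 (K 0), As 34 (V 34 \<boxplus> V 16)]) 15 (\<lambda>v \<mu>. v = v2 \<and> \<mu> = \<mu>1)"
    proof (rule T_blk)
    have "Bs + H + H = Bs + 2 * H" by simp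
    hence e: "ev W (V 34 \<boxplus> V 16) (v1(37 := 0)) \<mu> = Bs + 2 * H" for \<mu>
      using Bs_word[of "2 * H"] H_pos by (simp only: ev.simps) (simp add: a(2) v16 add.assoc)
    show "wp W [As 37 (K 0), As 34 (V 34 \<boxplus> V 16)] (\<lambda>v \<mu>. v = v2 \<and> \<mu> = \<mu>1) v \<mu>" if "v = v1 \<and> \<mu> = \<mu>1" for v \<mu>
      using that e unfolding wp.simps by (simp add: v2_def)
  qed simp
  have s2: "st v2" "v2 34 = Bs + 2 * H" "v2 37 = 0" using a(1) by (auto simp: st_def v2_def)
  let ?m = "put W (Bs + 2 * H) (map int ?l) \<mu>1"
  define idx where "idx k = (if k < length ?l then ?l ! k else 0)" for k
  have row: "?m (Bs + 2 * H + int k) = int (idx k) \<and> idx k < N" if "k < Bc" for k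
  proof (cases "k < length ?l")
    case True
    have "?l ! k \<in> set ?l" using True by (rule nth_mem)
    hence "?l ! k < N" by (auto dest: in_set_takeD)
    moreover have "wrap W (int (?l ! k)) = int (?l ! k)" using \<open>?l ! k < N\<close> N_word by (intro wrap_idI) auto
    ultimately show ?thesis using True by (simp add: idx_def put_def del: nth_take)
  next
    case False
    have "int k < H" using that Bc_N N_H by linarith
    hence "\<mu>1 (Bs + 2 * H + int k) = 0" using Bs H_pos by (intro a(4)) linarith+
    moreover have "idx k = 0" using False by (simp only: idx_def if_False)
    moreover have "?m (Bs + 2 * H + int k) = \<mu>1 (Bs + 2 * H + int k)" using False by (auto simp: put_def)
    ultimately show ?thesis using N_pos by simp
  qed
  have len: "int (length ?l) \<le> H" using Bc_N N_H by simp
  have tabm: "tab ?m" by (rule tab_cong[OF a(3)]) (use Bs H_pos in \<open>simp add: put_def\<close>)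
  let ?R = "\<lambda>v \<mu>. (Inv (Suc u) v \<mu> \<and> v 20 = int u \<and> (v0 19 \<noteq> 0 \<longrightarrow> v 19 \<noteq> 0)) \<and> ((\<exists>r\<in>set ?l. hit u r) \<longrightarrow> v 19 \<noteq> 0)"
  have 3: "T W (\<lambda>v \<mu>. eqx {25, 37} v v2 \<and> \<mu> = ?m) verify_code (Bc * (cap * (cap * 170 + 40) + 100) + 20) ?R"
  proof (rule T_exact)
    fix v3 \<mu>3 assume b: "eqx {25, 37} v3 v2 \<and> \<mu>3 = ?m"
    have e30: "eqx X0 v3 v0" by (rule eqx_trans[OF conjunct1[OF b], of X0 v0]) (use s2(1) in \<open>auto simp: st_def\<close>)
    hence s3: "st v3" "v3 34 = Bs + 2 * H" "v3 19 = v0 19"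
      using eqxD[OF conjunct1[OF b]] s2 v19 by (auto simp: st_def)
    have f: "v3 19 \<noteq> 0 \<Longrightarrow> sol" using facts0(4) s3(3) by simp
    show "T W (\<lambda>v \<mu>. v = v3 \<and> \<mu> = \<mu>3) verify_code (Bc * (cap * (cap * 170 + 40) + 100) + 20) ?R"
    proof (rule T_weaken[OF T_verify[OF s3(1,2) _ f, of \<mu>3 idx]])
      show "tab \<mu>3" using b tabm by simp
      show "\<mu>3 (Bs + 2 * H + int k) = int (idx k) \<and> idx k < N" if "k < Bc" for k using b row[OF that] by simp
      fix v \<mu> assume c: "\<mu> = \<mu>3 \<and> eqx {19, 25, 26, 30, 31, 32, 33, 36} v v3 \<and> (v 19 \<noteq> 0 \<longrightarrow> sol) \<and> (v3 19 \<noteq> 0 \<longrightarrow> v 19 \<noteq> 0) \<and>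
       (\<forall>k<Bc. hit u (idx k) \<longrightarrow> v 19 \<noteq> 0)"
      have ve: "env v" using env_X0[OF e30] env_eqx[of v3 "{19, 25, 26, 30, 31, 32, 33, 36}" v] c by auto
      have v20': "v 20 = int u" using eqxD[of "{19, 25, 26, 30, 31, 32, 33, 36}" v v3 20] c v20[OF e30] by auto
      have "?m z = 0" if "(4 * int (Suc u) + 9) * H \<le> z" "z < 2 ^ W" for z
      proof -
        have "Bs + 3 * H \<le> z" using that(1) by (simp add: Bs_def algebra_simps)
        thus ?thesis using a(4)[of z] that(2) len H_pos by (auto simp: put_def)
      qed
      hence "Inv (Suc u) v \<mu>" using ve tabm b c by (auto simp: Inv_def)
      moreover have "v 19 \<noteq> 0" if "r \<in> set ?l" "hit u r" for r
      proof -
        from that(1) obtain k where k: "k < length ?l" "r = ?l ! k" unfolding in_set_conv_nth by blast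
        have "k < Bc" using k(1) by simp
        moreover have "idx k = r" unfolding idx_def using k by (simp only: if_True)
        ultimately show ?thesis using c that(2) by blast
      qed
      moreover have "v0 19 \<noteq> 0 \<longrightarrow> v 19 \<noteq> 0" using c s3(3) by metis
      ultimately show "?R v \<mu>" using v20' by blast
    qed auto
  qed
  show ?thesis
    by (rule T_Seq[OF 1 T_Seq[OF T_collect[OF s2 a(4)] 3 order_refl]]) auto
qed

text \<open>That a raised flag stays raised is part of the certain postcondition; it makes detection
  stable under all later rounds.\<close>

lemma HT_round: "HT W (\<lambda>v \<mu>. v = v0 \<and> \<mu> = \<mu>0) (round_code p) round_time
    (\<lambda>v \<mu>. Inv (Suc u) v \<mu> \<and> v 20 = int u \<and> (v0 19 \<noteq> 0 \<longrightarrow> v 19 \<noteq> 0)) \<pi> (\<lambda>v \<mu>. good u \<longrightarrow> v 19 \<noteq> 0)"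
proof -
  let ?Q = "\<lambda>v \<mu>. Inv (Suc u) v \<mu> \<and> v 20 = int u \<and> (v0 19 \<noteq> 0 \<longrightarrow> v 19 \<noteq> 0)"
  let ?c = "Seq (blk [As 37 (K 0), As 34 (V 34 \<boxplus> V 16)]) (Seq collect_code verify_code)"
  let ?t = "N * 100 + Bc * (cap * (cap * 170 + 40) + 100) + 80"
  have r1: "T W after ?c ?t ?Q"
    by (rule T_exact, rule T_weaken[OF T_rest]) auto
  have "T W (\<lambda>v \<mu>. after v \<mu> \<and> correct v \<mu>) ?c ?t (\<lambda>v \<mu>. ?Q v \<mu> \<and> (good u \<longrightarrow> v 19 \<noteq> 0))"
  proof (rule T_exact)
    fix v1 \<mu>1 assume a: "after v1 \<mu>1 \<and> correct v1 \<mu>1"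
    hence f: "filter (\<lambda>r. \<mu>1 (Bs + int r) \<noteq> 0) [0..<N] = filter (posi u) [0..<N]"
      by (intro filter_cong) (auto simp: correct_def)
    show "T W (\<lambda>v \<mu>. v = v1 \<and> \<mu> = \<mu>1) ?c ?t (\<lambda>v \<mu>. ?Q v \<mu> \<and> (good u \<longrightarrow> v 19 \<noteq> 0))"
      by (rule T_weaken[OF T_rest]) (use a good_verified[of u] in \<open>auto simp: f\<close>)
  qed
  from HT_certain[OF this]
  have r2: "HT W (\<lambda>v \<mu>. after v \<mu> \<and> correct v \<mu>) ?c ?t ?Q 1 (\<lambda>v \<mu>. good u \<longrightarrow> v 19 \<noteq> 0)"
    by (rule HT_weaken) auto
  have r3: "HT W (\<lambda>v \<mu>. st v \<and> v 34 = Bs + H \<and> (\<exists>R S. rows_ok R N \<and> vec_ok S \<and>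
      (\<forall>z<Bs + H. \<mu> z = put w Bs (xs R @ encode_slp S) \<mu>0 z) \<and> (\<forall>z\<ge>Bs + 2 * H. \<mu> z = \<mu>0 z)))
    (Seq (call p) ?c) (5 * tp + 2 * reg_bound p + 12 + 1 + ?t) ?Q (\<pi> * 1) (\<lambda>v \<mu>. good u \<longrightarrow> v 19 \<noteq> 0)"
    by (rule HT_Seq[OF HT_call_round r1 r2]) simp
  have "HT W (\<lambda>v \<mu>. v = v0 \<and> \<mu> = \<mu>0) (round_code p) (120 + 1 + (N * (n * 700 + 80) + 20 + 1 + (n * 700 + 1 +
     (5 * tp + 2 * reg_bound p + 12 + 1 + ?t)))) ?Q (\<pi> * 1) (\<lambda>v \<mu>. good u \<longrightarrow> v 19 \<noteq> 0)"
    unfolding round_code_def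
    by (rule T_HT_Seq[OF T_start T_HT_Seq[OF T_rows T_HT_Seq[OF T_vector r3]]]) (use \<pi> in auto)
  thus ?thesis by (rule HT_weaken) (auto simp: round_time_def)
qed

end

end


section \<open>Filling the hash tables\<close>

text \<open>Elements beyond the capacity are dropped. This can hide a solution but never create one,
  so overflow only affects the success probability.\<close>

definition bucket :: "(int \<Rightarrow> nat) \<Rightarrow> nat \<Rightarrow> int list \<Rightarrow> nat \<Rightarrow> int list" where
  "bucket h c X r = take c (filter (\<lambda>x. h x = r) X)"

definition bucket_cell :: "(int \<Rightarrow> nat) \<Rightarrow> nat \<Rightarrow> int list \<Rightarrow> nat \<Rightarrow> nat \<Rightarrow> int" where
  "bucket_cell h c X r j = (if j < length (bucket h c X r) then bucket h c X r ! j else 0)"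

lemma bucket_cell_cases: "bucket_cell h c X r j = 0 \<or> bucket_cell h c X r j \<in> set X"
proof -
  have "x \<in> set (bucket h c X r) \<Longrightarrow> x \<in> set X" for x by (auto simp: bucket_def dest: in_set_takeD)
  thus ?thesis unfolding bucket_cell_def by (metis nth_mem)
qed

lemma bucket_snoc: "bucket h c (X @ [x]) r =
    bucket h c X r @ (if h x = r \<and> length (bucket h c X r) < c then [x] else [])"
  by (auto simp: bucket_def)

lemma bucket_cell_stored:
  assumes "x \<in> set X" "h x = r" "length (filter (\<lambda>x. h x = r) X) \<le> c"
  shows "\<exists>j<c. bucket_cell h c X r j = x"
proof -
  have b: "bucket h c X r = filter (\<lambda>x. h x = r) X" using assms(3) by (simp add: bucket_def)
  have "x \<in> set (bucket h c X r)" using assms b by simp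
  then obtain j where "j < length (bucket h c X r)" "bucket h c X r ! j = x" by (metis in_set_conv_nth)
  thus ?thesis using assms(3) b by (intro exI[of _ j]) (simp add: bucket_cell_def)
qed

text \<open>The input starts with \<open>m\<close> and \<open>U\<close>, hence the offset 2;
  \<open>X\<close> is 0, 1 or 2 for the sets \<open>A\<close>, \<open>B\<close>, \<open>C\<close>.
  The same number selects the block \<open>2 + X\<close> for the slots and \<open>5 + X\<close> for
  the counters.\<close>

definition inputE :: "int \<Rightarrow> aexp" where
  "inputE X = Ld (K 2 \<boxplus> K X \<boxtimes> V 3 \<boxplus> V 30)"

definition fill_code :: "int \<Rightarrow> com" where
  "fill_code X = loop 30 (V 3) (Seq (blk [As 33 (inputE X), As 32 (hashE 17 13 9 33), As 31 (Ld (K (5 + X) \<boxtimes> V 16 \<boxplus> V 32))])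
     (iff (Bi Less (V 31) (V 7)) (blk [St (K (2 + X) \<boxtimes> V 16 \<boxplus> (V 32 \<boxtimes> V 39 \<boxplus> V 31)) (V 33),
        St (K (5 + X) \<boxtimes> V 16 \<boxplus> V 32) (V 31 \<boxplus> K 1)]) (blk [])))"

definition table_code :: com where
  "table_code = loop 30 (V 3) (blk [St (V 16 \<boxplus> inputE 2) (K 1)])"

definition fill_all :: com where
  "fill_all = Seq (fill_code 0) (Seq (fill_code 1) (Seq (fill_code 2) table_code))"

context params
begin

abbreviation h1 :: "int \<Rightarrow> nat" where "h1 \<equiv> hsh W \<nu> \<alpha>1"

lemma h1_less: "h1 x < N"
  unfolding N_def using hsh_less L_W(2) .

definition filled :: "int \<Rightarrow> int list \<Rightarrow> (int \<Rightarrow> int) \<Rightarrow> (int \<Rightarrow> int) \<Rightarrow> bool" where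
  "filled X xs \<mu>0 \<mu> \<longleftrightarrow> (\<forall>r<N. \<mu> ((5 + X) * H + int r) = int (length (bucket h1 cap xs r))) \<and>
     (\<forall>r<N. \<forall>j<cap. slot \<mu> (2 + X) r j = bucket_cell h1 cap xs r j) \<and>
     (\<forall>z. \<not> ((2 + X) * H \<le> z \<and> z < (3 + X) * H) \<and> \<not> ((5 + X) * H \<le> z \<and> z < (6 + X) * H) \<longrightarrow> \<mu> z = \<mu>0 z)"

lemma slot_upd:
  assumes "r < N" "j < cap" "r' < N" "j' < cap"
  shows "slot (\<mu>(b * H + (int r * 2 ^ D + int j) := x)) b r' j' = (if r = r' \<and> j = j' then x else slot \<mu> b r' j')"
proof -
  have dm: "(x * 2 ^ D + y) div 2 ^ D = x" "(x * 2 ^ D + y) mod 2 ^ D = y" if "y < cap" for x y :: nat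
    using that by (auto simp: cap_def)
  have "r = r' \<and> j = j'" if "int r * 2 ^ D + int j = int r' * 2 ^ D + int j'"
  proof -
    have "int (r * 2 ^ D + j) = int (r' * 2 ^ D + j')" using that by simp
    hence "r * 2 ^ D + j = r' * 2 ^ D + j'" by (simp only: of_nat_eq_iff)
    thus ?thesis using dm[OF assms(2), of r] dm[OF assms(4), of r'] by simp
  qed
  thus ?thesis by (auto simp: slot_def fun_upd_apply)
qed

lemma ev_input:
  assumes "2 + 3 * int m \<le> H" "v 3 = int m" "0 \<le> X" "X \<le> 2" "v 30 = int i" "i < m"
  shows "ev W (inputE X) v \<mu> = \<mu> (2 + X * int m + int i)"
proof -
  have "X * int m \<le> 2 * int m" using assms(4) by (intro mult_right_mono) auto
  moreover have "0 \<le> X * int m" using assms(3) by simp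
  ultimately have "wrap W (2 + X * int m + int i) = 2 + X * int m + int i"
    using assms H_pos by (intro wrapH) linarith+
  thus ?thesis using assms(2,5) by (simp add: inputE_def wrap_ring)
qed

lemma T_fill:
  assumes env: "env v1" "v1 3 = int (length xs)" and X: "0 \<le> X" "X \<le> 2" and m: "2 + 3 * int (length xs) \<le> H"
    and xs: "\<And>i. i < length xs \<Longrightarrow> \<mu>0 (2 + X * int (length xs) + int i) = xs ! i"
    and zero: "\<And>z. (2 + X) * H \<le> z \<Longrightarrow> z < (3 + X) * H \<Longrightarrow> \<mu>0 z = 0" "\<And>z. (5 + X) * H \<le> z \<Longrightarrow> z < (6 + X) * H \<Longrightarrow> \<mu>0 z = 0"
  shows "T W (\<lambda>v \<mu>. v = v1 \<and> \<mu> = \<mu>0) (fill_code X) (length xs * 150 + 20)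
    (\<lambda>v \<mu>. eqx {30, 31, 32, 33} v v1 \<and> filled X xs \<mu>0 \<mu>)"
proof -
  let ?m = "length xs"
  let ?I = "\<lambda>i v \<mu>. eqx {30, 31, 32, 33} v v1 \<and> filled X (take i xs) \<mu>0 \<mu>"
  let ?b = "\<lambda>i. bucket h1 cap (take i xs)"
  have XH: "0 \<le> X * H" "X * H \<le> 2 * H" using X H_pos by (auto intro: mult_right_mono)
  have mW: "length xs < 2 ^ W"
  proof -
    have "int (length xs) < 2 ^ W" using m H_lt by linarith
    thus ?thesis by (metis of_nat_less_iff of_nat_numeral of_nat_power)
  qed
  have cnt: "wrap W ((5 + X) * H + int r) = (5 + X) * H + int r" if "r < N" for r
  proof -
    have "int r < int N" using that by simp
    thus ?thesis using N_H XH H_pos unfolding distrib_right by (intro wrapH) linarith+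
  qed
  have cel: "wrap W ((2 + X) * H + (int r * 2 ^ D + int j)) = (2 + X) * H + (int r * 2 ^ D + int j)"
    "int r * 2 ^ D + int j < H" if "r < N" "j < cap" for r j
  proof -
    have "int j < 2 ^ D" using cap_less[OF that(2)] by linarith
    note b = bucket_bound(1,2)[OF that(1) of_nat_0_le_iff this]
    thus "wrap W ((2 + X) * H + (int r * 2 ^ D + int j)) = (2 + X) * H + (int r * 2 ^ D + int j)"
      "int r * 2 ^ D + int j < H" using XH H_pos b unfolding distrib_right by (intro wrapH, linarith, linarith, intro b)
  qed
  have lp: "T W (?I 0) (fill_code X) (?m * 150 + 20) (?I ?m)"
    unfolding fill_code_def
  proof (rule T_loop[where I = ?I])
    fix i assume i: "i < ?m"
    let ?x = "xs ! i"
    let ?r = "h1 ?x"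
    let ?c1 = "[As 33 (inputE X), As 32 (hashE 17 13 9 33), As 31 (Ld (K (5 + X) \<boxtimes> V 16 \<boxplus> V 32))]"
    let ?c2 = "[St (K (2 + X) \<boxtimes> V 16 \<boxplus> (V 32 \<boxtimes> V 39 \<boxplus> V 31)) (V 33), St (K (5 + X) \<boxtimes> V 16 \<boxplus> V 32) (V 31 \<boxplus> K 1)]"
    have snoc: "?b (Suc i) r = ?b i r @ (if ?r = r \<and> length (?b i r) < cap then [?x] else [])" for r
      using i by (simp add: take_Suc_conv_app_nth bucket_snoc)
    let ?M = "\<lambda>v \<mu>. (?I i v \<mu> \<and> v 30 = int i) \<and> v 33 = ?x \<and> v 32 = int ?r \<and> v 31 = int (length (?b i ?r))"
    show "T W (\<lambda>v \<mu>. ?I i v \<mu> \<and> v 30 = int i) (Seq (blk ?c1) (iff (Bi Less (V 31) (V 7)) (blk ?c2) (blk []))) 120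
       (\<lambda>v \<mu>. ?I (Suc i) v \<mu> \<and> v 30 = int i)"
    proof (rule T_Seq[where ?t2.0 = 70])
      show "T W (\<lambda>v \<mu>. ?I i v \<mu> \<and> v 30 = int i) (blk ?c1) 49 ?M"
      proof (rule T_blk)
        fix v \<mu> assume a: "?I i v \<mu> \<and> v 30 = int i"
        have e: "env v" using env_eqx[OF env(1), of "{30, 31, 32, 33}" v] a by auto
        have v3: "v 3 = int ?m" using a env(2) eqxD[of "{30, 31, 32, 33}" v v1 3] by auto
        have "\<mu> (2 + X * int ?m + int i) = \<mu>0 (2 + X * int ?m + int i)"
        proof -
          have "X * int ?m \<le> 2 * int ?m" using X by (intro mult_right_mono) auto
          hence "2 + X * int ?m + int i < 2 * H" using m i H_pos by linarith
          thus ?thesis using a XH H_pos unfolding filled_def distrib_right by auto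
        qed
        hence e1: "ev W (inputE X) v \<mu> = ?x" using xs[OF i] a by (simp add: ev_input[where v = v and X = X and i = i and \<mu> = \<mu>, OF m v3 X _ i])
        let ?v1 = "v(33 := ?x)"
        have e2: "ev W (hashE 17 13 9 33) ?v1 \<mu> = int ?r" using ev_hash1[of ?v1 33 \<mu>] e by simp
        let ?v2 = "?v1(32 := int ?r)"
        have "?v2 16 = H" using e by (simp add: env_def)
        hence e3: "ev W (Ld (K (5 + X) \<boxtimes> V 16 \<boxplus> V 32)) ?v2 \<mu> = int (length (?b i ?r))"
          using cnt[OF h1_less] a h1_less[of ?x] by (simp add: wrap_ring filled_def)
        show "wp W ?c1 ?M v \<mu>" unfolding wp.simps e1 e2 e3 using a by simp
      qed (simp add: inputE_def hashE_def)
      show "T W ?M (iff (Bi Less (V 31) (V 7)) (blk ?c2) (blk [])) 70 (\<lambda>v \<mu>. ?I (Suc i) v \<mu> \<and> v 30 = int i)"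
      proof (rule T_iff[where t = 60])
        show "T W (\<lambda>v \<mu>. ?M v \<mu> \<and> ev W (Bi Less (V 31) (V 7)) v \<mu> \<noteq> 0) (blk ?c2) 60 (\<lambda>v \<mu>. ?I (Suc i) v \<mu> \<and> v 30 = int i)"
        proof (rule T_blk)
          fix v \<mu> assume a: "?M v \<mu> \<and> ev W (Bi Less (V 31) (V 7)) v \<mu> \<noteq> 0"
          have e: "env v" using env_eqx[OF env(1), of "{30, 31, 32, 33}" v] a by auto
          define k where "k = length (?b i ?r)"
          have vv: "v 33 = ?x" "v 32 = int ?r" "v 31 = int k" "v 16 = H" "v 39 = 2 ^ D" "v 7 = int cap"
            using a e by (auto simp: env_def k_def)
          have k: "k < cap" using a vv by (simp split: if_splits)
          note cel' = cel[OF h1_less k, of ?x]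
          have e1: "ev W (K (2 + X) \<boxtimes> V 16 \<boxplus> (V 32 \<boxtimes> V 39 \<boxplus> V 31)) v \<mu> = (2 + X) * H + (int ?r * 2 ^ D + int k)"
            using vv cel' by (simp add: wrap_ring)
          have e2: "ev W (K (5 + X) \<boxtimes> V 16 \<boxplus> V 32) v \<mu>' = (5 + X) * H + int ?r" for \<mu>'
            using vv cnt[OF h1_less, of ?x] by (simp add: wrap_ring)
          have e3: "ev W (V 31 \<boxplus> K 1) v \<mu>' = int (Suc k)" for \<mu>'
          proof -
            have "(2::nat) ^ D \<le> N" unfolding N_def by (intro power_increasing) (auto simp: \<nu>_def)
            hence "int (Suc k) \<le> int N" using k by (simp add: cap_def)
            hence "wrap W (int (Suc k)) = int (Suc k)" using N_H H_pos by (intro wrapH) linarith+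
            thus ?thesis using vv by (simp add: add.commute)
          qed
          have e4: "ev W (V 33) v \<mu>' = ?x" for \<mu>' using vv by simp
          let ?\<mu>1 = "\<mu>((2 + X) * H + (int ?r * 2 ^ D + int k) := ?x)"
          let ?\<mu>2 = "?\<mu>1((5 + X) * H + int ?r := int (Suc k))"
          have cl: "0 \<le> int r * 2 ^ D + int j" "int r * 2 ^ D + int j < H" if "r < N" "j < cap" for r j
            using cel(2)[OF that] by auto
          have rH: "int r < H" if "r < N" for r using that N_H by linarith
          have f: "filled X (take i xs) \<mu>0 \<mu>" using a by blast
          have "filled X (take (Suc i) xs) \<mu>0 ?\<mu>2"
            unfolding filled_def
          proof (intro conjI allI impI)
            fix r assume r: "r < N"
            have "(2 + X) * H + (int ?r * 2 ^ D + int k) \<noteq> (5 + X) * H + int r"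
              using cl[OF h1_less k, of ?x] H_pos unfolding distrib_right by linarith
            thus "?\<mu>2 ((5 + X) * H + int r) = int (length (?b (Suc i) r))"
              using f r k unfolding snoc by (auto simp: fun_upd_apply filled_def k_def)
            fix j assume j: "j < cap"
            have "(5 + X) * H + int ?r \<noteq> (2 + X) * H + (int r * 2 ^ D + int j)"
              using cl[OF r j] H_pos unfolding distrib_right by linarith
            hence "slot ?\<mu>2 (2 + X) r j = slot ?\<mu>1 (2 + X) r j" by (simp add: slot_def fun_upd_apply)
            also have "\<dots> = (if ?r = r \<and> k = j then ?x else slot \<mu> (2 + X) r j)" by (rule slot_upd[OF h1_less k r j])
            also have "\<dots> = bucket_cell h1 cap (take (Suc i) xs) r j"
              using f r j k unfolding bucket_cell_def snoc by (auto simp: filled_def bucket_cell_def k_def nth_append)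
            finally show "slot ?\<mu>2 (2 + X) r j = bucket_cell h1 cap (take (Suc i) xs) r j" .
          next
            fix z assume z: "\<not> ((2 + X) * H \<le> z \<and> z < (3 + X) * H) \<and> \<not> ((5 + X) * H \<le> z \<and> z < (6 + X) * H)"
            have "z \<noteq> (2 + X) * H + (int ?r * 2 ^ D + int k)" "z \<noteq> (5 + X) * H + int ?r"
              using z cl[OF h1_less k, of ?x] rH[OF h1_less, of ?x] unfolding distrib_right by auto
            thus "?\<mu>2 z = \<mu>0 z" using f z by (auto simp: fun_upd_apply filled_def)
          qed
          thus "wp W ?c2 (\<lambda>v \<mu>. ?I (Suc i) v \<mu> \<and> v 30 = int i) v \<mu>"
            unfolding wp.simps e1 e2 e3 e4 using a by blast
        qed simp
        show "T W (\<lambda>v \<mu>. ?M v \<mu> \<and> ev W (Bi Less (V 31) (V 7)) v \<mu> = 0) (blk []) 60 (\<lambda>v \<mu>. ?I (Suc i) v \<mu> \<and> v 30 = int i)"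
        proof (rule T_blk)
          fix v \<mu> assume a: "?M v \<mu> \<and> ev W (Bi Less (V 31) (V 7)) v \<mu> = 0"
          have "env v" using env_eqx[OF env(1), of "{30, 31, 32, 33}" v] a by auto
          hence "v 7 = int cap" "v 31 = int (length (?b i ?r))" using a by (auto simp: env_def)
          hence k: "\<not> length (?b i ?r) < cap" using a by (simp split: if_splits)
          have s: "?b (Suc i) r = ?b i r" for r unfolding snoc using k by auto
          have "filled X (take (Suc i) xs) \<mu>0 \<mu>" using a unfolding filled_def bucket_cell_def s by blast
          thus "wp W [] (\<lambda>v \<mu>. ?I (Suc i) v \<mu> \<and> v 30 = int i) v \<mu>" using a by simp
        qed simp
      qed simp
    qed simp
  next
    show "ev W (V 3) v \<mu> = int ?m" if "?I i v \<mu>" for i v \<mu>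
      using that env(2) eqxD[of "{30, 31, 32, 33}" v v1 3] by auto
  qed (use W_16 mW in \<open>auto simp: loop_time_def\<close>)
  have "filled X [] \<mu>0 \<mu>0"
    unfolding filled_def
  proof (intro conjI allI impI)
    fix r assume r: "r < N"
    show "\<mu>0 ((5 + X) * H + int r) = int (length (bucket h1 cap [] r))"
      using zero(2)[of "(5 + X) * H + int r"] r N_H H_pos by (simp add: bucket_def distrib_right)
    fix j assume j: "j < cap"
    have "0 \<le> int r * 2 ^ D + int j" by simp
    hence "slot \<mu>0 (2 + X) r j = 0" unfolding slot_def
      using cel(2)[OF r j] H_pos by (intro zero(1)) (unfold distrib_right, linarith+)
    thus "slot \<mu>0 (2 + X) r j = bucket_cell h1 cap [] r j" by (simp add: bucket_cell_def bucket_def)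
  qed simp
  hence "?I 0 v1 \<mu>0" by (simp only: take_0 eqx_refl)
  with lp[unfolded take_all[OF order_refl]] show ?thesis
    by (elim T_weaken) (simp_all only: order_refl)
qed

lemma T_table:
  assumes env: "env v1" "v1 3 = int (length xs)" and m: "2 + 3 * int (length xs) \<le> H"
    and xs: "\<And>i. i < length xs \<Longrightarrow> \<mu>0 (2 + 2 * int (length xs) + int i) = xs ! i" "set xs \<subseteq> {1..int U}"
  shows "T W (\<lambda>v \<mu>. v = v1 \<and> \<mu> = \<mu>0) table_code (length xs * 60 + 20)
    (\<lambda>v \<mu>. eqx {30} v v1 \<and> \<mu> = (\<lambda>z. if z - H \<in> set xs then 1 else \<mu>0 z))"
proof -
  let ?m = "length xs"
  let ?I = "\<lambda>i v \<mu>. eqx {30} v v1 \<and> \<mu> = (\<lambda>z. if z - H \<in> set (take i xs) then 1 else \<mu>0 z)"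
  have mW: "length xs < 2 ^ W"
  proof -
    have "int (length xs) < 2 ^ W" using m H_lt by linarith
    thus ?thesis by (metis of_nat_less_iff of_nat_numeral of_nat_power)
  qed
  have "T W (?I 0) table_code (?m * 60 + 20) (?I ?m)"
    unfolding table_code_def
  proof (rule T_loop[where I = ?I])
    fix i assume i: "i < ?m"
    show "T W (\<lambda>v \<mu>. ?I i v \<mu> \<and> v 30 = int i) (blk [St (V 16 \<boxplus> inputE 2) (K 1)]) 40 (\<lambda>v \<mu>. ?I (Suc i) v \<mu> \<and> v 30 = int i)"
    proof (rule T_blk)
      fix v \<mu> assume a: "?I i v \<mu> \<and> v 30 = int i"
      have v: "v 3 = int ?m" "v 16 = H"
        using a env eqxD[of "{30}" v v1 3] eqxD[of "{30}" v v1 16] by (auto simp: env_def)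
      have x: "1 \<le> xs ! i" "xs ! i \<le> int U" using xs(2) nth_mem[OF i] by auto
      have sub: "1 \<le> y" if "y \<in> set (take i xs)" for y using that xs(2) by (auto dest: in_set_takeD)
      have "\<mu> (2 + 2 * int ?m + int i) = \<mu>0 (2 + 2 * int ?m + int i)"
        using a sub[of "2 + 2 * int ?m + int i - H"] m i by auto
      moreover have "ev W (inputE 2) v \<mu> = \<mu> (2 + 2 * int ?m + int i)"
        by (rule ev_input[where v = v and X = 2 and i = i and \<mu> = \<mu>, OF m v(1)]) (use a i in auto)
      ultimately have "ev W (inputE 2) v \<mu> = xs ! i" using xs(1)[OF i] by simp
      moreover have "wrap W (H + xs ! i) = H + xs ! i" using x H_U H_pos by (intro wrapH) linarith+
      ultimately have e: "ev W (V 16 \<boxplus> inputE 2) v \<mu> = H + xs ! i" "ev W (K 1) v \<mu> = 1" using v(2) by simp_all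
      have "set (take (Suc i) xs) = insert (xs ! i) (set (take i xs))" using i by (simp add: take_Suc_conv_app_nth)
      thus "wp W [St (V 16 \<boxplus> inputE 2) (K 1)] (\<lambda>v \<mu>. ?I (Suc i) v \<mu> \<and> v 30 = int i) v \<mu>"
        unfolding wp.simps e using a by (auto simp: fun_eq_iff fun_upd_apply)
    qed (simp add: inputE_def)
  next
    show "ev W (V 3) v \<mu> = int ?m" if "?I i v \<mu>" for i v \<mu>
      using that env(2) eqxD[of "{30}" v v1 3] by auto
  qed (use W_16 mW in \<open>auto simp: loop_time_def\<close>)
  thus ?thesis by (rule T_weaken) auto
qed

end


section \<open>The loop over all rounds\<close>

definition outer_code :: "com \<Rightarrow> com" where
  "outer_code p = loop 20 (K 2 \<boxtimes> V 9) (round_code p)"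

definition tail_code :: "com \<Rightarrow> com" where
  "tail_code p = Seq fill_all (Seq (outer_code p) (blk [St (K 0) (V 19)]))"

locale reduction = search +
  fixes A B C :: "int list" and m :: nat
  assumes lens: "length A = m" "length B = m" "length C = m"
    and sets: "SA = set A" "SB = set B" "SC = set C"
    and buckets: "bA = bucket_cell (hsh W \<nu> \<alpha>1) cap A" "bB = bucket_cell (hsh W \<nu> \<alpha>1) cap B"
      "bC = bucket_cell (hsh W \<nu> \<alpha>1) cap C"
    and m_H: "2 + 3 * int m \<le> H" and \<pi>1: "\<pi> \<le> 1"
begin

definition input0 :: "(int \<Rightarrow> int) \<Rightarrow> bool" where
  "input0 \<mu> \<longleftrightarrow> (\<forall>z. \<mu> z = (if 0 \<le> z \<and> z < 2 + 3 * int m then ([int m, int U] @ A @ B @ C) ! nat z else 0))"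

lemma input0_nth:
  assumes "input0 \<mu>" "i < m"
  shows "\<mu> (2 + 0 * int m + int i) = A ! i" "\<mu> (2 + 1 * int m + int i) = B ! i" "\<mu> (2 + 2 * int m + int i) = C ! i"
proof -
  have "nat (2 + 0 * int m + int i) = Suc (Suc i)" "nat (2 + 1 * int m + int i) = Suc (Suc (m + i))"
    "nat (2 + 2 * int m + int i) = Suc (Suc (m + (m + i)))" by simp_all
  thus "\<mu> (2 + 0 * int m + int i) = A ! i" "\<mu> (2 + 1 * int m + int i) = B ! i" "\<mu> (2 + 2 * int m + int i) = C ! i"
    using assms lens by (simp_all add: input0_def nth_append)
qed

lemma T_fill_all: "T W (\<lambda>v \<mu>. env v \<and> v 3 = int m \<and> v 19 = 0 \<and> input0 \<mu>) fill_all (m * 510 + 90) (\<lambda>v \<mu>. Inv 0 v \<mu> \<and> v 19 = 0)"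
proof (rule T_exact)
  fix v0 \<mu>0 assume a: "env v0 \<and> v0 3 = int m \<and> v0 19 = 0 \<and> input0 \<mu>0"
  let ?X = "{30, 31, 32, 33} :: nat set"
  have z0: "\<mu>0 z = 0" if "H \<le> z" for z using a that m_H by (simp add: input0_def)
  have st: "env v" "v 3 = int m" "v 19 = 0" if "eqx ?X v v0" for v
    using a that env_eqx[OF _ that] eqxD[OF that, of 3] eqxD[OF that, of 19] by auto
  let ?P = "\<lambda>v1 \<mu>1 v \<mu>. v = v1 \<and> \<mu> = (\<mu>1 :: int \<Rightarrow> int)"
  let ?Q1 = "\<lambda>v \<mu>. eqx ?X v v0 \<and> filled 0 A \<mu>0 \<mu>"
  let ?Q2 = "\<lambda>v \<mu>. eqx ?X v v0 \<and> (\<exists>\<mu>1. filled 0 A \<mu>0 \<mu>1 \<and> filled 1 B \<mu>1 \<mu>)"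
  let ?Q3 = "\<lambda>v \<mu>. eqx ?X v v0 \<and> (\<exists>\<mu>1 \<mu>2. filled 0 A \<mu>0 \<mu>1 \<and> filled 1 B \<mu>1 \<mu>2 \<and> filled 2 C \<mu>2 \<mu>)"
  have 1: "T W (\<lambda>v \<mu>. v = v0 \<and> \<mu> = \<mu>0) (fill_code 0) (m * 150 + 20) ?Q1"
  proof (rule T_weaken[OF T_fill[of v0 A 0 \<mu>0]])
    show "env v0" "v0 3 = int (length A)" using a lens by auto
  qed (use input0_nth[of \<mu>0] a lens m_H H_pos z0 in auto)
  have 2: "T W ?Q1 (fill_code 1) (m * 150 + 20) ?Q2"
  proof (rule T_exact)
    fix v1 \<mu>1 assume b: "?Q1 v1 \<mu>1"
    note s = st[OF conjunct1[OF b]]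
    have f: "\<mu>1 z = \<mu>0 z" if "z < 2 * H \<or> 3 * H \<le> z \<and> z < 5 * H \<or> 6 * H \<le> z" for z
      using b that H_pos by (auto simp: filled_def)
    show "T W (\<lambda>v \<mu>. v = v1 \<and> \<mu> = \<mu>1) (fill_code 1) (m * 150 + 20) ?Q2"
    proof (rule T_weaken[OF T_fill[of v1 B 1 \<mu>1]])
      show "env v1" "v1 3 = int (length B)" using s lens by auto
      show "\<mu>1 (2 + 1 * int (length B) + int i) = B ! i" if "i < length B" for i
      proof -
        have "2 + 1 * int (length B) + int i < 2 * H" using that lens m_H H_pos by simp
        thus ?thesis using input0_nth(2)[of \<mu>0 i] f a that lens by simp
      qed
      fix v \<mu> assume "eqx ?X v v1 \<and> filled 1 B \<mu>1 \<mu>"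
      thus "?Q2 v \<mu>" using b eqx_trans[of ?X v v1 ?X v0 ?X] by blast
    qed (use lens m_H H_pos f z0 in auto)
  qed
  have 3: "T W ?Q2 (fill_code 2) (m * 150 + 20) ?Q3"
  proof (rule T_exact)
    fix v1 \<mu>2 assume b: "?Q2 v1 \<mu>2"
    then obtain \<mu>1 where \<mu>1: "filled 0 A \<mu>0 \<mu>1" "filled 1 B \<mu>1 \<mu>2" by blast
    note s = st[OF conjunct1[OF b]]
    have f: "\<mu>2 z = \<mu>0 z" if "z < 2 * H \<or> 4 * H \<le> z \<and> z < 5 * H \<or> 7 * H \<le> z" for z
      using \<mu>1 that H_pos by (auto simp: filled_def)
    show "T W (\<lambda>v \<mu>. v = v1 \<and> \<mu> = \<mu>2) (fill_code 2) (m * 150 + 20) ?Q3"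
    proof (rule T_weaken[OF T_fill[of v1 C 2 \<mu>2]])
      show "env v1" "v1 3 = int (length C)" using s lens by auto
      show "\<mu>2 (2 + 2 * int (length C) + int i) = C ! i" if "i < length C" for i
      proof -
        have "2 + 2 * int (length C) + int i < 2 * H" using that lens m_H H_pos by simp
        thus ?thesis using input0_nth(3)[of \<mu>0 i] f a that lens by simp
      qed
      fix v \<mu> assume "eqx ?X v v1 \<and> filled 2 C \<mu>2 \<mu>"
      thus "?Q3 v \<mu>" using b \<mu>1 eqx_trans[of ?X v v1 ?X v0 ?X] by blast
    qed (use lens m_H H_pos f z0 in auto)
  qed
  have 4: "T W ?Q3 table_code (m * 60 + 20) (\<lambda>v \<mu>. Inv 0 v \<mu> \<and> v 19 = 0)"
  proof (rule T_exact)
    fix v1 \<mu>3 assume b: "?Q3 v1 \<mu>3"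
    then obtain \<mu>1 \<mu>2 where \<mu>1: "filled 0 A \<mu>0 \<mu>1" "filled 1 B \<mu>1 \<mu>2" "filled 2 C \<mu>2 \<mu>3" by blast
    note s = st[OF conjunct1[OF b]]
    have f: "\<mu>3 z = \<mu>0 z" if "z < 2 * H \<or> 8 * H \<le> z" for z
      using \<mu>1 that H_pos by (auto simp: filled_def)
    have SC': "1 \<le> y \<and> y < H" if "y \<in> set C" for y
    proof -
      have "y \<in> {1..int U}" using that SC sets(3) by blast
      thus ?thesis using H_U by auto
    qed
    show "T W (\<lambda>v \<mu>. v = v1 \<and> \<mu> = \<mu>3) table_code (m * 60 + 20) (\<lambda>v \<mu>. Inv 0 v \<mu> \<and> v 19 = 0)"
    proof (rule T_weaken[OF T_table[of v1 C \<mu>3]])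
      show "env v1" "v1 3 = int (length C)" using s lens by auto
      show "\<mu>3 (2 + 2 * int (length C) + int i) = C ! i" if "i < length C" for i
      proof -
        have "2 + 2 * int (length C) + int i < 2 * H" using that lens m_H H_pos by simp
        thus ?thesis using input0_nth(3)[of \<mu>0 i] f a that lens by simp
      qed
      show "set C \<subseteq> {1..int U}" using SC sets(3) by simp
      fix v \<mu> assume c: "eqx {30} v v1 \<and> \<mu> = (\<lambda>z. if z - H \<in> set C then 1 else \<mu>3 z)"
      have "eqx ?X v v0" using b c eqx_trans[of "{30}" v v1 ?X v0 ?X] by blast
      note s' = st[OF this]
      have hi: "\<mu> z = \<mu>3 z" if "2 * H \<le> z" for z using c that SC'[of "z - H"] by auto
      have sl: "slot \<mu> b r j = slot \<mu>3 b r j" if "2 \<le> b" for b r j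
      proof -
        have "2 * H \<le> b * H" using that H_pos by (intro mult_right_mono) auto
        moreover have "0 \<le> int r * 2 ^ D + int j" by simp
        ultimately show ?thesis unfolding slot_def by (intro hi) linarith
      qed
      \<comment> \<open>Filling the table with number \<open>X\<close> writes only to the blocks
        \<open>2 + X\<close> and \<open>5 + X\<close>, so the slots of the other tables are
        unaffected.\<close>
      have fr: "slot \<mu>' b r j = slot \<mu>'' b r j" if "filled X xs \<mu>'' \<mu>'" "r < N" "j < cap" "b \<noteq> 2 + X" "2 \<le> b" "b \<le> 4" "0 \<le> X" for X xs \<mu>' \<mu>'' b r j
      proof -
        have "int j < 2 ^ D" using cap_less[OF that(3)] by linarith
        note q = bucket_bound(1,2)[OF that(2) of_nat_0_le_iff this]
        have "b * H + H \<le> (5 + X) * H"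
        proof -
          have "(b + 1) * H \<le> (5 + X) * H" using that H_pos by (intro mult_right_mono) auto
          thus ?thesis by (simp add: distrib_right)
        qed
        moreover have "b * H + H \<le> (2 + X) * H \<or> (3 + X) * H \<le> b * H"
        proof (cases "b < 2 + X")
          case True
          have "(b + 1) * H \<le> (2 + X) * H" using True H_pos by (intro mult_right_mono) auto
          thus ?thesis by (simp add: distrib_right)
        next
          case False
          have "(3 + X) * H \<le> b * H" using False that H_pos by (intro mult_right_mono) auto
          thus ?thesis ..
        qed
        ultimately show ?thesis using that(1) q unfolding filled_def slot_def by (smt (verit))
      qed
      have "slot \<mu> 2 r j = bA r j \<and> slot \<mu> 3 r j = bB r j \<and> slot \<mu> 4 r j = bC r j" if "r < N" "j < cap" for r j
      proof -
        have "slot \<mu> 4 r j = bC r j" using \<mu>1(3) that sl[of 4] by (simp add: filled_def buckets)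
        moreover have "slot \<mu> 3 r j = bB r j"
          using \<mu>1(2) that sl[of 3] fr[OF \<mu>1(3) that, of 3] by (simp add: filled_def buckets)
        moreover have "slot \<mu> 2 r j = bA r j"
          using \<mu>1(1) that sl[of 2] fr[OF \<mu>1(3) that, of 2] fr[OF \<mu>1(2) that, of 2] by (simp add: filled_def buckets)
        ultimately show ?thesis by blast
      qed
      moreover have "\<mu> (H + z) \<noteq> 0 \<longleftrightarrow> z \<in> SC" if "0 \<le> z" "z < H" for z
        using that c f[of "H + z"] z0[of "H + z"] sets(3) by simp
      ultimately have "tab \<mu>" by (simp add: tab_def)
      moreover have "\<mu> z = 0" if "9 * H \<le> z" for z using that hi[of z] f[of z] z0[of z] H_pos by simp
      ultimately show "Inv 0 v \<mu> \<and> v 19 = 0" using s' by (simp add: Inv_def)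
    qed (use lens m_H in auto)
  qed
  show "T W (\<lambda>v \<mu>. v = v0 \<and> \<mu> = \<mu>0) fill_all (m * 510 + 90) (\<lambda>v \<mu>. Inv 0 v \<mu> \<and> v 19 = 0)"
    unfolding fill_all_def by (rule T_Seq[OF 1 T_Seq[OF 2 T_Seq[OF 3 4 order_refl] order_refl]]) simp
qed

definition tail_time :: nat where
  "tail_time = m * 510 + 2 * N * (round_time + 30) + 150"

abbreviation lucky :: bool where "lucky \<equiv> \<exists>u<2 * N. good u"

text \<open>Any one good round serves as the event iteration of the loop rule, so a single factor
  \<open>\<pi>\<close> appears. Without a good round the claimed event is vacuous and
  \<open>\<pi> \<le> 1\<close> is enough.\<close>

lemma HT_outer: "HT W (\<lambda>v \<mu>. Inv 0 v \<mu>) (outer_code p) (2 * N * (round_time + 30) + 30) (Inv (2 * N)) \<pi>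
  (\<lambda>v \<mu>. lucky \<longrightarrow> v 19 \<noteq> 0)"
proof -
  have N2: "int (2 * N) < 2 ^ W" using N_H H16 H_pos by linarith
  hence NW: "2 * N < 2 ^ W" by (metis of_nat_less_iff of_nat_numeral of_nat_power)
  have rnd: "HT W (\<lambda>v \<mu>. Inv u v \<mu> \<and> v 20 = int u) (round_code p) round_time
    (\<lambda>v \<mu>. Inv (Suc u) v \<mu> \<and> v 20 = int u) \<pi> (\<lambda>v \<mu>. good u \<longrightarrow> v 19 \<noteq> 0)" if "u < 2 * N" for u
    by (rule T_exact, rule HT_weaken[OF HT_round[OF that]]) auto
  have stab: "T W (\<lambda>v \<mu>. (Inv u v \<mu> \<and> v 19 \<noteq> 0) \<and> v 20 = int u) (round_code p) round_time
    (\<lambda>v \<mu>. (Inv (Suc u) v \<mu> \<and> v 19 \<noteq> 0) \<and> v 20 = int u)" if "u < 2 * N" for u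
    by (rule T_exact, rule HT_weaken[OF HT_round[OF that]]) (use \<pi> in auto)
  have plain: "T W (\<lambda>v \<mu>. Inv u v \<mu> \<and> v 20 = int u) (round_code p) round_time (\<lambda>v \<mu>. Inv (Suc u) v \<mu> \<and> v 20 = int u)"
    if "u < 2 * N" for u by (rule HT_weaken[OF rnd[OF that]]) (use \<pi> in auto)
  have bnd: "ev W (K 2 \<boxtimes> V 9) v \<mu> = int (2 * N)" if "Inv u v \<mu>" for u v \<mu>
    using that N2 wrap_idI[of "int (2 * N)" W] by (simp add: Inv_def env_def)
  have ind: "Inv u (v(20 := x)) \<mu> = Inv u v \<mu>" for u v \<mu> x by (simp add: Inv_def)
  show ?thesis
  proof (cases lucky)
    case True
    then obtain u0 where u0: "u0 < 2 * N" "good u0" by blast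
    have "HT W (Inv 0) (outer_code p) (loop_time (2 * N) round_time (eval_time (K 2 \<boxtimes> V 9))) (Inv (2 * N)) \<pi> (\<lambda>v \<mu>. v 19 \<noteq> 0)"
      unfolding outer_code_def
    proof (rule HT_loop_event[where I = Inv and ?j0.0 = u0, OF plain])
      show "HT W (\<lambda>v \<mu>. Inv u0 v \<mu> \<and> v 20 = int u0) (round_code p) round_time
        (\<lambda>v \<mu>. Inv (Suc u0) v \<mu> \<and> v 20 = int u0) \<pi> (\<lambda>v \<mu>. v 19 \<noteq> 0)"
        by (rule HT_weaken[OF rnd[OF u0(1)]]) (use u0(2) in auto)
    qed (use NW W_16 \<pi> u0 bnd stab ind in auto)
    thus ?thesis by (rule HT_weaken) (auto simp: loop_time_def algebra_simps)
  next
    case False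

    have "T W (Inv 0) (outer_code p) (2 * N * (round_time + 30) + 30) (Inv (2 * N))"
      unfolding outer_code_def
      by (rule T_loop[where I = Inv, OF plain ind bnd NW]) (use W_16 in \<open>auto simp: loop_time_def algebra_simps\<close>)
    from HT_certain[OF this] show ?thesis by (rule HT_weaken) (use False \<pi>1 in auto)
  qed
qed

lemma HT_tail: "HT W (\<lambda>v \<mu>. env v \<and> v 3 = int m \<and> v 19 = 0 \<and> input0 \<mu>) (tail_code p) tail_time
  (\<lambda>v \<mu>. \<mu> 0 \<noteq> 0 \<longrightarrow> sol) \<pi> (\<lambda>v \<mu>. lucky \<longrightarrow> \<mu> 0 \<noteq> 0)"
proof -
  have f: "T W (Inv (2 * N)) (blk [St (K 0) (V 19)]) 10 (\<lambda>v \<mu>. \<mu> 0 \<noteq> 0 \<longrightarrow> sol)"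
    by (rule T_blk) (auto simp: Inv_def)
  have "T W (\<lambda>v \<mu>. Inv (2 * N) v \<mu> \<and> (lucky \<longrightarrow> v 19 \<noteq> 0)) (blk [St (K 0) (V 19)]) 10 (\<lambda>v \<mu>. (\<mu> 0 \<noteq> 0 \<longrightarrow> sol) \<and> (lucky \<longrightarrow> \<mu> 0 \<noteq> 0))"
    by (rule T_blk) (auto simp: Inv_def)
  from HT_certain[OF this]
  have g: "HT W (\<lambda>v \<mu>. Inv (2 * N) v \<mu> \<and> (lucky \<longrightarrow> v 19 \<noteq> 0)) (blk [St (K 0) (V 19)]) 10 (\<lambda>v \<mu>. \<mu> 0 \<noteq> 0 \<longrightarrow> sol)
     1 (\<lambda>v \<mu>. lucky \<longrightarrow> \<mu> 0 \<noteq> 0)"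
    by (rule HT_weaken) auto
  have "HT W (Inv 0) (Seq (outer_code p) (blk [St (K 0) (V 19)])) (2 * N * (round_time + 30) + 30 + 1 + 10)
    (\<lambda>v \<mu>. \<mu> 0 \<noteq> 0 \<longrightarrow> sol) (\<pi> * 1) (\<lambda>v \<mu>. lucky \<longrightarrow> \<mu> 0 \<noteq> 0)"
    by (rule HT_Seq[OF HT_outer f g]) simp
  hence h: "HT W (\<lambda>v \<mu>. Inv 0 v \<mu> \<and> v 19 = 0) (Seq (outer_code p) (blk [St (K 0) (V 19)])) (2 * N * (round_time + 30) + 30 + 1 + 10)
    (\<lambda>v \<mu>. \<mu> 0 \<noteq> 0 \<longrightarrow> sol) \<pi> (\<lambda>v \<mu>. lucky \<longrightarrow> \<mu> 0 \<noteq> 0)"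
    by (rule HT_weaken) auto
  show ?thesis unfolding tail_code_def
    by (rule HT_weaken[OF T_HT_Seq[OF T_fill_all h \<pi>]]) (auto simp: tail_time_def)
qed

end


section \<open>The random choices\<close>

text \<open>Markov's inequality as double counting: each counted \<open>\<alpha>\<close> contributes
  at least \<open>b\<close> to the number of pairs \<open>(\<alpha>, r)\<close> with
  \<open>Q \<alpha> r\<close>.\<close>

lemma card_many:
  assumes "finite \<Omega>" "finite R"
  shows "card {\<alpha> \<in> \<Omega>. b \<le> card {r \<in> R. Q \<alpha> r}} * b \<le> (\<Sum>r\<in>R. card {\<alpha> \<in> \<Omega>. Q \<alpha> r})"
proof -
  have c: "card {x \<in> X. P x} = (\<Sum>x\<in>X. if P x then 1 else 0)" if "finite X" for X :: "'x set" and P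
    using sum.inter_filter[OF that, of "\<lambda>_. 1 :: nat" P] by simp
  have "card {\<alpha> \<in> \<Omega>. b \<le> card {r \<in> R. Q \<alpha> r}} * b = (\<Sum>\<alpha> | \<alpha> \<in> \<Omega> \<and> b \<le> card {r \<in> R. Q \<alpha> r}. b)" by simp
  also have "\<dots> \<le> (\<Sum>\<alpha> | \<alpha> \<in> \<Omega> \<and> b \<le> card {r \<in> R. Q \<alpha> r}. card {r \<in> R. Q \<alpha> r})" by (intro sum_mono) auto
  also have "\<dots> \<le> (\<Sum>\<alpha>\<in>\<Omega>. card {r \<in> R. Q \<alpha> r})" using assms by (intro sum_mono2) auto
  also have "\<dots> = (\<Sum>\<alpha>\<in>\<Omega>. \<Sum>r\<in>R. if Q \<alpha> r then 1 else 0)"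
    by (simp only: c[OF assms(2)])
  also have "\<dots> = (\<Sum>r\<in>R. \<Sum>\<alpha>\<in>\<Omega>. if Q \<alpha> r then 1 else 0)" by (rule sum.swap)
  also have "\<dots> = (\<Sum>r\<in>R. card {\<alpha> \<in> \<Omega>. Q \<alpha> r})"
    by (simp only: c[OF assms(1)])
  finally show ?thesis .
qed

abbreviation wordset :: "nat \<Rightarrow> int set" where "wordset W \<equiv> {\<alpha>. okw W \<alpha>}"

lemma finite_words: "finite (wordset W)"
proof -
  have "wordset W = {- (2 ^ W) ..< 2 ^ W}" by (auto simp: okw_def)
  thus ?thesis by simp
qed

text \<open>By \<open>collision_near\<close> and \<open>card_near\<close>, every other element
  shares the bucket of \<open>x0\<close> for few multipliers; Markov's inequality then bounds the
  multipliers with many such elements. The bound on \<open>U\<close> ensures that differences are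
  small enough for \<open>card_near\<close>.\<close>

lemma overflow_count:
  assumes "distinct X" "x0 \<in> set X" "set X \<subseteq> {1..int U}" "int U \<le> 2 ^ (Suc W - b)" "b \<le> Suc W"
  shows "card {\<alpha> \<in> wordset W. c < length (filter (\<lambda>x. hsh W b \<alpha> x = hsh W b \<alpha> x0) X)} * c \<le> length X * (9 * 2 ^ (Suc W - b))"
proof -
  let ?R = "set X - {x0}" and ?Q = "\<lambda>\<alpha> x. hsh W b \<alpha> x = hsh W b \<alpha> x0"
  \<comment> \<open>\<open>x0\<close> always lies in its own bucket, so more than \<open>c\<close>
    elements mean at least \<open>c\<close> others.\<close>
  have l: "length (filter (?Q \<alpha>) X) = Suc (card {x \<in> ?R. ?Q \<alpha> x})" for \<alpha>
  proof -
    have "length (filter (?Q \<alpha>) X) = card (set (filter (?Q \<alpha>) X))" using assms(1) by (simp only: distinct_card distinct_filter)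
    also have "set (filter (?Q \<alpha>) X) = insert x0 {x \<in> ?R. ?Q \<alpha> x}" using assms(2) by auto
    finally show ?thesis by simp
  qed
  have "card {\<alpha> \<in> wordset W. c \<le> card {x \<in> ?R. ?Q \<alpha> x}} * c \<le> (\<Sum>x\<in>?R. card {\<alpha> \<in> wordset W. ?Q \<alpha> x})"
    by (rule card_many) (auto simp: finite_words)
  also have "\<dots> \<le> (\<Sum>x\<in>?R. 9 * 2 ^ (Suc W - b))"
  proof (rule sum_mono)
    fix x assume x: "x \<in> ?R"
    have "x \<in> {1..int U}" "x0 \<in> {1..int U}" using x assms(2,3) by auto
    hence "\<bar>x - x0\<bar> \<le> int U" by auto
    hence z: "x - x0 \<noteq> 0" "\<bar>x - x0\<bar> \<le> 2 ^ (Suc W - b)" using x assms(4) by (auto simp del: of_nat_le_numeral_power_cancel_iff)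
    have "(2::int) ^ (Suc W - b) \<le> 2 ^ Suc W" by (intro power_increasing) auto
    note cn = card_near[OF z this]
    have "card {\<alpha> \<in> wordset W. ?Q \<alpha> x} \<le> card {\<alpha>. okw W \<alpha> \<and> near W (2 ^ (Suc W - b)) (x - x0) \<alpha>}"
      by (rule card_mono[OF cn(1)]) (use collision_near[OF assms(5)] in auto)
    moreover have "int (card {\<alpha>. okw W \<alpha> \<and> near W (2 ^ (Suc W - b)) (x - x0) \<alpha>}) \<le> int (9 * 2 ^ (Suc W - b))"
      using cn(2) by (simp only: of_nat_mult of_nat_power of_nat_numeral)
    ultimately show "card {\<alpha> \<in> wordset W. ?Q \<alpha> x} \<le> 9 * 2 ^ (Suc W - b)"
      by (simp only: of_nat_le_iff)
  qed
  also have "\<dots> \<le> length X * (9 * 2 ^ (Suc W - b))"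
  proof -
    have "card ?R \<le> length X" using card_length[of X] card_Diff1_le[of "set X" x0] by linarith
    thus ?thesis by simp
  qed
  finally show ?thesis unfolding l Suc_le_eq[symmetric] Suc_le_mono .
qed

context search
begin

text \<open>The multiplier is an argument here because it is about to be counted, while the buckets,
  which depend on the first multiplier only, stay fixed.\<close>

definition false_row :: "nat \<Rightarrow> int \<Rightarrow> nat \<Rightarrow> bool" where
  "false_row u \<alpha> r \<longleftrightarrow> \<not> hit u r \<and> (\<exists>i<cap. \<exists>j<cap. \<exists>l<cap. \<exists>e\<in>{0, 1}.
     (hsh W L \<alpha> (el (bA r i)) + hsh W L \<alpha> (el (bB (r2 u r) j)) + e) mod 2 ^ L = hsh W L \<alpha> (bC (u div 2) l))"

text \<open>A row that is not a hit is positive only if one of its \<open>cap ^ 3\<close> triples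
  matches by accident. A union bound over the triples and Markov's inequality over the rows give the
  count; each accident is a \<open>near\<close> event with twice the cell width, since the sums have
  a carry.\<close>

lemma false_row_count:
  assumes "1 \<le> U" "u < 2 * N"
  shows "card {\<alpha> \<in> wordset W. Bc \<le> card {r \<in> {..<N}. false_row u \<alpha> r}} * Bc \<le> N * (cap ^ 3 * (36 * 2 ^ (Suc W - L)))"
proof -
  let ?s = "2 * 2 ^ (Suc W - L) :: int"
  have s: "2 * int U \<le> ?s" "?s \<le> 2 ^ Suc W"
  proof -
    have LS: "(2::int) ^ Suc W = 2 ^ L * 2 ^ (Suc W - L)" using L_W(1) by (simp add: power_add[symmetric] del: power_Suc)
    have "H * 2 ^ L \<le> H * int N" unfolding L_W(4) using H_pos by (intro mult_left_mono power_increasing) (auto simp: \<nu>_def)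
    also have "\<dots> \<le> H * (8 * int N + 16)" using H_pos by (intro mult_left_mono) auto
    also have "\<dots> \<le> 2 * 2 ^ W" using W_H zero_le_power[of "2 :: int" W] by linarith
    also have "\<dots> = 2 ^ Suc W" by simp
    finally have "2 ^ L * H \<le> 2 ^ L * 2 ^ (Suc W - L)" unfolding LS by (simp add: mult.commute)
    hence "H \<le> 2 ^ (Suc W - L)" by simp
    thus "2 * int U \<le> ?s" using H_U by linarith
    have "(2::int) * 2 ^ (Suc W - L) = 2 ^ Suc (Suc W - L)" by simp
    also have "\<dots> \<le> 2 ^ Suc W" using L L_W(1) by (intro power_increasing) auto
    finally show "?s \<le> 2 ^ Suc W" .
  qed
  let ?z = "\<lambda>r i j l. el (bA r i) + el (bB (r2 u r) j) - bC (u div 2) l"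
  have "card {\<alpha> \<in> wordset W. Bc \<le> card {r \<in> {..<N}. false_row u \<alpha> r}} * Bc \<le> (\<Sum>r\<in>{..<N}. card {\<alpha> \<in> wordset W. false_row u \<alpha> r})"
    by (rule card_many) (auto simp: finite_words)
  also have "\<dots> \<le> (\<Sum>r\<in>{..<N}. cap ^ 3 * (36 * 2 ^ (Suc W - L)))"
  proof (rule sum_mono)
    fix r assume "r \<in> {..<N}"
    hence r: "r < N" by simp
    show "card {\<alpha> \<in> wordset W. false_row u \<alpha> r} \<le> cap ^ 3 * (36 * 2 ^ (Suc W - L))"
    proof (cases "hit u r")
      case True
      thus ?thesis by (simp add: false_row_def)
    next
      case False
      let ?I = "{..<cap} \<times> {..<cap} \<times> {..<cap}"
      let ?S = "\<lambda>(i, j, l). {\<alpha>. okw W \<alpha> \<and> near W ?s (?z r i j l) \<alpha>}"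
      have z: "?z r i j l \<noteq> 0" "\<bar>?z r i j l\<bar> \<le> ?s" if "i < cap" "j < cap" "l < cap" for i j l
      proof -
        have u2: "u div 2 < N" using assms(2) by auto
        have e: "0 \<le> el (bA r i)" "el (bA r i) \<le> int U" "1 \<le> el (bB (r2 u r) j)" "el (bB (r2 u r) j) \<le> int U"
          using cells[OF r that(1)] cells[OF r2_less that(2), of u r] assms(1) by (auto simp: el_def)
        have ns: "el (bA r i) + el (bB (r2 u r) j) \<notin> SC" using False that by (auto simp: hit_def)
        \<comment> \<open>An empty slot of \<open>C\<close> counts as 0 here. It cannot equal the
          sum either, because \<open>el\<close> is at least 1 even on empty slots.\<close>
        show "?z r i j l \<noteq> 0" using bC[OF u2 that(3)] e ns by auto
        show "\<bar>?z r i j l\<bar> \<le> ?s" using e s(1) cells[OF u2 that(3)] by linarith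
      qed
      have fin: "finite (?S x)" "card (?S x) \<le> 36 * 2 ^ (Suc W - L)" if x: "x \<in> ?I" for x
      proof -
        obtain i j l where ijl: "x = (i, j, l)" "i < cap" "j < cap" "l < cap" using x by auto
        note cn = card_near[OF z[OF ijl(2-4)] s(2)]
        show "finite (?S x)" using cn(1) ijl(1) by simp
        have "int (card (?S x)) \<le> 18 * 2 ^ (Suc W - L)" using cn(2) ijl(1) by simp
        also have "\<dots> \<le> int (36 * 2 ^ (Suc W - L))" by simp
        finally show "card (?S x) \<le> 36 * 2 ^ (Suc W - L)" by (simp only: of_nat_le_iff)
      qed
      have "{\<alpha> \<in> wordset W. false_row u \<alpha> r} \<subseteq> \<Union> (?S ` ?I)"
      proof
        fix \<alpha> assume "\<alpha> \<in> {\<alpha> \<in> wordset W. false_row u \<alpha> r}"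
        then obtain i j l e where a: "okw W \<alpha>" "i < cap" "j < cap" "l < cap" "e \<in> {0, 1}"
          "(hsh W L \<alpha> (el (bA r i)) + hsh W L \<alpha> (el (bB (r2 u r) j)) + e) mod 2 ^ L = hsh W L \<alpha> (bC (u div 2) l)"
          unfolding false_row_def by blast
        have "near W ?s (?z r i j l) \<alpha>" by (rule hash_match_near[OF L_W(1) a(5,6)])
        thus "\<alpha> \<in> \<Union> (?S ` ?I)" using a by (intro UN_I[of "(i, j, l)"]) auto
      qed
      hence "card {\<alpha> \<in> wordset W. false_row u \<alpha> r} \<le> card (\<Union> (?S ` ?I))"
        using fin(1) by (intro card_mono) auto
      also have "\<dots> \<le> (\<Sum>x\<in>?I. card (?S x))" by (rule card_UN_le) simp
      also have "\<dots> \<le> (\<Sum>x\<in>?I. 36 * 2 ^ (Suc W - L))" by (rule sum_mono) (rule fin(2))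
      also have "\<dots> = cap ^ 3 * (36 * 2 ^ (Suc W - L))"
        by (simp add: card_cartesian_product power3_eq_cube)
      finally show ?thesis .
    qed
  qed
  finally show ?thesis by simp
qed

text \<open>By additivity up to a carry a genuine solution is positive for every second multiplier.
  Randomness of \<open>\<alpha>2\<close> is needed only against false rows.\<close>

lemma hit_posi:
  assumes "a \<in> SA" "b \<in> SB" "a + b \<in> SC" "i < cap" "j < cap" "l < cap" "r < N"
    and "bA r i = a" "bB (r2 u r) j = b" "bC (u div 2) l = a + b"
  shows "hit u r \<and> posi u r"
proof -
  have "1 \<le> a" "1 \<le> b" using assms(1,2) SA SB by auto
  hence e: "el (bA r i) = a" "el (bB (r2 u r) j) = b" using assms(8,9) by (auto simp: el_def)
  have "hit u r" unfolding hit_def using assms(3-5) e by blast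
  moreover obtain e' where "e' \<in> {0, 1}" "(h2 a + h2 b + e') mod 2 ^ L = h2 (a + b)"
    using hsh_sum[OF L_W(1)] .
  hence "posi u r" unfolding posi_def using assms(4-6,10) e by metis
  ultimately show ?thesis ..
qed

lemma good_iff: "good u \<longleftrightarrow> card {r \<in> {..<N}. false_row u \<alpha>2 r} < Bc \<and> (\<exists>r<N. posi u r \<and> hit u r)"
proof -
  have "{r. r < N \<and> posi u r \<and> \<not> hit u r} = {r \<in> {..<N}. false_row u \<alpha>2 r}"
    by (auto simp: false_row_def posi_def)
  thus ?thesis by (simp add: good_def)
qed

end

context reduction
begin

text \<open>The round \<open>u\<close> encodes the bucket of \<open>a + b\<close> together with the
  carry. It is determined by the first multiplier alone, hence fixed before the second is drawn, and
  no union bound over rounds is required.\<close>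

lemma witness:
  assumes "a \<in> set A" "b \<in> set B" "a + b \<in> set C"
    and "length (filter (\<lambda>x. h1 x = h1 a) A) \<le> cap" "length (filter (\<lambda>x. h1 x = h1 b) B) \<le> cap"
    and "length (filter (\<lambda>x. h1 x = h1 (a + b)) C) \<le> cap"
  obtains u r i j l where "u < 2 * N" "r < N" "i < cap" "j < cap" "l < cap"
    "bA r i = a" "bB (r2 u r) j = b" "bC (u div 2) l = a + b"
proof -
  obtain e where e: "e \<in> {0, 1}" "(h1 a + h1 b + e) mod 2 ^ \<nu> = h1 (a + b)" using hsh_sum[OF L_W(2)] .
  define u where "u = 2 * h1 (a + b) + e"
  have u: "u < 2 * N" "u div 2 = h1 (a + b)" "u mod 2 = e" using e(1) h1_less[of "a + b"] by (auto simp: u_def)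
  have "int (h1 (a + b)) = (int (h1 a) + int (h1 b) + int e) mod int N"
    using arg_cong[OF e(2), of int] by (simp add: zmod_int N_def)
  hence "(int (u div 2) - int (h1 a) - int (u mod 2)) mod int N =
     ((int (h1 a) + int (h1 b) + int e) mod int N - int (h1 a) - int e) mod int N" by (simp only: u)
  also have "\<dots> = (int (h1 a) + int (h1 b) + int e - int (h1 a) - int e) mod int N" by (simp only: diff_diff_eq mod_diff_left_eq)
  also have "\<dots> = int (h1 b)" using h1_less[of b] by simp
  finally have r2: "r2 u (h1 a) = h1 b" by (simp add: r2_def)
  obtain i where i: "i < cap" "bA (h1 a) i = a" using bucket_cell_stored[OF assms(1) refl assms(4)] by (auto simp: buckets)
  obtain j where j: "j < cap" "bB (h1 b) j = b" using bucket_cell_stored[OF assms(2) refl assms(5)] by (auto simp: buckets)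
  obtain l where l: "l < cap" "bC (h1 (a + b)) l = a + b"
    using bucket_cell_stored[OF assms(3) refl assms(6)] by (auto simp: buckets)
  show ?thesis by (rule that[of u "h1 a" i j l]) (use u h1_less i j l r2 in auto)
qed

end


definition rand_code :: "com \<Rightarrow> com" where
  "rand_code q = Seq (Rand (3 * 17)) (Seq (Rand (3 * 18)) (tail_code q))"

locale random_reduction =
  fixes W U D L n w Bc :: nat and H :: int and p :: com and tp :: nat and \<pi> :: real and A B C :: "int list" and m :: nat
  fixes \<nu> N cap :: nat
  defines "\<nu> \<equiv> L + 2 + 2 * D" and "N \<equiv> 2 ^ \<nu>" and "cap \<equiv> 2 ^ D - 1"
  assumes params: "params W U D L n w Bc H"
    and solver: "\<And>R V' M v. length R = N \<Longrightarrow> (\<forall>S \<in> set R. is_slp {0, 1} S \<and> length S = n) \<Longrightarrow>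
      is_slp {0, 1} V' \<Longrightarrow> length V' = n \<Longrightarrow> M \<in> carrier_mat N N \<Longrightarrow> v \<in> carrier_vec N \<Longrightarrow>
      (\<forall>i<N. slp_string (R ! i) = list_of_vec (row M i)) \<Longrightarrow> slp_string V' = list_of_vec v \<Longrightarrow>
      halts_within w tp (p, init_state w (mvm_input (N, n, R, V', M, v))) \<and>
      \<pi> \<le> measure_pmf.prob (steps w tp (p, init_state w (mvm_input (N, n, R, V', M, v))))
        {c'. mvm_correct (N, n, R, V', M, v) (mem (snd c'))}"
    and \<pi>: "0 \<le> \<pi>" "\<pi> \<le> 1" and U: "1 \<le> U" and Bc: "1 \<le> Bc"
    and inputs: "X \<in> {A, B, C} \<Longrightarrow> distinct X \<and> length X = m \<and> set X \<subseteq> {1..int U}"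
    and m_H: "2 + 3 * int m \<le> H"
begin

abbreviation "bk \<alpha> \<equiv> bucket_cell (hsh W \<nu> \<alpha>) cap"

lemma reduction: "reduction W U D L n w Bc H \<alpha> p tp \<pi> (bk \<alpha> A) (bk \<alpha> B) (bk \<alpha> C) (set A) (set B) (set C) A B C m"
proof -
  interpret params W U D L n w Bc H \<alpha> \<alpha> \<nu> N cap
    using params unfolding \<nu>_def N_def cap_def by simp_all
  show ?thesis
    by unfold_locales
      (use inputs[of A] inputs[of B] inputs[of C] m_H \<pi> bucket_cell_cases solver in
        \<open>auto simp only: \<nu>_def N_def cap_def insert_iff simp_thms\<close>)
qed

lemmas search = reduction[THEN reduction.axioms(1)]

abbreviation sol :: bool where "sol \<equiv> \<exists>a\<in>set A. \<exists>b\<in>set B. a + b \<in> set C"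

definition pre :: assn where
  "pre v \<mu> \<longleftrightarrow> params.env W U D L n w Bc H (v 17) (v 18) v \<and> v 3 = int m \<and> v 19 = 0 \<and> reduction.input0 U A B C m \<mu>"

abbreviation lucky :: "int \<Rightarrow> int \<Rightarrow> bool" where
  "lucky \<alpha>1 \<alpha>2 \<equiv> \<exists>u<2 * N. search.good W U D L Bc \<alpha>2 (bk \<alpha>1 A) (bk \<alpha>1 B) (bk \<alpha>1 C) (set C) u"

abbreviation "time \<equiv> reduction.tail_time D L n Bc p tp m"

lemma HT_lucky: "HT W (\<lambda>v \<mu>. pre v \<mu> \<and> lucky (v 17) (v 18)) (tail_code p) time (\<lambda>v \<mu>. \<mu> 0 \<noteq> 0 \<longrightarrow> sol) \<pi> (\<lambda>v \<mu>. \<mu> 0 \<noteq> 0)"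
  and T_any: "T W pre (tail_code p) time (\<lambda>v \<mu>. \<mu> 0 \<noteq> 0 \<longrightarrow> sol)"
proof -
  note tail = reduction.HT_tail[OF reduction, folded \<nu>_def N_def, unfolded search.sol_def[OF search]]
  show "HT W (\<lambda>v \<mu>. pre v \<mu> \<and> lucky (v 17) (v 18)) (tail_code p) time (\<lambda>v \<mu>. \<mu> 0 \<noteq> 0 \<longrightarrow> sol) \<pi> (\<lambda>v \<mu>. \<mu> 0 \<noteq> 0)"
  proof (rule T_exact)
    fix v0 \<mu>0 assume "pre v0 \<mu>0 \<and> lucky (v0 17) (v0 18)"
    thus "HT W (\<lambda>v \<mu>. v = v0 \<and> \<mu> = \<mu>0) (tail_code p) time (\<lambda>v \<mu>. \<mu> 0 \<noteq> 0 \<longrightarrow> sol) \<pi> (\<lambda>v \<mu>. \<mu> 0 \<noteq> 0)"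
      by (intro HT_weaken[OF tail[of "v0 17" "v0 18"]]) (auto simp only: pre_def)
  qed
  show "T W pre (tail_code p) time (\<lambda>v \<mu>. \<mu> 0 \<noteq> 0 \<longrightarrow> sol)"
  proof (rule T_exact)
    fix v0 \<mu>0 assume "pre v0 \<mu>0"
    thus "T W (\<lambda>v \<mu>. v = v0 \<and> \<mu> = \<mu>0) (tail_code p) time (\<lambda>v \<mu>. \<mu> 0 \<noteq> 0 \<longrightarrow> sol)"
      by (intro HT_weaken[OF tail[of "v0 17" "v0 18"]]) (use \<pi> in \<open>auto simp only: pre_def\<close>)
  qed
qed

lemma pre_upd: "pre v \<mu> \<Longrightarrow> pre (v(17 := a)) \<mu>" "pre v \<mu> \<Longrightarrow> pre (v(18 := a)) \<mu>"
  unfolding pre_def by (auto simp: params.env_def[OF params])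

lemma T_Rand:
  assumes "x \<in> {17, 18}"
  shows "T W pre (Rand (3 * x)) 1 pre"
proof -
  have "HT W pre (Rand (3 * x)) 1 pre (1 - 1) (\<lambda>_ _. True)"
    by (rule HT_Rand) (use assms pre_upd in auto)
  thus ?thesis by simp
qed

lemma T_rand: "T W pre (rand_code p) (time + 4) (\<lambda>v \<mu>. \<mu> 0 \<noteq> 0 \<longrightarrow> sol)"
  unfolding rand_code_def by (rule T_Seq[OF T_Rand T_Seq[OF T_Rand T_any order_refl]]) auto

abbreviation "\<delta>1 \<equiv> 27 * real m / (real N * real cap)"
abbreviation "\<delta>2 \<equiv> 36 * real N * real cap ^ 3 / (2 ^ L * real Bc)"

text \<open>The draws are treated in turn: \<open>\<delta>1\<close> bounds the chance that one of
  the three buckets of a fixed solution overflows, and given that none does,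
  \<open>\<delta>2\<close> bounds the chance of too many false rows in its round.\<close>

lemma HT_rand:
  assumes "sol" and "0 \<le> 1 - \<delta>1" "0 \<le> 1 - \<delta>2"
  shows "HT W pre (rand_code p) (time + 4) (\<lambda>v \<mu>. \<mu> 0 \<noteq> 0 \<longrightarrow> sol) ((1 - \<delta>1) * ((1 - \<delta>2) * \<pi>)) (\<lambda>v \<mu>. \<mu> 0 \<noteq> 0)"
proof -
  obtain a b where ab: "a \<in> set A" "b \<in> set B" "a + b \<in> set C" using assms(1) by blast
  define full where "full X x \<alpha> \<longleftrightarrow> cap < length (filter (\<lambda>y. hsh W \<nu> \<alpha> y = hsh W \<nu> \<alpha> x) X)" for X x \<alpha>
  define fits where "fits \<alpha> \<longleftrightarrow> \<not> full A a \<alpha> \<and> \<not> full B b \<alpha> \<and> \<not> full C (a + b) \<alpha>" for \<alpha>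
  note ps = params[unfolded params_def]
  interpret q: params W U D L n w Bc H 0 0 \<nu> N cap
    using params unfolding \<nu>_def N_def cap_def by simp_all
  have cap1: "1 \<le> cap" using q.D one_less_power[of "2 :: nat" D] unfolding q.cap_def by simp
  have split: "(2::real) ^ (W + 1) = 2 ^ b * 2 ^ (Suc W - b)" if "b \<le> Suc W" for b
    using that by (simp add: power_add[symmetric])
  have US: "int U \<le> 2 ^ (Suc W - \<nu>)"
  proof -
    have LS: "(2::int) ^ Suc W = int N * 2 ^ (Suc W - \<nu>)"
      using q.L_W(2) unfolding q.L_W(4) by (simp add: power_add[symmetric] del: power_Suc)
    have "int N * H \<le> H * (8 * int N + 16)" using q.H_pos by (simp add: distrib_left)
    also have "\<dots> \<le> 2 * 2 ^ W" using q.W_H zero_le_power[of "2 :: int" W] by linarith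
    also have "\<dots> = int N * 2 ^ (Suc W - \<nu>)" using LS by simp
    finally have "H \<le> 2 ^ (Suc W - \<nu>)" using q.L_W(4) by simp
    thus ?thesis using q.H_U by linarith
  qed
  have ov: "real (card {\<alpha> \<in> wordset W. full X x \<alpha>}) \<le> 9 * real m * 2 ^ (Suc W - \<nu>) / real cap"
    if "X \<in> {A, B, C}" "x \<in> set X" for X x
  proof -
    have "card {\<alpha> \<in> wordset W. full X x \<alpha>} * cap \<le> m * (9 * 2 ^ (Suc W - \<nu>))"
      using overflow_count[OF _ that(2) _ US q.L_W(2), of cap] inputs[OF that(1)] by (auto simp: full_def)
    hence "real (card {\<alpha> \<in> wordset W. full X x \<alpha>} * cap) \<le> real (m * (9 * 2 ^ (Suc W - \<nu>)))" by (simp only: of_nat_le_iff)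
    thus ?thesis using cap1 by (simp add: field_simps)
  qed
  \<comment> \<open>27 is three times the constant 9 of \<open>card_near\<close>, one share for each
    of the three buckets.\<close>
  have fits_card: "real (card {\<alpha>. okw W \<alpha> \<and> \<not> fits \<alpha>}) \<le> \<delta>1 * 2 ^ (W + 1)"
  proof -
    have "{\<alpha>. okw W \<alpha> \<and> \<not> fits \<alpha>} = {\<alpha> \<in> wordset W. full A a \<alpha>} \<union> ({\<alpha> \<in> wordset W. full B b \<alpha>} \<union> {\<alpha> \<in> wordset W. full C (a + b) \<alpha>})"
      by (auto simp: fits_def)
    hence "card {\<alpha>. okw W \<alpha> \<and> \<not> fits \<alpha>} \<le> card {\<alpha> \<in> wordset W. full A a \<alpha>} + (card {\<alpha> \<in> wordset W. full B b \<alpha>} + card {\<alpha> \<in> wordset W. full C (a + b) \<alpha>})"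
      by (simp only:) (intro order_trans[OF card_Un_le] add_mono order_refl card_Un_le)
    hence "real (card {\<alpha>. okw W \<alpha> \<and> \<not> fits \<alpha>}) \<le> 3 * (9 * real m * 2 ^ (Suc W - \<nu>) / real cap)"
      using ov[of A a] ov[of B b] ov[of C "a + b"] ab by simp
    also have "\<dots> = \<delta>1 * 2 ^ (W + 1)"
      unfolding split[OF q.L_W(2)] by (simp add: q.N_def)
    finally show ?thesis .
  qed
  have r1: "HT W pre (Rand (3 * 17)) 1 pre (1 - \<delta>1) (\<lambda>v \<mu>. fits (v 17))"
    by (rule HT_Rand) (use pre_upd fits_card in simp_all)
  have r2: "HT W (\<lambda>v \<mu>. pre v \<mu> \<and> fits (v 17)) (Rand (3 * 18)) 1 pre (1 - \<delta>2) (\<lambda>v \<mu>. lucky (v 17) (v 18))"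
  proof (rule HT_Rand)
    fix v \<mu> assume v: "pre v \<mu> \<and> fits (v 17)"
    let ?\<alpha> = "v 17"
    \<comment> \<open>0 is a placeholder for the second multiplier, which is still to be drawn; the
      round and the notion of a false row have to be fixed beforehand.\<close>
    interpret r: reduction W U D L n w Bc H ?\<alpha> 0 \<nu> N cap p tp \<pi> "bk ?\<alpha> A" "bk ?\<alpha> B" "bk ?\<alpha> C" "set A" "set B" "set C" A B C m
      using reduction unfolding \<nu>_def N_def cap_def by simp_all
    have nf: "length (filter (\<lambda>x. r.h1 x = r.h1 a) A) \<le> cap" "length (filter (\<lambda>x. r.h1 x = r.h1 b) B) \<le> cap"
      "length (filter (\<lambda>x. r.h1 x = r.h1 (a + b)) C) \<le> cap" using v by (auto simp: fits_def full_def)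
    obtain u r i j l where wit: "u < 2 * N" "r < N" "i < cap" "j < cap" "l < cap"
        "bk ?\<alpha> A r i = a" "bk ?\<alpha> B (r.r2 u r) j = b" "bk ?\<alpha> C (u div 2) l = a + b"
      using r.witness[OF ab nf] by blast
    \<comment> \<open>In round \<open>u\<close> the solution itself supplies a positive hit, so the
      round can fail to be good only through false rows.\<close>
    have sub: "{\<alpha>. okw W \<alpha> \<and> \<not> lucky ?\<alpha> \<alpha>} \<subseteq> {\<alpha> \<in> wordset W. Bc \<le> card {r \<in> {..<N}. r.false_row u \<alpha> r}}"
    proof safe
      fix \<alpha> assume nl: "\<not> lucky ?\<alpha> \<alpha>"
      interpret s: reduction W U D L n w Bc H ?\<alpha> \<alpha> \<nu> N cap p tp \<pi> "bk ?\<alpha> A" "bk ?\<alpha> B" "bk ?\<alpha> C" "set A" "set B" "set C" A B C m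
        using reduction unfolding \<nu>_def N_def cap_def by simp_all
      show "Bc \<le> card {r \<in> {..<N}. r.false_row u \<alpha> r}"
        using nl s.good_iff[of u] s.hit_posi[OF ab wit(3-5,2,6-8)] wit(1,2) by (meson linorder_not_le)
    qed
    have "card {\<alpha>. okw W \<alpha> \<and> \<not> lucky ?\<alpha> \<alpha>} \<le> card {\<alpha> \<in> wordset W. Bc \<le> card {r \<in> {..<N}. r.false_row u \<alpha> r}}"
      by (intro card_mono[OF _ sub]) (simp add: finite_words)
    hence "card {\<alpha>. okw W \<alpha> \<and> \<not> lucky ?\<alpha> \<alpha>} * Bc \<le> N * (cap ^ 3 * (36 * 2 ^ (Suc W - L)))"
      using r.false_row_count[OF U wit(1)] by (meson le_trans mult_le_mono1)
    hence "real (card {\<alpha>. okw W \<alpha> \<and> \<not> lucky ?\<alpha> \<alpha>} * Bc) \<le> real (N * (cap ^ 3 * (36 * 2 ^ (Suc W - L))))"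
      by (simp only: of_nat_le_iff)
    hence "real (card {\<alpha>. okw W \<alpha> \<and> \<not> lucky ?\<alpha> \<alpha>}) \<le> \<delta>2 * 2 ^ (W + 1)"
      unfolding split[OF q.L_W(1)] using Bc by (simp add: field_simps)
    thus "real (card {\<alpha>. okw W \<alpha> \<and> \<not> lucky ((v(18 := \<alpha>)) 17) ((v(18 := \<alpha>)) 18)}) \<le> \<delta>2 * 2 ^ (W + 1)" by simp
  qed (use pre_upd in auto)
  have t2: "T W pre (Seq (Rand (3 * 18)) (tail_code p)) (1 + 1 + time) (\<lambda>v \<mu>. \<mu> 0 \<noteq> 0 \<longrightarrow> sol)"
    by (rule T_Seq[OF T_Rand T_any]) auto
  have "HT W (\<lambda>v \<mu>. pre v \<mu> \<and> fits (v 17)) (Seq (Rand (3 * 18)) (tail_code p)) (1 + 1 + time) (\<lambda>v \<mu>. \<mu> 0 \<noteq> 0 \<longrightarrow> sol) ((1 - \<delta>2) * \<pi>) (\<lambda>v \<mu>. \<mu> 0 \<noteq> 0)"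
    by (rule HT_Seq[OF r2 T_any HT_lucky \<pi>(1)])
  note seq = HT_Seq[OF r1 t2 this mult_nonneg_nonneg[OF assms(3) \<pi>(1)]]
  show ?thesis unfolding rand_code_def
  proof (rule HT_weaken[OF seq _ order_refl])
    show "1 + 1 + (1 + 1 + time) \<le> time + 4" by simp
  qed assumption+
qed

end


section \<open>The choice of the parameters\<close>

text \<open>Without a logarithm instruction, \<open>f\<close> is found by counting up in a loop of
  \<open>m\<close> iterations, which linear time permits. The word length is
  \<open>4 * \<eta>\<close>, so a shift by two bits yields \<open>\<eta>\<close> and hence the block
  size \<open>2 ^ \<eta>\<close>.\<close>

definition param_code :: "nat \<Rightarrow> nat \<Rightarrow> nat \<Rightarrow> nat \<Rightarrow> com" where
  "param_code J \<kappa> q k = Seq (Seq (blk [As 3 (Ld (K 0)), As 4 (Ld (K 1))])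
    (loop 20 (V 3) (blk [As 5 (V 5 \<boxplus> Bi Less (K 0) (Bi Shr (V 3) (K (int (6 * J + 4)) \<boxtimes> (V 5 \<boxplus> K 1))))])))
    (blk [As 6 (K (int J) \<boxtimes> V 5 \<boxplus> K 1), As 39 (Bi Shl (K 1) (V 6)), As 7 (V 39 \<boxminus> K 1),
      As 10 (K (int (\<kappa> - 4)) \<boxplus> K (int (3 * J + 5)) \<boxtimes> V 5), As 38 (Bi Shl (K 1) (V 10)),
      As 8 (K (int \<kappa>) \<boxplus> K (int (5 * J + 5)) \<boxtimes> V 5), As 9 (Bi Shl (K 1) (V 8)),
      As 11 (K (int q) \<boxtimes> Bi Shl (K 1) (K (int (J + 1)) \<boxtimes> V 5)), As 12 (K (int k) \<boxtimes> (V 8 \<boxplus> K 1)),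
      As 2 (V 0 \<boxminus> V 12), As 13 (V 0 \<boxplus> K 1 \<boxminus> V 8), As 14 (V 0 \<boxplus> K 1 \<boxminus> V 10),
      As 15 (Bi Shl (K 1) (K (int \<kappa>) \<boxplus> K (int (5 * J + 2)) \<boxtimes> V 5)), As 16 (Bi Shl (K 1) (Bi Shr (V 0) (K 2)))])"

text \<open>All exponents in use are linear in \<open>f\<close> and \<open>\<beta>\<close>, and
  \<open>f \<le> \<beta>\<close>; this constant dominates the sum of their coefficients. Four times
  it becomes the word length constant of the program.\<close>

definition factor :: "nat \<Rightarrow> nat \<Rightarrow> nat \<Rightarrow> nat \<Rightarrow> nat" where
  "factor J \<kappa> q k = k * (\<kappa> + 5 * J + 6) + q + 4 * \<kappa> + 20 * J + 40"

lemma le_mult_add: "1 \<le> \<beta> \<Longrightarrow> f \<le> \<beta> \<Longrightarrow> a + b * f \<le> (a + b) * \<beta>" for a b f \<beta> :: nat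
  unfolding distrib_right by (intro add_mono mult_left_mono) auto

lemma less_two_power: "n < 2 ^ n" for n :: nat
  by simp

text \<open>Up to constant factors, \<open>m\<close> is \<open>2 ^ ((6 * J + 4) * f)\<close>.  The exponents are chosen such that
  \<open>n\<close> is of order \<open>N ^ (1 / 5)\<close> and both \<open>m / (N * cap)\<close> and \<open>N * cap ^ 3 / (2 ^ L * Bc)\<close> tend to \<open>0\<close>, while
  \<open>N * (N * n ^ (2 - 5 / (J + 1)))\<close> and \<open>N * (Bc * cap\<^sup>2)\<close> are of order \<open>m ^ (2 - 1 / (6 * J + 4))\<close>.\<close>

locale parameters =
  fixes J \<kappa> q k m U f \<beta> :: nat
  fixes D L \<nu> n w Bc W \<eta> N cap :: nat and H :: int
  defines "D \<equiv> J * f + 1" and "L \<equiv> (\<kappa> - 4) + (3 * J + 5) * f" and "\<nu> \<equiv> \<kappa> + (5 * J + 5) * f"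
    and "n \<equiv> q * 2 ^ ((J + 1) * f)" and "w \<equiv> k * (\<nu> + 1)" and "Bc \<equiv> 2 ^ (\<kappa> + (5 * J + 2) * f)"
    and "\<eta> \<equiv> factor J \<kappa> q k * \<beta>" and "W \<equiv> 4 * \<eta>" and "N \<equiv> 2 ^ \<nu>" and "cap \<equiv> 2 ^ D - 1" and "H \<equiv> 2 ^ \<eta>"
  assumes \<kappa>: "5 \<le> \<kappa>" and q: "5 * \<kappa> + 17 * J + 40 \<le> q" "q < 2 ^ \<kappa>"
    and m: "2 ^ ((6 * J + 4) * f) \<le> m" "m < 2 ^ ((6 * J + 4) * (f + 1))" and \<beta>: "m + U + 1 \<le> 2 ^ \<beta>" "1 \<le> \<beta>"
begin

lemma f_\<beta>: "f \<le> \<beta>"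
proof -
  have "(2::nat) ^ ((6 * J + 4) * f) < 2 ^ \<beta>" using m(1) \<beta>(1) by linarith
  hence "(6 * J + 4) * f < \<beta>" by simp
  thus ?thesis by (simp add: distrib_right)
qed

lemma \<nu>_eq: "\<nu> = L + 2 + 2 * D"
  using \<kappa> by (simp add: \<nu>_def L_def D_def algebra_simps)

lemma \<eta>: "w + q + 4 * \<kappa> + 20 * (J * f) + 40 * \<beta> \<le> \<eta>"
proof -
  have "\<nu> + 1 \<le> (\<kappa> + 5 * J + 6) * \<beta>"
    using le_mult_add[OF \<beta>(2) f_\<beta>, of "\<kappa> + 1" "5 * J + 5"] by (simp add: \<nu>_def ac_simps)
  hence "w \<le> k * (\<kappa> + 5 * J + 6) * \<beta>" unfolding w_def by (simp only: mult.assoc mult_le_mono2)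
  moreover have "q \<le> q * \<beta>" "4 * \<kappa> \<le> 4 * \<kappa> * \<beta>" using \<beta>(2) by simp_all
  moreover have "20 * (J * f) \<le> 20 * J * \<beta>" using f_\<beta> by simp
  ultimately show ?thesis unfolding \<eta>_def factor_def distrib_right by linarith
qed

lemma exps: "L = \<kappa> - 4 + 3 * (J * f) + 5 * f" "\<nu> = \<kappa> + 5 * (J * f) + 5 * f" "D = J * f + 1"
  by (simp_all add: L_def \<nu>_def D_def distrib_right)

lemma HI: "e \<le> \<eta> \<Longrightarrow> x \<le> 2 ^ e \<Longrightarrow> int x \<le> H"
proof -
  assume "e \<le> \<eta>" "x \<le> 2 ^ e"
  hence "x \<le> 2 ^ \<eta>" by (meson le_trans one_le_numeral power_increasing)
  hence "int x \<le> int (2 ^ \<eta>)" by (simp only: of_nat_le_iff)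
  thus "int x \<le> H" by (simp add: H_def)
qed

lemma n_le: "n \<le> 2 ^ (q + J * f + f)"
proof -
  have "q \<le> 2 ^ q" using less_two_power[of q] by simp
  hence "q * 2 ^ (J * f + f) \<le> 2 ^ q * 2 ^ (J * f + f)" by (rule mult_le_mono1)
  thus ?thesis by (simp add: n_def power_add distrib_right mult.assoc)
qed

lemma N_pos: "1 \<le> N" and Bc_pos: "1 \<le> Bc"
  by (simp_all add: N_def Bc_def)

lemma input_le: "2 + 3 * int m \<le> H" "2 * int U < H"
proof -
  have "2 + 3 * m \<le> 2 ^ (\<beta> + 3)" using \<beta> by (simp add: power_add)
  thus "2 + 3 * int m \<le> H" using HI[of "\<beta> + 3" "2 + 3 * m"] \<eta> \<beta>(2) by simp
  have "2 * U + 1 \<le> 2 ^ (\<beta> + 1)" using \<beta> by simp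
  thus "2 * int U < H" using HI[of "\<beta> + 1" "2 * U + 1"] \<eta> \<beta>(2) by simp
qed

text \<open>The capacity is about \<open>2 ^ (J * f)\<close> and the hash length is linear in
  \<open>f\<close>, whereas \<open>n\<close> has a further factor \<open>2 ^ f\<close>. This slack
  swallows the logarithm; \<open>q\<close> swallows the constants.\<close>

lemma rules_le: "cap * (2 * L + 4) + L + 2 * D + 5 \<le> n"
proof -
  have "cap + 1 = 2 * 2 ^ (J * f)" by (simp add: cap_def D_def)
  hence "cap * (2 * L + 4) \<le> 2 * 2 ^ (J * f) * (2 * L + 4)" by (intro mult_le_mono1) simp
  moreover have "L + 2 * D + 5 \<le> 2 ^ (J * f) * (L + 2 * D + 5)" by simp
  ultimately have "cap * (2 * L + 4) + (L + 2 * D + 5) \<le> 2 ^ (J * f) * (4 * L + 8 + (L + 2 * D + 5))"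
    unfolding distrib_left by linarith
  also have "4 * L + 8 + (L + 2 * D + 5) \<le> (5 * \<kappa> + 15 ) + (17 * J + 25) * f"
    unfolding exps distrib_right by simp
  also have "\<dots> \<le> (5 * \<kappa> + 15 + (17 * J + 25)) * 2 ^ f"
    by (rule le_mult_add) (simp_all add: less_imp_le)
  also have "\<dots> \<le> q * 2 ^ f" using q(1) by (intro mult_le_mono1) simp
  also have "2 ^ (J * f) * (q * 2 ^ f) = n" by (simp add: n_def power_add distrib_right)
  finally show ?thesis by simp
qed

lemma params: "params W U D L n w Bc H"
proof
  have fl: "f \<le> \<beta>" by (rule f_\<beta>)
  note e = \<eta> \<beta>(2) fl
  have \<nu>: "L + 2 + 2 * D = \<nu>" and N: "2 ^ (L + 2 + 2 * D) = N" and Nr: "2 ^ \<nu> = N" using \<nu>_eq N_def by simp_all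
  show "1 \<le> L" "1 \<le> D" using \<kappa> by (auto simp: exps)
  show "(2 ^ D - 1) * (2 * L + 4) + L + 2 * D + 5 \<le> n" using rules_le by (simp add: cap_def)
  have "q * 2 ^ (J * f + f) < 2 ^ \<kappa> * 2 ^ (J * f + f)" using q(2) by simp
  also have "\<dots> = 2 ^ (\<kappa> + (J * f + f))" by (rule power_add[symmetric])
  also have "\<dots> \<le> 2 ^ \<nu>" by (intro power_increasing) (simp_all add: exps)
  finally show "n < 2 ^ (L + 2 + 2 * D)" unfolding \<nu> by (simp add: n_def distrib_right add.commute)
  have "N * 2 ^ D = 2 ^ (\<nu> + D)" by (simp add: N_def power_add)
  thus "int (2 ^ (L + 2 + 2 * D)) * 2 ^ D \<le> H" unfolding N using HI[of "\<nu> + D" "N * 2 ^ D"] e by (simp add: exps)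
  have L2: "2 * L \<le> \<eta>" using e by (simp add: exps)
  have "L + 1 \<le> 2 ^ L" using less_two_power[of L] by linarith
  hence "(L + 1) * 2 ^ L \<le> 2 ^ L * 2 ^ L" by (rule mult_le_mono1)
  hence "(L + 1) * 2 ^ L \<le> 2 ^ (2 * L)" by (simp add: mult_2 power_add)
  thus "(int L + 1) * 2 ^ L \<le> H" using HI[of "2 * L" "(L + 1) * 2 ^ L"] L2 by (simp add: distrib_right add.commute)
  show "2 + 3 * int n * (int (2 ^ (L + 2 + 2 * D)) + 1) \<le> H"
  proof -
    have "1 \<le> n" using rules_le by linarith
    hence "1 \<le> n * N" "n \<le> n * N" using N_pos by simp_all
    moreover have "3 * n * (N + 1) = 3 * (n * N) + 3 * n" by (simp add: algebra_simps)
    ultimately have "2 + 3 * n * (N + 1) \<le> 8 * (n * N)" by linarith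
    also have "\<dots> \<le> 2 ^ 3 * (2 ^ (q + J * f + f) * 2 ^ \<nu>)"
      unfolding N_def using n_le by (intro mult_le_mono) auto
    also have "\<dots> = 2 ^ (3 + (q + J * f + f + \<nu>))" by (simp only: power_add)
    finally have "int (2 + 3 * n * (N + 1)) \<le> H" using e by (intro HI[of "3 + (q + J * f + f + \<nu>)"]) (simp_all add: exps)
    thus ?thesis unfolding N by (simp add: distrib_left add.commute)
  qed
  show "2 * int U < H" by (rule input_le)
  show "2 ^ w \<le> H" using HI[of w "2 ^ w"] e by simp
  show "H * (8 * int (2 ^ (L + 2 + 2 * D)) + 16) \<le> 2 ^ W"
  proof -
    have "8 * N + 16 \<le> 2 ^ 5 * N" using N_pos by simp
    hence "8 * N + 16 \<le> 2 ^ (\<nu> + 5)" by (simp only: N_def power_add mult.commute)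
    hence "int (8 * N + 16) \<le> int (2 ^ (\<nu> + 5))" by (simp only: of_nat_le_iff)
    hence "H * int (8 * N + 16) \<le> H * 2 ^ (\<nu> + 5)" unfolding H_def by (intro mult_left_mono) auto
    also have "\<dots> = 2 ^ (\<eta> + (\<nu> + 5))" by (simp only: H_def power_add)
    also have "\<dots> \<le> 2 ^ W" using e unfolding W_def by (intro power_increasing) (simp_all add: exps)
    finally show ?thesis unfolding N by simp
  qed
  show "w \<le> W" "L + 2 + 2 * D \<le> W" "16 \<le> W" unfolding \<nu> using e by (auto simp: W_def exps)
  show "Bc \<le> 2 ^ (L + 2 + 2 * D)" unfolding \<nu> Bc_def by (intro power_increasing) (auto simp: \<nu>_def distrib_right)
qed


lemma \<eta>2: "6 * J + 4 + \<beta> \<le> \<eta>"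
proof -
  have "6 * J + 4 + \<beta> \<le> (20 * J + 40) * \<beta>"
  proof -
    have "J \<le> J * \<beta>" using \<beta>(2) by simp
    thus ?thesis using \<beta>(2) unfolding distrib_right mult.assoc by linarith
  qed
  also have "\<dots> \<le> factor J \<kappa> q k * \<beta>" unfolding factor_def by (intro mult_le_mono1) simp
  finally show ?thesis by (simp add: \<eta>_def)
qed

lemma word: "e \<le> \<eta> \<Longrightarrow> x \<le> 2 ^ e \<Longrightarrow> wrap W (int x) = int x"
proof -
  assume "e \<le> \<eta>" "x \<le> 2 ^ e"
  hence "int x \<le> H" by (rule HI)
  also have "H < 2 ^ W" unfolding H_def W_def using \<eta> \<beta>(2) by (intro power_strict_increasing) auto
  finally show ?thesis by (intro wrap_idI) auto
qed

lemma W_word: "wrap W (int x) = int x" if "x \<le> W + 1"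
proof -
  have "W + 1 < 2 ^ W"
  proof -
    have "4 \<le> W" using \<eta> \<beta>(2) by (simp add: W_def)
    thus ?thesis by (induction W rule: dec_induct) auto
  qed
  hence "int x < int (2 ^ W)" using that by (simp only: of_nat_less_iff)
  thus ?thesis by (intro wrap_idI) auto
qed

text \<open>The counter \<open>g\<close> has either grown in every iteration or reached the largest
  value with \<open>2 ^ (?M * g) \<le> m\<close>. After \<open>m\<close> iterations it is the
  largest one, because \<open>m < 2 ^ m\<close>.\<close>

lemma T_search:
  assumes v0: "v0 5 = 0" and \<mu>0: "\<mu>0 0 = int m" "\<mu>0 1 = int U"
  shows "T W (\<lambda>v \<mu>. v = v0 \<and> \<mu> = \<mu>0) (Seq (blk [As 3 (Ld (K 0)), As 4 (Ld (K 1))])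
    (loop 20 (V 3) (blk [As 5 (V 5 \<boxplus> Bi Less (K 0) (Bi Shr (V 3) (K (int (6 * J + 4)) \<boxtimes> (V 5 \<boxplus> K 1))))])))
    (m * 100 + 60) (\<lambda>v \<mu>. eqx {3, 4, 5, 20} v v0 \<and> \<mu> = \<mu>0 \<and> v 3 = int m \<and> v 4 = int U \<and> v 5 = int f)"
proof -
  let ?M = "6 * J + 4"
  let ?I = "\<lambda>i v \<mu>. eqx {3, 4, 5, 20} v v0 \<and> \<mu> = \<mu>0 \<and> v 3 = int m \<and> v 4 = int U \<and>
    (\<exists>g\<le>i. v 5 = int g \<and> 2 ^ (?M * g) \<le> m \<and> (g = i \<or> m < 2 ^ (?M * (g + 1))))"
  have m2: "m \<le> 2 ^ \<beta>" "\<beta> \<le> \<eta>" using \<beta>(1) \<eta>2 by auto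
  have 1: "T W (\<lambda>v \<mu>. v = v0 \<and> \<mu> = \<mu>0) (blk [As 3 (Ld (K 0)), As 4 (Ld (K 1))]) 20 (?I 0)"
  proof (rule T_blk)
    fix v \<mu> assume "v = v0 \<and> \<mu> = \<mu>0"
    moreover have "wrap W 1 = 1" using W_word[of 1] by simp
    moreover have "1 \<le> m" using m(1) by (meson le_trans one_le_numeral one_le_power)
    ultimately show "wp W [As 3 (Ld (K 0)), As 4 (Ld (K 1))] (?I 0) v \<mu>" using v0 \<mu>0 by simp
  qed simp
  have 2: "T W (?I 0) (loop 20 (V 3) (blk [As 5 (V 5 \<boxplus> Bi Less (K 0) (Bi Shr (V 3) (K (int ?M) \<boxtimes> (V 5 \<boxplus> K 1))))]))
    (m * 100 + 20) (?I m)"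
  proof (rule T_loop[where I = ?I])
    fix i assume i: "i < m"
    show "T W (\<lambda>v \<mu>. ?I i v \<mu> \<and> v 20 = int i) (blk [As 5 (V 5 \<boxplus> Bi Less (K 0) (Bi Shr (V 3) (K (int ?M) \<boxtimes> (V 5 \<boxplus> K 1))))]) 50
      (\<lambda>v \<mu>. ?I (Suc i) v \<mu> \<and> v 20 = int i)"
    proof (rule T_blk)
      fix v \<mu> assume "?I i v \<mu> \<and> v 20 = int i"
      then obtain g where g: "eqx {3, 4, 5, 20} v v0" "\<mu> = \<mu>0" "v 3 = int m" "v 4 = int U" "v 20 = int i"
        "g \<le> i" "v 5 = int g" "2 ^ (?M * g) \<le> m" "g = i \<or> m < 2 ^ (?M * (g + 1))" by blast
      have "?M * (g + 1) \<le> 2 ^ ?M * m" using g(6) i less_two_power[of ?M] by (intro mult_le_mono) linarith+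
      also have "\<dots> \<le> 2 ^ (?M + \<beta>)" unfolding power_add using m2 by (intro mult_le_mono2) auto
      finally have w1: "wrap W (int (?M * (g + 1))) = int (?M * (g + 1))" using \<eta>2 by (intro word) auto
      have "ev W (K (int ?M) \<boxtimes> (V 5 \<boxplus> K 1)) v \<mu> = wrap W (int (?M * (g + 1)))"
        by (simp only: ev.simps binop_val.simps g(7) wrap_ring) (simp add: algebra_simps)
      hence e1: "ev W (K (int ?M) \<boxtimes> (V 5 \<boxplus> K 1)) v \<mu> = int (?M * (g + 1))" by (simp only: w1)
      have w2: "wrap W (int (m div 2 ^ (?M * (g + 1)))) = int (m div 2 ^ (?M * (g + 1)))"
        using m2 div_le_dividend[of m "2 ^ (?M * (g + 1))"] by (intro word[of \<beta>]) linarith+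
      have "drop_bit (?M * (g + 1)) (int m) = int (m div 2 ^ (?M * (g + 1)))"
        by (simp add: drop_bit_eq_div zdiv_int)
      hence "ev W (Bi Shr (V 3) (K (int ?M) \<boxtimes> (V 5 \<boxplus> K 1))) v \<mu> = wrap W (int (m div 2 ^ (?M * (g + 1))))"
        by (simp only: ev.simps(3)[of _ Shr] binop_val.simps e1 nat_int) (simp add: g(3))
      hence e2: "ev W (Bi Shr (V 3) (K (int ?M) \<boxtimes> (V 5 \<boxplus> K 1))) v \<mu> = int (m div 2 ^ (?M * (g + 1)))"
        by (simp only: w2)
      define g' where "g' = (if 2 ^ (?M * (g + 1)) \<le> m then g + 1 else g)"
      have pos: "0 < m div 2 ^ (?M * (g + 1)) \<longleftrightarrow> 2 ^ (?M * (g + 1)) \<le> m" by (simp add: div_greater_zero_iff)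
      have "g' \<le> m" using g(6) i by (simp add: g'_def)
      hence w3: "wrap W (int g') = int g'" using m2 by (intro word[of \<beta>]) linarith+
      have "ev W (Bi Less (K 0) (Bi Shr (V 3) (K (int ?M) \<boxtimes> (V 5 \<boxplus> K 1)))) v \<mu> = (if 2 ^ (?M * (g + 1)) \<le> m then 1 else 0)"
        using pos W_word[of 1] by (simp only: ev.simps(3)[of _ Less] binop_val.simps e2) simp
      hence "ev W (V 5 \<boxplus> Bi Less (K 0) (Bi Shr (V 3) (K (int ?M) \<boxtimes> (V 5 \<boxplus> K 1)))) v \<mu> = wrap W (int g')"
        by (simp only: ev.simps(3)[of _ Add] binop_val.simps ev.simps(1) g(7)) (simp add: g'_def add.commute)
      hence e3: "ev W (V 5 \<boxplus> Bi Less (K 0) (Bi Shr (V 3) (K (int ?M) \<boxtimes> (V 5 \<boxplus> K 1)))) v \<mu> = int g'" by (simp only: w3)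
      have "2 ^ (?M * g') \<le> m" "g' \<le> Suc i" using g(6,8) by (auto simp: g'_def)
      moreover have "g' = Suc i \<or> m < 2 ^ (?M * (g' + 1))" using g(9) by (auto simp: g'_def)
      ultimately have "?I (Suc i) (v(5 := int g')) \<mu>" using g(1-4) by (intro conjI exI[of _ g']) simp_all
      thus "wp W [As 5 (V 5 \<boxplus> Bi Less (K 0) (Bi Shr (V 3) (K (int ?M) \<boxtimes> (V 5 \<boxplus> K 1))))] (\<lambda>v \<mu>. ?I (Suc i) v \<mu> \<and> v 20 = int i) v \<mu>"
        unfolding wp.simps e3 using g(5) by simp
    qed simp
  next
    show "m < 2 ^ W"
    proof -
      have "m < 2 ^ \<beta>" using \<beta>(1) by linarith
      also have "(2::nat) ^ \<beta> \<le> 2 ^ W" using m2 by (intro power_increasing) (auto simp: W_def)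
      finally show ?thesis .
    qed
    show "1 \<le> W" using \<eta> \<beta>(2) by (simp add: W_def)
  qed (auto simp: loop_time_def)
  have "v 5 = int f" if I: "?I m v \<mu>" for v \<mu>
  proof -
    obtain g where g: "v 5 = int g" "2 ^ (?M * g) \<le> m" "g = m \<or> m < 2 ^ (?M * (g + 1))" using I by blast
    have "m < 2 ^ m" by (rule less_two_power)
    also have "(2::nat) ^ m \<le> 2 ^ (?M * m)" by (intro power_increasing) (auto simp: distrib_right)
    finally have "m < 2 ^ (?M * m)" .
    hence "m < 2 ^ (?M * (g + 1))" using g(2,3) by auto
    hence "2 ^ (?M * f) < (2 :: nat) ^ (?M * (g + 1))" "2 ^ (?M * g) < (2 :: nat) ^ (?M * (f + 1))"
      using m g(2) by linarith+
    hence "?M * f < ?M * (g + 1)" "?M * g < ?M * (f + 1)" by (simp_all only: power_strict_increasing_iff one_less_numeral_iff semiring_norm)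
    hence "f = g" unfolding mult_less_cancel1 by linarith
    thus ?thesis using g(1) by simp
  qed
  thus ?thesis by (intro T_Seq[OF 1 T_weaken[OF 2]]) auto
qed


lemma shl_word: "e \<le> \<eta> \<Longrightarrow> ev W a v \<mu> = int e \<Longrightarrow> ev W (Bi Shl (K 1) a) v \<mu> = int (2 ^ e)"
  using word[of e "2 ^ e"] W_word[of 1] by (simp add: push_bit_eq_mult)

lemma lin_word:
  assumes "a + b * f \<le> \<eta>" "v 5 = int f"
  shows "ev W (K (int a) \<boxplus> K (int b) \<boxtimes> V 5) v \<mu> = int (a + b * f)"
proof -
  have "ev W (K (int a) \<boxplus> K (int b) \<boxtimes> V 5) v \<mu> = wrap W (int (a + b * f))"
    using assms(2) by (simp add: wrap_ring)
  thus ?thesis using word[OF assms(1), of "a + b * f"] less_two_power[of "a + b * f"] by simp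
qed

lemma wp_As: "ev w' e v \<mu> = x \<Longrightarrow> wp w' ss Q (v(r := x)) \<mu> \<Longrightarrow> wp w' (As r e # ss) Q v \<mu>"
  by simp

lemma T_param:
  assumes v0: "\<And>r. v0 r = (if r = 0 then int W else 0)" and \<mu>0: "\<mu>0 0 = int m" "\<mu>0 1 = int U"
  shows "T W (\<lambda>v \<mu>. v = v0 \<and> \<mu> = \<mu>0) (param_code J \<kappa> q k) (m * 100 + 500)
    (\<lambda>v \<mu>. params.env W U D L n w Bc H (v 17) (v 18) v \<and> v 3 = int m \<and> v 19 = 0 \<and> \<mu> = \<mu>0)"
proof -
  interpret p: params W U D L n w Bc H 0 0 "L + 2 + 2 * D" "2 ^ (L + 2 + 2 * D)" "2 ^ D - 1"
    by (rule params)
  let ?Q1 = "\<lambda>v \<mu>. eqx {3, 4, 5, 20} v v0 \<and> \<mu> = \<mu>0 \<and> v 3 = int m \<and> v 4 = int U \<and> v 5 = int f"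
  let ?c = "[As 6 (K (int J) \<boxtimes> V 5 \<boxplus> K 1), As 39 (Bi Shl (K 1) (V 6)), As 7 (V 39 \<boxminus> K 1),
      As 10 (K (int (\<kappa> - 4)) \<boxplus> K (int (3 * J + 5)) \<boxtimes> V 5), As 38 (Bi Shl (K 1) (V 10)),
      As 8 (K (int \<kappa>) \<boxplus> K (int (5 * J + 5)) \<boxtimes> V 5), As 9 (Bi Shl (K 1) (V 8)),
      As 11 (K (int q) \<boxtimes> Bi Shl (K 1) (K (int (J + 1)) \<boxtimes> V 5)), As 12 (K (int k) \<boxtimes> (V 8 \<boxplus> K 1)),
      As 2 (V 0 \<boxminus> V 12), As 13 (V 0 \<boxplus> K 1 \<boxminus> V 8), As 14 (V 0 \<boxplus> K 1 \<boxminus> V 10),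
      As 15 (Bi Shl (K 1) (K (int \<kappa>) \<boxplus> K (int (5 * J + 2)) \<boxtimes> V 5)), As 16 (Bi Shl (K 1) (Bi Shr (V 0) (K 2)))]"
  let ?Q2 = "\<lambda>v \<mu>. params.env W U D L n w Bc H (v 17) (v 18) v \<and> v 3 = int m \<and> v 19 = 0 \<and> \<mu> = \<mu>0"
  have bnd: "D \<le> \<eta>" "L \<le> \<eta>" "\<nu> \<le> \<eta>" "\<kappa> + (5 * J + 2) * f \<le> \<eta>" "(J + 1) * f \<le> \<eta>" "w \<le> \<eta>" "2 \<le> \<eta>"
    using \<eta> f_\<beta> \<beta>(2) by (auto simp: exps distrib_right)
  have s: "wrap W 1 = 1" "wrap W 2 = 2" by simp_all
  have e6: "ev W (K (int J) \<boxtimes> V 5 \<boxplus> K 1) v \<mu> = int D" if "v 5 = int f" for v \<mu>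
  proof -
    have "ev W (K (int J) \<boxtimes> V 5 \<boxplus> K 1) v \<mu> = wrap W (int D)" using that by (simp add: wrap_ring D_def add.commute)
    thus ?thesis using word[OF bnd(1), of D] less_two_power[of D] by simp
  qed
  have e39: "ev W (Bi Shl (K 1) (V x)) v \<mu> = 2 ^ e" if "v x = int e" "e \<le> \<eta>" for v \<mu> x e
    using shl_word[OF that(2), of "V x" v \<mu>] that(1) by simp
  have e7: "ev W (V 39 \<boxminus> K 1) v \<mu> = int (2 ^ D - 1)" if "v 39 = 2 ^ D" for v \<mu>
  proof -
    have "int (2 ^ D - 1) = 2 ^ D - 1" by (simp add: of_nat_diff)
    moreover have "wrap W (int (2 ^ D - 1)) = int (2 ^ D - 1)" using bnd(1) by (intro word[of D]) auto
    ultimately show ?thesis using that s by simp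
  qed
  have e10: "ev W (K (int (\<kappa> - 4)) \<boxplus> K (int (3 * J + 5)) \<boxtimes> V 5) v \<mu> = int L" if "v 5 = int f" for v \<mu>
    using lin_word[where v = v and a = "\<kappa> - 4" and b = "3 * J + 5" and \<mu> = \<mu>, OF _ that] bnd(2) unfolding L_def by (simp only: distrib_right)
  have e8: "ev W (K (int \<kappa>) \<boxplus> K (int (5 * J + 5)) \<boxtimes> V 5) v \<mu> = int \<nu>" if "v 5 = int f" for v \<mu>
    using lin_word[where v = v and a = \<kappa> and b = "5 * J + 5" and \<mu> = \<mu>, OF _ that] bnd(3) unfolding \<nu>_def by simp
  have e15: "ev W (Bi Shl (K 1) (K (int \<kappa>) \<boxplus> K (int (5 * J + 2)) \<boxtimes> V 5)) v \<mu> = int Bc" if "v 5 = int f" for v \<mu>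
    unfolding Bc_def by (rule shl_word[OF bnd(4) lin_word[where v = v and \<mu> = \<mu>, OF bnd(4) that]])
  have e11: "ev W (K (int q) \<boxtimes> Bi Shl (K 1) (K (int (J + 1)) \<boxtimes> V 5)) v \<mu> = int n" if "v 5 = int f" for v \<mu>
  proof -
    have "ev W (K (int (J + 1)) \<boxtimes> V 5) v \<mu> = wrap W (int ((J + 1) * f))" using that by (simp add: wrap_ring distrib_right)
    hence "ev W (K (int (J + 1)) \<boxtimes> V 5) v \<mu> = int ((J + 1) * f)"
      using word[OF bnd(5), of "(J + 1) * f"] less_two_power[of "(J + 1) * f"] by simp
    from shl_word[OF bnd(5) this]
    have "ev W (K (int q) \<boxtimes> Bi Shl (K 1) (K (int (J + 1)) \<boxtimes> V 5)) v \<mu> = wrap W (wrap W (int q) * int (2 ^ ((J + 1) * f)))"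
      by (simp only: ev.simps(3)[of _ Mul] binop_val.simps ev.simps(2))
    also have "\<dots> = wrap W (int n)" by (simp add: wrap_ring n_def)
    finally show ?thesis using word[OF _ n_le] \<eta> f_\<beta> by simp
  qed
  have e12: "ev W (K (int k) \<boxtimes> (V 8 \<boxplus> K 1)) v \<mu> = int w" if "v 8 = int \<nu>" for v \<mu>
  proof -
    have "ev W (K (int k) \<boxtimes> (V 8 \<boxplus> K 1)) v \<mu> = wrap W (int w)" by (simp only: ev.simps binop_val.simps that wrap_ring) (simp add: w_def distrib_left add.commute)
    thus ?thesis using word[OF bnd(6), of w] less_two_power[of w] by simp
  qed
  have dW: "wrap W (int W - int x) = int (W - x)" if "x \<le> W" for x
    using W_word[of "W - x"] that by (simp add: of_nat_diff)
  have dW1: "wrap W (int W + 1 - int x) = int (Suc W - x)" if "x \<le> Suc W" for x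
    using W_word[of "Suc W - x"] that by (simp add: of_nat_diff add.commute)
  have eW: "\<eta> \<le> W" by (simp add: W_def)
  have e2: "ev W (V 0 \<boxminus> V 12) v \<mu> = int (W - w)" if "v 0 = int W" "v 12 = int w" for v \<mu>
    using that dW[of w] bnd(6) eW by simp
  have e13: "ev W (V 0 \<boxplus> K 1 \<boxminus> V y) v \<mu> = int (Suc W - x)" if "v 0 = int W" "v y = int x" "x \<le> \<eta>" for v \<mu> x y
    using that dW1[of x] eW s by (simp add: wrap_ring)
  have e16: "ev W (Bi Shl (K 1) (Bi Shr (V 0) (K 2))) v \<mu> = H" if "v 0 = int W" for v \<mu>
  proof -
    have "drop_bit 2 (int W) = int \<eta>" by (simp add: W_def drop_bit_eq_div)
    hence "ev W (Bi Shr (V 0) (K 2)) v \<mu> = int \<eta>" using that s W_word[of \<eta>] eW by simp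
    from shl_word[OF order_refl this] show ?thesis by (simp add: H_def)
  qed
  have "T W ?Q1 (blk ?c) 400 ?Q2"
  proof (rule T_blk)
    fix v \<mu> assume a: "?Q1 v \<mu>"
    have ve: "v r = v0 r" if "r \<notin> {3, 4, 5, 20}" for r using a that by (auto dest: eqxD)
    have v: "v 0 = int W" "v 3 = int m" "v 4 = int U" "v 5 = int f" "v 17 = 0" "v 18 = 0" "v 19 = 0" "\<mu> = \<mu>0"
      using a ve[of 0] ve[of 17] ve[of 18] ve[of 19] v0 by auto
    show "wp W ?c ?Q2 v \<mu>"
      apply (rule wp_As[OF e6], simp add: v)
      apply (rule wp_As[OF e39[where e = D]], simp, rule bnd)
      apply (rule wp_As[OF e7], simp)
      apply (rule wp_As[OF e10], simp add: v)
      apply (rule wp_As[OF e39[where e = L]], simp, rule bnd)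
      apply (rule wp_As[OF e8], simp add: v)
      apply (rule wp_As[OF e39[where e = \<nu>]], simp, rule bnd)
      apply (rule wp_As[OF e11], simp add: v)
      apply (rule wp_As[OF e12], simp)
      apply (rule wp_As[OF e2], simp add: v, simp)
      apply (rule wp_As[OF e13[where x = \<nu>]], simp add: v, simp, rule bnd)
      apply (rule wp_As[OF e13[where x = L]], simp add: v, simp, rule bnd)
      apply (rule wp_As[OF e15], simp add: v)
      apply (rule wp_As[OF e16], simp add: v)
      apply (simp add: v params.env_def[OF params] \<nu>_eq)
      done
  qed simp
  from T_Seq[OF T_search[OF _ \<mu>0, of v0] this order_refl]
  show ?thesis unfolding param_code_def by (rule T_weaken) (use v0 in auto)
qed

end


section \<open>Success probability and running time of the whole program\<close>

definition main_code :: "nat \<Rightarrow> nat \<Rightarrow> nat \<Rightarrow> nat \<Rightarrow> com \<Rightarrow> com" where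
  "main_code J \<kappa> q k p = Seq (param_code J \<kappa> q k) (rand_code p)"

context parameters
begin

lemma solve:
  fixes A B C :: "nat list" and \<pi> :: real
  assumes m1: "1 \<le> m" and inputs: "\<And>X. X \<in> {A, B, C} \<Longrightarrow> distinct X \<and> length X = m \<and> set X \<subseteq> {1..U}"
    and solver: "\<And>R V' M v. length R = N \<Longrightarrow> (\<forall>S \<in> set R. is_slp {0, 1} S \<and> length S = n) \<Longrightarrow>
      is_slp {0, 1} V' \<Longrightarrow> length V' = n \<Longrightarrow> M \<in> carrier_mat N N \<Longrightarrow> v \<in> carrier_vec N \<Longrightarrow>
      (\<forall>i<N. slp_string (R ! i) = list_of_vec (row M i)) \<Longrightarrow> slp_string V' = list_of_vec v \<Longrightarrow>
      halts_within w tp (p, init_state w (mvm_input (N, n, R, V', M, v))) \<and>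
      \<pi> \<le> measure_pmf.prob (steps w tp (p, init_state w (mvm_input (N, n, R, V', M, v))))
        {c'. mvm_correct (N, n, R, V', M, v) (mem (snd c'))}"
    and \<pi>: "0 \<le> \<pi>" "\<pi> \<le> 1"
    and \<delta>: "27 * real m / (real N * real cap) \<le> \<delta>1" "36 * real N * real cap ^ 3 / (2 ^ L * real Bc) \<le> \<delta>2" "\<delta>1 \<le> 1" "\<delta>2 \<le> 1"
    and t: "m * 610 + 2 * N * (N * (n * 700 + 80) + n * 700 + (5 * tp + 2 * reg_bound p + 12) +
      (N * 100 + Bc * (cap * (cap * 170 + 40) + 100)) + 270) + 655 \<le> t"
  shows "halts_within W t (main_code J \<kappa> q k p, init_state W (three_sum_input (m, U, A, B, C)))"
    and "(1 - \<delta>1) * ((1 - \<delta>2) * \<pi>) \<le> measure_pmf.prob (steps W t (main_code J \<kappa> q k p, init_state W (three_sum_input (m, U, A, B, C))))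
      {c'. three_sum_correct (m, U, A, B, C) (mem (snd c'))}"
proof -
  let ?A = "map int A" and ?B = "map int B" and ?C = "map int C"
  have U: "1 \<le> U"
  proof -
    have "A \<noteq> []" "set A \<subseteq> {1..U}" using inputs[of A] m1 by auto
    then obtain x where "x \<in> set A" "x \<in> {1..U}" by (cases A) auto
    thus ?thesis by simp
  qed
  have \<nu>N: "2 ^ (L + 2 + 2 * D) = N" using \<nu>_eq by (simp add: N_def)
  have inp: "distinct X" "length X = m" "set X \<subseteq> {1..int U}" if X: "X \<in> {?A, ?B, ?C}" for X
  proof -
    obtain Y where Y: "X = map int Y" "Y \<in> {A, B, C}" using X by auto
    have "distinct Y" "length Y = m" "set Y \<subseteq> {1..U}" using inputs[OF Y(2)] by auto
    thus "distinct X" "length X = m" "set X \<subseteq> {1..int U}" unfolding Y(1) by (auto simp: distinct_map)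
  qed
  have "random_reduction W U D L n w Bc H p tp \<pi> ?A ?B ?C m"
    unfolding random_reduction_def \<nu>N
    by (intro conjI allI impI; (rule params \<pi> U Bc_pos input_le | (erule inp) |
      (rule solver[THEN conjunct1]; assumption) | (rule solver[THEN conjunct2]; assumption)))
  then interpret r: random_reduction W U D L n w Bc H p tp \<pi> ?A ?B ?C m \<nu> N cap
    unfolding \<nu>_eq N_def cap_def by simp_all
  define s0 where "s0 = init_state W (three_sum_input (m, U, A, B, C))"
  have HW: "H < 2 ^ W" unfolding H_def W_def using \<eta> \<beta>(2) by (intro power_strict_increasing) auto
  have len: "length A = m" "length B = m" "length C = m" using inputs by auto
  have v0: "vars s0 r = (if r = 0 then int W else 0)" for r
    using W_word[of W] by (simp add: s0_def init_state_def vars_def)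
  have nths: "0 \<le> map int ([m, U] @ A @ B @ C) ! i \<and> map int ([m, U] @ A @ B @ C) ! i < H" if "i < 2 + 3 * m" for i
  proof -
    have "map int ([m, U] @ A @ B @ C) ! i \<in> set (map int ([m, U] @ A @ B @ C))" using that len by (intro nth_mem) simp
    moreover have "y < H" if "y \<in> set (map int ([m, U] @ A @ B @ C))" for y
      using that inputs[of A] inputs[of B] inputs[of C] input_le by auto
    moreover have "0 \<le> y" if "y \<in> set (map int ([m, U] @ A @ B @ C))" for y using that by auto
    ultimately show ?thesis by blast
  qed
  have \<mu>0: "reduction.input0 U ?A ?B ?C m (mem s0)"
    unfolding reduction.input0_def[OF r.reduction]
  proof
    fix z
    have "wrap W (map int ([m, U] @ A @ B @ C) ! nat z) = map int ([m, U] @ A @ B @ C) ! nat z" if "0 \<le> z" "z < 2 + 3 * int m"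
      using nths[of "nat z"] that HW by (intro wrap_idI) linarith+
    thus "mem s0 z = (if 0 \<le> z \<and> z < 2 + 3 * int m then ([int m, int U] @ ?A @ ?B @ ?C) ! nat z else 0)"
      using len by (simp add: s0_def init_state_def)
  qed
  have \<mu>01: "mem s0 0 = int m" "mem s0 1 = int U"
    using \<mu>0 m1 by (simp_all add: reduction.input0_def[OF r.reduction])
  have sol: "r.sol \<longleftrightarrow> (\<exists>a \<in> set A. \<exists>b \<in> set B. \<exists>c \<in> set C. a + b = c)"
  proof -
    have "int a + int b \<in> int ` set C \<longleftrightarrow> a + b \<in> set C" for a b
      unfolding of_nat_add[symmetric] by (metis imageE imageI of_nat_eq_iff)
    thus ?thesis by simp
  qed
  let ?good = "\<lambda>v \<mu>. three_sum_correct (m, U, A, B, C) \<mu>"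
  let ?t = "m * 100 + 500 + 1 + (r.time + 4)"
  have \<delta>0: "0 \<le> \<delta>1" "0 \<le> \<delta>2" using \<delta>(1,2) by (auto intro: order_trans[rotated])
  have HTr: "HT W r.pre (rand_code p) (r.time + 4) (\<lambda>v \<mu>. \<mu> 0 \<noteq> 0 \<longrightarrow> r.sol) ((1 - \<delta>1) * ((1 - \<delta>2) * \<pi>)) ?good"
  proof (cases "r.sol")
    case True
    show ?thesis
    proof (rule HT_weaken[OF r.HT_rand[OF True]])
      show "(1 - \<delta>1) * ((1 - \<delta>2) * \<pi>) \<le> (1 - 27 * real m / (real N * real cap)) * ((1 - 36 * real N * real cap ^ 3 / (2 ^ L * real Bc)) * \<pi>)"
        using \<delta> \<pi> by (intro mult_mono mult_right_mono mult_nonneg_nonneg) auto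
    qed (use \<delta> sol True in auto)
  next
    case False
    \<comment> \<open>Without a solution the answer is certainly correct, as the flag is sound; only
      the claimed probability has to be at most 1.\<close>
    have "(1 - \<delta>1) * ((1 - \<delta>2) * \<pi>) \<le> 1" using \<delta> \<delta>0 \<pi> by (intro mult_le_one mult_nonneg_nonneg) auto
    thus ?thesis using False sol by (intro HT_weaken[OF HT_certain[OF r.T_rand]]) auto
  qed
  have "0 \<le> (1 - \<delta>1) * ((1 - \<delta>2) * \<pi>)" using \<delta> \<pi> by simp
  hence HTm: "HT W (\<lambda>v \<mu>. v = vars s0 \<and> \<mu> = mem s0) (main_code J \<kappa> q k p) ?t (\<lambda>v \<mu>. \<mu> 0 \<noteq> 0 \<longrightarrow> r.sol) ((1 - \<delta>1) * ((1 - \<delta>2) * \<pi>)) ?good"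
    unfolding main_code_def
    by (intro T_HT_Seq[OF T_weaken[OF T_param[OF v0 \<mu>01]] HTr]) (auto simp: r.pre_def \<mu>0)
  have "?t \<le> t"
    using t unfolding reduction.tail_time_def[OF r.reduction] search.round_time_def[OF r.search] \<nu>N cap_def[symmetric] by simp
  from HT_weaken[OF HTm this order_refl]
  have "HT W (\<lambda>v \<mu>. v = vars s0 \<and> \<mu> = mem s0) (main_code J \<kappa> q k p) t (\<lambda>v \<mu>. True) ((1 - \<delta>1) * ((1 - \<delta>2) * \<pi>)) ?good" by auto
  then obtain DD where DD: "outcome W (main_code J \<kappa> q k p) s0 t DD"
    "(1 - \<delta>1) * ((1 - \<delta>2) * \<pi>) \<le> measure_pmf.prob DD {s'. three_sum_correct (m, U, A, B, C) (mem s')}"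
    unfolding HT_def HS_def s0_def using wf_init_state[of W] by blast
  show "halts_within W t (main_code J \<kappa> q k p, init_state W (three_sum_input (m, U, A, B, C)))"
    using outcome_halts[OF DD(1)] by (simp only: s0_def)
  show "(1 - \<delta>1) * ((1 - \<delta>2) * \<pi>) \<le> measure_pmf.prob (steps W t (main_code J \<kappa> q k p, init_state W (three_sum_input (m, U, A, B, C))))
      {c'. three_sum_correct (m, U, A, B, C) (mem (snd c'))}"
    using DD unfolding outcome_def s0_def by (simp add: measure_map_pmf vimage_def del: three_sum_correct.simps)
qed

lemma powers: "real N = 2 ^ \<kappa> * (2 ^ f) ^ (5 * J + 5)" "real n = real q * (2 ^ f) ^ (J + 1)" "real cap \<le> 2 * (2 ^ f) ^ J"
  "(2 ^ f) ^ J \<le> real cap" "real Bc = 2 ^ \<kappa> * (2 ^ f) ^ (5 * J + 2)" "real m \<le> 2 ^ (6 * J + 4) * (2 ^ f) ^ (6 * J + 4)"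
  "16 * 2 ^ L = (2 ^ \<kappa> * (2 ^ f) ^ (3 * J + 5) :: real)"
proof -
  have p: "(2 ^ f) ^ c = (2 :: real) ^ (c * f)" for c by (simp add: power_mult[symmetric] mult.commute)
  show "real N = 2 ^ \<kappa> * (2 ^ f) ^ (5 * J + 5)" unfolding p by (simp add: N_def \<nu>_def power_add)
  show "real n = real q * (2 ^ f) ^ (J + 1)" unfolding p by (simp add: n_def)
  have "cap + 1 = 2 * 2 ^ (J * f)" by (simp add: cap_def D_def)
  hence "real (cap + 1) = real (2 * 2 ^ (J * f))" by (simp only:)
  hence "real cap + 1 = 2 * 2 ^ (J * f)" by (simp only: of_nat_mult of_nat_power of_nat_numeral of_nat_add of_nat_1)
  hence c: "real cap = 2 * 2 ^ (J * f) - 1" by simp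
  have one: "(1 :: real) \<le> 2 ^ (J * f)" by simp
  show "real cap \<le> 2 * (2 ^ f) ^ J" "(2 ^ f) ^ J \<le> real cap" unfolding p c using one by linarith+
  show "real Bc = 2 ^ \<kappa> * (2 ^ f) ^ (5 * J + 2)" unfolding p by (simp add: Bc_def power_add)
  have "real m \<le> real (2 ^ ((6 * J + 4) * (f + 1)))" using m(2) by (simp only: of_nat_le_iff)
  thus "real m \<le> 2 ^ (6 * J + 4) * (2 ^ f) ^ (6 * J + 4)" unfolding p by (simp add: power_add distrib_left)
  have "(2 :: real) ^ (4 + L) = 2 ^ (\<kappa> + (3 * J + 5) * f)" using \<kappa> by (simp add: L_def)
  thus "16 * 2 ^ L = (2 ^ \<kappa> * (2 ^ f) ^ (3 * J + 5) :: real)" unfolding p by (simp add: power_add)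
qed


text \<open>In powers of \<open>2 ^ f\<close> the exponents are \<open>6 * J + 4\<close> against
  \<open>6 * J + 5\<close>, and \<open>8 * J + 5\<close> against \<open>8 * J + 7\<close>. So both
  bounds decay with \<open>f\<close>, and the remaining factor \<open>1 / 2 ^ \<kappa>\<close> can
  be made small by the choice of \<open>\<kappa>\<close>.\<close>

lemma failure_bounds:
  "27 * real m / (real N * real cap) \<le> 27 * 2 ^ (6 * J + 4) / 2 ^ \<kappa> / 2 ^ f"
  "36 * real N * real cap ^ 3 / (2 ^ L * real Bc) \<le> 4608 / 2 ^ \<kappa> / 2 ^ f"
proof -
  define x :: real where "x = 2 ^ f"
  have x: "1 \<le> x" "0 < x" by (simp_all add: x_def)
  note pw = powers[folded x_def]
  let ?P = "(2 :: real) ^ \<kappa>" and ?M = "6 * J + 4"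
  have "?P * (x * x ^ ?M) = ?P * x ^ (5 * J + 5) * x ^ J"
    by (simp add: power_add[symmetric] add.commute flip: power_Suc)
  also have "\<dots> \<le> real N * real cap" unfolding pw(1) using x pw(4) by (intro mult_left_mono) auto
  finally have d: "?P * (x * x ^ ?M) \<le> real N * real cap" .
  have "27 * real m / (real N * real cap) \<le> 27 * (2 ^ ?M * x ^ ?M) / (?P * (x * x ^ ?M))"
    using pw(6) d x by (intro frac_le) auto
  also have "\<dots> = 27 * 2 ^ ?M / ?P / x" using x by (simp add: field_simps)
  finally show "27 * real m / (real N * real cap) \<le> 27 * 2 ^ ?M / 2 ^ \<kappa> / 2 ^ f" by (simp add: x_def)
  have "real cap ^ 3 \<le> (2 * x ^ J) ^ 3" using pw(3) by (intro power_mono) auto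
  also have "\<dots> = 8 * x ^ (3 * J)" by (simp add: power_mult_distrib power_mult[symmetric] mult.commute)
  finally have "36 * real N * real cap ^ 3 \<le> 36 * real N * (8 * x ^ (3 * J))" by (intro mult_left_mono) auto
  also have "\<dots> = 288 * ?P * x ^ (8 * J + 5)" unfolding pw(1) by (simp add: power_add[symmetric])
  finally have n: "36 * real N * real cap ^ 3 \<le> 288 * ?P * x ^ (8 * J + 5)" .
  have e: "2 ^ L * real Bc = ?P * x ^ (3 * J + 5) / 16 * (?P * x ^ (5 * J + 2))"
  proof -
    have "2 ^ L = ?P * x ^ (3 * J + 5) / 16" using pw(7) by simp
    thus ?thesis by (simp only: pw(5))
  qed
  also have "\<dots> = ?P * ?P * (x ^ (3 * J + 5) * x ^ (5 * J + 2)) / 16" by simp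
  also have "x ^ (3 * J + 5) * x ^ (5 * J + 2) = x * x * x ^ (8 * J + 5)"
  proof -
    have "3 * J + 5 + (5 * J + 2) = 2 + (8 * J + 5)" by simp
    thus ?thesis by (metis power_add power2_eq_square)
  qed
  finally have "36 * real N * real cap ^ 3 / (2 ^ L * real Bc) \<le> 288 * ?P * x ^ (8 * J + 5) / (?P * ?P * (x * x * x ^ (8 * J + 5)) / 16)"
    using n by (simp only:) (intro divide_right_mono, use x in auto)
  also have "\<dots> = 4608 / ?P / (x * x)" using x by (simp add: field_simps)
  also have "\<dots> \<le> 4608 / ?P / x" using x by (intro divide_left_mono) auto
  finally show "36 * real N * real cap ^ 3 / (2 ^ L * real Bc) \<le> 4608 / 2 ^ \<kappa> / 2 ^ f" by (simp add: x_def)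
qed

lemma m_powr:
  "(2 ^ f) ^ (12 * J + 7) \<le> real m powr (2 - 1 / real (6 * J + 4))"
  "0 \<le> g \<Longrightarrow> 2 powr (- g * (real f + 1)) \<le> real m powr (- (g / real (6 * J + 4)))"
proof -
  let ?M = "6 * J + 4"
  have m0: "0 < m" using m(1) by (meson less_le_trans zero_less_numeral zero_less_power)
  have "(2 ^ f) ^ (12 * J + 7) = (2 :: real) powr (real (?M * f) * (2 - 1 / real ?M))"
  proof -
    have "real (?M * f) * (2 - 1 / real ?M) = real (f * (12 * J + 7))" by (simp add: field_simps)
    moreover have "(2 ^ f) ^ (12 * J + 7) = (2 :: real) powr real (f * (12 * J + 7))"
      by (subst powr_realpow) (simp_all only: power_mult zero_less_numeral)
    ultimately show ?thesis by (simp only:)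
  qed
  also have "\<dots> = (2 ^ (?M * f)) powr (2 - 1 / real ?M)" by (simp only: powr_realpow[symmetric] powr_powr zero_less_numeral)
  also have "\<dots> \<le> real m powr (2 - 1 / real ?M)"
  proof (rule powr_mono2)
    have "real (2 ^ (?M * f)) \<le> real m" using m(1) by (simp only: of_nat_le_iff)
    thus "2 ^ (?M * f) \<le> real m" by simp
  qed (auto simp: field_simps)
  finally show "(2 ^ f) ^ (12 * J + 7) \<le> real m powr (2 - 1 / real ?M)" .
  assume g: "0 \<le> g"
  have "real m \<le> real (2 ^ (?M * (f + 1)))" using m(2) by (simp only: of_nat_le_iff)
  hence "real m \<le> 2 powr real (?M * (f + 1))"
    by (simp only: powr_realpow zero_less_numeral of_nat_power of_nat_numeral)
  hence "(2 powr real (?M * (f + 1))) powr (- (g / real ?M)) \<le> real m powr (- (g / real ?M))"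
    using m0 g by (intro powr_mono2') auto
  moreover have "real (?M * (f + 1)) * (- (g / real ?M)) = - g * (real f + 1)" by (simp add: field_simps)
  ultimately show "2 powr (- g * (real f + 1)) \<le> real m powr (- (g / real ?M))" by (simp add: powr_powr)
qed

text \<open>All three failure probabilities are at most a constant times
  \<open>h = 2 powr (- g * f)\<close>; \<open>g \<le> 1\<close> serves the hash functions and
  \<open>g \<le> \<gamma>\<close> the solver. The choice of \<open>\<kappa>\<close> makes the
  constants sum up to at most 1/2, and this factor pays for the rounding, as \<open>m\<close> may be
  close to the power belonging to \<open>f + 1\<close>.\<close>

lemma success_bound:
  assumes \<gamma>: "0 < \<gamma>" and g: "g = min 1 \<gamma>" and \<kappa>g: "(27 * 2 ^ (6 * J + 4) + 4608) / 2 ^ \<kappa> + 2 powr (- g * real \<kappa>) \<le> 1 / 2"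
  shows "1 - real m powr (- (g / real (6 * J + 4))) \<le>
     (1 - 27 * 2 ^ (6 * J + 4) / 2 ^ \<kappa> / 2 ^ f) * ((1 - 4608 / 2 ^ \<kappa> / 2 ^ f) * (1 - real N powr (- \<gamma>)))"
    and "27 * 2 ^ (6 * J + 4) / 2 ^ \<kappa> / 2 ^ f \<le> (1 :: real)" "4608 / 2 ^ \<kappa> / 2 ^ f \<le> (1 :: real)"
    and "0 \<le> 1 - real N powr (- \<gamma>)" "1 - real N powr (- \<gamma>) \<le> 1"
proof -
  let ?a = "27 * 2 ^ (6 * J + 4) / 2 ^ \<kappa> / 2 ^ f :: real" and ?b = "4608 / 2 ^ \<kappa> / 2 ^ f :: real" and ?c = "real N powr (- \<gamma>)"
  define h where "h = (2 :: real) powr (- g * real f)"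
  have g1: "0 < g" "g \<le> 1" "g \<le> \<gamma>" using \<gamma> g by auto
  have h: "0 < h" "h \<le> 1" using g1 powr_mono[of "- g * real f" 0 2] by (auto simp: h_def)
  have "1 / 2 ^ f = (2 :: real) powr (- real f)" by (simp add: powr_minus powr_realpow field_simps)
  also have "\<dots> \<le> h" unfolding h_def using g1 mult_right_mono[of g 1 "real f"] by (intro powr_mono) auto
  finally have f: "1 / 2 ^ f \<le> h" .
  have "?a + ?b = (27 * 2 ^ (6 * J + 4) + 4608) / 2 ^ \<kappa> * (1 / 2 ^ f)" by (simp add: field_simps)
  also have "\<dots> \<le> (27 * 2 ^ (6 * J + 4) + 4608) / 2 ^ \<kappa> * h" using f by (intro mult_left_mono) auto
  finally have ab: "?a + ?b \<le> (27 * 2 ^ (6 * J + 4) + 4608) / 2 ^ \<kappa> * h" .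
  have N1: "1 \<le> real N" using N_pos by simp
  have "?c \<le> real N powr (- g)" using N1 g1 by (intro powr_mono) auto
  also have "\<dots> = 2 powr (- g * real \<nu>)" by (simp add: N_def powr_realpow[symmetric] powr_powr mult.commute)
  also have "\<dots> \<le> 2 powr (- g * real \<kappa> + - g * real f)"
  proof (intro powr_mono)
    have "real \<kappa> + real f \<le> real \<nu>" unfolding exps(2) by simp
    hence "g * (real \<kappa> + real f) \<le> g * real \<nu>" using g1 by (intro mult_left_mono) auto
    thus "- g * real \<nu> \<le> - g * real \<kappa> + - g * real f" by (simp add: algebra_simps)
  qed simp
  also have "\<dots> = 2 powr (- g * real \<kappa>) * h" unfolding h_def by (rule powr_add)
  finally have c: "?c \<le> 2 powr (- g * real \<kappa>) * h" .
  have "?a + ?b + ?c \<le> ((27 * 2 ^ (6 * J + 4) + 4608) / 2 ^ \<kappa> + 2 powr (- g * real \<kappa>)) * h"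
    using ab c by (simp add: distrib_right)
  also have "\<dots> \<le> 1 / 2 * h" using \<kappa>g h by (intro mult_right_mono) auto
  finally have abc: "?a + ?b + ?c \<le> h / 2" by simp
  have pos: "0 \<le> ?a" "0 \<le> ?b" "0 \<le> ?c" by simp_all
  show a1: "?a \<le> 1" and b1: "?b \<le> 1" and c1: "0 \<le> 1 - ?c" and "1 - ?c \<le> 1" using abc pos h by linarith+
  have "h / 2 \<le> 2 powr (- g * (real f + 1))"
  proof -
    have "2 powr (- g * (real f + 1)) = h * 2 powr (- g)" by (simp add: h_def powr_add[symmetric] algebra_simps)
    moreover have "(2 :: real) powr (- 1) \<le> 2 powr (- g)" using g1 by (intro powr_mono) auto
    hence "h * 2 powr (- 1) \<le> h * 2 powr (- g)" using h by (intro mult_left_mono) auto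
    moreover have "h * 2 powr (- 1) = h / 2" by (simp add: powr_minus)
    ultimately show ?thesis by linarith
  qed
  also have "\<dots> \<le> real m powr (- (g / real (6 * J + 4)))" using g1 by (intro m_powr) auto
  finally have "1 - real m powr (- (g / real (6 * J + 4))) \<le> 1 - (?a + ?b + ?c)" using abc by linarith
  also have "\<dots> \<le> (1 - ?a) * ((1 - ?b) * (1 - ?c))"
  proof -
    have p: "1 - y - z \<le> (1 - y) * (1 - z)" if "0 \<le> y" "0 \<le> z" for y z :: real
      using mult_nonneg_nonneg[OF that] by (simp add: algebra_simps)
    have "1 - ?a - (?b + ?c) \<le> (1 - ?a) * (1 - (?b + ?c))" using pos by (intro p) auto
    also have "\<dots> \<le> (1 - ?a) * ((1 - ?b) * (1 - ?c))" using p[OF pos(2,3)] a1 by (intro mult_left_mono) auto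
    finally show ?thesis by simp
  qed
  finally show "1 - real m powr (- (g / real (6 * J + 4))) \<le> (1 - ?a) * ((1 - ?b) * (1 - ?c))" .
qed


text \<open>Here \<open>(J + 1) * (2 - 5 / (J + 1)) = 2 * J - 3\<close>. Saving a factor
  \<open>(2 ^ f) ^ 5\<close> per row outweighs the losses caused by the slack in \<open>n\<close>
  and by the hash functions.\<close>

lemma powr_solver:
  assumes J: "4 \<le> J" and \<epsilon>: "5 / (real J + 1) \<le> \<epsilon>"
  shows "real n powr (2 - \<epsilon>) \<le> real q ^ 2 * (2 ^ f) ^ (2 * J - 3)"
proof -
  let ?a = "2 - 5 / (real J + 1)" and ?x = "2 ^ f :: real"
  have q0: "1 \<le> real q" using q(1) by simp
  have "1 \<le> n" using rules_le by linarith
  hence "real n powr (2 - \<epsilon>) \<le> real n powr ?a" using \<epsilon> by (intro powr_mono) auto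
  also have "\<dots> = real q powr ?a * (?x ^ (J + 1)) powr ?a" unfolding powers(2) by (rule powr_mult)
  also have "(?x ^ (J + 1)) powr ?a = ?x powr (real (J + 1) * ?a)"
  proof -
    have "?x ^ (J + 1) = ?x powr real (J + 1)" by (rule powr_realpow[symmetric]) simp
    thus ?thesis by (simp only: powr_powr)
  qed
  also have "real (J + 1) * ?a = real (2 * J - 3)" using J by (simp add: of_nat_diff field_simps)
  also have "?x powr real (2 * J - 3) = ?x ^ (2 * J - 3)" by (rule powr_realpow) simp
  also have "real q powr ?a \<le> real q powr real 2" using q0 by (intro powr_mono) auto
  also have "real q powr real 2 = real q ^ 2" using q0 by (intro powr_realpow) auto
  finally show ?thesis by simp
qed

definition const :: "real \<Rightarrow> nat \<Rightarrow> real" where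
  "const Kt rb = 610 * 2 ^ (6 * J + 4) + 2 * 2 ^ \<kappa> * (2 ^ \<kappa> * (700 * real q + 80) + 700 * real q + (5 * (Kt * 2 ^ \<kappa> * real q ^ 2) + 2 * real rb + 12) +
     (100 * 2 ^ \<kappa> + 860 * 2 ^ \<kappa>) + 270) + 655"

text \<open>A round costs of order \<open>(2 ^ f) ^ (7 * J + 2)\<close>: the call of
  \<open>p\<close> and the verification both reach this exponent. The \<open>2 * N\<close> rounds
  contribute \<open>5 * J + 5\<close> to it.\<close>

lemma time_bound:
  assumes J: "4 \<le> J" and \<epsilon>: "5 / (real J + 1) \<le> \<epsilon>" and Kt: "0 \<le> Kt" "real tp \<le> Kt * (real N * real n powr (2 - \<epsilon>))"
  shows "real (m * 610 + 2 * N * (N * (n * 700 + 80) + n * 700 + (5 * tp + 2 * rb + 12) +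
      (N * 100 + Bc * (cap * (cap * 170 + 40) + 100)) + 270) + 655) \<le> const Kt rb * (2 ^ f) ^ (12 * J + 7)"
proof -
  define x :: real where "x = 2 ^ f"
  have x: "1 \<le> x" by (simp add: x_def)
  note pw = powers[folded x_def]
  have mono: "x ^ a \<le> x ^ b" if "a \<le> b" for a b using x that by (intro power_increasing)
  have one: "1 \<le> x ^ a" for a using x by (rule one_le_power)
  let ?P = "(2 :: real) ^ \<kappa>" and ?z = "x ^ (7 * J + 2)"
  have z1: "y \<le> y * ?z" if "0 \<le> y" for y using that one[of "7 * J + 2"] by (simp add: mult_le_cancel_left1)
  have 1: "real N * (real n * 700 + 80) \<le> ?P * (700 * real q + 80) * ?z"
  proof -
    have "real n * 700 + 80 \<le> (700 * real q + 80) * x ^ (J + 1)"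
      using one[of "J + 1"] unfolding pw(2) distrib_right by (simp add: mult_ac)
    hence "real N * (real n * 700 + 80) \<le> ?P * x ^ (5 * J + 5) * ((700 * real q + 80) * x ^ (J + 1))"
      unfolding pw(1) using x by (intro mult_left_mono) auto
    also have "\<dots> = ?P * (700 * real q + 80) * x ^ (6 * J + 6)"
    proof -
      have "x ^ (5 * J + 5) * x ^ (J + 1) = x ^ (6 * J + 6)" unfolding power_add[symmetric] by (rule arg_cong[where f = "power x"]) simp
      thus ?thesis by (simp only: mult_ac) (simp add: mult_ac)
    qed
    \<comment> \<open>Writing down the rows costs \<open>N * n\<close>. The inequality
      \<open>6 * J + 6 \<le> 7 * J + 2\<close> holds from \<open>J = 4\<close> on.\<close>
    also have "\<dots> \<le> ?P * (700 * real q + 80) * ?z" using J by (intro mult_left_mono mono) auto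
    finally show ?thesis .
  qed
  have 2: "real n * 700 \<le> 700 * real q * ?z"
  proof -
    have "real n * 700 = 700 * real q * x ^ (J + 1)" unfolding pw(2) by simp
    also have "\<dots> \<le> 700 * real q * ?z" by (intro mult_left_mono mono) auto
    finally show ?thesis .
  qed
  have 3: "real tp \<le> Kt * ?P * real q ^ 2 * ?z"
  proof -
    have "real tp \<le> Kt * (real N * (real q ^ 2 * x ^ (2 * J - 3)))"
      using Kt powr_solver[OF J \<epsilon>] unfolding x_def by (meson mult_left_mono of_nat_0_le_iff order_trans)
    also have "\<dots> = Kt * ?P * real q ^ 2 * (x ^ (5 * J + 5) * x ^ (2 * J - 3))" unfolding pw(1) by (simp only: mult_ac)
    also have "x ^ (5 * J + 5) * x ^ (2 * J - 3) = ?z" using J by (simp add: power_add[symmetric])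
    finally show ?thesis .
  qed
  have 5: "real N * 100 \<le> 100 * ?P * ?z"
    using mono[of "5 * J + 5" "7 * J + 2"] J unfolding pw(1) by simp
  have 6: "real Bc * (real cap * (real cap * 170 + 40) + 100) \<le> 860 * ?P * ?z"
  proof -
    have "real cap * 170 + 40 \<le> 380 * x ^ J" using pw(3) one[of J] by linarith
    hence "real cap * (real cap * 170 + 40) \<le> 2 * x ^ J * (380 * x ^ J)" using pw(3) one[of J] by (intro mult_mono) auto
    also have "\<dots> = 760 * x ^ (2 * J)" by (simp only: mult_2[of J] power_add)
    finally have "real cap * (real cap * 170 + 40) + 100 \<le> 860 * x ^ (2 * J)" using one[of "2 * J"] by linarith
    hence "real Bc * (real cap * (real cap * 170 + 40) + 100) \<le> ?P * x ^ (5 * J + 2) * (860 * x ^ (2 * J))"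
      unfolding pw(5) using x by (intro mult_left_mono) auto
    also have "\<dots> = 860 * ?P * (x ^ (5 * J + 2) * x ^ (2 * J))" by (simp only: mult_ac)
    also have "x ^ (5 * J + 2) * x ^ (2 * J) = ?z" by (simp add: power_add[symmetric])
    finally show ?thesis .
  qed
  let ?R = "?P * (700 * real q + 80) + 700 * real q + (5 * (Kt * ?P * real q ^ 2) + 2 * real rb + 12) + (100 * ?P + 860 * ?P) + 270"
  have c: "2 * real rb + 12 + 270 \<le> (2 * real rb + 12 + 270) * ?z" by (rule z1) simp
  have "real N * (real n * 700 + 80) + real n * 700 + (5 * real tp + 2 * real rb + 12) + (real N * 100 + real Bc * (real cap * (real cap * 170 + 40) + 100)) + 270
      \<le> ?P * (700 * real q + 80) * ?z + 700 * real q * ?z + (5 * (Kt * ?P * real q ^ 2 * ?z) + (2 * real rb + 12 + 270) * ?z) + (100 * ?P * ?z + 860 * ?P * ?z)"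
    using 1 2 3 5 6 c by linarith
  also have "\<dots> = ?R * ?z" by (simp add: algebra_simps)
  finally have r: "real N * (real n * 700 + 80) + real n * 700 + (5 * real tp + 2 * real rb + 12) + (real N * 100 + real Bc * (real cap * (real cap * 170 + 40) + 100)) + 270 \<le> ?R * ?z" .
  have "2 * real N * (real N * (real n * 700 + 80) + real n * 700 + (5 * real tp + 2 * real rb + 12) + (real N * 100 + real Bc * (real cap * (real cap * 170 + 40) + 100)) + 270)
    \<le> 2 * real N * (?R * ?z)" using r by (intro mult_left_mono) auto
  also have "\<dots> = 2 * ?P * ?R * (x ^ (5 * J + 5) * ?z)" unfolding pw(1) by (simp only: mult_ac)
  also have "x ^ (5 * J + 5) * ?z = x ^ (12 * J + 7)"
    unfolding power_add[symmetric] by (rule arg_cong[where f = "power x"]) simp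
  finally have l: "2 * real N * (real N * (real n * 700 + 80) + real n * 700 + (5 * real tp + 2 * real rb + 12) + (real N * 100 + real Bc * (real cap * (real cap * 170 + 40) + 100)) + 270)
    \<le> 2 * ?P * ?R * x ^ (12 * J + 7)" .
  have "real m \<le> 2 ^ (6 * J + 4) * x ^ (12 * J + 7)"
    by (rule order_trans[OF pw(6) mult_left_mono[OF mono]]) auto
  hence mm: "real m * 610 \<le> 610 * 2 ^ (6 * J + 4) * x ^ (12 * J + 7)" by linarith
  have "655 \<le> 655 * x ^ (12 * J + 7)" using one[of "12 * J + 7"] by linarith
  hence "real m * 610 + 2 * real N * (real N * (real n * 700 + 80) + real n * 700 + (5 * real tp + 2 * real rb + 12) + (real N * 100 + real Bc * (real cap * (real cap * 170 + 40) + 100)) + 270) + 655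
    \<le> 610 * 2 ^ (6 * J + 4) * x ^ (12 * J + 7) + 2 * ?P * ?R * x ^ (12 * J + 7) + 655 * x ^ (12 * J + 7)"
    using l mm by linarith
  also have "\<dots> = const Kt rb * x ^ (12 * J + 7)" unfolding const_def by (simp only: distrib_right)
  finally show ?thesis by (simp add: x_def)
qed

end


section \<open>The reduction\<close>

text \<open>With \<open>\<kappa> = 5 * j\<close> the fifth root of \<open>N\<close> is exactly a
  power of two, and its ratio to \<open>n\<close> is \<open>q / 2 ^ j\<close>. Because
  \<open>lo < hi\<close>, an integer \<open>q\<close> with ratio in the prescribed range exists for
  large \<open>j\<close>; it also outgrows the linear lower bound on \<open>q\<close>.\<close>

lemma exists_parameters:
  fixes lo hi g :: real
  assumes "0 < lo" "lo < hi" "0 < g"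
  obtains j q :: nat where "1 \<le> j" "5 * (5 * j) + 17 * J + 40 \<le> q" "q < 2 ^ (5 * j)"
    "lo * 2 ^ j \<le> real q" "real q \<le> hi * 2 ^ j"
    "(27 * 2 ^ (6 * J + 4) + 4608) / 2 ^ (5 * j) + 2 powr (- g * real (5 * j)) \<le> 1 / 2"
proof -
  define c :: real where "c = 27 * 2 ^ (6 * J + 4) + 4608"
  define b :: real where "b = 17 * real J + 40"
  define d where "d = hi - lo"
  have d: "0 < d" "0 < hi" using assms by (auto simp: d_def)
  have "eventually (\<lambda>j::nat. 25 * real j + b \<le> lo * 2 ^ j) at_top" using assms(1) by real_asymp
  moreover have "eventually (\<lambda>j::nat. 1 \<le> d * 2 ^ j) at_top" using d by real_asymp
  moreover have "eventually (\<lambda>j::nat. hi * 2 ^ j < 2 ^ (5 * j)) at_top" using d by real_asymp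
  moreover have "eventually (\<lambda>j::nat. c / 2 ^ (5 * j) + 2 powr (- g * (5 * real j)) \<le> 1 / 2) at_top"
  proof -
    have "(2 :: real) powr (- g * 5) < 1" using assms(3) powr_less_mono[of "- g * 5" 0 2] by simp
    hence "(\<lambda>j. (2 powr (- g * 5)) ^ j) \<longlonglongrightarrow> 0" by (intro LIMSEQ_power_zero) simp
    moreover have "(2 powr (- g * 5)) ^ j = 2 powr (- g * (5 * real j))" for j
      by (subst powr_realpow[symmetric]) (simp_all add: powr_powr mult.assoc)
    ultimately have "(\<lambda>j::nat. 2 powr (- g * (5 * real j))) \<longlonglongrightarrow> 0" by simp
    moreover have "(\<lambda>j::nat. c / 2 ^ (5 * j)) \<longlonglongrightarrow> 0" by real_asymp
    ultimately have "(\<lambda>j::nat. c / 2 ^ (5 * j) + 2 powr (- g * (5 * real j))) \<longlonglongrightarrow> 0"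
      using tendsto_add[of _ 0 _ _ 0] by fastforce
    from order_tendstoD(2)[OF this, of "1 / 2"] show ?thesis by (auto elim: eventually_mono)
  qed
  moreover have "eventually (\<lambda>j::nat. 1 \<le> j) at_top" by (rule eventually_ge_at_top)
  ultimately have "eventually (\<lambda>j::nat. 25 * real j + b \<le> lo * 2 ^ j \<and> 1 \<le> d * 2 ^ j \<and> hi * 2 ^ j < 2 ^ (5 * j) \<and>
      c / 2 ^ (5 * j) + 2 powr (- g * (5 * real j)) \<le> 1 / 2 \<and> 1 \<le> j) at_top"
    by eventually_elim blast
  then obtain j :: nat where j: "25 * real j + b \<le> lo * 2 ^ j" "1 \<le> d * 2 ^ j" "hi * 2 ^ j < 2 ^ (5 * j)"
      "c / 2 ^ (5 * j) + 2 powr (- g * (5 * real j)) \<le> 1 / 2" "1 \<le> j"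
    using eventually_happens'[OF sequentially_bot] by blast
  define q where "q = nat \<lceil>lo * 2 ^ j\<rceil>"
  have "0 \<le> lo * 2 ^ j" using assms by simp
  hence q: "lo * 2 ^ j \<le> real q" "real q < lo * 2 ^ j + 1" unfolding q_def by linarith+
  hence qhi: "real q \<le> hi * 2 ^ j" using j(2) by (simp add: d_def left_diff_distrib)
  show ?thesis
  proof (rule that[OF j(5) _ _ q(1) qhi])
    have "real (5 * (5 * j) + 17 * J + 40) \<le> real q" using j(1) q(1) by (simp add: b_def)
    thus "5 * (5 * j) + 17 * J + 40 \<le> q" by (simp only: of_nat_le_iff)
    have "real q < 2 ^ (5 * j)" using qhi j(3) by linarith
    hence "real q < real (2 ^ (5 * j))" by (simp only: of_nat_power of_nat_numeral)
    thus "q < 2 ^ (5 * j)" by (simp only: of_nat_less_iff)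
    show "(27 * 2 ^ (6 * J + 4) + 4608) / 2 ^ (5 * j) + 2 powr (- g * real (5 * j)) \<le> 1 / 2"
      using j(4) by (simp add: c_def)
  qed
qed

lemma log_bound:
  fixes x :: nat
  assumes "1 \<le> x"
  shows "x + 1 \<le> 2 ^ nat \<lceil>log 2 (real x + 1)\<rceil>" "1 \<le> nat \<lceil>log 2 (real x + 1)\<rceil>"
proof -
  let ?l = "\<lceil>log 2 (real x + 1)\<rceil>"
  have "1 \<le> log 2 (real x + 1)" using assms by (subst le_log_iff) auto
  hence l: "1 \<le> ?l" by linarith
  thus "1 \<le> nat ?l" by linarith
  have "log 2 (real x + 1) \<le> real (nat ?l)" using l by linarith
  hence "real x + 1 \<le> 2 powr real (nat ?l)" using assms by (subst (asm) log_le_iff) auto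
  hence "real x + 1 \<le> 2 ^ nat ?l" by (simp only: powr_realpow zero_less_numeral)
  hence "real (x + 1) \<le> real (2 ^ nat ?l)" by simp
  thus "x + 1 \<le> 2 ^ nat ?l" by (simp only: of_nat_le_iff)
qed

text \<open>As \<open>n < N\<close>, the rounded logarithm of \<open>N + n + 1\<close> is
  \<open>\<nu> + 1\<close>, so the program can compute the word length of the simulated machine
  exactly.\<close>

lemma word_length_power:
  assumes "1 \<le> n" "n < 2 ^ \<nu>"
  shows "word_length k (2 ^ \<nu> + n) = k * (\<nu> + 1)"
proof -
  have "\<lceil>log (real 2) (real (2 ^ \<nu> + n + 1))\<rceil> = int \<nu> + 1"
    using assms by (intro ceiling_log_nat_eq_if) auto
  thus ?thesis by (simp add: word_length_def ac_simps nat_add_distrib)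
qed

theorem three_sum_reduction:
  fixes \<Sigma> :: "int set" and lo hi \<epsilon> :: real
  assumes solves: "mvm_solves_in_time \<Sigma> lo hi p (\<lambda>N n. real N * real n powr (2 - \<epsilon>))"
    and \<Sigma>: "{0, 1} \<subseteq> \<Sigma>" and lohi: "0 < lo" "lo < hi" and \<epsilon>: "0 < \<epsilon>"
  obtains p' \<epsilon>' where "0 < \<epsilon>'" "solves_in_time p' three_sum_instances three_sum_input (\<lambda>(m, U, A, B, C). m + U)
    (\<lambda>(m, U, A, B, C). m) three_sum_correct (\<lambda>(m, U, A, B, C). real m powr (2 - \<epsilon>'))"
proof -
  obtain k K \<gamma> where \<gamma>: "0 < \<gamma>" and slv: "\<And>N n R V M v. (N, n, R, V, M, v) \<in> mvm_instances \<Sigma> lo hi \<Longrightarrow>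
      \<exists>t::nat. real t \<le> K * (real N * real n powr (2 - \<epsilon>)) \<and>
        halts_within (word_length k (N + n)) t (p, init_state (word_length k (N + n)) (mvm_input (N, n, R, V, M, v))) \<and>
        1 - real N powr (- \<gamma>) \<le> measure_pmf.prob (steps (word_length k (N + n)) t (p, init_state (word_length k (N + n)) (mvm_input (N, n, R, V, M, v))))
          {c'. mvm_correct (N, n, R, V, M, v) (mem (snd c'))}"
    using solves unfolding mvm_solves_in_time_def solves_in_time_def Let_def by fast
  define g where "g = min 1 \<gamma>"
  have g: "0 < g" using \<gamma> by (simp add: g_def)
  \<comment> \<open>The term \<open>5 / \<epsilon>\<close> makes the saving of \<open>p\<close>
    sufficient, and 4 keeps the cost of writing the rows in check.\<close>
  define J where "J = max 4 (nat \<lceil>5 / \<epsilon>\<rceil>)"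
  have J: "4 \<le> J" "5 / (real J + 1) \<le> \<epsilon>"
  proof -
    show "4 \<le> J" by (simp add: J_def)
    have "5 / \<epsilon> \<le> real (nat \<lceil>5 / \<epsilon>\<rceil>)" by linarith
    also have "\<dots> \<le> real J + 1" by (simp add: J_def)
    finally show "5 / (real J + 1) \<le> \<epsilon>" using \<epsilon> by (simp add: field_simps)
  qed
  obtain j q where j: "1 \<le> j" "5 * (5 * j) + 17 * J + 40 \<le> q" "q < 2 ^ (5 * j)" "lo * 2 ^ j \<le> real q" "real q \<le> hi * 2 ^ j"
    "(27 * 2 ^ (6 * J + 4) + 4608) / 2 ^ (5 * j) + 2 powr (- g * real (5 * j)) \<le> 1 / 2"
    using exists_parameters[OF lohi g, where J = J] .
  define \<kappa> where "\<kappa> = 5 * j"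
  \<comment> \<open>The constant \<open>K\<close> of the solver is an arbitrary real number and
    might be negative; monotonicity arguments need a nonnegative one.\<close>
  define Kt where "Kt = max 0 K"
  define M where "M = 6 * J + 4"
  have inst: "\<exists>t::nat. let w = word_length (4 * factor J \<kappa> q k) (m + U); c = (main_code J \<kappa> q k p, init_state w (three_sum_input (m, U, A, B, C))) in
      real t \<le> parameters.const J \<kappa> q Kt (reg_bound p) * real m powr (2 - 1 / real M) \<and> halts_within w t c \<and>
      measure_pmf.prob (steps w t c) {c'. three_sum_correct (m, U, A, B, C) (mem (snd c'))} \<ge> 1 - real m powr (- (g / real M))"
    if i: "(m, U, A, B, C) \<in> three_sum_instances" for m U A B C
  proof -
    have m1: "1 \<le> m" and ABC: "\<And>X. X \<in> {A, B, C} \<Longrightarrow> distinct X \<and> length X = m \<and> set X \<subseteq> {1..U}"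
      using i by (auto simp: three_sum_instances_def)
    define \<beta> where "\<beta> = nat \<lceil>log 2 (real (m + U) + 1)\<rceil>"
    have \<beta>: "m + U + 1 \<le> 2 ^ \<beta>" "1 \<le> \<beta>" using log_bound[of "m + U"] m1 unfolding \<beta>_def by simp_all
    have "2 \<le> (2 :: nat) ^ M" using self_le_power[of "2 :: nat" M] by (simp add: M_def)
    from ex_power_ivl1[OF this m1] obtain f where f: "2 ^ ((6 * J + 4) * f) \<le> m" "m < 2 ^ ((6 * J + 4) * (f + 1))"
      unfolding power_mult M_def by blast
    define D L \<nu> n w Bc \<eta> W N cap and H :: int where "D = J * f + 1" and "L = (\<kappa> - 4) + (3 * J + 5) * f" and
      "\<nu> = \<kappa> + (5 * J + 5) * f" and "n = q * 2 ^ ((J + 1) * f)" and "w = k * (\<nu> + 1)" and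
      "Bc = (2 :: nat) ^ (\<kappa> + (5 * J + 2) * f)" and "\<eta> = factor J \<kappa> q k * \<beta>" and "W = 4 * \<eta>" and "N = (2 :: nat) ^ \<nu>" and
      "cap = (2 :: nat) ^ D - 1" and "H = 2 ^ \<eta>"
    note defs = D_def L_def \<nu>_def n_def w_def Bc_def \<eta>_def W_def N_def cap_def H_def
    have "parameters J \<kappa> q m U f \<beta>"
      using j f \<beta> by (intro parameters.intro) (auto simp: \<kappa>_def)
    then interpret pp: parameters J \<kappa> q k m U f \<beta> D L \<nu> n w Bc W \<eta> N cap H
      unfolding defs by simp_all
    have W: "word_length (4 * factor J \<kappa> q k) (m + U) = W" by (simp add: word_length_def W_def \<eta>_def \<beta>_def)
    have n1: "1 \<le> n" "n < N"
    proof -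
      show "1 \<le> n" using pp.rules_le by linarith
      interpret q: params W U D L n w Bc H 0 0 "L + 2 + 2 * D" "2 ^ (L + 2 + 2 * D)" "2 ^ D - 1" by (rule pp.params)
      show "n < N" using q.nN by (simp add: N_def pp.\<nu>_eq)
    qed
    have wl: "word_length k (N + n) = w" using word_length_power[of n \<nu> k] n1 by (simp add: N_def w_def)
    \<comment> \<open>The halting time of \<open>p\<close> may depend on the instance, whereas all
      calls are analysed with one bound. A halted run may be continued up to \<open>tp\<close>
      without changing its result.\<close>
    define tp where "tp = nat \<lfloor>Kt * (real N * real n powr (2 - \<epsilon>))\<rfloor>"
    have Kt: "0 \<le> Kt" by (simp add: Kt_def)
    hence tp: "real tp \<le> Kt * (real N * real n powr (2 - \<epsilon>))"
      unfolding tp_def by (simp add: mult_nonneg_nonneg)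
    have root: "real N powr (1 / 5) = 2 ^ (j + (J + 1) * f)"
    proof -
      have "real N = 2 powr real \<nu>" by (simp add: N_def powr_realpow)
      moreover have "real \<nu> * (1 / 5) = real (j + (J + 1) * f)" by (simp add: \<nu>_def \<kappa>_def field_simps)
      ultimately have "real N powr (1 / 5) = 2 powr real (j + (J + 1) * f)" by (simp only: powr_powr)
      thus ?thesis by (subst (asm) powr_realpow) simp_all
    qed
    have solver: "halts_within w tp (p, init_state w (mvm_input (N, n, R, V', X, v))) \<and>
      1 - real N powr (- \<gamma>) \<le> measure_pmf.prob (steps w tp (p, init_state w (mvm_input (N, n, R, V', X, v))))
        {c'. mvm_correct (N, n, R, V', X, v) (mem (snd c'))}"
      if "length R = N" "\<forall>S \<in> set R. is_slp {0, 1} S \<and> length S = n" "is_slp {0, 1} V'" "length V' = n"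
        "X \<in> carrier_mat N N" "v \<in> carrier_vec N" "\<forall>i<N. slp_string (R ! i) = list_of_vec (row X i)" "slp_string V' = list_of_vec v"
      for R V' X v
    proof -
      have "lo * real N powr (1 / 5) \<le> real n" "real n \<le> hi * real N powr (1 / 5)"
        unfolding root using j(4,5) by (auto simp: n_def power_add mult_right_mono simp flip: mult.assoc)
      hence "(N, n, R, V', X, v) \<in> mvm_instances \<Sigma> lo hi"
        using that pp.N_pos is_slp_mono[OF _ \<Sigma>] by (auto simp: mvm_instances_def)
      from slv[OF this] obtain t :: nat where t: "real t \<le> K * (real N * real n powr (2 - \<epsilon>))"
        "halts_within w t (p, init_state w (mvm_input (N, n, R, V', X, v)))"
        "1 - real N powr (- \<gamma>) \<le> measure_pmf.prob (steps w t (p, init_state w (mvm_input (N, n, R, V', X, v))))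
          {c'. mvm_correct (N, n, R, V', X, v) (mem (snd c'))}" unfolding wl by blast
      have "K * (real N * real n powr (2 - \<epsilon>)) \<le> Kt * (real N * real n powr (2 - \<epsilon>))"
        by (intro mult_right_mono) (auto simp: Kt_def)
      hence "t \<le> tp" using t(1) unfolding tp_def by (simp add: le_nat_floor)
      then obtain u where "tp = t + u" using le_Suc_ex by blast
      hence "steps w tp (p, init_state w (mvm_input (N, n, R, V', X, v))) = steps w t (p, init_state w (mvm_input (N, n, R, V', X, v)))"
        using steps_halted[OF t(2)] by simp
      thus ?thesis using t(2,3) by (simp only: halts_within_def)
    qed
    note sb = pp.success_bound[OF \<gamma> g_def, unfolded \<kappa>_def, OF j(6), folded \<kappa>_def]
    let ?t = "m * 610 + 2 * N * (N * (n * 700 + 80) + n * 700 + (5 * tp + 2 * reg_bound p + 12) +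
      (N * 100 + Bc * (cap * (cap * 170 + 40) + 100)) + 270) + 655"
    note bounds = sb(4,5) pp.failure_bounds sb(2,3) order_refl
    have sol: "halts_within W ?t (main_code J \<kappa> q k p, init_state W (three_sum_input (m, U, A, B, C)))"
      by (rule pp.solve(1)[OF m1 _ _ bounds], erule ABC) (rule solver; assumption)
    have "(1 - 27 * 2 ^ (6 * J + 4) / 2 ^ \<kappa> / 2 ^ f) * ((1 - 4608 / 2 ^ \<kappa> / 2 ^ f) * (1 - real N powr (- \<gamma>))) \<le>
      measure_pmf.prob (steps W ?t (main_code J \<kappa> q k p, init_state W (three_sum_input (m, U, A, B, C))))
        {c'. three_sum_correct (m, U, A, B, C) (mem (snd c'))}"
      by (rule pp.solve(2)[OF m1 _ _ bounds], erule ABC) (rule solver; assumption)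
    note prob = order_trans[OF sb(1) this]
    have const: "0 \<le> pp.const Kt (reg_bound p)" unfolding pp.const_def using Kt by (intro add_nonneg_nonneg mult_nonneg_nonneg) auto
    have "real ?t \<le> pp.const Kt (reg_bound p) * (2 ^ f) ^ (12 * J + 7)" by (rule pp.time_bound[OF J Kt tp])
    also have "\<dots> \<le> pp.const Kt (reg_bound p) * real m powr (2 - 1 / real M)"
      unfolding M_def by (rule mult_left_mono[OF pp.m_powr(1) const])
    finally have "real ?t \<le> pp.const Kt (reg_bound p) * real m powr (2 - 1 / real M)" .
    thus ?thesis unfolding W Let_def
      by (intro exI[of _ ?t] conjI sol prob[folded M_def])
  qed
  show ?thesis
  proof (rule that)
    show "0 < 1 / real M" by (simp add: M_def)
    have gM: "0 < g / real M" using g by (simp add: M_def)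
    show "solves_in_time (main_code J \<kappa> q k p) three_sum_instances three_sum_input (\<lambda>(m, U, A, B, C). m + U)
      (\<lambda>(m, U, A, B, C). m) three_sum_correct (\<lambda>(m, U, A, B, C). real m powr (2 - 1 / real M))"
      unfolding solves_in_time_def
      by (rule exI[of _ "4 * factor J \<kappa> q k"], rule exI[of _ "parameters.const J \<kappa> q Kt (reg_bound p)"], rule exI[of _ "g / real M"])
        (use inst gM in \<open>auto simp only: split_paired_all prod.case Ball_def simp_thms split_paired_All\<close>)
  qed
qed

theorem theorem2:
  fixes \<Sigma> :: "int set" and lo hi \<epsilon> :: real
  assumes "three_sum_conjecture"
    and "finite \<Sigma>" and "{0, 1} \<subseteq> \<Sigma>"
    and "0 < lo" and "lo < hi"
    and "\<epsilon> > 0"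
  shows "\<not> (\<exists>p. mvm_solves_in_time \<Sigma> lo hi p (\<lambda>N n. real N * real n powr (2 - \<epsilon>)))"
proof
  assume "\<exists>p. mvm_solves_in_time \<Sigma> lo hi p (\<lambda>N n. real N * real n powr (2 - \<epsilon>))"
  then obtain p where "mvm_solves_in_time \<Sigma> lo hi p (\<lambda>N n. real N * real n powr (2 - \<epsilon>))" ..
  from three_sum_reduction[OF this assms(3-6)] show False
    using assms(1) unfolding three_sum_conjecture_def by metis
qed

end
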